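(* Let $N\in\{1,2\}$. For any non-negative functions $f,g$ on $\mathbb{R}^N$ satisfying $$ \int_{\mathbb{R}^N}f(x)\,dx=\int_{\mathbb{R}^N}g(x)\,dx=1 $$ and $$ \int_{\mathbb{R}^N} f(x)\log_+\!\left(f(x)\left(\tfrac{1+|x|^2}{2}\right)^N\right)dx<\infty,\qquad \int_{\mathbb{R}^N} g(x)\log_+\!\left(g(x)\left(\tfrac{1+|x|^2}{2}\right)^N\right)dx<\infty, $$ one has $$ J[f,g]\le \mathcal H_N,\qquad \mathcal H_N=\frac12\log\pi+\frac12\bigl(\psi(N)-\psi(N/2)\bigr)-\frac1N\log\frac{\Gamma(N)}{\Gamma(N/2)} . $$ Equality holds if and only if $$ f(x)=g(x)=\frac{2^{N-1}\,\Gamma((N+1)/2)}{\pi^{(N+1)/2}}\;b^{N}\left(b^2+|x-a|^2\right)^{-N} $$ for some $a\in\mathbb{R}^N$ and $b>0$.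
   Context: For non-negative functions $f,g$ on $\mathbb{R}^N$ with integral one, $$ J[f,g]:=\iint_{\mathbb{R}^N\times\mathbb{R}^N}\overline{f(x)}\,\log\frac{1}{|x-y|}\,g(y)\,dx\,dy-\frac1{2N}\int_{\mathbb{R}^N}f(x)\log f(x)\,dx-\frac1{2N}\int_{\mathbb{R}^N}g(x)\log g(x)\,dx , $$ with the convention $0\log 0=0$. Here $\log_+ t=\max\{\log t,0\}$ (and $\log_+0=0$), $\Gamma$ is the Gamma function and $\psi=(\log\Gamma)'$ is the digamma function. Identities between functions are understood almost everywhere. *)

theory Defs
  imports "HOL-Analysis.Analysis"
begin

text \<open>
  Functions on \<open>\<real>\<^sup>N\<close> are modelled as \<open>real ^ 'n \<Rightarrow> real\<close> with \<open>N = CARD('n)\<close>, and all integrals are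
  taken with respect to Lebesgue measure. Since \<open>ln 0 = 0\<close> in HOL, the conventions
  \<open>0 log 0 = 0\<close> and \<open>log\<^sub>+ 0 = 0\<close> hold automatically.
\<close>

definition log_plus :: "real \<Rightarrow> real" where
  "log_plus t = max (ln t) 0"

text \<open>
  The complex conjugate on the first factor is dropped because \<open>f\<close> is real-valued. The double
  integral is over Lebesgue measure on the product space; the value of the integrand on the
  (null) diagonal is irrelevant. The Bochner integral of a non-integrable function is \<open>0\<close>, but for
  functions of unit mass satisfying the entropy condition below all three integrals
  converge absolutely.
\<close>

definition log_HLS_functional ::
    "(real ^ 'n \<Rightarrow> real) \<Rightarrow> (real ^ 'n \<Rightarrow> real) \<Rightarrow> real" where
  "log_HLS_functional f g =
     (LINT (x, y)|lebesgue. f x * ln (1 / norm (x - y)) * g y)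
     - 1 / (2 * real CARD('n)) * (LINT x|lebesgue. f x * ln (f x))
     - 1 / (2 * real CARD('n)) * (LINT x|lebesgue. g x * ln (g x))"

definition finite_entropy :: "(real ^ 'n \<Rightarrow> real) \<Rightarrow> bool" where
  "finite_entropy f \<longleftrightarrow>
     (\<integral>\<^sup>+ x. ennreal (f x * log_plus (f x * ((1 + (norm x)\<^sup>2) / 2) ^ CARD('n))) \<partial>lebesgue) < \<infinity>"

definition log_HLS_const :: "nat \<Rightarrow> real" where
  "log_HLS_const N =
     1 / 2 * ln pi + 1 / 2 * (Digamma (real N) - Digamma (real N / 2))
     - 1 / real N * ln (Gamma (real N) / Gamma (real N / 2))"

definition log_HLS_optimizer :: "real ^ 'n \<Rightarrow> real \<Rightarrow> real ^ 'n \<Rightarrow> real" where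
  "log_HLS_optimizer a b x =
     2 ^ (CARD('n) - 1) * Gamma ((real CARD('n) + 1) / 2) / pi powr ((real CARD('n) + 1) / 2)
     * b ^ CARD('n) / (b\<^sup>2 + (norm (x - a))\<^sup>2) ^ CARD('n)"

end

theory Submission imports Defs "HOL-Probability.Probability" "HOL-Complex_Analysis.Complex_Analysis" begin

text \<open>
  The kernel \<open>- log \<bar>x - y\<bar>\<close> is positive definite on functions of mean zero, so
  \<open>J[f,g] \<le> (J[f,f] + J[g,g]) / 2\<close>, and only the diagonal \<open>f = g\<close> has to be treated.

  For \<open>N = 1\<close>, stereographic projection moves \<open>J[f,f]\<close> to the unit circle, where expanding the kernel
  into a Fourier series turns the inequality into the Lebedev--Milin inequality
  \<open>\<Sum> \<bar>F\<^sub>m\<bar>\<^sup>2 / m \<le> \<integral> F ln F\<close>. If all odd coefficients vanish, the right-hand side can be halved. A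
  function whose mass is bisected by two orthogonal mirrors and which is extremal is invariant under
  both reflections, by polarization, hence even; the halved bound then leaves only the constants.

  For \<open>N = 2\<close>, reflection positivity in two orthogonal lines bisecting the mass reduces the inequality
  to functions with \<open>f (- x) = f x\<close>. On each pair of circles the halved Lebedev--Milin bound
  controls the loss of energy by the loss of entropy when \<open>f\<close> is replaced by its average over
  rotations. What remains is a one-dimensional inequality for the law of \<open>\<pi> \<bar>x\<bar>\<^sup>2\<close>: with density \<open>\<rho>\<close>
  and distribution function \<open>M\<close>, it is Gibbs' inequality for \<open>\<rho>\<close> against \<open>M (1 - M) / v\<close>, because \<open>M\<close>
  is uniformly distributed under its own law. Equality is the logistic equation
  \<open>v M' = M (1 - M)\<close>, whose solutions are the optimizers.
\<close>

section \<open>Averages over the unit circle\<close>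

text \<open>A factor two decides the shape of the proof. On the line, the energy and the entropy
  pick up the same logarithmic moment under stereographic projection; these cancel and leave the
  entropy with weight one, as Lebedev--Milin requires. In the plane the entropy has weight 1/2 only,
  so the same bound, applied to angles, misses by a factor two. An even function has only the modes
  2, 4, 6, ..., and the gain of two makes the balance exact. Reflection positivity gives this
  reduction for the value of the bound but says nothing about a given extremal, whose evenness comes
  from the equality case of polarization.

  Rigidity survives the averaging because two circles of different radius have ratio below one: the
  angular estimate is strict unless the entropy loss vanishes. Translations, and on the line also
  dilations, are fixed by medians, which make the mirrors bisect the mass. Equality for a pair
  \<open>f\<close>, \<open>g\<close> does not go through strict definiteness of the kernel: the
  potential of an optimizer is affine in its logarithm, and this turns the question into equality in
  Gibbs' inequality.\<close>

lemma exp_poly_expansion: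
  fixes a :: "nat \<Rightarrow> complex" and n :: nat
  obtains b :: "nat \<Rightarrow> complex" where "b 0 = 1"
    and "\<And>m. of_nat (Suc m) * b (Suc m) =
           (\<Sum>k\<le>m. (if k < n then of_nat (Suc k) * a (Suc k) else 0) * b (m - k))"
    and "\<And>z. (\<lambda>m. b m * z ^ m) sums exp (\<Sum>k=1..n. a k * z ^ k)"
proof -
  define p where "p = (\<lambda>z::complex. \<Sum>k=1..n. a k * z ^ k)"
  define f where "f = (\<lambda>z. exp (p z))"
  define P where "P = (\<Sum>k=1..n. fps_const (a k) * fps_X ^ k)"
  define F where "F = fps_expansion f 0"
  have p_hol: "p holomorphic_on UNIV" unfolding p_def by (intro holomorphic_intros)
  have f_hol: "f holomorphic_on UNIV" unfolding f_def by (intro holomorphic_intros p_hol)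
  have F: "f has_fps_expansion F"
    unfolding F_def by (rule analytic_at_imp_has_fps_expansion_0)
      (use f_hol in \<open>auto intro: holomorphic_on_imp_analytic_at\<close>)
  have P: "p has_fps_expansion P"
    unfolding p_def P_def by (intro fps_expansion_intros)
  \<comment> \<open>The recursion is the coefficient form of \<open>f' = p' f\<close>; its cut-off
    \<open>k < n\<close> is the degree of \<open>p\<close>.\<close>
  have der: "deriv f = (\<lambda>z. deriv p z * f z)"
  proof
    fix z
    have "(p has_field_derivative deriv p z) (at z)"
      using p_hol by (simp add: holomorphic_derivI)
    then have "(f has_field_derivative exp (p z) * deriv p z) (at z)"
      unfolding f_def by (rule DERIV_fun_exp)
    then show "deriv f z = deriv p z * f z" by (simp add: DERIV_imp_deriv f_def)
  qed
  have "deriv f has_fps_expansion fps_deriv P * F"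
    unfolding der by (intro fps_expansion_intros P F)
  then have eq: "fps_deriv F = fps_deriv P * F"
    using fps_expansion_unique_complex has_fps_expansion_deriv[OF F] by blast
  have Pn: "P $ k = (if 1 \<le> k \<and> k \<le> n then a k else 0)" for k
  proof -
    have "P $ k = (\<Sum>i=1..n. if i = k then a i else 0)"
      unfolding P_def fps_sum_nth by (intro sum.cong) (auto simp: fps_X_power_nth)
    then show ?thesis by simp
  qed
  show thesis
  proof (rule that[of "fps_nth F"])
    show "F $ 0 = 1"
      by (simp add: F_def fps_expansion_def f_def p_def power_0_left)
    show "of_nat (Suc m) * F $ Suc m =
           (\<Sum>k\<le>m. (if k < n then of_nat (Suc k) * a (Suc k) else 0) * F $ (m - k))" for m
    proof -
      have "of_nat (Suc m) * F $ Suc m = fps_deriv F $ m" by simp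
      also have "\<dots> = (\<Sum>k=0..m. fps_deriv P $ k * F $ (m - k))"
        unfolding eq fps_mult_nth ..
      also have "\<dots> = (\<Sum>k\<le>m. (if k < n then of_nat (Suc k) * a (Suc k) else 0) * F $ (m - k))"
        by (intro sum.cong) (auto simp: Pn)
      finally show ?thesis .
    qed
    show "(\<lambda>m. F $ m * z ^ m) sums exp (\<Sum>k=1..n. a k * z ^ k)" for z
      using has_fps_expansion_imp_sums_complex[OF F, of \<infinity> z] f_hol
      by (auto simp: f_def p_def eball_def holomorphic_on_subset)
  qed
qed

text \<open>Cauchy--Schwarz against the constant vector costs a factor \<open>j + 1\<close>, one of
  the two that squaring the recursion produces; the other one is left for the recursion of
  \<open>B\<close>. In the application \<open>d k\<close> is
  \<open>(k + 1) a (k + 1)\<close>.\<close>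

lemma lebedev_milin_coeffs:
  fixes b d B :: "nat \<Rightarrow> complex"
  assumes "b 0 = 1" "B 0 = 1"
    and b: "\<And>m. of_nat (Suc m) * b (Suc m) = (\<Sum>k\<le>m. d k * b (m - k))"
    and B: "\<And>m. of_nat (Suc m) * B (Suc m) = (\<Sum>k\<le>m. of_real ((norm (d k))\<^sup>2) * B (m - k))"
  shows "(norm (b m))\<^sup>2 \<le> Re (B m)"
proof (induction m rule: less_induct)
  case (less m)
  show ?case
  proof (cases m)
    case 0
    then show ?thesis by (simp add: assms)
  next
    case (Suc j)
    have "(real (Suc j))\<^sup>2 * (norm (b (Suc j)))\<^sup>2 = (norm (of_nat (Suc j) * b (Suc j)))\<^sup>2"
      by (simp only: norm_mult norm_of_nat power_mult_distrib)
    also have "\<dots> \<le> (\<Sum>k\<le>j. norm (d k) * norm (b (j - k)))\<^sup>2"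
      unfolding b by (intro power_mono sum_norm_le) (auto simp: norm_mult)
    also have "\<dots> \<le> (\<Sum>k\<le>j. 1) * (\<Sum>k\<le>j. (norm (d k) * norm (b (j - k)))\<^sup>2)"
      using Cauchy_Schwarz_ineq_sum[of "\<lambda>_. 1" "\<lambda>k. norm (d k) * norm (b (j - k))" "{..j}"] by simp
    also have "\<dots> \<le> real (Suc j) * (\<Sum>k\<le>j. (norm (d k))\<^sup>2 * Re (B (j - k)))"
      by (auto simp: power_mult_distrib Suc intro!: mult_left_mono sum_mono less.IH)
    also have "(\<Sum>k\<le>j. (norm (d k))\<^sup>2 * Re (B (j - k))) = Re (of_nat (Suc j) * B (Suc j))"
      unfolding B by simp
    also have "real (Suc j) * \<dots> = (real (Suc j))\<^sup>2 * Re (B (Suc j))"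
      by (simp add: power2_eq_square algebra_simps)
    finally show ?thesis unfolding Suc by (subst (asm) mult_le_cancel_left_pos) auto
  qed
qed

text \<open>The majorants \<open>Re (B m)\<close> are nonnegative and sum to the exponential on the
  right, the value of their generating function at 1.\<close>

lemma exp_poly_coeffs_bound:
  fixes a :: "nat \<Rightarrow> complex" and n :: nat
  obtains b :: "nat \<Rightarrow> complex"
  where "\<And>z. (\<lambda>m. b m * z ^ m) sums exp (\<Sum>k=1..n. a k * z ^ k)"
    and "\<And>M. (\<Sum>m<M. (norm (b m))\<^sup>2) \<le> exp (\<Sum>k=1..n. real k * (norm (a k))\<^sup>2)"
proof -
  obtain b where b: "b 0 = 1"
    "\<And>m. of_nat (Suc m) * b (Suc m) =
           (\<Sum>k\<le>m. (if k < n then of_nat (Suc k) * a (Suc k) else 0) * b (m - k))"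
    "\<And>z. (\<lambda>m. b m * z ^ m) sums exp (\<Sum>k=1..n. a k * z ^ k)"
    using exp_poly_expansion[of n a] by blast
  \<comment> \<open>This choice makes \<open>(k + 1) A (k + 1)\<close> the square modulus of
    \<open>(k + 1) a (k + 1)\<close>, which is the driving term of \<open>B\<close> in
    \<open>lebedev_milin_coeffs\<close>.\<close>
  define A where "A k = complex_of_real (real k * (norm (a k))\<^sup>2)" for k
  obtain B where B: "B 0 = 1"
    "\<And>m. of_nat (Suc m) * B (Suc m) =
           (\<Sum>k\<le>m. (if k < n then of_nat (Suc k) * A (Suc k) else 0) * B (m - k))"
    "\<And>z. (\<lambda>m. B m * z ^ m) sums exp (\<Sum>k=1..n. A k * z ^ k)"
    using exp_poly_expansion[of n A] by blast
  let ?d = "\<lambda>k. if k < n then of_nat (Suc k) * a (Suc k) else 0"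
  have "of_real ((norm (?d k))\<^sup>2) = (if k < n then of_nat (Suc k) * A (Suc k) else 0)" for k
    by (auto simp: A_def norm_mult power2_eq_square simp del: of_nat_Suc)
  then have le: "(norm (b m))\<^sup>2 \<le> Re (B m)" for m
    using lebedev_milin_coeffs[of b B ?d m] b(1,2) B(1,2) by simp
  have "(\<lambda>m. Re (B m * 1 ^ m)) sums Re (exp (\<Sum>k=1..n. A k * 1 ^ k))"
    using B(3)[of 1] by (rule sums_Re)
  moreover have "(\<Sum>k=1..n. A k * 1 ^ k) = of_real (\<Sum>k=1..n. real k * (norm (a k))\<^sup>2)"
    by (simp add: A_def)
  ultimately have S: "(\<lambda>m. Re (B m)) sums exp (\<Sum>k=1..n. real k * (norm (a k))\<^sup>2)"
    by (simp only: power_one mult_1_right exp_of_real Re_complex_of_real)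
  have "(\<Sum>m<M. (norm (b m))\<^sup>2) \<le> exp (\<Sum>k=1..n. real k * (norm (a k))\<^sup>2)" for M
  proof -
    have "(\<Sum>m<M. (norm (b m))\<^sup>2) \<le> (\<Sum>m<M. Re (B m))" by (intro sum_mono le)
    also have "\<dots> \<le> exp (\<Sum>k=1..n. real k * (norm (a k))\<^sup>2)"
      using S le by (subst sums_unique[OF S], intro sum_le_suminf)
        (auto simp: sums_iff intro: order_trans[OF zero_le_power2])
    finally show ?thesis .
  qed
  then show thesis using b(3) that by blast
qed

section \<open>Normalized arc length on the unit circle\<close>

text \<open>Kept as a measure on all of \<open>complex\<close>, so that functions of the plane
  restrict to circles without a change of type.\<close>

definition circ :: "complex measure" where
  "circ = distr (uniform_measure lborel {-pi<..pi}) borel cis"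

lemma sets_circ [measurable_cong, simp]: "sets circ = sets borel"
  by (simp add: circ_def)

lemma space_circ [simp]: "space circ = UNIV"
  by (simp add: circ_def)

lemma cis_measurable [measurable]: "cis \<in> borel_measurable borel"
  by (intro borel_measurable_continuous_onI continuous_intros)

lemma cnj_measurable [measurable]: "cnj \<in> borel_measurable borel"
  by (intro borel_measurable_continuous_onI continuous_intros)

interpretation circ: prob_space circ
proof -
  interpret u: prob_space "uniform_measure lborel {-pi<..pi::real}"
    by (rule prob_space_uniform_measure) auto
  show "prob_space circ"
    unfolding circ_def by (rule u.prob_space_distr) simp
qed

lemma nn_integral_circ:
  assumes [measurable]: "f \<in> borel_measurable borel"
  shows "(\<integral>\<^sup>+z. f z \<partial>circ) = (\<integral>\<^sup>+t. f (cis t) * indicator {-pi<..pi} t \<partial>lborel) / ennreal (2 * pi)"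
  unfolding circ_def
  by (simp add: nn_integral_distr nn_integral_uniform_measure)

lemma AE_circ_norm: "AE z in circ. norm z = 1"
  unfolding circ_def by (subst AE_distr_iff) auto

lemma circ_eqI:
  assumes [measurable]: "T \<in> borel_measurable borel"
    and "\<And>f::complex \<Rightarrow> ennreal. f \<in> borel_measurable borel \<Longrightarrow>
      (\<integral>\<^sup>+t. f (T (cis t)) * indicator {-pi<..pi} t \<partial>lborel) = (\<integral>\<^sup>+t. f (cis t) * indicator {-pi<..pi} t \<partial>lborel)"
  shows "distr circ borel T = circ"
proof (rule measure_eqI)
  fix X assume "X \<in> sets (distr circ borel T)"
  then have [measurable]: "X \<in> sets borel" by simp
  have "emeasure (distr circ borel T) X = (\<integral>\<^sup>+z. indicator X (T z) \<partial>circ)"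
    by (simp add: nn_integral_distr flip: nn_integral_indicator)
  also have "\<dots> = (\<integral>\<^sup>+z. indicator X z \<partial>circ)"
    by (subst (1 2) nn_integral_circ) (simp_all add: assms(2)[of "indicator X"])
  also have "\<dots> = emeasure circ X" by (subst nn_integral_indicator) simp_all
  finally show "emeasure (distr circ borel T) X = emeasure circ X" .
qed simp

lemma circ_cnj: "distr circ borel cnj = circ"
proof (rule circ_eqI)
  fix f :: "complex \<Rightarrow> ennreal" assume [measurable]: "f \<in> borel_measurable borel"
  have "(\<integral>\<^sup>+t. f (cnj (cis t)) * indicator {-pi<..pi} t \<partial>lborel)
      = (\<integral>\<^sup>+t. f (cnj (cis (-t))) * indicator {-pi<..pi} (-t) \<partial>lborel)"
    by (subst lborel_distr_uminus[symmetric], subst nn_integral_distr) auto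
  also have "\<dots> = (\<integral>\<^sup>+t. f (cis t) * indicator {-pi<..pi} t \<partial>lborel)"
    using AE_lborel_singleton[of pi] AE_lborel_singleton[of "-pi"]
    by (intro nn_integral_cong_AE) (auto simp: cis_cnj split: split_indicator)
  finally show "(\<integral>\<^sup>+t. f (cnj (cis t)) * indicator {-pi<..pi} t \<partial>lborel)
      = (\<integral>\<^sup>+t. f (cis t) * indicator {-pi<..pi} t \<partial>lborel)" .
qed simp

lemma circ_rotate:
  assumes "norm u = 1"
  shows "distr circ borel ((*) u) = circ"
proof (rule circ_eqI)
  fix f :: "complex \<Rightarrow> ennreal" assume [measurable]: "f \<in> borel_measurable borel"
  define s where "s = Arg u"
  have s: "-pi < s" "s \<le> pi" "u = cis s"
    using Arg_bounded[of u] cis_Arg[of u] assms by (cases "u = 0"; simp add: s_def sgn_div_norm)+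
  have per: "cis (t + 2 * pi) = cis t" for t by (simp add: cis.ctr)
  have "(\<integral>\<^sup>+t. f (u * cis t) * indicator {-pi<..pi} t \<partial>lborel)
      = (\<integral>\<^sup>+t. f (cis (t + s)) * indicator {-pi<..pi} t \<partial>lborel)"
    by (simp add: s(3) cis_mult add.commute)
  also have "\<dots> = (\<integral>\<^sup>+t. f (cis t) * indicator {s-pi<..s+pi} t \<partial>lborel)"
    by (subst nn_integral_real_affine[where c=1 and t=s and f="\<lambda>t. f (cis t) * indicator {s-pi<..s+pi} t"])
      (auto intro!: nn_integral_cong simp: add.commute split: split_indicator)
  \<comment> \<open>The two windows have the same length. The overhang at one end is carried to the
    other by a shift of one period.\<close>
  also have "\<dots> = (\<integral>\<^sup>+t. f (cis t) * indicator {-pi<..pi} t \<partial>lborel)"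
  proof -
    have shift: "(\<integral>\<^sup>+t. f (cis t) * indicator {x<..y} t \<partial>lborel)
        = (\<integral>\<^sup>+t. f (cis t) * indicator {x + 2*pi<..y + 2*pi} t \<partial>lborel)" for x y
      by (subst (2) nn_integral_real_affine[where c=1 and t="2*pi"])
        (auto intro!: nn_integral_cong simp: add.commute per split: split_indicator)
    have split: "(\<integral>\<^sup>+t. f (cis t) * indicator {x<..z} t \<partial>lborel)
        = (\<integral>\<^sup>+t. f (cis t) * indicator {x<..y} t \<partial>lborel) + (\<integral>\<^sup>+t. f (cis t) * indicator {y<..z} t \<partial>lborel)"
      if "x \<le> y" "y \<le> z" for x y z
      using that by (subst nn_integral_add[symmetric]) (auto intro!: nn_integral_cong split: split_indicator)
    show ?thesis
    proof (cases "s \<ge> 0")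
      case True
      show ?thesis
        using split[of "-pi" "s-pi" pi] split[of "s-pi" pi "s+pi"] shift[of "-pi" "s-pi"] s True
        by (simp add: algebra_simps)
    next
      case False
      show ?thesis
        using split[of "-pi" "s+pi" pi] split[of "s-pi" "-pi" "s+pi"] shift[of "s-pi" "-pi"] s False
        by (simp add: algebra_simps)
    qed
  qed
  finally show "(\<integral>\<^sup>+t. f (u * cis t) * indicator {-pi<..pi} t \<partial>lborel)
      = (\<integral>\<^sup>+t. f (cis t) * indicator {-pi<..pi} t \<partial>lborel)" .
qed simp

section \<open>The Lebedev--Milin inequality and logarithmic series\<close>

lemma (in pair_sigma_finite) integrable_mult_pair:
  fixes f :: "'a \<Rightarrow> 'c :: {real_normed_field, banach, second_countable_topology}" and g :: "'b \<Rightarrow> 'c"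
  assumes f: "integrable M1 f" and g: "integrable M2 g"
  shows "integrable (M1 \<Otimes>\<^sub>M M2) (\<lambda>p. f (fst p) * g (snd p))"
    and "(\<integral>p. f (fst p) * g (snd p) \<partial>(M1 \<Otimes>\<^sub>M M2)) = (\<integral>x. f x \<partial>M1) * (\<integral>y. g y \<partial>M2)"
proof -
  have [measurable]: "f \<in> borel_measurable M1" "g \<in> borel_measurable M2" using f g by auto
  show *: "integrable (M1 \<Otimes>\<^sub>M M2) (\<lambda>p. f (fst p) * g (snd p))"
    by (rule Fubini_integrable) (use f g in \<open>auto simp: norm_mult\<close>)
  show "(\<integral>p. f (fst p) * g (snd p) \<partial>(M1 \<Otimes>\<^sub>M M2)) = (\<integral>x. f x \<partial>M1) * (\<integral>y. g y \<partial>M2)"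
    using integral_fst'[OF *] by simp
qed

lemma integral_circ_rotate:
  fixes f :: "complex \<Rightarrow> 'b :: {banach, second_countable_topology}"
  assumes [measurable]: "f \<in> borel_measurable borel" and "norm u = 1"
  shows "(\<integral>z. f (u * z) \<partial>circ) = (\<integral>z. f z \<partial>circ)"
  by (subst (2) circ_rotate[OF assms(2), symmetric]) (simp add: integral_distr)

lemma integrable_circ_bounded:
  fixes f :: "complex \<Rightarrow> 'b :: {banach, second_countable_topology}"
  assumes [measurable]: "f \<in> borel_measurable borel" and "\<And>z. norm z = 1 \<Longrightarrow> norm (f z) \<le> B"
  shows "integrable circ f"
  by (rule circ.integrable_const_bound[where B=B]) (use AE_circ_norm assms(2) in \<open>auto elim: eventually_mono\<close>)

section \<open>Orthogonality of monomials and exponential moments\<close>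

lemma integral_circ_monomial:
  "(\<integral>z. z ^ j * cnj z ^ k \<partial>circ) = (if j = k then 1 else 0)"
proof (cases "j = k")
  case True
  have "(\<integral>z. z ^ j * cnj z ^ k \<partial>circ) = (\<integral>z. 1 \<partial>circ)"
    unfolding True using AE_circ_norm
    by (intro integral_cong_AE)
      (auto simp: power_mult_distrib[symmetric] complex_norm_square[symmetric] elim!: eventually_mono)
  then show ?thesis using True circ.prob_space by simp
next
  case False
  \<comment> \<open>Chosen with \<open>u ^ j * cnj u ^ k = -1\<close>, so that rotation invariance
    makes the integral its own negative.\<close>
  define u where "u = cis (pi / (real j - real k))"
  have u: "u ^ j * cnj u ^ k = -1"
  proof -
    have "u ^ j * cnj u ^ k = cis (real j * (pi / (real j - real k)) + real k * (- (pi / (real j - real k))))"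
      by (simp only: u_def cis_cnj Complex.DeMoivre cis_mult)
    also have "real j * (pi / (real j - real k)) + real k * (- (pi / (real j - real k))) = pi"
      using False by (simp add: diff_divide_distrib[symmetric] left_diff_distrib[symmetric])
    finally show ?thesis by simp
  qed
  have "(\<integral>z. z ^ j * cnj z ^ k \<partial>circ) = (\<integral>z. (u * z) ^ j * cnj (u * z) ^ k \<partial>circ)"
    by (subst integral_circ_rotate[where u=u, symmetric]) (simp_all add: u_def)
  also have "\<dots> = (\<integral>z. (u ^ j * cnj u ^ k) * (z ^ j * cnj z ^ k) \<partial>circ)"
    by (simp add: power_mult_distrib mult_ac)
  also have "\<dots> = - (\<integral>z. z ^ j * cnj z ^ k \<partial>circ)"
    unfolding u by simp
  finally show ?thesis using False by simp
qed

lemma parseval_finite: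
  assumes d: "d \<ge> 1"
  shows "(\<integral>z. (norm (\<Sum>m<M. b m * z ^ (d * m)))\<^sup>2 \<partial>circ) = (\<Sum>m<M. (norm (b m))\<^sup>2)"
proof -
  have int: "integrable circ (\<lambda>z. z ^ j * cnj z ^ k)" for j k
    by (rule integrable_circ_bounded[where B=1]) (auto simp: norm_mult norm_power)
  have "complex_of_real (\<integral>z. (norm (\<Sum>m<M. b m * z ^ (d * m)))\<^sup>2 \<partial>circ)
      = (\<integral>z. complex_of_real ((norm (\<Sum>m<M. b m * z ^ (d * m)))\<^sup>2) \<partial>circ)"
    by (rule integral_complex_of_real[symmetric])
  also have "\<dots> = (\<integral>z. (\<Sum>j<M. \<Sum>k<M. (b j * cnj (b k)) * (z ^ (d * j) * cnj z ^ (d * k))) \<partial>circ)"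
    by (intro Bochner_Integration.integral_cong)
      (auto simp: complex_norm_square cnj_sum sum_product mult_ac simp del: of_real_power)
  also have "\<dots> = (\<Sum>j<M. \<Sum>k<M. (b j * cnj (b k)) * (if j = k then 1 else 0))"
    using d by (subst Bochner_Integration.integral_sum; (intro Bochner_Integration.integrable_sum integrable_mult_right int)?)+
      (simp add: integral_circ_monomial int if_distrib cong: if_cong)
  also have "\<dots> = (\<Sum>j<M. complex_of_real ((norm (b j))\<^sup>2))"
  proof (intro sum.cong refl)
    fix j assume j: "j \<in> {..<M}"
    have "(\<Sum>k<M. b j * cnj (b k) * (if j = k then 1 else 0)) = (\<Sum>k<M. if k = j then b j * cnj (b j) else 0)"
      by (intro sum.cong) auto
    also have "\<dots> = b j * cnj (b j)" using j by simp
    finally show "(\<Sum>k<M. b j * cnj (b k) * (if j = k then 1 else 0)) = complex_of_real ((norm (b j))\<^sup>2)"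
      by (simp only: complex_norm_square)
  qed
  also have "\<dots> = complex_of_real (\<Sum>j<M. (norm (b j))\<^sup>2)" by (simp only: of_real_sum)
  finally show ?thesis by (simp only: of_real_eq_iff)
qed

text \<open>\<open>exp (2 Re p)\<close> is the square modulus of \<open>exp p\<close>, so Parseval
  for the partial sums and Fatou's lemma suffice. Replacing \<open>z\<close> by \<open>z ^ d\<close>
  only spreads the coefficients and leaves the bound unchanged; the gain for sparse Fourier series
  starts here.\<close>

lemma nn_integral_exp_trig_poly:
  assumes d: "d \<ge> 1"
  shows "(\<integral>\<^sup>+z. ennreal (exp (2 * Re (\<Sum>k=1..n. a k * z ^ (d * k)))) \<partial>circ)
    \<le> ennreal (exp (\<Sum>k=1..n. real k * (norm (a k))\<^sup>2))"
proof -
  obtain b where b: "\<And>z. (\<lambda>m. b m * z ^ m) sums exp (\<Sum>k=1..n. a k * z ^ k)"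
    "\<And>M. (\<Sum>m<M. (norm (b m))\<^sup>2) \<le> exp (\<Sum>k=1..n. real k * (norm (a k))\<^sup>2)"
    using exp_poly_coeffs_bound[of a n] by blast
  let ?s = "\<lambda>M z. (norm (\<Sum>m<M. b m * z ^ (d * m)))\<^sup>2"
  have lim: "(\<lambda>M. ennreal (?s M z)) \<longlonglongrightarrow> ennreal (exp (2 * Re (\<Sum>k=1..n. a k * z ^ (d * k))))" for z
  proof -
    have "(\<lambda>M. \<Sum>m<M. b m * z ^ (d * m)) \<longlonglongrightarrow> exp (\<Sum>k=1..n. a k * z ^ (d * k))"
      using b(1)[of "z ^ d"] by (simp add: sums_def power_mult)
    then have "(\<lambda>M. ?s M z) \<longlonglongrightarrow> (norm (exp (\<Sum>k=1..n. a k * z ^ (d * k))))\<^sup>2"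
      by (intro tendsto_intros)
    moreover have "(norm (exp (\<Sum>k=1..n. a k * z ^ (d * k))))\<^sup>2 = exp (2 * Re (\<Sum>k=1..n. a k * z ^ (d * k)))"
      by (simp only: norm_exp_eq_Re exp_double)
    ultimately show ?thesis by (intro tendsto_ennrealI) simp
  qed
  have "(\<integral>\<^sup>+z. ennreal (exp (2 * Re (\<Sum>k=1..n. a k * z ^ (d * k)))) \<partial>circ)
      = (\<integral>\<^sup>+z. liminf (\<lambda>M. ennreal (?s M z)) \<partial>circ)"
    by (intro nn_integral_cong lim_imp_Liminf[symmetric] lim) simp
  also have "\<dots> \<le> liminf (\<lambda>M. \<integral>\<^sup>+z. ennreal (?s M z) \<partial>circ)"
    by (rule nn_integral_liminf) measurable
  also have "\<dots> \<le> liminf (\<lambda>M::nat. ennreal (exp (\<Sum>k=1..n. real k * (norm (a k))\<^sup>2)))"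
  proof (intro Liminf_mono always_eventually allI)
    fix M
    have "integrable circ (?s M)"
      by (rule integrable_circ_bounded[where B="(\<Sum>m<M. norm (b m))\<^sup>2"])
        (auto simp: norm_mult norm_power intro!: power_mono sum_norm_le)
    then have "(\<integral>\<^sup>+z. ennreal (?s M z) \<partial>circ) = ennreal (\<integral>z. ?s M z \<partial>circ)"
      by (rule nn_integral_eq_integral) simp
    then show "(\<integral>\<^sup>+z. ennreal (?s M z) \<partial>circ) \<le> ennreal (exp (\<Sum>k=1..n. real k * (norm (a k))\<^sup>2))"
      using b(2) by (simp add: parseval_finite[OF d] ennreal_leI)
  qed
  finally show ?thesis by (simp add: Liminf_const)
qed

text \<open>Convex duality between \<open>t ln t - t\<close> and \<open>exp\<close>, from
  \<open>1 + x \<le> exp x\<close>. It trades a logarithm for entropy plus an integrable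
  power.\<close>

lemma young_exp:
  fixes t s :: real
  assumes "t \<ge> 0"
  shows "t * s \<le> t * ln t - t + exp s"
proof (cases "t = 0")
  case False
  have "1 + (s - ln t) \<le> exp (s - ln t)" by (rule exp_ge_add_one_self)
  then have "t * (1 + (s - ln t)) \<le> t * exp (s - ln t)" using assms by (rule mult_left_mono)
  also have "\<dots> = exp s" using assms False by (simp add: exp_diff)
  finally show ?thesis by (simp add: algebra_simps)
qed simp

text \<open>The exponential moment bound is dualized: the entropy is tested against a trigonometric
  polynomial \<open>u\<close> in \<open>z ^ d\<close>. The weights come out as \<open>1 / k\<close>
  although the frequency is \<open>d * k\<close>.\<close>

lemma lebedev_milin:
  fixes F :: "complex \<Rightarrow> real"
  assumes d: "d \<ge> 1" and nn: "\<And>z. 0 \<le> F z" and F: "integrable circ F"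
    and FF: "integrable circ (\<lambda>z. F z * ln (F z))"
  defines "c \<equiv> (\<integral>z. F z \<partial>circ)"
  shows "(\<Sum>k=1..n. (norm (\<integral>z. of_real (F z) * z ^ (d * k) \<partial>circ))\<^sup>2 / real k)
    \<le> c * ((\<integral>z. F z * ln (F z) \<partial>circ) - c * ln c)"
proof -
  define f where "f k = (\<integral>z. of_real (F z) * z ^ (d * k) \<partial>circ)" for k
  define X where "X = (\<Sum>k=1..n. (norm (f k))\<^sup>2 / real k)"
  have meas [measurable]: "F \<in> borel_measurable borel"
    using borel_measurable_integrable[OF F] by (simp cong: measurable_cong_sets)
  have c0: "c \<ge> 0" unfolding c_def using nn by simp
  have int: "integrable circ (\<lambda>z. of_real (F z) * z ^ m)" for m :: nat
    by (rule Bochner_Integration.integrable_bound[OF F])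
      (use AE_circ_norm nn in \<open>auto simp: norm_mult norm_power elim!: eventually_mono\<close>)
  have norm_f: "norm (f k) \<le> c" for k
  proof -
    have "norm (f k) \<le> (\<integral>z. norm (of_real (F z) * z ^ (d * k)) \<partial>circ)"
      unfolding f_def by (rule integral_norm_bound)
    also have "\<dots> = c"
      unfolding c_def using AE_circ_norm nn
      by (intro integral_cong_AE) (auto simp: norm_mult norm_power elim!: eventually_mono)
    finally show ?thesis .
  qed
  show ?thesis
  proof (cases "c = 0")
    case True
    then have "norm (f k) = 0" for k using norm_f[of k] by simp
    then show ?thesis using True by (simp add: f_def[symmetric])
  next
    case False
    then have c: "c > 0" using c0 by simp
    \<comment> \<open>The maximizer of \<open>2 Re (a k * f k) - c k |a k|^2\<close>, the
      contribution of the frequency \<open>d * k\<close> to the dual bound.\<close>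
    define a where "a k = cnj (f k) / of_real (real k * c)" for k
    define L where "L = (\<Sum>k=1..n. real k * (norm (a k))\<^sup>2)"
    define u where "u z = 2 * Re (\<Sum>k=1..n. a k * z ^ (d * k))" for z
    have [measurable]: "u \<in> borel_measurable borel" unfolding u_def by measurable
    have L: "L = X / c\<^sup>2"
      unfolding L_def X_def a_def sum_divide_distrib
      by (intro sum.cong) (auto simp: norm_divide norm_mult power_divide power_mult_distrib power2_eq_square)
    have "(\<integral>\<^sup>+z. ennreal (exp (u z)) \<partial>circ) \<le> ennreal (exp L)"
      using nn_integral_exp_trig_poly[OF d] by (simp add: u_def L_def)
    moreover have eint: "integrable circ (\<lambda>z. exp (u z))"
      by (rule integrableI_bounded) (use calculation in \<open>auto simp: le_less_trans\<close>)
    ultimately have "(\<integral>z. exp (u z) \<partial>circ) \<le> exp L"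
      by (simp add: nn_integral_eq_integral)
    then have e1: "(\<integral>z. exp (u z - L) \<partial>circ) \<le> 1"
      by (simp add: exp_diff divide_simps)
    have eint': "integrable circ (\<lambda>z. exp (u z - L))"
      using eint by (simp add: exp_diff)
    have uF: "F z * u z = 2 * Re (\<Sum>k=1..n. a k * (of_real (F z) * z ^ (d * k)))" for z
    proof -
      have "(\<Sum>k=1..n. a k * (of_real (F z) * z ^ (d * k))) = of_real (F z) * (\<Sum>k=1..n. a k * z ^ (d * k))"
        by (simp add: sum_distrib_left mult_ac)
      then show ?thesis by (simp add: u_def del: Re_sum)
    qed
    have Sint: "integrable circ (\<lambda>z. \<Sum>k=1..n. a k * (of_real (F z) * z ^ (d * k)))"
      by (intro Bochner_Integration.integrable_sum integrable_mult_right int)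
    have Sval: "(\<integral>z. (\<Sum>k=1..n. a k * (of_real (F z) * z ^ (d * k))) \<partial>circ) = (\<Sum>k=1..n. a k * f k)"
      unfolding f_def by (subst Bochner_Integration.integral_sum) (auto intro!: integrable_mult_right int)
    have uint: "integrable circ (\<lambda>z. F z * u z)"
      unfolding uF by (intro integrable_mult_right integrable_Re Sint)
    have "(\<integral>z. F z * u z \<partial>circ) = 2 * Re (\<Sum>k=1..n. a k * f k)"
      unfolding uF integral_mult_right_zero integral_Re[OF Sint] Sval ..
    also have "(\<Sum>k=1..n. a k * f k) = of_real (X / c)"
      unfolding X_def sum_divide_distrib of_real_sum
      using c by (intro sum.cong) (auto simp: a_def complex_norm_square mult_ac simp del: of_real_power)
    finally have uval: "(\<integral>z. F z * u z \<partial>circ) = 2 * X / c" by simp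
    \<comment> \<open>Young's inequality for \<open>F / c\<close> and \<open>u - L\<close>.
      Subtracting \<open>L\<close> brings the exponential moment down to at most one, by
      \<open>e1\<close>.\<close>
    have pt: "F z * u z \<le> F z * ln (F z) - (ln c + 1 - L) * F z + c * exp (u z - L)" for z
    proof -
      have "F z / c * (u z - L) \<le> F z / c * ln (F z / c) - F z / c + exp (u z - L)"
        using nn c by (intro young_exp) auto
      then have "c * (F z / c * (u z - L)) \<le> c * (F z / c * ln (F z / c) - F z / c + exp (u z - L))"
        using c by (intro mult_left_mono) auto
      moreover have "c * (F z / c * (u z - L)) = F z * (u z - L)"
        "c * (F z / c * ln (F z / c) - F z / c + exp (u z - L)) = F z * ln (F z / c) - F z + c * exp (u z - L)"
        using c by (simp_all add: field_simps)
      ultimately have "F z * (u z - L) \<le> F z * ln (F z / c) - F z + c * exp (u z - L)" by (simp only:)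
      moreover have "F z * ln (F z / c) = F z * ln (F z) - F z * ln c"
        using nn[of z] c by (cases "F z = 0") (auto simp: ln_div algebra_simps)
      ultimately show ?thesis by (simp add: algebra_simps)
    qed
    have "2 * X / c \<le> (\<integral>z. F z * ln (F z) - (ln c + 1 - L) * F z + c * exp (u z - L) \<partial>circ)"
      unfolding uval[symmetric] by (intro integral_mono uint) (use FF F eint' pt in auto)
    also have "\<dots> = (\<integral>z. F z * ln (F z) \<partial>circ) - (ln c + 1 - L) * c + c * (\<integral>z. exp (u z - L) \<partial>circ)"
      using FF F eint' by (simp add: c_def)
    also have "\<dots> \<le> (\<integral>z. F z * ln (F z) \<partial>circ) - (ln c + 1 - L) * c + c * 1"
      using e1 c by (intro add_left_mono mult_left_mono) auto
    finally have "2 * X / c \<le> (\<integral>z. F z * ln (F z) \<partial>circ) - (ln c + 1 - L) * c + c * 1" .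
    moreover have "L * c = X / c" "2 * X / c = X / c + X / c" "(ln c + 1 - L) * c = c * ln c + c - L * c"
      using c by (simp_all add: L power2_eq_square algebra_simps)
    ultimately have "X / c \<le> (\<integral>z. F z * ln (F z) \<partial>circ) - c * ln c" by linarith
    then have "X \<le> c * ((\<integral>z. F z * ln (F z) \<partial>circ) - c * ln c)"
      using c by (simp add: field_simps)
    then show ?thesis by (simp only: X_def f_def)
  qed
qed

section \<open>Abel summation of the logarithmic kernel\<close>

text \<open>The term \<open>m = 0\<close> is a division by zero and has the value zero, so the
  series in effect starts at \<open>m = 1\<close>. The same convention holds in all later sums over
  \<open>m\<close>.\<close>

lemma ln_norm_series:
  assumes "norm w < 1"
  shows "(\<lambda>m. Re (w ^ m / of_nat m)) sums (- ln (norm (1 - w)))"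
proof -
  have "1 - w \<noteq> 0" using assms by auto
  then have "Re (Ln (1 - w)) = ln (norm (1 - w))" by simp
  moreover have "(\<lambda>m. - (- (w ^ m) / of_nat m)) sums (- Ln (1 - w))"
    using Ln_series'[of "-w"] assms by (intro sums_minus) simp
  ultimately show ?thesis using sums_Re by fastforce
qed

lemma Re_of_real_mult: "Re (of_real r * w) = r * Re w"
  by simp

text \<open>The damping factor \<open>w\<close> supplies a geometric majorant, so series and
  integral can be exchanged before anything is known about the undamped logarithm.\<close>

lemma abel_series:
  fixes h :: "'a \<Rightarrow> real" and p :: "'a \<Rightarrow> complex"
  assumes h: "integrable M h" and [measurable]: "p \<in> borel_measurable M"
    and p: "AE x in M. norm (p x) \<le> 1" and w: "norm w < 1"
  shows "(\<lambda>m. Re (w ^ m / of_nat m * (\<integral>x. of_real (h x) * p x ^ m \<partial>M))) sums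
    (\<integral>x. h x * (- ln (norm (1 - w * p x))) \<partial>M)"
    and "integrable M (\<lambda>x. of_real (h x) * p x ^ m)"
proof -
  have [measurable]: "h \<in> borel_measurable M" using h by auto
  show int: "integrable M (\<lambda>x. of_real (h x) * p x ^ m)" for m
    by (rule Bochner_Integration.integrable_bound[OF h])
      (use p in \<open>auto simp: norm_mult norm_power power_le_one mult_left_le elim!: eventually_mono\<close>)
  let ?f = "\<lambda>m x. Re (w ^ m / of_nat m * (of_real (h x) * p x ^ m))"
  have fint: "integrable M (?f m)" for m by (intro integrable_Re integrable_mult_right int)
  have bound: "\<bar>?f m x\<bar> \<le> norm w ^ m * \<bar>h x\<bar>" if "norm (p x) \<le> 1" for m x
  proof -
    have "\<bar>?f m x\<bar> \<le> norm (w ^ m / of_nat m * (of_real (h x) * p x ^ m))" by (rule abs_Re_le_cmod)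
    also have "\<dots> = norm w ^ m * inverse (real m) * (\<bar>h x\<bar> * norm (p x) ^ m)"
      by (simp add: norm_mult norm_power norm_divide) (simp add: divide_inverse)
    also have "\<dots> \<le> norm w ^ m * 1 * (\<bar>h x\<bar> * 1)"
      using that by (intro mult_mono power_le_one) (auto simp: inverse_le_1_iff)
    finally show ?thesis by simp
  qed
  have geo: "summable (\<lambda>m. norm w ^ m * C)" for C
    using w by (intro summable_mult2 summable_geometric) simp
  have "(\<lambda>m. integral\<^sup>L M (?f m)) sums (\<integral>x. (\<Sum>m. ?f m x) \<partial>M)"
  proof (rule sums_integral)
    show "AE x in M. summable (\<lambda>m. norm (?f m x))"
      using p
    proof (rule eventually_mono)
      fix x assume px: "norm (p x) \<le> 1"
      show "summable (\<lambda>m. norm (?f m x))"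
        by (rule summable_comparison_test'[OF geo[of "\<bar>h x\<bar>"], of 0])
          (simp only: real_norm_def abs_idempotent bound[OF px])
    qed
    show "summable (\<lambda>m. \<integral>x. norm (?f m x) \<partial>M)"
    proof (rule summable_comparison_test'[OF geo[of "\<integral>x. \<bar>h x\<bar> \<partial>M"], of 0])
      fix m
      have "(\<integral>x. norm (?f m x) \<partial>M) \<le> (\<integral>x. norm w ^ m * \<bar>h x\<bar> \<partial>M)"
      proof (rule integral_mono_AE)
        show "AE x in M. norm (?f m x) \<le> norm w ^ m * \<bar>h x\<bar>"
          using p by (rule eventually_mono) (simp only: real_norm_def bound)
      qed (use h fint[of m] in \<open>simp_all only: integrable_norm integrable_mult_right integrable_abs\<close>)
      moreover have "0 \<le> (\<integral>x. norm (?f m x) \<partial>M)" by (rule integral_nonneg_AE) (rule AE_I2, rule norm_ge_zero)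
      ultimately show "norm (\<integral>x. norm (?f m x) \<partial>M) \<le> norm w ^ m * (\<integral>x. \<bar>h x\<bar> \<partial>M)"
        by (simp only: real_norm_def abs_of_nonneg integral_mult_right_zero)
    qed
  qed (rule fint)
  moreover have "(\<integral>x. (\<Sum>m. ?f m x) \<partial>M) = (\<integral>x. h x * (- ln (norm (1 - w * p x))) \<partial>M)"
  proof (rule integral_cong_AE)
    show "AE x in M. (\<Sum>m. ?f m x) = h x * (- ln (norm (1 - w * p x)))"
      using p
    proof (rule eventually_mono)
      fix x assume px: "norm (p x) \<le> 1"
      have "norm (w * p x) < 1"
        unfolding norm_mult using px w mult_left_le[of "norm (p x)" "norm w"] by simp
      then have "(\<lambda>m. h x * Re ((w * p x) ^ m / of_nat m)) sums (h x * (- ln (norm (1 - w * p x))))"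
        by (intro sums_mult ln_norm_series)
      moreover have "h x * Re ((w * p x) ^ m / of_nat m) = ?f m x" for m
      proof -
        have "w ^ m / of_nat m * (of_real (h x) * p x ^ m) = of_real (h x) * ((w * p x) ^ m / of_nat m)"
          by (simp add: power_mult_distrib)
        then show ?thesis by (simp only: Re_of_real_mult)
      qed
      ultimately have "(\<lambda>m. ?f m x) sums (h x * (- ln (norm (1 - w * p x))))" by (simp only:)
      then show "(\<Sum>m. ?f m x) = h x * (- ln (norm (1 - w * p x)))" by (rule sums_unique[symmetric])
    qed
  qed measurable
  moreover have "integral\<^sup>L M (?f m) = Re (w ^ m / of_nat m * (\<integral>x. of_real (h x) * p x ^ m \<partial>M))" for m
    using int by (subst integral_Re) auto
  ultimately show "(\<lambda>m. Re (w ^ m / of_nat m * (\<integral>x. of_real (h x) * p x ^ m \<partial>M))) sums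
    (\<integral>x. h x * (- ln (norm (1 - w * p x))) \<partial>M)" by (simp only:)
qed

text \<open>\<open>1 - z = (1 - r z) - (1 - r) z\<close>, and the last term has modulus at most
  \<open>1 - r \<le> |1 - r z|\<close>; hence \<open>|1 - z| \<le> 2 |1 - r z|\<close>. The bound is
  uniform in \<open>r\<close> and dominates the limit \<open>r \<rightarrow> 1\<close>.\<close>

lemma abs_ln_one_minus_le:
  assumes "norm z \<le> 1" "z \<noteq> (1::complex)" "0 \<le> r" "r < 1"
  shows "\<bar>ln (norm (1 - of_real r * z))\<bar> \<le> ln 2 + \<bar>ln (norm (1 - z))\<bar>"
proof -
  have r: "norm (of_real r * z) \<le> r" using assms by (simp add: norm_mult mult_left_le)
  have 1: "norm (1 - of_real r * z) \<le> 2"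
    using norm_triangle_ineq4[of 1 "of_real r * z"] r assms by simp
  have 2: "1 - r \<le> norm (1 - of_real r * z)"
    using norm_triangle_ineq2[of 1 "of_real r * z"] r by simp
  have "norm (1 - z) \<le> norm (1 - of_real r * z) + norm ((of_real r - 1) * z)"
    using norm_triangle_ineq[of "1 - of_real r * z" "(of_real r - 1) * z"] by (simp add: algebra_simps)
  also have "norm ((of_real r - 1) * z) \<le> 1 - r"
  proof -
    have "norm (complex_of_real r - 1) = 1 - r"
      using norm_of_real[of "r - 1", where 'a=complex] assms by simp
    then show ?thesis using assms by (simp add: norm_mult mult_left_le)
  qed
  finally have 3: "norm (1 - z) \<le> 2 * norm (1 - of_real r * z)" using 2 by simp
  have pos: "0 < norm (1 - z)" "0 < norm (1 - of_real r * z)"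
    using assms(2) by simp (use 2 assms(4) in linarith)
  define A B where "A = norm (1 - z)" and "B = norm (1 - of_real r * z)"
  have AB: "0 < A" "0 < B" "A \<le> 2 * B" "B \<le> 2" unfolding A_def B_def by (fact pos 3 1)+
  have "ln A \<le> ln (2 * B)" using AB by (intro ln_mono) linarith+
  also have "ln (2 * B) = ln 2 + ln B" using AB by (intro ln_mult_pos) linarith+
  finally have "ln A \<le> ln 2 + ln B" .
  moreover have "ln B \<le> ln 2" using AB by (intro ln_mono) linarith+
  ultimately have "\<bar>ln B\<bar> \<le> ln 2 + \<bar>ln A\<bar>" by (auto simp: abs_if)
  then show ?thesis by (simp only: A_def B_def)
qed


lemma abel_limit:
  fixes h :: "'a \<Rightarrow> real" and p :: "'a \<Rightarrow> complex"
  assumes h: "integrable M h" and [measurable]: "p \<in> borel_measurable M"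
    and p: "AE x in M. norm (p x) \<le> 1" "AE x in M. p x \<noteq> 1"
    and int: "integrable M (\<lambda>x. h x * ln (norm (1 - p x)))"
  shows "(\<lambda>n. \<integral>x. h x * (- ln (norm (1 - of_real (real n / (real n + 1)) * p x))) \<partial>M) \<longlonglongrightarrow>
    (\<integral>x. h x * (- ln (norm (1 - p x))) \<partial>M)"
proof -
  define r where "r n = real n / (real n + 1)" for n
  have r: "0 \<le> r n" "r n < 1" for n by (auto simp: r_def field_simps)
  have rlim: "r \<longlonglongrightarrow> 1" unfolding r_def by real_asymp
  have [measurable]: "h \<in> borel_measurable M" using h by auto
  have "(\<lambda>n. \<integral>x. h x * (- ln (norm (1 - of_real (r n) * p x))) \<partial>M) \<longlonglongrightarrow>
    (\<integral>x. h x * (- ln (norm (1 - p x))) \<partial>M)"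
  proof (rule integral_dominated_convergence[where w="\<lambda>x. ln 2 * \<bar>h x\<bar> + \<bar>h x * ln (norm (1 - p x))\<bar>"])
    show "integrable M (\<lambda>x. ln 2 * \<bar>h x\<bar> + \<bar>h x * ln (norm (1 - p x))\<bar>)"
      using h int by (intro Bochner_Integration.integrable_add integrable_mult_right integrable_abs)
    show "AE x in M. (\<lambda>n. h x * (- ln (norm (1 - of_real (r n) * p x)))) \<longlonglongrightarrow> h x * (- ln (norm (1 - p x)))"
      using p(2)
    proof (rule eventually_mono)
      fix x assume "p x \<noteq> 1"
      then have "(\<lambda>n. h x * (- ln (norm (1 - of_real (r n) * p x)))) \<longlonglongrightarrow> h x * (- ln (norm (1 - of_real 1 * p x)))"
        by (intro tendsto_intros rlim) auto
      then show "(\<lambda>n. h x * (- ln (norm (1 - of_real (r n) * p x)))) \<longlonglongrightarrow> h x * (- ln (norm (1 - p x)))" by simp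
    qed
    show "AE x in M. norm (h x * (- ln (norm (1 - of_real (r n) * p x))))
        \<le> ln 2 * \<bar>h x\<bar> + \<bar>h x * ln (norm (1 - p x))\<bar>" for n
      using p
    proof eventually_elim
      fix x assume "norm (p x) \<le> 1" "p x \<noteq> 1"
      from mult_left_mono[OF abs_ln_one_minus_le[OF this r], of "\<bar>h x\<bar>"]
      show "norm (h x * (- ln (norm (1 - of_real (r n) * p x))))
        \<le> ln 2 * \<bar>h x\<bar> + \<bar>h x * ln (norm (1 - p x))\<bar>"
        by (simp add: abs_mult algebra_simps)
    qed
  qed measurable
  then show ?thesis by (simp only: r_def)
qed

text \<open>In the damped series the coefficient of order \<open>m\<close> is
  \<open>r ^ m / m\<close> times the square modulus of the moment of \<open>h\<close> against
  \<open>p ^ m\<close>. The damping is then removed by \<open>abel_limit\<close>.\<close>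

lemma (in sigma_finite_measure) log_kernel_nonneg:
  fixes h :: "'a \<Rightarrow> real" and p :: "'a \<Rightarrow> complex"
  assumes h: "integrable M h" and p: "p \<in> borel_measurable M" "AE x in M. norm (p x) \<le> 1"
    and ne: "AE z in M \<Otimes>\<^sub>M M. p (fst z) * cnj (p (snd z)) \<noteq> 1"
    and int: "integrable (M \<Otimes>\<^sub>M M) (\<lambda>z. (h (fst z) * h (snd z)) * ln (norm (1 - p (fst z) * cnj (p (snd z)))))"
  shows "(\<integral>z. (h (fst z) * h (snd z)) * ln (norm (1 - p (fst z) * cnj (p (snd z)))) \<partial>(M \<Otimes>\<^sub>M M)) \<le> 0"
proof -
  interpret pair_sigma_finite M M ..
  have [measurable]: "p \<in> borel_measurable M" "h \<in> borel_measurable M" using p h by auto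
  let ?h = "\<lambda>z. h (fst z) * h (snd z)" and ?p = "\<lambda>z. p (fst z) * cnj (p (snd z))"
  have hh: "integrable (M \<Otimes>\<^sub>M M) ?h" by (rule integrable_mult_pair(1)[OF h h])
  have pp: "AE z in M \<Otimes>\<^sub>M M. norm (?p z) \<le> 1"
  proof (rule AE_pair_measure)
    show "{z \<in> space (M \<Otimes>\<^sub>M M). norm (?p z) \<le> 1} \<in> sets (M \<Otimes>\<^sub>M M)" by measurable
    show "AE x in M. AE y in M. norm (?p (x, y)) \<le> 1"
      using p(2) by (rule eventually_mono) (use p(2) in \<open>auto simp: norm_mult mult_le_one elim!: eventually_mono\<close>)
  qed
  have "0 \<le> (\<integral>z. ?h z * (- ln (norm (1 - of_real (real n / (real n + 1)) * ?p z))) \<partial>(M \<Otimes>\<^sub>M M))" for n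
  proof -
    define r where "r = real n / (real n + 1)"
    have r: "0 \<le> r" "r < 1" by (auto simp: r_def field_simps)
    have S: "(\<lambda>m. Re (of_real r ^ m / of_nat m * (\<integral>z. of_real (?h z) * ?p z ^ m \<partial>(M \<Otimes>\<^sub>M M)))) sums
      (\<integral>z. ?h z * (- ln (norm (1 - of_real r * ?p z))) \<partial>(M \<Otimes>\<^sub>M M))"
      using r by (intro abel_series hh pp) auto
    have "0 \<le> Re (of_real r ^ m / of_nat m * (\<integral>z. of_real (?h z) * ?p z ^ m \<partial>(M \<Otimes>\<^sub>M M)))" for m
    proof -
      define c where "c = (\<integral>x. of_real (h x) * p x ^ m \<partial>M)"
      have i: "integrable M (\<lambda>x. of_real (h x) * p x ^ m)"
        using abel_series(2)[OF h p, of 0 m] by simp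
      have "(\<integral>z. of_real (?h z) * ?p z ^ m \<partial>(M \<Otimes>\<^sub>M M))
          = (\<integral>z. (of_real (h (fst z)) * p (fst z) ^ m) * cnj (of_real (h (snd z)) * p (snd z) ^ m) \<partial>(M \<Otimes>\<^sub>M M))"
        by (intro Bochner_Integration.integral_cong) (simp_all add: power_mult_distrib mult_ac)
      also have "\<dots> = c * cnj c"
        using integrable_mult_pair(2)[OF i integrable_cnj[OF i]] by (simp only: c_def Bochner_Integration.integral_cnj)
      also have "\<dots> = of_real ((norm c)\<^sup>2)" by (rule complex_norm_square[symmetric])
      finally have "of_real r ^ m / of_nat m * (\<integral>z. of_real (?h z) * ?p z ^ m \<partial>(M \<Otimes>\<^sub>M M))
          = of_real (r ^ m / real m * (norm c)\<^sup>2)" by simp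
      then show ?thesis using r by (simp only: Re_complex_of_real) simp
    qed
    then have "0 \<le> (\<integral>z. ?h z * (- ln (norm (1 - of_real r * ?p z))) \<partial>(M \<Otimes>\<^sub>M M))"
      by (rule sums_le[OF _ sums_zero S])
    then show ?thesis by (simp only: r_def)
  qed
  then have "0 \<le> (\<integral>z. ?h z * (- ln (norm (1 - ?p z))) \<partial>(M \<Otimes>\<^sub>M M))"
    by (intro LIMSEQ_le_const[OF abel_limit[OF hh _ pp ne int]]) auto
  then show ?thesis by simp
qed

section \<open>Radial integration\<close>

text \<open>The volume of the ball around 0 through \<open>x\<close>. In this coordinate Lebesgue
  measure becomes Lebesgue measure on the half-line, so radial integrals carry no Jacobian.\<close>

definition ball_vol :: "'a::euclidean_space \<Rightarrow> real" where
  "ball_vol x = unit_ball_vol (real DIM('a)) * norm x ^ DIM('a)"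

lemma ball_vol_measurable [measurable]: "ball_vol \<in> borel_measurable borel"
  unfolding ball_vol_def by measurable

lemma ball_vol_nonneg: "0 \<le> ball_vol x"
  by (simp add: ball_vol_def)

text \<open>The sublevel set at \<open>v \<ge> 0\<close> is a closed ball of volume
  \<open>v\<close>, and half-lines generate the Borel sets.\<close>

lemma distr_ball_vol:
  "distr (lborel :: 'a::euclidean_space measure) borel ball_vol = density lborel (indicator {0..})"
proof (rule measure_eqI_generator_eq[where E="range (\<lambda>v. {..v})" and \<Omega>=UNIV and A="\<lambda>i. {..real i}"])
  show "Int_stable (range (\<lambda>v::real. {..v}))"
    by (auto simp: Int_stable_def Int_atMost)
  fix X assume "X \<in> range (\<lambda>v::real. {..v})"
  then obtain v where X: "X = {..v}" by auto
  let ?c = "unit_ball_vol (real DIM('a))" and ?N = "DIM('a)"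
  have c: "?c > 0" by simp
  have "emeasure (distr (lborel :: 'a measure) borel ball_vol) X = ennreal (max v 0)"
  proof (cases "v < 0")
    case True
    have "\<not> ball_vol x \<le> v" for x :: 'a using ball_vol_nonneg[of x] True by linarith
    then have "ball_vol -` X = ({} :: 'a set)" by (auto simp: X)
    then show ?thesis using True by (simp add: emeasure_distr X)
  next
    case False
    define r where "r = root ?N (v / ?c)"
    have r: "r \<ge> 0" "?c * r ^ ?N = v" using False c by (auto simp: r_def less_imp_neq[symmetric])
    have "ball_vol x \<le> v \<longleftrightarrow> norm x \<le> r" for x :: 'a
    proof -
      have "ball_vol x \<le> v \<longleftrightarrow> norm x ^ ?N \<le> r ^ ?N"
        unfolding r(2)[symmetric] ball_vol_def using c by simp
      also have "\<dots> \<longleftrightarrow> norm x \<le> r" using r by (intro power_mono_iff) auto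
      finally show ?thesis .
    qed
    then have "ball_vol -` X = cball (0::'a) r" by (auto simp: X)
    then show ?thesis using False r emeasure_cball[of r "0::'a"] by (simp add: emeasure_distr X)
  qed
  also have "\<dots> = emeasure lborel {0..v}" by (cases "v < 0") auto
  also have "\<dots> = emeasure (density lborel (indicator {0..})) X"
    by (subst emeasure_density) (auto simp: X nn_integral_indicator[symmetric] simp del: nn_integral_indicator
        intro!: nn_integral_cong split: split_indicator)
  finally show "emeasure (distr (lborel :: 'a measure) borel ball_vol) X = emeasure (density lborel (indicator {0..})) X" .
next
  show "sets (distr (lborel :: 'a measure) borel ball_vol) = sigma_sets UNIV (range (\<lambda>v::real. {..v}))"
    by (simp add: borel_eq_atMost)
  show "sets (density lborel (indicator {0..} :: real \<Rightarrow> ennreal)) = sigma_sets UNIV (range (\<lambda>v::real. {..v}))"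
    by (simp add: borel_eq_atMost)
  show "(\<Union>i. {..real i}) = UNIV" by (auto intro: real_arch_simple)
  fix i :: nat
  have "emeasure (distr (lborel :: 'a measure) borel ball_vol) {..real i}
      \<le> emeasure lborel (cball (0::'a) (root DIM('a) (real i / unit_ball_vol (real DIM('a)))))"
  proof -
    let ?c = "unit_ball_vol (real DIM('a))" and ?N = "DIM('a)"
    have "norm x \<le> root ?N (real i / ?c)" if "ball_vol x \<le> real i" for x :: 'a
    proof -
      have "norm x ^ ?N \<le> real i / ?c" using that by (simp add: ball_vol_def field_simps)
      then have "root ?N (norm x ^ ?N) \<le> root ?N (real i / ?c)" by (intro real_root_le_mono) auto
      then show ?thesis by (simp add: real_root_power_cancel)
    qed
    then show ?thesis by (subst emeasure_distr) (auto intro!: emeasure_mono)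
  qed
  also have "\<dots> < \<infinity>" by (rule emeasure_bounded_finite) simp
  finally show "emeasure (distr (lborel :: 'a measure) borel ball_vol) {..real i} \<noteq> \<infinity>" by simp
qed auto

lemma nn_integral_radial:
  assumes [measurable]: "h \<in> borel_measurable borel"
  shows "(\<integral>\<^sup>+x. h (norm x) \<partial>(lborel :: 'a::euclidean_space measure)) =
    (\<integral>\<^sup>+v. h (root DIM('a) (v / unit_ball_vol (real DIM('a)))) * indicator {0..} v \<partial>lborel)"
proof -
  let ?g = "\<lambda>v. h (root DIM('a) (v / unit_ball_vol (real DIM('a))))"
  have [measurable]: "?g \<in> borel_measurable borel" by measurable
  have "(\<integral>\<^sup>+x. h (norm x) \<partial>(lborel :: 'a measure)) = (\<integral>\<^sup>+x. ?g (ball_vol x) \<partial>(lborel :: 'a measure))"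
    by (intro nn_integral_cong) (simp add: ball_vol_def real_root_power_cancel less_imp_neq[OF unit_ball_vol_pos, symmetric])
  also have "\<dots> = (\<integral>\<^sup>+v. ?g v \<partial>(distr (lborel :: 'a measure) borel ball_vol))"
    by (simp add: nn_integral_distr)
  also have "\<dots> = (\<integral>\<^sup>+v. ?g v * indicator {0..} v \<partial>lborel)"
    unfolding distr_ball_vol by (subst nn_integral_density) (auto simp: mult.commute)
  finally show ?thesis .
qed

text \<open>The exponent \<open>-1/2\<close> is locally integrable in every dimension, and this
  power dominates the logarithmic singularity of the kernel.\<close>

lemma nn_integral_powr_ball:
  "(\<integral>\<^sup>+x. ennreal (norm x powr (-1/2)) * indicator (ball 0 1) x \<partial>(lborel :: 'a::euclidean_space measure)) < \<infinity>"
proof -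
  let ?c = "unit_ball_vol (real DIM('a))" and ?N = "DIM('a)"
  let ?a = "(-1/2) / real ?N"
  have "real ?N \<ge> 1" by (simp add: DIM_positive Suc_leI)
  then have N2: "1 < real ?N * 2" by linarith
  have "(\<integral>\<^sup>+x. ennreal (norm x powr (-1/2)) * indicator (ball 0 1) x \<partial>(lborel :: 'a measure))
      = (\<integral>\<^sup>+x. ennreal (norm x powr (-1/2)) * indicator {..<1} (norm x) \<partial>(lborel :: 'a measure))"
    by (intro nn_integral_cong) (auto split: split_indicator)
  also have "\<dots> = (\<integral>\<^sup>+v. ennreal (root ?N (v / ?c) powr (-1/2)) * indicator {..<1} (root ?N (v / ?c)) * indicator {0..} v \<partial>lborel)"
    by (rule nn_integral_radial) measurable
  also have "\<dots> \<le> (\<integral>\<^sup>+v. ennreal ((1 / ?c) powr ?a * v powr ?a) * indicator {0..?c} v \<partial>lborel)"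
  proof (intro nn_integral_mono)
    fix v :: real
    have "root ?N (v / ?c) powr (-1/2) = (1 / ?c) powr ?a * v powr ?a" "v \<le> ?c" if v: "0 \<le> v" "root ?N (v / ?c) < 1"
    proof -
      have "v / ?c < 1" using v(2) real_root_lt_1_iff[of ?N "v / ?c"] by simp
      then show "v \<le> ?c" by (simp add: field_simps)
      show "root ?N (v / ?c) powr (-1/2) = (1 / ?c) powr ?a * v powr ?a"
        using v by (cases "v = 0") (simp_all add: root_powr_inverse powr_powr powr_mult[symmetric] mult.commute)
    qed
    then show "ennreal (root ?N (v / ?c) powr (-1/2)) * indicator {..<1} (root ?N (v / ?c)) * indicator {0..} v
      \<le> ennreal ((1 / ?c) powr ?a * v powr ?a) * indicator {0..?c} v"
      by (auto split: split_indicator)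
  qed
  also have "\<dots> = ennreal ((1 / ?c) powr ?a) * (\<integral>\<^sup>+v. ennreal (v powr ?a) * indicator {0..?c} v \<partial>lborel)"
    by (subst nn_integral_cmult[symmetric]) (auto simp: ennreal_mult mult.assoc)
  also have "(\<integral>\<^sup>+v. ennreal (v powr ?a) * indicator {0..?c} v \<partial>lborel) = ennreal (?c powr (?a + 1) / (?a + 1))"
    by (intro nn_integral_has_integral_lebesgue' has_integral_powr_from_0) (use N2 in \<open>auto simp: field_simps\<close>)
  also have "ennreal ((1 / ?c) powr ?a) * \<dots> < \<infinity>" by (simp add: ennreal_mult_less_top)
  finally show ?thesis .
qed

text \<open>The decay \<open>-2 N\<close> of the optimizers, weakened by \<open>1/2\<close>, is
  still integrable for every \<open>N \<ge> 1\<close>. The spare half absorbs logarithms.\<close>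

lemma nn_integral_tail:
  "(\<integral>\<^sup>+x. ennreal ((1 + norm x) powr (1/2 - 2 * real DIM('a))) \<partial>(lborel :: 'a::euclidean_space measure)) < \<infinity>"
proof -
  let ?c = "unit_ball_vol (real DIM('a))" and ?N = "DIM('a)"
  let ?b = "1/2 - 2 * real ?N" let ?a = "?b / real ?N"
  have c: "?c > 0" by simp
  have N: "real ?N \<ge> 1" by (simp add: DIM_positive Suc_leI)
  have b: "?b \<le> 0" using N by linarith
  have "1 < real ?N * 2" using N by linarith
  then have a: "?a < -1" by (auto simp: field_simps)
  have "(\<integral>\<^sup>+x. ennreal ((1 + norm x) powr ?b) \<partial>(lborel :: 'a measure))
     = (\<integral>\<^sup>+v. ennreal ((1 + root ?N (v / ?c)) powr ?b) * indicator {0..} v \<partial>lborel)"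
    by (rule nn_integral_radial) measurable
  also have "\<dots> \<le> (\<integral>\<^sup>+v. indicator {0..?c} v + ennreal ((1 / ?c) powr ?a) * (ennreal (v powr ?a) * indicator {?c..} v) \<partial>lborel)"
  proof (intro nn_integral_mono)
    fix v :: real
    show "ennreal ((1 + root ?N (v / ?c)) powr ?b) * indicator {0..} v
      \<le> indicator {0..?c} v + ennreal ((1 / ?c) powr ?a) * (ennreal (v powr ?a) * indicator {?c..} v)"
    proof (cases "0 \<le> v \<and> v \<le> ?c")
      case True
      have "0 \<le> root ?N (v / ?c)" using True by simp
      then have "(1 + root ?N (v / ?c)) powr ?b \<le> 1 powr ?b"
        using b by (intro powr_mono2') auto
      then have "ennreal ((1 + root ?N (v / ?c)) powr ?b) \<le> 1" by simp
      then show ?thesis using True by (auto split: split_indicator intro: add_increasing2)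
    next
      case False
      show ?thesis
      proof (cases "0 \<le> v")
        case True
        then have v: "v > ?c" "v > 0" using False c by linarith+
        have r: "0 < root ?N (v / ?c)" using divide_pos_pos[OF v(2) c] by (simp only: real_root_gt_0_iff DIM_positive)
        have "(1 + root ?N (v / ?c)) powr ?b \<le> root ?N (v / ?c) powr ?b"
          using b r by (intro powr_mono2') auto
        also have "\<dots> = (1 / ?c) powr ?a * v powr ?a"
          using v by (simp add: root_powr_inverse powr_powr powr_mult[symmetric])
        finally show ?thesis using v by (auto split: split_indicator simp: ennreal_mult[symmetric] intro!: ennreal_leI)
      qed simp
    qed
  qed
  also have "\<dots> = emeasure lborel {0..?c} + ennreal ((1 / ?c) powr ?a) * (\<integral>\<^sup>+v. ennreal (v powr ?a) * indicator {?c..} v \<partial>lborel)"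
    by (subst nn_integral_add) (auto simp: nn_integral_cmult)
  also have "(\<integral>\<^sup>+v. ennreal (v powr ?a) * indicator {?c..} v \<partial>lborel) = ennreal (- (?c powr (?a + 1)) / (?a + 1))"
    using a c by (intro nn_integral_has_integral_lebesgue' has_integral_powr_to_inf) auto
  also have "emeasure lborel {0..?c} + ennreal ((1 / ?c) powr ?a) * \<dots> < \<infinity>"
    by (simp add: ennreal_mult_less_top)
  finally show ?thesis .
qed

section \<open>Admissible functions and the logarithmic energy\<close>

text \<open>The working class: Borel representatives with finite entropy and finite logarithmic
  moment. The hypothesis of the theorem leads into it by \<open>finite_entropy_adm\<close>, and
  dilations, isometries, polarization and angular averaging stay inside.\<close>

definition adm :: "('a::euclidean_space \<Rightarrow> real) \<Rightarrow> bool" where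
  "adm f \<longleftrightarrow> f \<in> borel_measurable borel \<and> (\<forall>x. 0 \<le> f x) \<and> integrable lborel f \<and>
     integrable lborel (\<lambda>x. f x * ln (f x)) \<and> integrable lborel (\<lambda>x. f x * ln (1 + norm x))"

text \<open>The sign is opposite to that of the double integral in J: lowering \<open>logE\<close>
  raises \<open>logJ\<close>.\<close>

definition logE :: "('a::euclidean_space \<Rightarrow> real) \<Rightarrow> ('a \<Rightarrow> real) \<Rightarrow> real" where
  "logE f g = (\<integral>z. (f (fst z) * g (snd z)) * ln (norm (fst z - snd z)) \<partial>(lborel \<Otimes>\<^sub>M lborel))"

definition entS :: "('a::euclidean_space \<Rightarrow> real) \<Rightarrow> real" where
  "entS f = (\<integral>x. f x * ln (f x) \<partial>lborel)"

definition logJ :: "('a::euclidean_space \<Rightarrow> real) \<Rightarrow> ('a \<Rightarrow> real) \<Rightarrow> real" where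
  "logJ f g = - logE f g - (entS f + entS g) / (2 * real DIM('a))"

lemma admD:
  assumes "adm f"
  shows "f \<in> borel_measurable borel" "0 \<le> f x" "integrable lborel f"
    "integrable lborel (\<lambda>x. f x * ln (f x))" "integrable lborel (\<lambda>x. f x * ln (1 + norm x))"
  using assms by (auto simp: adm_def)

lemma distr_lborel_minus: "distr lborel borel (\<lambda>x. x - y) = (lborel :: 'a::euclidean_space measure)"
proof -
  have "(\<lambda>x. x - y) = (+) (- y)" by auto
  then show ?thesis by (simp only: lborel_distr_plus)
qed

text \<open>At distance at least 1 the logarithm is below
  \<open>ln (1 + |x|) + ln (1 + |y|)\<close>. At smaller distance, Young's inequality for half of it
  gives the entropy of \<open>f\<close> plus \<open>|x - y|^(-1/2)\<close>, whose integral over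
  \<open>x\<close> does not depend on \<open>y\<close>.\<close>

lemma integrable_log_kernel:
  fixes f g :: "'a::euclidean_space \<Rightarrow> real"
  assumes f: "adm f" and g: "adm g"
  shows "integrable (lborel \<Otimes>\<^sub>M lborel) (\<lambda>z. (f (fst z) * g (snd z)) * ln (norm (fst z - snd z)))"
proof -
  note [measurable] = admD(1)[OF f] admD(1)[OF g]
  have fn: "0 \<le> f x" and gn: "0 \<le> g x" for x using f g by (auto simp: adm_def)
  define \<phi> where "\<phi> z = norm z powr (-1/2) * indicator {..<1} (norm z)" for z :: 'a
  have [measurable]: "\<phi> \<in> borel_measurable borel" unfolding \<phi>_def by measurable
  have \<phi>: "integrable lborel \<phi>"
  proof (rule integrableI_bounded)
    have "(\<integral>\<^sup>+x. ennreal (norm (\<phi> x)) \<partial>lborel) = (\<integral>\<^sup>+x. ennreal (norm x powr (-1/2)) * indicator (ball 0 1) x \<partial>(lborel :: 'a measure))"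
      by (intro nn_integral_cong) (auto simp: \<phi>_def split: split_indicator)
    then show "(\<integral>\<^sup>+x. ennreal (norm (\<phi> x)) \<partial>lborel) < \<infinity>" using nn_integral_powr_ball[where 'a='a] by simp
  qed simp
  have \<phi>n: "0 \<le> \<phi> z" for z by (simp add: \<phi>_def)
  have I\<phi>: "integrable (lborel \<Otimes>\<^sub>M lborel) (\<lambda>z. \<phi> (fst z - snd z) * g (snd z))"
  proof (rule integrableI_bounded)
    have "(\<integral>\<^sup>+z. ennreal (norm (\<phi> (fst z - snd z) * g (snd z))) \<partial>(lborel \<Otimes>\<^sub>M lborel))
        = (\<integral>\<^sup>+y. (\<integral>\<^sup>+x. ennreal (\<phi> (x - y)) * ennreal (g y) \<partial>lborel) \<partial>lborel)"
      by (subst lborel_pair.nn_integral_snd[symmetric]) (auto simp: ennreal_mult \<phi>n gn case_prod_beta intro!: nn_integral_cong)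
    also have "\<dots> = (\<integral>\<^sup>+y. (\<integral>\<^sup>+x. ennreal (\<phi> x) \<partial>lborel) * ennreal (g y) \<partial>lborel)"
    proof (intro nn_integral_cong)
      fix y :: 'a
      have "(\<integral>\<^sup>+x. ennreal (\<phi> x) \<partial>lborel) = (\<integral>\<^sup>+x. ennreal (\<phi> (x - y)) \<partial>lborel)"
        by (subst distr_lborel_minus[of y, symmetric]) (simp add: nn_integral_distr)
      then show "(\<integral>\<^sup>+x. ennreal (\<phi> (x - y)) * ennreal (g y) \<partial>lborel) = (\<integral>\<^sup>+x. ennreal (\<phi> x) \<partial>lborel) * ennreal (g y)"
        by (simp add: nn_integral_multc)
    qed
    also have "\<dots> = (\<integral>\<^sup>+x. ennreal (\<phi> x) \<partial>lborel) * (\<integral>\<^sup>+y. ennreal (g y) \<partial>lborel)"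
      by (simp add: nn_integral_cmult)
    also have "\<dots> < \<infinity>"
      using \<phi> admD(3)[OF g] by (simp add: nn_integral_eq_integral \<phi>n gn ennreal_mult_less_top)
    finally show "(\<integral>\<^sup>+z. ennreal (norm (\<phi> (fst z - snd z) * g (snd z))) \<partial>(lborel \<Otimes>\<^sub>M lborel)) < \<infinity>" .
  qed measurable
  let ?B = "\<lambda>z. (f (fst z) * ln (1 + norm (fst z))) * g (snd z) + f (fst z) * (g (snd z) * ln (1 + norm (snd z)))
      + 2 * (\<bar>f (fst z) * ln (f (fst z))\<bar> * g (snd z)) + 2 * (\<phi> (fst z - snd z) * g (snd z))"
  have B: "integrable (lborel \<Otimes>\<^sub>M lborel) ?B"
    by (intro Bochner_Integration.integrable_add integrable_mult_right I\<phi>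
        lborel_pair.integrable_mult_pair(1)[where f="\<lambda>x. f x * ln (1 + norm x)" and g=g]
        lborel_pair.integrable_mult_pair(1)[where g="\<lambda>x. g x * ln (1 + norm x)" and f=f]
        lborel_pair.integrable_mult_pair(1)[where f="\<lambda>x. \<bar>f x * ln (f x)\<bar>" and g=g]
        integrable_abs admD[OF f] admD[OF g])
  have bound: "\<bar>(f x * g y) * ln (norm (x - y))\<bar> \<le> ?B (x, y)" for x y
  proof -
    have Lx: "0 \<le> ln (1 + norm x)" "0 \<le> ln (1 + norm y)" by auto
    have P: "0 \<le> (f x * ln (1 + norm x)) * g y" "0 \<le> f x * (g y * ln (1 + norm y))"
      "0 \<le> \<bar>f x * ln (f x)\<bar> * g y" "0 \<le> \<phi> (x - y) * g y"
      using fn gn \<phi>n Lx by auto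
    consider "x = y" | "norm (x - y) \<ge> 1" | "0 < norm (x - y)" "norm (x - y) < 1" by fastforce
    then show ?thesis
    proof cases
      case 1
      then show ?thesis using P by simp
    next
      case 2
      have "norm (x - y) \<le> norm x + norm y" by (rule norm_triangle_ineq4)
      also have "\<dots> \<le> (1 + norm x) * (1 + norm y)" by (simp add: algebra_simps)
      finally have "ln (norm (x - y)) \<le> ln ((1 + norm x) * (1 + norm y))" using 2 by (intro ln_mono) auto
      also have "\<dots> = ln (1 + norm x) + ln (1 + norm y)" by (intro ln_mult_pos) (auto intro: add_pos_nonneg)
      finally have "(f x * g y) * ln (norm (x - y)) \<le> (f x * g y) * (ln (1 + norm x) + ln (1 + norm y))"
        using fn gn by (intro mult_left_mono) auto
      moreover have "0 \<le> (f x * g y) * ln (norm (x - y))" using fn gn 2 by simp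
      ultimately show ?thesis using P by (simp add: algebra_simps)
    next
      case 3
      have "f x * (- ln (norm (x - y)) / 2) \<le> f x * ln (f x) - f x + exp (- ln (norm (x - y)) / 2)"
        using fn by (rule young_exp)
      also have "exp (- ln (norm (x - y)) / 2) = \<phi> (x - y)"
        using 3 by (simp add: \<phi>_def powr_def)
      finally have "f x * (- ln (norm (x - y))) \<le> 2 * \<bar>f x * ln (f x)\<bar> + 2 * \<phi> (x - y)"
        using fn[of x] by (simp add: abs_if split: if_splits)
      then have "(f x * (- ln (norm (x - y)))) * g y \<le> (2 * \<bar>f x * ln (f x)\<bar> + 2 * \<phi> (x - y)) * g y"
        using gn by (rule mult_right_mono)
      moreover have "(f x * g y) * ln (norm (x - y)) \<le> 0" using fn[of x] gn[of y] 3 by (intro mult_nonneg_nonpos) auto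
      ultimately show ?thesis using P by (simp add: algebra_simps)
    qed
  qed
  show ?thesis
    by (rule Bochner_Integration.integrable_bound[OF B])
       (measurable, use bound order_trans[OF bound abs_ge_self] in auto)
qed

section \<open>Relative entropy and the Frullani integral\<close>

lemma gibbs_pointwise:
  fixes a b :: real
  assumes "0 \<le> a" "0 \<le> b" "b = 0 \<Longrightarrow> a = 0"
  shows "0 \<le> a * ln a - a * ln b - a + b"
    and "a * ln a - a * ln b - a + b = 0 \<Longrightarrow> a = b"
proof -
  have "0 \<le> a * ln a - a * ln b - a + b \<and> (a * ln a - a * ln b - a + b = 0 \<longrightarrow> a = b)"
  proof (cases "a = 0")
    case False
    then have ab: "a > 0" "b > 0" using assms by fastforce+
    have eq: "a * ln a - a * ln b - a + b = a * ((b / a - 1) - ln (b / a))"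
      using ab by (simp add: ln_div field_simps)
    have "ln (b / a) \<le> b / a - 1" using ab by (intro ln_le_minus_one) simp
    moreover have "a = b" if "ln (b / a) = b / a - 1"
      using ln_eq_minus_one[OF _ that] ab by (simp add: field_simps)
    ultimately show ?thesis using ab unfolding eq by auto
  qed (use assms in auto)
  then show "0 \<le> a * ln a - a * ln b - a + b" "a * ln a - a * ln b - a + b = 0 \<Longrightarrow> a = b" by auto
qed

text \<open>The summand \<open>- f + g\<close> integrates to zero and makes the integrand
  nonnegative pointwise. As \<open>ln 0 = 0\<close>, a point with \<open>g = 0 < f\<close> would not
  be penalized; \<open>ac\<close> excludes it.\<close>

lemma gibbs:
  fixes f g :: "'a \<Rightarrow> real"
  assumes nn: "\<And>x. 0 \<le> f x" "\<And>x. 0 \<le> g x" and int: "integrable M f" "integrable M g"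
    and mass: "(\<integral>x. f x \<partial>M) = (\<integral>x. g x \<partial>M)"
    and ent: "integrable M (\<lambda>x. f x * ln (f x))" "integrable M (\<lambda>x. f x * ln (g x))"
    and ac: "AE x in M. g x = 0 \<longrightarrow> f x = 0"
  shows "(\<integral>x. f x * ln (g x) \<partial>M) \<le> (\<integral>x. f x * ln (f x) \<partial>M)"
    and "(\<integral>x. f x * ln (g x) \<partial>M) = (\<integral>x. f x * ln (f x) \<partial>M) \<Longrightarrow> AE x in M. f x = g x"
proof -
  let ?h = "\<lambda>x. f x * ln (f x) - f x * ln (g x) - f x + g x"
  note i1 = Bochner_Integration.integrable_diff[OF ent]
  note i2 = Bochner_Integration.integrable_diff[OF i1 int(1)]
  note h = Bochner_Integration.integrable_add[OF i2 int(2)]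
  have val: "(\<integral>x. ?h x \<partial>M) = (\<integral>x. f x * ln (f x) \<partial>M) - (\<integral>x. f x * ln (g x) \<partial>M)"
    unfolding Bochner_Integration.integral_add[OF i2 int(2)] Bochner_Integration.integral_diff[OF i1 int(1)]
      Bochner_Integration.integral_diff[OF ent] mass by simp
  have pos: "AE x in M. 0 \<le> ?h x"
    using ac by eventually_elim (use nn in \<open>auto intro!: gibbs_pointwise(1)\<close>)
  show "(\<integral>x. f x * ln (g x) \<partial>M) \<le> (\<integral>x. f x * ln (f x) \<partial>M)"
    using integral_nonneg_AE[OF pos] val by simp
  assume "(\<integral>x. f x * ln (g x) \<partial>M) = (\<integral>x. f x * ln (f x) \<partial>M)"
  then have "AE x in M. ?h x = 0"
    using integral_nonneg_eq_0_iff_AE[OF h pos] val by simp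
  with ac show "AE x in M. f x = g x"
    by eventually_elim (use nn gibbs_pointwise(2) in auto)
qed

text \<open>The quotient is the integral of \<open>exp (- (s * t))\<close> over \<open>s\<close>
  between \<open>a\<close> and \<open>b\<close>; integrating over \<open>t\<close> first leaves
  \<open>1 / s\<close>.\<close>

lemma frullani:
  assumes "0 < a" "a \<le> b"
  shows "(\<integral>\<^sup>+t. ennreal ((exp (- (a * t)) - exp (- (b * t))) / t) * indicator {0<..} t \<partial>lborel) = ennreal (ln b - ln a)"
proof -
  have exp_int: "(\<integral>\<^sup>+t. ennreal (exp (- (s * t))) * indicator {0..} t \<partial>lborel) = ennreal (1 / s)" if s: "s > 0" for s
  proof -
    have "(\<integral>\<^sup>+t. ennreal (exp (- (s * t))) * indicator {0..} t \<partial>lborel) = ennreal (0 - (- exp (- (s * 0)) / s))"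
    proof (rule nn_integral_FTC_atLeast)
      show "((\<lambda>t. - exp (- (s * t)) / s) \<longlongrightarrow> 0) at_top" using s by real_asymp
      show "((\<lambda>t. - exp (- (s * t)) / s) has_real_derivative exp (- (s * t))) (at t)" for t
        using s by (auto intro!: derivative_eq_intros)
    qed auto
    then show ?thesis by simp
  qed
  have inner: "(\<integral>\<^sup>+s. ennreal (exp (- (s * t))) * indicator {a..b} s \<partial>lborel) = ennreal ((exp (- (a * t)) - exp (- (b * t))) / t)"
    if t: "t > 0" for t
  proof -
    have "(\<integral>\<^sup>+s. ennreal (exp (- (s * t))) * indicator {a..b} s \<partial>lborel) = ennreal (- exp (- (b * t)) / t - (- exp (- (a * t)) / t))"
      using t assms by (intro nn_integral_FTC_Icc) (auto intro!: derivative_eq_intros)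
    then show ?thesis by (simp add: diff_divide_distrib)
  qed
  have "(\<integral>\<^sup>+t. ennreal ((exp (- (a * t)) - exp (- (b * t))) / t) * indicator {0<..} t \<partial>lborel)
      = (\<integral>\<^sup>+t. (\<integral>\<^sup>+s. ennreal (exp (- (s * t))) * indicator {a..b} s * indicator {0<..} t \<partial>lborel) \<partial>lborel)"
    by (intro nn_integral_cong) (auto simp: inner nn_integral_multc split: split_indicator)
  also have "\<dots> = (\<integral>\<^sup>+s. (\<integral>\<^sup>+t. ennreal (exp (- (s * t))) * indicator {a..b} s * indicator {0<..} t \<partial>lborel) \<partial>lborel)"
    by (rule lborel_pair.Fubini') measurable
  also have "\<dots> = (\<integral>\<^sup>+s. ennreal (1 / s) * indicator {a..b} s \<partial>lborel)"
  proof (intro nn_integral_cong)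
    fix s
    have "(\<integral>\<^sup>+t. ennreal (exp (- (s * t))) * indicator {a..b} s * indicator {0<..} t \<partial>lborel)
        = (\<integral>\<^sup>+t. indicator {a..b} s * (ennreal (exp (- (s * t))) * indicator {0..} t) \<partial>lborel)"
      using AE_lborel_singleton[of 0] by (intro nn_integral_cong_AE) (auto split: split_indicator)
    also have "\<dots> = indicator {a..b} s * (\<integral>\<^sup>+t. ennreal (exp (- (s * t))) * indicator {0..} t \<partial>lborel)"
      by (rule nn_integral_cmult) measurable
    also have "\<dots> = ennreal (1 / s) * indicator {a..b} s"
      using assms exp_int[of s] by (auto split: split_indicator)
    finally show "(\<integral>\<^sup>+t. ennreal (exp (- (s * t))) * indicator {a..b} s * indicator {0<..} t \<partial>lborel)
      = ennreal (1 / s) * indicator {a..b} s" .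
  qed
  also have "\<dots> = ennreal (ln b - ln a)"
    using assms by (intro nn_integral_FTC_Icc) (auto intro!: derivative_eq_intros simp: field_simps)
  finally show ?thesis .
qed

section \<open>Negative definiteness of the logarithmic energy\<close>

text \<open>Parallelogram law. It turns a product of Gaussians in \<open>x - w\<close> and
  \<open>y - w\<close> into one in \<open>x - y\<close> times one in \<open>w\<close> around the
  midpoint.\<close>

lemma norm_midpoint_identity:
  fixes x y w :: "'a::real_inner"
  shows "2 * (norm (x - w))\<^sup>2 + 2 * (norm (y - w))\<^sup>2 = (norm (x - y))\<^sup>2 + 4 * (norm (w - (1/2) *\<^sub>R (x + y)))\<^sup>2"
  by (simp add: power2_norm_eq_inner inner_diff inner_add inner_commute algebra_simps)

text \<open>Completing the square gives \<open>2 N ln (1 + |x|) \<le> t |x|^2 + N^2 / t\<close>,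
  which puts the Gaussian below a multiple of the power in \<open>nn_integral_tail\<close>.\<close>

lemma gaussian_integrable:
  assumes "t > 0"
  shows "integrable lborel (\<lambda>x :: 'a::euclidean_space. exp (- (t * (norm x)\<^sup>2)))"
proof (rule integrableI_bounded)
  let ?N = "real DIM('a)"
  have "(\<integral>\<^sup>+x. ennreal (norm (exp (- (t * (norm x)\<^sup>2)))) \<partial>(lborel :: 'a measure))
     \<le> (\<integral>\<^sup>+x. ennreal (exp (?N\<^sup>2 / t)) * ennreal ((1 + norm x) powr (1/2 - 2 * ?N)) \<partial>(lborel :: 'a measure))"
  proof (intro nn_integral_mono)
    fix x :: 'a
    have "ln (1 + norm x) \<le> norm x" by (rule ln_add_one_self_le_self) simp
    then have "2 * ?N * ln (1 + norm x) \<le> 2 * ?N * norm x" by (intro mult_left_mono) auto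
    also have "\<dots> \<le> t * (norm x)\<^sup>2 + ?N\<^sup>2 / t"
    proof -
      have "0 \<le> (t * norm x - ?N)\<^sup>2 / t" using assms by simp
      also have "\<dots> = t * (norm x)\<^sup>2 + ?N\<^sup>2 / t - 2 * ?N * norm x"
        using assms by (simp add: power2_eq_square field_simps)
      finally show ?thesis by simp
    qed
    finally have "2 * ?N * ln (1 + norm x) \<le> t * (norm x)\<^sup>2 + ?N\<^sup>2 / t" .
    moreover have "(1/2 - 2 * ?N) * ln (1 + norm x) = ln (1 + norm x) / 2 - 2 * ?N * ln (1 + norm x)"
      by (simp add: left_diff_distrib)
    moreover have "0 \<le> ln (1 + norm x)" by simp
    ultimately have "- (t * (norm x)\<^sup>2) \<le> ?N\<^sup>2 / t + (1/2 - 2 * ?N) * ln (1 + norm x)"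
      by linarith
    then have "exp (- (t * (norm x)\<^sup>2)) \<le> exp (?N\<^sup>2 / t) * (1 + norm x) powr (1/2 - 2 * ?N)"
      by (auto simp: powr_def exp_add[symmetric] add_nonneg_eq_0_iff)
    then show "ennreal (norm (exp (- (t * (norm x)\<^sup>2)))) \<le> ennreal (exp (?N\<^sup>2 / t)) * ennreal ((1 + norm x) powr (1/2 - 2 * ?N))"
      by (simp add: ennreal_mult[symmetric])
  qed
  also have "\<dots> < \<infinity>"
    using nn_integral_tail[where 'a='a] by (simp add: nn_integral_cmult ennreal_mult_less_top)
  finally show "(\<integral>\<^sup>+x. ennreal (norm (exp (- (t * (norm x)\<^sup>2)))) \<partial>(lborel :: 'a measure)) < \<infinity>" .
qed measurable

lemma gaussian_integral_pos:
  assumes "t > 0"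
  shows "0 < (\<integral>x. exp (- (t * (norm x)\<^sup>2)) \<partial>(lborel :: 'a::euclidean_space measure))"
proof -
  have "(\<integral>x. exp (- (t * (norm x)\<^sup>2)) \<partial>(lborel :: 'a measure)) \<noteq> 0"
    using integral_nonneg_eq_0_iff_AE[OF gaussian_integrable[OF assms, where 'a='a]]
    by (auto simp: eventually_False ae_filter_eq_bot_iff)
  moreover have "0 \<le> (\<integral>x. exp (- (t * (norm x)\<^sup>2)) \<partial>(lborel :: 'a measure))" by simp
  ultimately show ?thesis by linarith
qed

lemma integral_translate:
  fixes f :: "'a::euclidean_space \<Rightarrow> 'b :: {banach, second_countable_topology}"
  assumes [measurable]: "f \<in> borel_measurable borel"
  shows "(\<integral>x. f (x - y) \<partial>lborel) = (\<integral>x. f x \<partial>lborel)"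
    and "integrable lborel (\<lambda>x. f (x - y)) \<longleftrightarrow> integrable lborel f"
proof -
  show "(\<integral>x. f (x - y) \<partial>lborel) = (\<integral>x. f x \<partial>lborel)"
    by (subst (2) distr_lborel_minus[of y, symmetric]) (simp add: integral_distr)
  show "integrable lborel (\<lambda>x. f (x - y)) \<longleftrightarrow> integrable lborel f"
    by (subst (2) distr_lborel_minus[of y, symmetric]) (simp add: integrable_distr_eq)
qed

text \<open>Up to the factor \<open>c\<close>, the Gaussian of \<open>x - y\<close> is the integral
  over \<open>w\<close> of the product of Gaussians of \<open>x - w\<close> and
  \<open>y - w\<close>. The form is thus an integral of squares, which replaces the Fourier
  transform.\<close>

lemma gaussian_kernel_nonneg:
  fixes h :: "'a::euclidean_space \<Rightarrow> real"
  assumes h: "integrable lborel h" and [measurable]: "h \<in> borel_measurable borel" and t: "t > 0"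
  shows "0 \<le> (\<integral>z. (h (fst z) * h (snd z)) * exp (- (t * (norm (fst z - snd z))\<^sup>2)) \<partial>(lborel \<Otimes>\<^sub>M lborel))"
proof -
  interpret P: pair_sigma_finite "lborel \<Otimes>\<^sub>M lborel :: ('a \<times> 'a) measure" "lborel :: 'a measure" ..
  define c where "c = (\<integral>x. exp (- ((4 * t) * (norm x)\<^sup>2)) \<partial>(lborel :: 'a measure))"
  have c: "c > 0" unfolding c_def using t by (intro gaussian_integral_pos) simp
  let ?e = "\<lambda>x w::'a. exp (- (2 * t * (norm (x - w))\<^sup>2))"
  have ee: "?e x w * ?e y w = exp (- (t * (norm (x - y))\<^sup>2)) * exp (- ((4 * t) * (norm (w - (1/2) *\<^sub>R (x + y)))\<^sup>2))" for x y w
  proof -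
    have "2 * t * (norm (x - w))\<^sup>2 + 2 * t * (norm (y - w))\<^sup>2
      = t * (norm (x - y))\<^sup>2 + (4 * t) * (norm (w - (1/2) *\<^sub>R (x + y)))\<^sup>2"
      using arg_cong[OF norm_midpoint_identity[of x w y], of "\<lambda>u. t * u"] by (simp add: algebra_simps)
    then show ?thesis unfolding exp_add[symmetric] by simp
  qed
  have ei: "integrable lborel (\<lambda>w. ?e x w * ?e y w)" and ev: "(\<integral>w. ?e x w * ?e y w \<partial>lborel) = c * exp (- (t * (norm (x - y))\<^sup>2))" for x y
  proof -
    let ?G = "\<lambda>w::'a. exp (- ((4 * t) * (norm w)\<^sup>2))"
    have "integrable lborel (\<lambda>w. ?G (w - (1/2) *\<^sub>R (x + y)))"
      using gaussian_integrable[of "4 * t", where 'a='a] t by (subst integral_translate(2)) auto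
    then show "integrable lborel (\<lambda>w. ?e x w * ?e y w)" unfolding ee by simp
    show "(\<integral>w. ?e x w * ?e y w \<partial>lborel) = c * exp (- (t * (norm (x - y))\<^sup>2))"
      unfolding ee using integral_translate(1)[of ?G "(1/2) *\<^sub>R (x + y)"] by (simp add: c_def)
  qed
  let ?H = "\<lambda>z. h (fst z) * h (snd z)"
  have H: "integrable (lborel \<Otimes>\<^sub>M lborel) ?H" by (rule lborel_pair.integrable_mult_pair(1)[OF h h])
  let ?K = "\<lambda>q. ?H (fst q) * (?e (fst (fst q)) (snd q) * ?e (snd (fst q)) (snd q))"
  have K: "integrable ((lborel \<Otimes>\<^sub>M lborel) \<Otimes>\<^sub>M lborel) ?K"
  proof (rule P.Fubini_integrable)
    show "AE z in lborel \<Otimes>\<^sub>M lborel. integrable lborel (\<lambda>w. ?K (z, w))"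
      using ei by (intro AE_I2) simp
    have "(\<integral>w. norm (?K (z, w)) \<partial>lborel) = norm (?H z) * (c * exp (- (t * (norm (fst z - snd z))\<^sup>2)))" for z
    proof -
      have "(\<integral>w. norm (?K (z, w)) \<partial>lborel) = (\<integral>w. norm (?H z) * (?e (fst z) w * ?e (snd z) w) \<partial>lborel)"
        by (intro Bochner_Integration.integral_cong refl) (simp only: fst_conv snd_conv abs_mult real_norm_def abs_exp_cancel)
      then show ?thesis by (simp only: integral_mult_right_zero ev)
    qed
    moreover have "integrable (lborel \<Otimes>\<^sub>M lborel) (\<lambda>z. norm (?H z) * (c * exp (- (t * (norm (fst z - snd z))\<^sup>2))))"
      by (rule Bochner_Integration.integrable_bound[OF integrable_mult_right[OF integrable_abs[OF H], of c]])
        (use c t in \<open>auto simp: abs_mult mult_left_le mult.left_commute[of _ c] intro!: mult_left_mono\<close>)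
    ultimately show "integrable (lborel \<Otimes>\<^sub>M lborel) (\<lambda>z. \<integral>w. norm (?K (z, w)) \<partial>lborel)" by simp
  qed measurable
  have "c * (\<integral>z. ?H z * exp (- (t * (norm (fst z - snd z))\<^sup>2)) \<partial>(lborel \<Otimes>\<^sub>M lborel))
      = (\<integral>z. (\<integral>w. ?K (z, w) \<partial>lborel) \<partial>(lborel \<Otimes>\<^sub>M lborel))"
    unfolding integral_mult_right_zero[symmetric]
    by (intro Bochner_Integration.integral_cong) (simp_all add: ev)
  also have "\<dots> = (\<integral>w. (\<integral>z. ?K (z, w) \<partial>(lborel \<Otimes>\<^sub>M lborel)) \<partial>lborel)"
  proof (rule P.Fubini_integral[symmetric])
    have "(\<lambda>(z, w). ?K (z, w)) = ?K" by auto
    then show "integrable ((lborel \<Otimes>\<^sub>M lborel) \<Otimes>\<^sub>M lborel) (\<lambda>(z, w). ?K (z, w))" using K by (simp only:)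
  qed
  also have "\<dots> = (\<integral>w. (\<integral>x. h x * ?e x w \<partial>lborel)\<^sup>2 \<partial>lborel)"
  proof (intro Bochner_Integration.integral_cong refl)
    fix w :: 'a
    have i: "integrable lborel (\<lambda>x. h x * ?e x w)"
      by (rule Bochner_Integration.integrable_bound[OF h]) (use t in \<open>auto simp: abs_mult mult_left_le\<close>)
    have "(\<integral>z. ?K (z, w) \<partial>(lborel \<Otimes>\<^sub>M lborel))
       = (\<integral>z. (h (fst z) * ?e (fst z) w) * (h (snd z) * ?e (snd z) w) \<partial>(lborel \<Otimes>\<^sub>M lborel))"
      by (simp add: mult_ac)
    also have "\<dots> = (\<integral>x. h x * ?e x w \<partial>lborel)\<^sup>2"
      unfolding lborel_pair.integrable_mult_pair(2)[OF i i] by (rule power2_eq_square[symmetric])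
    finally show "(\<integral>z. ?K (z, w) \<partial>(lborel \<Otimes>\<^sub>M lborel)) = (\<integral>x. h x * ?e x w \<partial>lborel)\<^sup>2" .
  qed
  also have "\<dots> \<ge> 0" by simp
  finally show ?thesis using c by (simp add: zero_le_mult_iff)
qed

lemma AE_lborel_pair_neq: "AE z in lborel \<Otimes>\<^sub>M lborel. fst z \<noteq> (snd z :: 'a::euclidean_space)"
proof (rule lborel_pair.AE_pair_measure)
  show "AE x in lborel. AE y in lborel. fst (x, y) \<noteq> (snd (x, y) :: 'a)"
  proof (rule AE_I2)
    fix x :: 'a
    show "AE y in lborel. fst (x, y) \<noteq> snd (x, y)"
      using AE_lborel_singleton[of x] by eventually_elim auto
  qed
qed measurable

text \<open>With \<open>D = |x - y|^2\<close>, \<open>ln D\<close> is the integral of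
  \<open>(exp (- t) - exp (- D t)) / t\<close> over \<open>t > 0\<close>. The first exponential is
  constant in \<open>x\<close> and \<open>y\<close> and vanishes against mean zero; the second is a
  positive definite Gaussian with a minus sign.\<close>

lemma log_energy_nonpos:
  fixes h :: "'a::euclidean_space \<Rightarrow> real"
  assumes h: "integrable lborel h" and [measurable]: "h \<in> borel_measurable borel"
    and mean: "(\<integral>x. h x \<partial>lborel) = 0"
    and int: "integrable (lborel \<Otimes>\<^sub>M lborel) (\<lambda>z. (h (fst z) * h (snd z)) * ln (norm (fst z - snd z)))"
  shows "(\<integral>z. (h (fst z) * h (snd z)) * ln (norm (fst z - snd z)) \<partial>(lborel \<Otimes>\<^sub>M lborel)) \<le> 0"
proof -
  interpret P: pair_sigma_finite "lborel \<Otimes>\<^sub>M lborel :: ('a \<times> 'a) measure" "lborel :: real measure" ..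
  let ?H = "\<lambda>z. h (fst z) * h (snd z)" and ?D = "\<lambda>z. (norm (fst z - snd z))\<^sup>2"
  have H: "integrable (lborel \<Otimes>\<^sub>M lborel) ?H" by (rule lborel_pair.integrable_mult_pair(1)[OF h h])
  have H0: "(\<integral>z. ?H z \<partial>(lborel \<Otimes>\<^sub>M lborel)) = 0"
    using lborel_pair.integrable_mult_pair(2)[OF h h] mean by simp
  \<comment> \<open>For each \<open>D\<close> the integrand has a constant sign. Its modulus
    therefore integrates to \<open>|ln D|\<close>, and Fubini follows from the assumed integrability
    of the logarithmic kernel.\<close>
  define k where "k D t = (exp (- (1 * t)) - exp (- (D * t))) / t * indicator {0<..} t" for D t :: real
  have [measurable]: "(\<lambda>(D, t). k D t) \<in> borel_measurable (borel \<Otimes>\<^sub>M borel)" unfolding k_def by measurable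
  have ki: "integrable lborel (k D)" and kv: "(\<integral>t. k D t \<partial>lborel) = ln D"
    and kn: "(\<integral>t. norm (k D t) \<partial>lborel) = \<bar>ln D\<bar>" if D: "D > 0" for D
  proof -
    have [measurable]: "k D \<in> borel_measurable borel" unfolding k_def by measurable
    have "has_bochner_integral lborel (k D) (ln D) \<and> (\<integral>t. norm (k D t) \<partial>lborel) = \<bar>ln D\<bar>"
    proof (cases "D \<ge> 1")
      case True
      have pos: "0 \<le> k D t" for t using True by (auto simp: k_def split: split_indicator)
      have "(\<integral>\<^sup>+t. ennreal (k D t) \<partial>lborel) = ennreal (ln D - ln 1)"
        by (subst frullani[symmetric, OF _ True]) (auto simp: k_def intro!: nn_integral_cong split: split_indicator)
      then have "has_bochner_integral lborel (k D) (ln D)"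
        using pos True by (intro has_bochner_integral_nn_integral) auto
      then show ?thesis using pos True by (simp add: has_bochner_integral_iff)
    next
      case False
      have neg: "0 \<le> - k D t" for t
        using False D by (auto simp: k_def divide_le_0_iff split: split_indicator)
      have "(\<integral>\<^sup>+t. ennreal (- k D t) \<partial>lborel) = ennreal (ln 1 - ln D)"
      proof -
        have "- k D t = (exp (- (D * t)) - exp (- (1 * t))) / t * indicator {0<..} t" for t
          by (simp add: k_def diff_divide_distrib left_diff_distrib)
        then have "(\<integral>\<^sup>+t. ennreal (- k D t) \<partial>lborel)
            = (\<integral>\<^sup>+t. ennreal ((exp (- (D * t)) - exp (- (1 * t))) / t) * indicator {0<..} t \<partial>lborel)"
          by (intro nn_integral_cong) (simp split: split_indicator)
        also have "\<dots> = ennreal (ln 1 - ln D)" using False by (intro frullani D) simp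
        finally show ?thesis .
      qed
      then have "has_bochner_integral lborel (\<lambda>t. - k D t) (- ln D)"
        using neg False D by (intro has_bochner_integral_nn_integral) auto
      from has_bochner_integral_minus[OF this] have *: "has_bochner_integral lborel (k D) (ln D)" by simp
      have "norm (k D t) = - k D t" for t using neg[of t] by simp
      then show ?thesis using * False D by (simp add: has_bochner_integral_iff)
    qed
    then show "integrable lborel (k D)" "(\<integral>t. k D t \<partial>lborel) = ln D" "(\<integral>t. norm (k D t) \<partial>lborel) = \<bar>ln D\<bar>"
      by (auto simp: has_bochner_integral_iff)
  qed
  note ne = AE_lborel_pair_neq[where 'a='a]
  have lnD: "ln (?D z) = 2 * ln (norm (fst z - snd z))" if "fst z \<noteq> snd z" for z :: "'a \<times> 'a"
    using that by (simp add: ln_realpow)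
  have lnD2: "ln ((norm (a - b))\<^sup>2) = 2 * ln (norm (a - b))" if "a \<noteq> b" for a b :: 'a
    using lnD[of "(a, b)"] that by simp
  let ?K = "\<lambda>q. ?H (fst q) * k (?D (fst q)) (snd q)"
  have K: "integrable ((lborel \<Otimes>\<^sub>M lborel) \<Otimes>\<^sub>M lborel) ?K"
  proof (rule P.Fubini_integrable)
    show "AE z in lborel \<Otimes>\<^sub>M lborel. integrable lborel (\<lambda>t. ?K (z, t))"
      using ne by eventually_elim (auto intro!: integrable_mult_right ki)
    have "AE z in lborel \<Otimes>\<^sub>M lborel. 2 * norm (?H z * ln (norm (fst z - snd z))) = (\<integral>t. norm (?K (z, t)) \<partial>lborel)"
      using ne
    proof eventually_elim
      fix z :: "'a \<times> 'a" assume z: "fst z \<noteq> snd z"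
      have "(\<integral>t. norm (?K (z, t)) \<partial>lborel) = (\<integral>t. norm (?H z) * norm (k (?D z) t) \<partial>lborel)"
        by (intro Bochner_Integration.integral_cong) (simp_all add: abs_mult)
      also have "\<dots> = norm (?H z) * \<bar>ln (?D z)\<bar>"
        using z by (simp only: integral_mult_right_zero kn zero_less_power zero_less_norm_iff right_minus_eq not_False_eq_True)
      finally show "2 * norm (?H z * ln (norm (fst z - snd z))) = (\<integral>t. norm (?K (z, t)) \<partial>lborel)"
        using lnD[OF z] by (auto simp: abs_mult)
    qed
    then show "integrable (lborel \<Otimes>\<^sub>M lborel) (\<lambda>z. \<integral>t. norm (?K (z, t)) \<partial>lborel)"
      by (rule integrable_cong_AE_imp[rotated 2]) (use int in auto)
  qed measurable
  have "2 * (\<integral>z. ?H z * ln (norm (fst z - snd z)) \<partial>(lborel \<Otimes>\<^sub>M lborel))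
      = (\<integral>z. (\<integral>t. ?K (z, t) \<partial>lborel) \<partial>(lborel \<Otimes>\<^sub>M lborel))"
    unfolding integral_mult_right_zero[symmetric]
    using ne by (intro integral_cong_AE) (auto simp: kv lnD2 elim!: eventually_mono)
  also have "\<dots> = (\<integral>t. (\<integral>z. ?K (z, t) \<partial>(lborel \<Otimes>\<^sub>M lborel)) \<partial>lborel)"
  proof (rule P.Fubini_integral[symmetric])
    have "(\<lambda>(z, t). ?K (z, t)) = ?K" by auto
    then show "integrable ((lborel \<Otimes>\<^sub>M lborel) \<Otimes>\<^sub>M lborel) (\<lambda>(z, t). ?K (z, t))" using K by (simp only:)
  qed
  also have "\<dots> \<le> 0"
  proof -
    have "(\<integral>z. ?K (z, t) \<partial>(lborel \<Otimes>\<^sub>M lborel)) \<le> 0" for t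
    proof (cases "t > 0")
      case True
      have He: "integrable (lborel \<Otimes>\<^sub>M lborel) (\<lambda>z. ?H z * exp (- (t * ?D z)))"
        by (rule Bochner_Integration.integrable_bound[OF H]) (use True in \<open>auto simp: abs_mult mult_left_le\<close>)
      have "(\<integral>z. ?K (z, t) \<partial>(lborel \<Otimes>\<^sub>M lborel))
        = (\<integral>z. (exp (- t) / t) * ?H z - (?H z * exp (- (t * ?D z))) / t \<partial>(lborel \<Otimes>\<^sub>M lborel))"
        using True by (intro Bochner_Integration.integral_cong) (auto simp: k_def field_simps)
      also have "\<dots> = - (\<integral>z. ?H z * exp (- (t * ?D z)) \<partial>(lborel \<Otimes>\<^sub>M lborel)) / t"
        by (subst Bochner_Integration.integral_diff) (use H He H0 in auto)
      also have "\<dots> \<le> 0" using gaussian_kernel_nonneg[OF h _ True] True by (simp add: divide_nonpos_pos)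
      finally show ?thesis .
    qed (simp add: k_def)
    then have "0 \<le> (\<integral>t. - (\<integral>z. ?K (z, t) \<partial>(lborel \<Otimes>\<^sub>M lborel)) \<partial>lborel)"
      by (intro integral_nonneg_AE AE_I2) (simp only: neg_0_le_iff_le)
    then show ?thesis by (simp only: Bochner_Integration.integral_minus neg_0_le_iff_le)
  qed
  finally show ?thesis by simp
qed

lemma pair_measure_preserving:
  assumes N: "sigma_finite_measure N" and sets: "sets M = sets borel" "sets N = sets borel"
    and [measurable]: "S \<in> borel_measurable borel" "T \<in> borel_measurable borel"
    and S: "distr M borel S = N" and T: "distr M borel T = N"
  shows "distr (M \<Otimes>\<^sub>M M) (N \<Otimes>\<^sub>M N) (\<lambda>z. (S (fst z), T (snd z))) = N \<Otimes>\<^sub>M N"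
proof -
  have *: "distr M N S = N" "distr M N T = N" using S T sets by (metis distr_cong)+
  have "S \<in> measurable M N" "T \<in> measurable M N" using sets by (simp_all cong: measurable_cong_sets)
  moreover have "(\<lambda>(x, y). (S x, T y)) = (\<lambda>z. (S (fst z), T (snd z)))" by auto
  ultimately show ?thesis
    using pair_measure_distr[of S M N T M N] N by (simp add: *)
qed

lemma AE_pair_both:
  assumes "sigma_finite_measure M" and P: "AE x in M. P x"
  shows "AE z in M \<Otimes>\<^sub>M M. P (fst z) \<and> P (snd z)"
proof -
  interpret sigma_finite_measure M by fact
  interpret pair_sigma_finite M M ..
  obtain N where N: "N \<in> null_sets M" "{x \<in> space M. \<not> P x} \<subseteq> N"
    using P by (auto simp: eventually_ae_filter)
  have [measurable]: "N \<in> sets M" using N by auto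
  have "AE x in M. AE y in M. (x, y) \<in> {z \<in> space (M \<Otimes>\<^sub>M M). fst z \<notin> N \<and> snd z \<notin> N}"
    using AE_not_in[OF N(1)] AE_space
  proof eventually_elim
    fix x assume x: "x \<notin> N" "x \<in> space M"
    show "AE y in M. (x, y) \<in> {z \<in> space (M \<Otimes>\<^sub>M M). fst z \<notin> N \<and> snd z \<notin> N}"
      using AE_not_in[OF N(1)] AE_space by eventually_elim (use x in \<open>auto simp: space_pair_measure\<close>)
  qed
  then have "AE z in M \<Otimes>\<^sub>M M. z \<in> {z \<in> space (M \<Otimes>\<^sub>M M). fst z \<notin> N \<and> snd z \<notin> N}"
    by (rule AE_pair_measure[rotated]) measurable
  then show ?thesis
    by (rule eventually_mono) (use N(2) in \<open>auto simp: space_pair_measure\<close>)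
qed

lemma logE_cong_AE:
  assumes [measurable]: "f \<in> borel_measurable borel" "f' \<in> borel_measurable borel" "g \<in> borel_measurable borel" "g' \<in> borel_measurable borel"
    and "AE x in lborel. f x = f' x" "AE x in lborel. g x = g' x"
  shows "logE f g = logE f' g'"
  unfolding logE_def
proof (rule integral_cong_AE)
  have "AE z in lborel \<Otimes>\<^sub>M lborel. (f (fst z) = f' (fst z) \<and> g (fst z) = g' (fst z)) \<and> (f (snd z) = f' (snd z) \<and> g (snd z) = g' (snd z))"
    by (rule AE_pair_both[OF sigma_finite_lborel]) (use assms(5,6) in auto)
  then show "AE z in lborel \<Otimes>\<^sub>M lborel. f (fst z) * g (snd z) * ln (norm (fst z - snd z)) = f' (fst z) * g' (snd z) * ln (norm (fst z - snd z))"
    by eventually_elim simp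
qed measurable

lemma entS_cong_AE:
  assumes [measurable]: "f \<in> borel_measurable borel" "f' \<in> borel_measurable borel" and "AE x in lborel. f x = f' x"
  shows "entS f = entS f'"
  unfolding entS_def using assms(3) by (intro integral_cong_AE) auto

lemma logE_commute: "logE f g = logE g (f :: 'a::euclidean_space \<Rightarrow> real)"
proof -
  let ?F = "\<lambda>z. (f (fst z) * g (snd z)) * ln (norm (fst z - snd z))"
  have "logE g f = (\<integral>(x, y). ?F (y, x) \<partial>(lborel \<Otimes>\<^sub>M lborel))"
    unfolding logE_def by (intro Bochner_Integration.integral_cong) (auto simp: norm_minus_commute mult_ac)
  also have "\<dots> = logE f g"
  proof (cases "integrable (lborel \<Otimes>\<^sub>M lborel) ?F")
    case True
    then have "?F \<in> borel_measurable (lborel \<Otimes>\<^sub>M lborel)" by auto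
    then show ?thesis unfolding logE_def by (rule lborel_pair.integral_product_swap)
  next
    case False
    then show ?thesis unfolding logE_def
      using lborel_pair.integrable_product_swap_iff[of ?F] by (simp add: not_integrable_integral_eq)
  qed
  finally show ?thesis ..
qed

text \<open>\<open>log_energy_nonpos\<close> for \<open>f - g\<close>, which has mean zero because
  the masses agree.\<close>

lemma logE_diff_nonpos:
  fixes f g :: "'a::euclidean_space \<Rightarrow> real"
  assumes f: "adm f" and g: "adm g" and eq: "(\<integral>x. f x \<partial>lborel) = (\<integral>x. g x \<partial>lborel)"
  shows "logE f f + logE g g \<le> 2 * logE f g"
proof -
  let ?h = "\<lambda>x. f x - g x" and ?L = "\<lambda>z::'a \<times> 'a. ln (norm (fst z - snd z))"
  have e: "(?h (fst z) * ?h (snd z)) * ?L z = (f (fst z) * f (snd z)) * ?L z - (f (fst z) * g (snd z)) * ?L z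
     - (g (fst z) * f (snd z)) * ?L z + (g (fst z) * g (snd z)) * ?L z" for z
    by (simp add: algebra_simps)
  note i = integrable_log_kernel[OF f f] integrable_log_kernel[OF f g] integrable_log_kernel[OF g f] integrable_log_kernel[OF g g]
  note i1 = Bochner_Integration.integrable_diff[OF i(1,2)]
  note i2 = Bochner_Integration.integrable_diff[OF i1 i(3)]
  have "(\<integral>z. (?h (fst z) * ?h (snd z)) * ?L z \<partial>(lborel \<Otimes>\<^sub>M lborel)) \<le> 0"
  proof (rule log_energy_nonpos)
    show "integrable (lborel \<Otimes>\<^sub>M lborel) (\<lambda>z. (?h (fst z) * ?h (snd z)) * ?L z)"
      unfolding e by (rule Bochner_Integration.integrable_add[OF i2 i(4)])
  qed (use admD[OF f] admD[OF g] eq in auto)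
  then have "logE f f - logE f g - logE g f + logE g g \<le> 0"
    unfolding e Bochner_Integration.integral_add[OF i2 i(4)] Bochner_Integration.integral_diff[OF i1 i(3)]
      Bochner_Integration.integral_diff[OF i(1,2)] by (simp only: logE_def)
  then show ?thesis using logE_commute[of f g] by simp
qed

text \<open>If \<open>logJ f g = H\<close>, the mean of the two diagonal values forces
  \<open>logJ f f = H\<close>, so \<open>f\<close> is some \<open>\<phi> a b\<close>. By
  \<open>pot\<close> the potential of \<open>\<phi> a b\<close> is affine in its logarithm;
  comparing \<open>logJ (\<phi> a b) g\<close> with the value at \<open>g = \<phi> a b\<close>
  leaves equality in Gibbs' inequality for \<open>g\<close> against
  \<open>\<phi> a b\<close>.\<close>

lemma logHLS_from_diagonal:
  fixes \<phi> :: "'a::euclidean_space \<Rightarrow> real \<Rightarrow> 'a \<Rightarrow> real" and H :: real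
  assumes diag: "\<And>f :: 'a \<Rightarrow> real. adm f \<Longrightarrow> (\<integral>x. f x \<partial>lborel) = 1 \<Longrightarrow> logJ f f \<le> H"
    and diag_eq: "\<And>f :: 'a \<Rightarrow> real. adm f \<Longrightarrow> (\<integral>x. f x \<partial>lborel) = 1 \<Longrightarrow> logJ f f = H \<Longrightarrow>
        \<exists>a b. 0 < b \<and> (AE x in lborel. f x = \<phi> a b x)"
    and \<phi>: "\<And>a b. 0 < b \<Longrightarrow> adm (\<phi> a b)" "\<And>a b x. 0 < b \<Longrightarrow> 0 < \<phi> a b x"
      "\<And>a b. 0 < b \<Longrightarrow> (\<integral>x. \<phi> a b x \<partial>lborel) = 1" "\<And>a b. 0 < b \<Longrightarrow> logJ (\<phi> a b) (\<phi> a b) = H"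
    and pot: "\<And>a b g. 0 < b \<Longrightarrow> adm g \<Longrightarrow> (\<integral>x. g x \<partial>lborel) = 1 \<Longrightarrow>
        integrable lborel (\<lambda>x. g x * ln (\<phi> a b x)) \<and>
        logE (\<phi> a b) g = K a b - (\<integral>x. g x * ln (\<phi> a b x) \<partial>lborel) / (2 * real DIM('a))"
    and f: "adm f" "(\<integral>x. f x \<partial>lborel) = 1" and g: "adm g" "(\<integral>x. g x \<partial>lborel) = 1"
  shows "logJ f g \<le> H \<and> (logJ f g = H \<longleftrightarrow>
    (\<exists>a b. 0 < b \<and> (AE x in lborel. f x = \<phi> a b x \<and> g x = \<phi> a b x)))"
proof -
  have N: "real DIM('a) > 0" by simp
  have mean: "2 * logJ f g \<le> logJ f f + logJ g g"
    using logE_diff_nonpos[OF f(1) g(1)] f(2) g(2) by (simp add: logJ_def add_divide_distrib)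
  have le: "logJ f g \<le> H" using mean diag[OF f] diag[OF g] by linarith
  moreover have "logJ f g = H \<longleftrightarrow> (\<exists>a b. 0 < b \<and> (AE x in lborel. f x = \<phi> a b x \<and> g x = \<phi> a b x))"
  proof
    assume J: "logJ f g = H"
    then have "logJ f f = H" using mean diag[OF f] diag[OF g] by linarith
    then obtain a b where b: "0 < b" and fe: "AE x in lborel. f x = \<phi> a b x"
      using diag_eq[OF f] by blast
    note p = \<phi>(1)[OF b] \<phi>(3)[OF b]
    have "logJ (\<phi> a b) g = logJ f g"
      using logE_cong_AE[OF admD(1)[OF f(1)] admD(1)[OF p(1)] admD(1)[OF g(1)] admD(1)[OF g(1)] fe]
        entS_cong_AE[OF admD(1)[OF f(1)] admD(1)[OF p(1)] fe] by (simp add: logJ_def)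
    then have "logJ (\<phi> a b) g = logJ (\<phi> a b) (\<phi> a b)" using J \<phi>(4)[OF b] by simp
    moreover have "logE (\<phi> a b) g = K a b - (\<integral>x. g x * ln (\<phi> a b x) \<partial>lborel) / (2 * real DIM('a))"
      using pot[OF b g] by simp
    moreover have "logE (\<phi> a b) (\<phi> a b) = K a b - entS (\<phi> a b) / (2 * real DIM('a))"
      using pot[OF b p] by (simp add: entS_def)
    ultimately have "(\<integral>x. g x * ln (\<phi> a b x) \<partial>lborel) = (\<integral>x. g x * ln (g x) \<partial>lborel)"
      using N by (simp add: logJ_def entS_def[of g] field_simps)
    then have "AE x in lborel. g x = \<phi> a b x"
      using gibbs(2)[of g "\<phi> a b" lborel] admD[OF g(1)] admD[OF p(1)] p(2) g(2) pot[OF b g] \<phi>(2)[OF b]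
      by (simp add: less_imp_neq[symmetric])
    with fe b show "\<exists>a b. 0 < b \<and> (AE x in lborel. f x = \<phi> a b x \<and> g x = \<phi> a b x)" by auto
  next
    assume "\<exists>a b. 0 < b \<and> (AE x in lborel. f x = \<phi> a b x \<and> g x = \<phi> a b x)"
    then obtain a b where b: "0 < b" and fe: "AE x in lborel. f x = \<phi> a b x" and ge: "AE x in lborel. g x = \<phi> a b x"
      by auto
    note p = admD(1)[OF \<phi>(1)[OF b]]
    have "logJ f g = logJ (\<phi> a b) (\<phi> a b)"
      using logE_cong_AE[OF admD(1)[OF f(1)] p admD(1)[OF g(1)] p fe ge]
        entS_cong_AE[OF admD(1)[OF f(1)] p fe] entS_cong_AE[OF admD(1)[OF g(1)] p ge] by (simp add: logJ_def)
    then show "logJ f g = H" using \<phi>(4)[OF b] by simp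
  qed
  ultimately show ?thesis by blast
qed

section \<open>Translations, dilations and isometries\<close>

lemma lborel_affine_integral:
  fixes f :: "'a::euclidean_space \<Rightarrow> real"
  assumes c: "c > 0" and [measurable]: "f \<in> borel_measurable borel"
  shows "(\<integral>x. f x \<partial>lborel) = c ^ DIM('a) * (\<integral>x. f (t + c *\<^sub>R x) \<partial>lborel)"
    and "integrable lborel (\<lambda>x. f (t + c *\<^sub>R x)) \<longleftrightarrow> integrable lborel f"
proof -
  have eq: "lborel = density (distr lborel borel (\<lambda>x::'a. t + c *\<^sub>R x)) (\<lambda>_. ennreal (c ^ DIM('a)))"
    using lborel_affine[of c t] c by simp
  show "(\<integral>x. f x \<partial>lborel) = c ^ DIM('a) * (\<integral>x. f (t + c *\<^sub>R x) \<partial>lborel)"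
    by (subst eq, subst integral_density) (use c in \<open>auto simp: integral_distr\<close>)
  show "integrable lborel (\<lambda>x. f (t + c *\<^sub>R x)) \<longleftrightarrow> integrable lborel f"
    by (subst (2) eq, subst integrable_density) (use c in \<open>auto simp: integrable_distr_eq\<close>)
qed

definition rescale :: "real \<Rightarrow> 'a \<Rightarrow> ('a::euclidean_space \<Rightarrow> real) \<Rightarrow> 'a \<Rightarrow> real" where
  "rescale c t f x = c ^ DIM('a) * f (t + c *\<^sub>R x)"

lemma integral_rescale:
  fixes f :: "'a::euclidean_space \<Rightarrow> real"
  assumes c: "c > 0" and [measurable]: "f \<in> borel_measurable borel" "w \<in> borel_measurable borel"
  shows "(\<integral>x. rescale c t f x * w (t + c *\<^sub>R x) \<partial>lborel) = (\<integral>x. f x * w x \<partial>lborel)"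
    and "integrable lborel (\<lambda>x. rescale c t f x * w (t + c *\<^sub>R x)) \<longleftrightarrow> integrable lborel (\<lambda>x. f x * w x)"
proof -
  show "(\<integral>x. rescale c t f x * w (t + c *\<^sub>R x) \<partial>lborel) = (\<integral>x. f x * w x \<partial>lborel)"
    using lborel_affine_integral(1)[OF c, of "\<lambda>x. f x * w x" t] by (simp add: rescale_def mult.assoc)
  show "integrable lborel (\<lambda>x. rescale c t f x * w (t + c *\<^sub>R x)) \<longleftrightarrow> integrable lborel (\<lambda>x. f x * w x)"
    using lborel_affine_integral(2)[OF c, of "\<lambda>x. f x * w x" t] c by (simp add: rescale_def mult.assoc)
qed

lemma rescale_entropy:
  fixes f :: "'a::euclidean_space \<Rightarrow> real"
  assumes c: "c > 0" and f: "\<And>x. 0 \<le> f x"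
  shows "rescale c t f x * ln (rescale c t f x)
    = rescale c t f x * (real DIM('a) * ln c + ln (f (t + c *\<^sub>R x)))"
proof (cases "f (t + c *\<^sub>R x) = 0")
  case False
  then have "f (t + c *\<^sub>R x) > 0" using f[of "t + c *\<^sub>R x"] by linarith
  then show ?thesis using c by (simp add: rescale_def ln_mult_pos ln_realpow)
qed (simp add: rescale_def)

lemma adm_rescale:
  fixes f :: "'a::euclidean_space \<Rightarrow> real"
  assumes c: "c > 0" and f: "adm f"
  shows "adm (rescale c t f)" "(\<integral>x. rescale c t f x \<partial>lborel) = (\<integral>x. f x \<partial>lborel)"
    "entS (rescale c t f) = entS f + real DIM('a) * ln c * (\<integral>x. f x \<partial>lborel)"
proof -
  note m [measurable] = admD(1)[OF f]
  have fn: "0 \<le> f x" for x using f by (auto simp: adm_def)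
  have rn: "0 \<le> rescale c t f x" for x using c fn by (simp add: rescale_def)
  have rm [measurable]: "rescale c t f \<in> borel_measurable borel" unfolding rescale_def by measurable
  show mass: "(\<integral>x. rescale c t f x \<partial>lborel) = (\<integral>x. f x \<partial>lborel)"
    using integral_rescale(1)[OF c m, of "\<lambda>_. 1" t] by simp
  have ri: "integrable lborel (rescale c t f)"
    using integral_rescale(2)[OF c m, of "\<lambda>_. 1" t] admD(3)[OF f] by simp
  have e1: "integrable lborel (\<lambda>x. rescale c t f x * ln (f (t + c *\<^sub>R x)))"
    using integral_rescale(2)[OF c m, of "\<lambda>x. ln (f x)" t] admD(4)[OF f] by simp
  have e2: "integrable lborel (\<lambda>x. rescale c t f x * ln (1 + norm (t + c *\<^sub>R x)))"
    using integral_rescale(2)[OF c m, of "\<lambda>x. ln (1 + norm x)" t] admD(5)[OF f] by simp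
  have ee: "rescale c t f x * ln (rescale c t f x)
      = real DIM('a) * ln c * rescale c t f x + rescale c t f x * ln (f (t + c *\<^sub>R x))" for x
    by (subst rescale_entropy[OF c fn]) (simp add: algebra_simps)
  have ent: "integrable lborel (\<lambda>x. rescale c t f x * ln (rescale c t f x))"
    unfolding ee by (intro Bochner_Integration.integrable_add integrable_mult_right ri e1)
  show "entS (rescale c t f) = entS f + real DIM('a) * ln c * (\<integral>x. f x \<partial>lborel)"
    unfolding entS_def ee
    by (subst Bochner_Integration.integral_add)
      (use ri e1 mass integral_rescale(1)[OF c m, of "\<lambda>x. ln (f x)" t] in auto)
  define C where "C = ln (1 + (1 + norm t) / c)"
  have lnb: "ln (1 + norm x) \<le> ln (1 + norm (t + c *\<^sub>R x)) + C" for x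
  proof -
    have "norm (c *\<^sub>R x) \<le> norm (t + c *\<^sub>R x) + norm t"
      using norm_triangle_ineq4[of "t + c *\<^sub>R x" t] by simp
    then have "norm x \<le> (norm (t + c *\<^sub>R x) + norm t) / c" using c by (simp add: field_simps)
    also have "\<dots> \<le> (1 + norm (t + c *\<^sub>R x)) * ((1 + norm t) / c)"
      using c by (simp add: field_simps)
    finally have "1 + norm x \<le> (1 + norm (t + c *\<^sub>R x)) * (1 + (1 + norm t) / c)"
      using norm_ge_zero[of "t + c *\<^sub>R x"] by (simp only: distrib_left mult_1_right)
    then have "ln (1 + norm x) \<le> ln ((1 + norm (t + c *\<^sub>R x)) * (1 + (1 + norm t) / c))"
      by (intro ln_mono) (auto intro: add_pos_nonneg)
    also have "\<dots> = ln (1 + norm (t + c *\<^sub>R x)) + C"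
      unfolding C_def using c by (intro ln_mult_pos) (auto intro!: add_pos_nonneg divide_nonneg_pos)
    finally show ?thesis .
  qed
  have "integrable lborel (\<lambda>x. rescale c t f x * ln (1 + norm x))"
  proof (rule Bochner_Integration.integrable_bound)
    show "integrable lborel (\<lambda>x. rescale c t f x * ln (1 + norm (t + c *\<^sub>R x)) + rescale c t f x * C)"
      by (intro Bochner_Integration.integrable_add integrable_mult_left ri e2)
    show "AE x in lborel. norm (rescale c t f x * ln (1 + norm x))
        \<le> norm (rescale c t f x * ln (1 + norm (t + c *\<^sub>R x)) + rescale c t f x * C)"
    proof (rule AE_I2)
      fix x
      have "rescale c t f x * ln (1 + norm x) \<le> rescale c t f x * (ln (1 + norm (t + c *\<^sub>R x)) + C)"
        by (intro mult_left_mono lnb rn)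
      then show "norm (rescale c t f x * ln (1 + norm x))
        \<le> norm (rescale c t f x * ln (1 + norm (t + c *\<^sub>R x)) + rescale c t f x * C)"
        using rn[of x] by (simp add: distrib_left abs_mult)
    qed
  qed measurable
  with rm rn ri ent show "adm (rescale c t f)" by (simp add: adm_def)
qed

lemma logE_rescale:
  fixes f g :: "'a::euclidean_space \<Rightarrow> real"
  assumes c: "c > 0" and f: "adm f" and g: "adm g"
  shows "logE (rescale c t f) (rescale c t g) = logE f g - ln c * ((\<integral>x. f x \<partial>lborel) * (\<integral>x. g x \<partial>lborel))"
proof -
  note m [measurable] = admD(1)[OF f] admD(1)[OF g]
  let ?L = "\<lambda>z::'a \<times> 'a. ln (norm (fst z - snd z))"
  let ?F = "\<lambda>z. (f (fst z) * g (snd z)) * ?L z - ln c * (f (fst z) * g (snd z))"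
  note i = integrable_log_kernel[OF f g] lborel_pair.integrable_mult_pair(1)[OF admD(3)[OF f] admD(3)[OF g]]
  have [measurable]: "?F \<in> borel_measurable borel" unfolding borel_prod[symmetric] by measurable
  have "logE (rescale c t f) (rescale c t g)
      = c ^ DIM('a \<times> 'a) * (\<integral>z. ?F ((t, t) + c *\<^sub>R z) \<partial>(lborel \<Otimes>\<^sub>M lborel))"
    unfolding logE_def integral_mult_right_zero[symmetric]
  proof (rule integral_cong_AE)
    show "AE z in lborel \<Otimes>\<^sub>M lborel. rescale c t f (fst z) * rescale c t g (snd z) * ln (norm (fst z - snd z))
      = c ^ DIM('a \<times> 'a) * ?F ((t, t) + c *\<^sub>R z)"
      using AE_lborel_pair_neq
    proof eventually_elim
      fix z :: "'a \<times> 'a" assume "fst z \<noteq> snd z"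
      have "norm (c *\<^sub>R (fst z - snd z)) = c * norm (fst z - snd z)" using c by simp
      then have "ln (norm (c *\<^sub>R fst z - c *\<^sub>R snd z)) = ln c + ?L z"
        using c \<open>fst z \<noteq> snd z\<close> by (simp only: scaleR_diff_right) (simp add: ln_mult_pos)
      then have "?F ((t, t) + c *\<^sub>R z) = (f (t + c *\<^sub>R fst z) * g (t + c *\<^sub>R snd z)) * ?L z"
        by (simp add: algebra_simps)
      then show "rescale c t f (fst z) * rescale c t g (snd z) * ln (norm (fst z - snd z))
        = c ^ DIM('a \<times> 'a) * ?F ((t, t) + c *\<^sub>R z)"
        by (simp only:) (simp add: rescale_def power_add algebra_simps)
    qed
    show "(\<lambda>z. c ^ DIM('a \<times> 'a) * ?F ((t, t) + c *\<^sub>R z)) \<in> borel_measurable (lborel \<Otimes>\<^sub>M lborel)"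
      unfolding lborel_prod by measurable
  qed (unfold rescale_def, measurable)
  also have "\<dots> = (\<integral>z. ?F z \<partial>(lborel \<Otimes>\<^sub>M lborel))"
    unfolding lborel_prod by (rule lborel_affine_integral(1)[OF c, symmetric]) measurable
  also have "\<dots> = logE f g - ln c * ((\<integral>x. f x \<partial>lborel) * (\<integral>x. g x \<partial>lborel))"
    using i lborel_pair.integrable_mult_pair(2)[OF admD(3)[OF f] admD(3)[OF g]]
    by (subst Bochner_Integration.integral_diff) (auto simp: logE_def)
  finally show ?thesis .
qed

text \<open>\<open>logE\<close> drops by \<open>ln c\<close> and each entropy grows by
  \<open>N ln c\<close>; the weight \<open>1 / (2 N)\<close> in \<open>logJ\<close> is the one that
  balances them.\<close>

lemma logJ_rescale:
  fixes f :: "'a::euclidean_space \<Rightarrow> real"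
  assumes c: "c > 0" and f: "adm f" "(\<integral>x. f x \<partial>lborel) = 1"
  shows "logJ (rescale c t f) (rescale c t f) = logJ f f"
  using adm_rescale(3)[OF c f(1), of t] logE_rescale[OF c f(1) f(1), of t] f(2)
  by (simp add: logJ_def add_divide_distrib)

text \<open>\<open>T\<close> may change the space: the lemma serves both for rotations and
  reflections of the plane and for identifying \<open>real ^ 'n\<close> with \<open>real\<close> or
  \<open>complex\<close>.\<close>

lemma isometry_invariance:
  fixes f g :: "'a::euclidean_space \<Rightarrow> real" and T :: "'b::euclidean_space \<Rightarrow> 'a"
  assumes [measurable]: "T \<in> borel_measurable borel" and T: "distr lborel borel T = lborel"
    and iso: "\<And>x y. norm (T x - T y) = norm (x - y)" "\<And>x. norm (T x) = norm x"
    and f: "adm f" and g: "adm g"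
  shows "adm (\<lambda>x. f (T x))" "(\<integral>x. f (T x) \<partial>lborel) = (\<integral>x. f x \<partial>lborel)"
    "entS (\<lambda>x. f (T x)) = entS f" "logE (\<lambda>x. f (T x)) (\<lambda>x. g (T x)) = logE f g"
proof -
  note m [measurable] = admD(1)[OF f] admD(1)[OF g]
  have int: "(\<integral>x. h (T x) \<partial>lborel) = (\<integral>x. h x \<partial>lborel)" "integrable lborel (\<lambda>x. h (T x)) \<longleftrightarrow> integrable lborel h"
    if [measurable]: "h \<in> borel_measurable borel" for h :: "'a \<Rightarrow> real"
  proof -
    show "(\<integral>x. h (T x) \<partial>lborel) = (\<integral>x. h x \<partial>lborel)"
      by (subst T[symmetric]) (simp add: integral_distr)
    show "integrable lborel (\<lambda>x. h (T x)) \<longleftrightarrow> integrable lborel h"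
      by (subst T[symmetric]) (simp add: integrable_distr_eq)
  qed
  show "adm (\<lambda>x. f (T x))"
    using admD[OF f] int(2)[of f] int(2)[of "\<lambda>x. f x * ln (f x)"] int(2)[of "\<lambda>x. f x * ln (1 + norm x)"]
    by (auto simp: adm_def iso)
  show "(\<integral>x. f (T x) \<partial>lborel) = (\<integral>x. f x \<partial>lborel)" by (rule int(1)) simp
  show "entS (\<lambda>x. f (T x)) = entS f"
    unfolding entS_def using int(1)[of "\<lambda>x. f x * ln (f x)"] by simp
  have "logE f g = (\<integral>z. (f (fst z) * g (snd z)) * ln (norm (fst z - snd z))
      \<partial>(distr (lborel \<Otimes>\<^sub>M lborel) (lborel \<Otimes>\<^sub>M lborel) (\<lambda>z. (T (fst z), T (snd z)))))"
    unfolding logE_def by (subst pair_measure_preserving[OF sigma_finite_lborel]) (use T in auto)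
  also have "\<dots> = logE (\<lambda>x. f (T x)) (\<lambda>x. g (T x))"
    unfolding logE_def by (subst integral_distr) (auto simp: iso)
  finally show "logE (\<lambda>x. f (T x)) (\<lambda>x. g (T x)) = logE f g" ..
qed

section \<open>Reflections and polarization\<close>

text \<open>Reflection in the imaginary axis. A single mirror suffices because other lines are
  brought to it by translating and rotating the function.\<close>

definition mirror :: "complex \<Rightarrow> complex" where
  "mirror z = - cnj z"

lemma mirror_simps [simp]: "mirror (mirror z) = z" "Re (mirror z) = - Re z" "Im (mirror z) = Im z"
  "norm (mirror z) = norm z"
  by (simp_all add: mirror_def)

lemma mirror_measurable [measurable]: "mirror \<in> borel_measurable borel"
  unfolding mirror_def by measurable

lemma norm_mirror_diff: "norm (mirror x - mirror y) = norm (x - y)"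
proof -
  have "mirror x - mirror y = - cnj (x - y)" by (simp add: mirror_def)
  then show ?thesis by (simp only: norm_minus_cancel complex_mod_cnj)
qed

text \<open>Reflecting one of two points increases their distance exactly when they lie on the same
  side of the mirror. Polarization rests on this sign.\<close>

lemma norm_mirror_compare: "(norm (x - y))\<^sup>2 = (norm (x - mirror y))\<^sup>2 - 4 * (Re x * Re y)"
  unfolding cmod_power2 by (simp add: power2_eq_square algebra_simps)

lemma mirror_eq_self: "Re x = 0 \<Longrightarrow> mirror x = x"
  by (simp add: complex_eq_iff)

definition even_part :: "(complex \<Rightarrow> real) \<Rightarrow> complex \<Rightarrow> real" where
  "even_part f x = (f x + f (mirror x)) / 2"

definition odd_part :: "(complex \<Rightarrow> real) \<Rightarrow> complex \<Rightarrow> real" where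
  "odd_part f x = (f x - f (mirror x)) / 2"

text \<open>Two-point rearrangement: of the values at \<open>x\<close> and at its mirror image the
  larger one is placed on the side of positive real part.\<close>

definition polarize :: "(complex \<Rightarrow> real) \<Rightarrow> complex \<Rightarrow> real" where
  "polarize f x = even_part f x + sgn (Re x) * \<bar>odd_part f x\<bar>"

text \<open>For \<open>c = 1\<close> the right half of \<open>f\<close> is copied to the left by
  reflection, for \<open>c = -1\<close> the left half to the right.\<close>

definition symm :: "real \<Rightarrow> (complex \<Rightarrow> real) \<Rightarrow> complex \<Rightarrow> real" where
  "symm c f x = even_part f x + c * (sgn (Re x) * odd_part f x)"

lemma part_mirror: "even_part f (mirror x) = even_part f x" "odd_part f (mirror x) = - odd_part f x"
  by (simp_all add: even_part_def odd_part_def field_simps)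

lemma polarize_values:
  "(polarize f x = f x \<and> polarize f (mirror x) = f (mirror x)) \<or> (polarize f x = f (mirror x) \<and> polarize f (mirror x) = f x)"
proof (cases "Re x = 0")
  case True
  then show ?thesis by (simp add: polarize_def even_part_def odd_part_def mirror_eq_self)
next
  case False
  then show ?thesis
    unfolding polarize_def part_mirror mirror_simps
    by (cases "Re x > 0"; cases "f x \<le> f (mirror x)") (auto simp: even_part_def odd_part_def field_simps)
qed

lemma symm_values:
  "(symm 1 f x = f x \<and> symm (-1) f x = f (mirror x)) \<or> (symm 1 f x = f (mirror x) \<and> symm (-1) f x = f x)"
proof (cases "Re x = 0")
  case True
  then show ?thesis by (simp add: symm_def even_part_def odd_part_def mirror_eq_self)
next
  case False
  then show ?thesis
    by (cases "Re x > 0") (auto simp: symm_def even_part_def odd_part_def field_simps)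
qed

lemma symm_mirror: "symm c f (mirror x) = symm c f x"
  by (simp add: symm_def part_mirror)

lemma parts_measurable [measurable]:
  assumes [measurable]: "f \<in> borel_measurable borel"
  shows "even_part f \<in> borel_measurable borel" "odd_part f \<in> borel_measurable borel"
    "polarize f \<in> borel_measurable borel" "symm c f \<in> borel_measurable borel"
proof -
  show [measurable]: "even_part f \<in> borel_measurable borel" "odd_part f \<in> borel_measurable borel"
    unfolding even_part_def odd_part_def by measurable
  show "polarize f \<in> borel_measurable borel" "symm c f \<in> borel_measurable borel"
    unfolding polarize_def symm_def by measurable
qed

section \<open>Polarization, for the plane and the circle at once\<close>

locale mirror_space = sigma_finite_measure M for M :: "complex measure" +
  assumes sets_M: "sets M = sets borel"
    and mirror_M: "distr M borel mirror = M"
    and diag_M: "AE z in M \<Otimes>\<^sub>M M. fst z \<noteq> snd z"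
begin

interpretation PM: pair_sigma_finite M M ..

lemma measurable_M: "measurable M N = measurable borel N"
  using sets_M by (intro measurable_cong_sets) auto

lemma measurable_MM: "measurable (M \<Otimes>\<^sub>M M) N = measurable (borel \<Otimes>\<^sub>M borel) N"
  using sets_M by (intro measurable_cong_sets sets_pair_measure_cong) auto

lemma integral_mirror:
  fixes h :: "complex \<Rightarrow> real"
  assumes [measurable]: "h \<in> borel_measurable borel"
  shows "(\<integral>x. h (mirror x) \<partial>M) = (\<integral>x. h x \<partial>M)" "integrable M (\<lambda>x. h (mirror x)) \<longleftrightarrow> integrable M h"
proof -
  have [measurable]: "mirror \<in> measurable M borel" by (simp add: measurable_M)
  show "(\<integral>x. h (mirror x) \<partial>M) = (\<integral>x. h x \<partial>M)"
    by (subst (2) mirror_M[symmetric]) (simp add: integral_distr)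
  show "integrable M (\<lambda>x. h (mirror x)) \<longleftrightarrow> integrable M h"
    by (subst (2) mirror_M[symmetric]) (simp add: integrable_distr_eq)
qed

lemma distr_pair:
  assumes "S = id \<or> S = mirror" "T = id \<or> T = mirror"
  shows "distr (M \<Otimes>\<^sub>M M) (M \<Otimes>\<^sub>M M) (\<lambda>z. (S (fst z), T (snd z))) = M \<Otimes>\<^sub>M M"
proof (rule pair_measure_preserving)
  have "distr M borel id = M" using distr_id2[of borel M] sets_M by (simp add: id_def)
  then show "distr M borel S = M" "distr M borel T = M" using assms mirror_M by auto
  have "id \<in> borel_measurable (borel :: complex measure)" by (simp add: id_def)
  then show "S \<in> borel_measurable borel" "T \<in> borel_measurable borel" using assms mirror_measurable by auto
qed (use sets_M sigma_finite_measure_axioms in auto)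

lemma integral_pair_mirror:
  fixes h :: "complex \<times> complex \<Rightarrow> real"
  assumes [measurable]: "h \<in> borel_measurable (borel \<Otimes>\<^sub>M borel)"
    and "S = id \<or> S = mirror" "T = id \<or> T = mirror"
  shows "(\<integral>z. h (S (fst z), T (snd z)) \<partial>(M \<Otimes>\<^sub>M M)) = (\<integral>z. h z \<partial>(M \<Otimes>\<^sub>M M))"
    and "integrable (M \<Otimes>\<^sub>M M) (\<lambda>z. h (S (fst z), T (snd z))) \<longleftrightarrow> integrable (M \<Otimes>\<^sub>M M) h"
proof -
  have hm: "h \<in> borel_measurable (M \<Otimes>\<^sub>M M)" by (simp add: measurable_MM)
  have id: "id \<in> borel_measurable (borel :: complex measure)" by (simp add: id_def)
  have [measurable]: "S \<in> borel_measurable borel" "T \<in> borel_measurable borel"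
    using assms(2,3) id mirror_measurable by auto
  have "(\<lambda>z. (S (fst z), T (snd z))) \<in> measurable (borel \<Otimes>\<^sub>M borel) (borel \<Otimes>\<^sub>M borel)" by measurable
  then have Sm: "(\<lambda>z. (S (fst z), T (snd z))) \<in> measurable (M \<Otimes>\<^sub>M M) (M \<Otimes>\<^sub>M M)"
    unfolding measurable_MM using sets_M by (subst measurable_cong_sets[OF refl sets_pair_measure_cong]) auto
  note d = distr_pair[OF assms(2,3)]
  show "(\<integral>z. h (S (fst z), T (snd z)) \<partial>(M \<Otimes>\<^sub>M M)) = (\<integral>z. h z \<partial>(M \<Otimes>\<^sub>M M))"
    by (subst (2) d[symmetric], subst integral_distr[OF Sm hm]) simp
  show "integrable (M \<Otimes>\<^sub>M M) (\<lambda>z. h (S (fst z), T (snd z))) \<longleftrightarrow> integrable (M \<Otimes>\<^sub>M M) h"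
    by (subst (2) d[symmetric], subst integrable_distr_eq[OF Sm hm]) simp
qed

lemma diag_mirror_M: "AE z in M \<Otimes>\<^sub>M M. fst z \<noteq> mirror (snd z)"
proof -
  have id: "id \<in> borel_measurable (borel :: complex measure)" by (simp add: id_def)
  have "(\<lambda>z. (id (fst z), mirror (snd z))) \<in> measurable (borel \<Otimes>\<^sub>M borel) (borel \<Otimes>\<^sub>M borel)"
    unfolding id_def by measurable
  then have Sm: "(\<lambda>z. (id (fst z), mirror (snd z))) \<in> measurable (M \<Otimes>\<^sub>M M) (M \<Otimes>\<^sub>M M)"
    unfolding measurable_MM using sets_M by (subst measurable_cong_sets[OF refl sets_pair_measure_cong]) auto
  have "AE z in distr (M \<Otimes>\<^sub>M M) (M \<Otimes>\<^sub>M M) (\<lambda>z. (id (fst z), mirror (snd z))). fst z \<noteq> snd z"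
    using diag_M by (subst distr_pair) auto
  then have "AE z in M \<Otimes>\<^sub>M M. fst (id (fst z), mirror (snd z)) \<noteq> snd (id (fst z), mirror (snd z))"
    by (rule AE_distrD[OF Sm])
  then show ?thesis by simp
qed

definition B :: "(complex \<Rightarrow> real) \<Rightarrow> (complex \<Rightarrow> real) \<Rightarrow> real" where
  "B u v = (\<integral>z. (u (fst z) * v (snd z)) * ln (norm (fst z - snd z)) \<partial>(M \<Otimes>\<^sub>M M))"

text \<open>All functions met below are bounded by the even majorant \<open>P\<close>, so
  \<open>f_ker\<close> settles every integrability question about the kernels \<open>k\<close> and
  \<open>k'\<close>.\<close>

context
  fixes f :: "complex \<Rightarrow> real"
  assumes f_meas [measurable]: "f \<in> borel_measurable borel" and f_nn: "\<And>x. 0 \<le> f x"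
    and f_int: "integrable M f"
    and f_ker: "integrable (M \<Otimes>\<^sub>M M) (\<lambda>z. ((f (fst z) + f (mirror (fst z))) * (f (snd z) + f (mirror (snd z)))) * ln (norm (fst z - snd z)))"
begin

abbreviation (input) P where "P x \<equiv> f x + f (mirror x)"
abbreviation (input) k where "k z \<equiv> ln (norm (fst z - snd z :: complex))"
abbreviation (input) k' where "k' z \<equiv> ln (norm (fst z - mirror (snd z)))"

lemma ker_int:
  assumes [measurable]: "u \<in> borel_measurable borel" "v \<in> borel_measurable borel"
    and u: "\<And>x. \<bar>u x\<bar> \<le> P x" and v: "\<And>x. \<bar>v x\<bar> \<le> P x"
  shows "integrable (M \<Otimes>\<^sub>M M) (\<lambda>z. (u (fst z) * v (snd z)) * k z)"
    and "integrable (M \<Otimes>\<^sub>M M) (\<lambda>z. (u (fst z) * v (snd z)) * k' z)"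
    and "(\<integral>z. (u (fst z) * v (snd z)) * k' z \<partial>(M \<Otimes>\<^sub>M M)) = (\<integral>z. (u (fst z) * v (mirror (snd z))) * k z \<partial>(M \<Otimes>\<^sub>M M))"
proof -
  have main: "integrable (M \<Otimes>\<^sub>M M) (\<lambda>z. (u (fst z) * w (snd z)) * k z)"
    if [measurable]: "w \<in> borel_measurable borel" and w: "\<And>x. \<bar>w x\<bar> \<le> P x" for w
  proof (rule Bochner_Integration.integrable_bound[OF f_ker])
    show "(\<lambda>z. (u (fst z) * w (snd z)) * k z) \<in> borel_measurable (M \<Otimes>\<^sub>M M)"
      unfolding measurable_MM by measurable
    show "AE z in M \<Otimes>\<^sub>M M. norm ((u (fst z) * w (snd z)) * k z) \<le> norm ((P (fst z) * P (snd z)) * k z)"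
    proof (rule AE_I2)
      fix z
      have "\<bar>u (fst z)\<bar> * \<bar>w (snd z)\<bar> \<le> P (fst z) * P (snd z)"
        using f_nn by (intro mult_mono u w) auto
      then have "\<bar>u (fst z)\<bar> * \<bar>w (snd z)\<bar> * \<bar>k z\<bar> \<le> P (fst z) * P (snd z) * \<bar>k z\<bar>" by (rule mult_right_mono) simp
      moreover have "0 \<le> P (fst z)" "0 \<le> P (snd z)" using f_nn by auto
      ultimately show "norm ((u (fst z) * w (snd z)) * k z) \<le> norm ((P (fst z) * P (snd z)) * k z)"
        by (simp only: real_norm_def abs_mult abs_of_nonneg)
    qed
  qed
  show "integrable (M \<Otimes>\<^sub>M M) (\<lambda>z. (u (fst z) * v (snd z)) * k z)" by (rule main) (use v in auto)
  have w: "integrable (M \<Otimes>\<^sub>M M) (\<lambda>z. (u (fst z) * v (mirror (snd z))) * k z)"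
  proof (rule main)
    show "\<bar>v (mirror x)\<bar> \<le> P x" for x using v[of "mirror x"] by simp
  qed measurable
  let ?h = "\<lambda>z. (u (fst z) * v (mirror (snd z))) * k z"
  have hm: "?h \<in> borel_measurable (borel \<Otimes>\<^sub>M borel)" by measurable
  show "integrable (M \<Otimes>\<^sub>M M) (\<lambda>z. (u (fst z) * v (snd z)) * k' z)"
    using integral_pair_mirror(2)[OF hm, of id mirror] w by simp
  show "(\<integral>z. (u (fst z) * v (snd z)) * k' z \<partial>(M \<Otimes>\<^sub>M M)) = (\<integral>z. (u (fst z) * v (mirror (snd z))) * k z \<partial>(M \<Otimes>\<^sub>M M))"
    using integral_pair_mirror(1)[OF hm, of id mirror] by simp
qed

lemma part_bounds: "\<bar>even_part f x\<bar> \<le> P x" "\<bar>odd_part f x\<bar> \<le> P x" "\<bar>sgn (Re x) * odd_part f x\<bar> \<le> P x"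
  "\<bar>sgn (Re x) * \<bar>odd_part f x\<bar>\<bar> \<le> P x"
  using f_nn[of x] f_nn[of "mirror x"]
  by (auto simp: even_part_def odd_part_def abs_mult sgn_if abs_if field_simps)

lemma B_expand:
  assumes [measurable]: "v \<in> borel_measurable borel" and v: "\<And>x. \<bar>v x\<bar> \<le> P x"
  shows "B (\<lambda>x. even_part f x + v x) (\<lambda>x. even_part f x + v x)
    = B (even_part f) (even_part f) + B (even_part f) v + B v (even_part f) + B v v"
proof -
  note i = ker_int(1)[OF parts_measurable(1)[OF f_meas] parts_measurable(1)[OF f_meas] part_bounds(1) part_bounds(1)]
    ker_int(1)[OF parts_measurable(1)[OF f_meas] assms(1) part_bounds(1) v]
    ker_int(1)[OF assms(1) parts_measurable(1)[OF f_meas] v part_bounds(1)]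
    ker_int(1)[OF assms(1) assms(1) v v]
  note i1 = Bochner_Integration.integrable_add[OF i(1,2)]
  note i2 = Bochner_Integration.integrable_add[OF i1 i(3)]
  have e: "((even_part f (fst z) + v (fst z)) * (even_part f (snd z) + v (snd z))) * k z
     = (even_part f (fst z) * even_part f (snd z)) * k z + (even_part f (fst z) * v (snd z)) * k z
       + (v (fst z) * even_part f (snd z)) * k z + (v (fst z) * v (snd z)) * k z" for z
    by (simp add: algebra_simps)
  show ?thesis
    unfolding B_def e Bochner_Integration.integral_add[OF i2 i(4)] Bochner_Integration.integral_add[OF i1 i(3)]
      Bochner_Integration.integral_add[OF i(1,2)] ..
qed

lemma B_cross_odd:
  assumes [measurable]: "v \<in> borel_measurable borel" and odd: "\<And>x. v (mirror x) = - v x"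
  shows "B (even_part f) v = 0" "B v (even_part f) = 0"
proof -
  let ?h = "\<lambda>z. (even_part f (fst z) * v (snd z)) * k z" and ?h' = "\<lambda>z. (v (fst z) * even_part f (snd z)) * k z"
  have "?h \<in> borel_measurable (borel \<Otimes>\<^sub>M borel)" "?h' \<in> borel_measurable (borel \<Otimes>\<^sub>M borel)" by measurable
  from integral_pair_mirror(1)[OF this(1), of mirror mirror] integral_pair_mirror(1)[OF this(2), of mirror mirror]
  show "B (even_part f) v = 0" "B v (even_part f) = 0"
    by (simp_all add: B_def part_mirror odd norm_mirror_diff)
qed

text \<open>Reflecting the second variable exchanges \<open>k\<close> and \<open>k'\<close> and
  flips the sign of \<open>v\<close>; the right-hand side is the sum of the two forms of
  \<open>B v v\<close>.\<close>

lemma B_odd: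
  assumes [measurable]: "v \<in> borel_measurable borel" and v: "\<And>x. \<bar>v x\<bar> \<le> P x" and odd: "\<And>x. v (mirror x) = - v x"
  shows "2 * B v v = (\<integral>z. (v (fst z) * v (snd z)) * (k z - k' z) \<partial>(M \<Otimes>\<^sub>M M))"
    and "integrable (M \<Otimes>\<^sub>M M) (\<lambda>z. (v (fst z) * v (snd z)) * (k z - k' z))"
proof -
  note i = ker_int[OF assms(1) assms(1) v v]
  show "integrable (M \<Otimes>\<^sub>M M) (\<lambda>z. (v (fst z) * v (snd z)) * (k z - k' z))"
    unfolding right_diff_distrib by (rule Bochner_Integration.integrable_diff[OF i(1,2)])
  show "2 * B v v = (\<integral>z. (v (fst z) * v (snd z)) * (k z - k' z) \<partial>(M \<Otimes>\<^sub>M M))"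
    unfolding right_diff_distrib Bochner_Integration.integral_diff[OF i(1,2)] i(3) odd by (simp add: B_def)
qed

lemma B_even:
  assumes [measurable]: "v \<in> borel_measurable borel" and v: "\<And>x. \<bar>v x\<bar> \<le> P x" and even: "\<And>x. v (mirror x) = v x"
  shows "2 * B v v = (\<integral>z. (v (fst z) * v (snd z)) * (k z + k' z) \<partial>(M \<Otimes>\<^sub>M M))"
    and "integrable (M \<Otimes>\<^sub>M M) (\<lambda>z. (v (fst z) * v (snd z)) * (k z + k' z))"
proof -
  note i = ker_int[OF assms(1) assms(1) v v]
  show "integrable (M \<Otimes>\<^sub>M M) (\<lambda>z. (v (fst z) * v (snd z)) * (k z + k' z))"
    unfolding distrib_left by (rule Bochner_Integration.integrable_add[OF i(1,2)])
  show "2 * B v v = (\<integral>z. (v (fst z) * v (snd z)) * (k z + k' z) \<partial>(M \<Otimes>\<^sub>M M))"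
    unfolding distrib_left Bochner_Integration.integral_add[OF i(1,2)] i(3) even by (simp add: B_def)
qed

lemma B_decomp: "B f f = B (even_part f) (even_part f) + B (odd_part f) (odd_part f)"
proof -
  have "f = (\<lambda>x. even_part f x + odd_part f x)" by (auto simp: even_part_def odd_part_def field_simps)
  then have "B f f = B (\<lambda>x. even_part f x + odd_part f x) (\<lambda>x. even_part f x + odd_part f x)" by simp
  also have "\<dots> = B (even_part f) (even_part f) + B (odd_part f) (odd_part f)"
    using B_expand[of "odd_part f"] B_cross_odd[of "odd_part f"] part_bounds by (simp add: part_mirror)
  finally show ?thesis .
qed

lemma odd_part_zero: "Re x = 0 \<Longrightarrow> odd_part f x = 0"
  by (simp add: odd_part_def mirror_eq_self)

lemma kernel_sign:
  assumes "x \<noteq> y" "x \<noteq> mirror y"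
  shows "Re x * Re y > 0 \<Longrightarrow> k (x, y) < k' (x, y)" "Re x * Re y < 0 \<Longrightarrow> k' (x, y) < k (x, y)"
proof -
  have pos: "0 < norm (x - y)" "0 < norm (x - mirror y)" using assms by auto
  note c = norm_mirror_compare[of x y]
  show "k (x, y) < k' (x, y)" if "Re x * Re y > 0"
  proof -
    have "norm (x - y) < norm (x - mirror y)" by (rule power2_less_imp_less) (use c that in linarith, simp)
    then show ?thesis using pos by simp
  qed
  show "k' (x, y) < k (x, y)" if "Re x * Re y < 0"
  proof -
    have "norm (x - mirror y) < norm (x - y)" by (rule power2_less_imp_less) (use c that in linarith, simp)
    then show ?thesis using pos by simp
  qed
qed

text \<open>Only the odd part changes, and twice the loss of \<open>B\<close> is the integral of a
  pointwise nonnegative \<open>?W\<close>. Equality makes \<open>|o x| |o y|\<close> agree almost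
  everywhere with the product of the signed odd parts. Integrating this, the square of the integral
  of \<open>|o|\<close> equals that of \<open>sgn (Re x) * o x\<close>, which vanishes when the
  mirror bisects the mass.\<close>

lemma polarization:
  shows "B (polarize f) (polarize f) \<le> B f f"
    and "B (polarize f) (polarize f) = B f f \<Longrightarrow> (\<integral>x. sgn (Re x) * f x \<partial>M) = 0 \<Longrightarrow> AE x in M. f (mirror x) = f x"
proof -
  let ?o = "odd_part f" and ?s = "\<lambda>x. sgn (Re x)"
  let ?v = "\<lambda>x. ?s x * \<bar>?o x\<bar>"
  have vm [measurable]: "?v \<in> borel_measurable borel" by measurable
  have vo: "?v (mirror x) = - ?v x" for x by (simp add: part_mirror sgn_minus)
  have pol: "B (polarize f) (polarize f) = B (even_part f) (even_part f) + B ?v ?v"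
    using B_expand[OF vm part_bounds(4)] B_cross_odd[OF vm vo] by (simp add: polarize_def[abs_def])
  let ?W = "\<lambda>z. (?o (fst z) * ?o (snd z) - ?v (fst z) * ?v (snd z)) * (k z - k' z)"
  note o = B_odd[OF parts_measurable(2)[OF f_meas] part_bounds(2) part_mirror(2)]
  note v = B_odd[OF vm part_bounds(4) vo]
  have W: "integrable (M \<Otimes>\<^sub>M M) ?W"
    using Bochner_Integration.integrable_diff[OF o(2) v(2)] by (simp only: left_diff_distrib[symmetric])
  have Wv: "(\<integral>z. ?W z \<partial>(M \<Otimes>\<^sub>M M)) = 2 * (B f f - B (polarize f) (polarize f))"
    unfolding pol B_decomp using Bochner_Integration.integral_diff[OF o(2) v(2)] o(1) v(1)
    by (simp only: left_diff_distrib[symmetric]) simp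
  \<comment> \<open>On one side of the mirror \<open>k < k'\<close>, and the product of the odd
    parts is at most that of their moduli; on opposite sides both signs turn. On the mirror itself
    the odd part is zero.\<close>
  have pt: "0 \<le> ?W (x, y) \<and> (?W (x, y) = 0 \<longrightarrow> \<bar>?o x\<bar> * \<bar>?o y\<bar> = (?s x * ?o x) * (?s y * ?o y))"
    if "x \<noteq> y" "x \<noteq> mirror y" for x y
  proof -
    define a b where "a = ?o x" and "b = ?o y"
    consider "Re x * Re y = 0" | "Re x * Re y > 0" | "Re x * Re y < 0" by linarith
    then show ?thesis
    proof cases
      case 1
      then have "a = 0 \<or> b = 0" using odd_part_zero by (auto simp: a_def b_def)
      then show ?thesis by (auto simp: a_def[symmetric] b_def[symmetric])
    next
      case 2
      then have s: "?s x * ?s y = 1" by (metis sgn_mult sgn_1_pos)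
      have e: "(?s x * c) * (?s y * d) = c * d" for c d :: real
        using s by (metis mult.assoc mult.left_commute mult_1)
      have W: "?W (x, y) = (a * b - \<bar>a\<bar> * \<bar>b\<bar>) * (k (x, y) - k' (x, y))"
        unfolding fst_conv snd_conv e by (simp only: a_def b_def)
      have "a * b \<le> \<bar>a\<bar> * \<bar>b\<bar>" by (metis abs_ge_self abs_mult)
      then show ?thesis
        using kernel_sign(1)[OF that 2] unfolding W a_def[symmetric] b_def[symmetric] e
        by (auto intro: mult_nonpos_nonpos)
    next
      case 3
      then have s: "?s x * ?s y = -1" by (metis sgn_mult sgn_1_neg)
      have e: "(?s x * c) * (?s y * d) = - (c * d)" for c d :: real
        using s by (metis mult.assoc mult.left_commute mult_minus1)
      have W: "?W (x, y) = (a * b - - (\<bar>a\<bar> * \<bar>b\<bar>)) * (k (x, y) - k' (x, y))"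
        unfolding fst_conv snd_conv e by (simp only: a_def b_def)
      have "- (a * b) \<le> \<bar>a\<bar> * \<bar>b\<bar>" by (metis abs_ge_minus_self abs_mult)
      then show ?thesis
        using kernel_sign(2)[OF that 3] unfolding W a_def[symmetric] b_def[symmetric] e
        by auto
    qed
  qed
  have ptz: "0 \<le> ?W z \<and> (?W z = 0 \<longrightarrow> \<bar>?o (fst z)\<bar> * \<bar>?o (snd z)\<bar> = (?s (fst z) * ?o (fst z)) * (?s (snd z) * ?o (snd z)))"
    if "fst z \<noteq> snd z" "fst z \<noteq> mirror (snd z)" for z
    by (rule pt[OF that, unfolded fst_conv snd_conv])
  have pos: "AE z in M \<Otimes>\<^sub>M M. 0 \<le> ?W z"
    using diag_M diag_mirror_M by eventually_elim (use ptz in blast)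
  then have "0 \<le> (\<integral>z. ?W z \<partial>(M \<Otimes>\<^sub>M M))" by (rule integral_nonneg_AE)
  then show "B (polarize f) (polarize f) \<le> B f f" unfolding Wv by simp
  assume eq: "B (polarize f) (polarize f) = B f f" and bis: "(\<integral>x. sgn (Re x) * f x \<partial>M) = 0"
  have "AE z in M \<Otimes>\<^sub>M M. ?W z = 0"
    using integral_nonneg_eq_0_iff_AE[OF W pos] Wv eq by simp
  with diag_M diag_mirror_M have ae: "AE z in M \<Otimes>\<^sub>M M.
      \<bar>?o (fst z)\<bar> * \<bar>?o (snd z)\<bar> = (?s (fst z) * ?o (fst z)) * (?s (snd z) * ?o (snd z))"
    by eventually_elim (use ptz in blast)
  have fm: "integrable M (\<lambda>x. f (mirror x))" using integral_mirror(2)[OF f_meas] f_int by simp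
  have oi: "integrable M ?o"
    unfolding odd_part_def by (intro Bochner_Integration.integrable_diff integrable_divide f_int fm)
  have sb: "integrable M (\<lambda>x. ?s x * h x)" if "integrable M h" for h
    using that by (rule Bochner_Integration.integrable_bound)
      (use borel_measurable_integrable[OF that] in \<open>auto simp: measurable_M abs_mult sgn_if\<close>)
  note soi = sb[OF oi] and sfi = sb[OF f_int] and sfm = sb[OF fm]
  have "(\<integral>x. ?s x * f (mirror x) \<partial>M) = - (\<integral>x. ?s x * f x \<partial>M)"
  proof -
    have "(\<integral>x. ?s x * f (mirror x) \<partial>M) = (\<integral>x. ?s (mirror x) * f (mirror (mirror x)) \<partial>M)"
      by (rule integral_mirror(1)[symmetric]) measurable
    then show ?thesis by (simp add: sgn_minus)
  qed
  then have so: "(\<integral>x. ?s x * ?o x \<partial>M) = 0"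
    using bis sfi sfm by (simp add: odd_part_def right_diff_distrib)
  have "(\<integral>x. \<bar>?o x\<bar> \<partial>M) * (\<integral>x. \<bar>?o x\<bar> \<partial>M) = (\<integral>z. \<bar>?o (fst z)\<bar> * \<bar>?o (snd z)\<bar> \<partial>(M \<Otimes>\<^sub>M M))"
    using oi by (intro PM.integrable_mult_pair(2)[symmetric]) auto
  also have "\<dots> = (\<integral>z. (?s (fst z) * ?o (fst z)) * (?s (snd z) * ?o (snd z)) \<partial>(M \<Otimes>\<^sub>M M))"
    using ae by (intro integral_cong_AE) (auto simp: measurable_MM)
  also have "\<dots> = 0" using PM.integrable_mult_pair(2)[OF soi soi] so by simp
  finally have "(\<integral>x. \<bar>?o x\<bar> \<partial>M) = 0" by simp
  then have "AE x in M. \<bar>?o x\<bar> = 0"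
    using integral_nonneg_eq_0_iff_AE[of M "\<lambda>x. \<bar>?o x\<bar>"] oi by simp
  then show "AE x in M. f (mirror x) = f x" by eventually_elim (simp add: odd_part_def)
qed

end

end

section \<open>Isometries of the plane preserve Lebesgue measure\<close>

lemma lborel_distr_orthogonal:
  fixes f :: "real ^ 'n::{finite,wellorder} \<Rightarrow> real ^ 'n::_"
  assumes f: "orthogonal_transformation f"
  shows "distr lborel borel f = lborel"
proof (rule lborel_eqI[symmetric])
  fix l u :: "real ^ 'n::_" assume lu: "\<And>b. b \<in> Basis \<Longrightarrow> l \<bullet> b \<le> u \<bullet> b"
  have fm [measurable]: "f \<in> borel_measurable borel"
    using orthogonal_transformation_linear[OF f] by (intro borel_measurable_continuous_onI linear_continuous_on linear_conv_bounded_linear[THEN iffD1])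
  have "f -` box l u = inv f ` box l u"
    using orthogonal_transformation_bij[OF f] by (simp add: bij_vimage_eq_inv_image)
  moreover have "measure lebesgue (inv f ` box l u) = measure lebesgue (box l u)"
    by (intro measure_orthogonal_image orthogonal_transformation_inv f) auto
  moreover have "inv f ` box l u \<in> lmeasurable"
    by (intro measurable_orthogonal_image orthogonal_transformation_inv f) auto
  moreover have "f -` box l u \<in> sets borel" using measurable_sets[OF fm, of "box l u"] by simp
  moreover have le: "emeasure lborel S = ennreal (measure lebesgue S)" if "S \<in> sets borel" "S \<in> lmeasurable" for S :: "(real ^ 'n::_) set"
    using that by (subst emeasure_eq_measure2[symmetric]) simp_all
  ultimately have "emeasure lborel (f -` box l u) = emeasure lborel (box l u)"
    by (subst (1 2) le) simp_all
  then show "emeasure (distr lborel borel f) (box l u) = ennreal (\<Prod>b\<in>Basis. (u - l) \<bullet> b)"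
    using lu by (simp add: emeasure_distr emeasure_lborel_box)
qed simp

lemma lborel_distr_Complex:
  fixes i j :: "'n::finite"
  assumes ij: "(UNIV :: 'n set) = {i, j}" "i \<noteq> j"
  shows "distr (lborel :: (real ^ 'n) measure) borel (\<lambda>v. Complex (v $ i) (v $ j)) = lborel"
proof (rule lborel_eqI[symmetric])
  have Tm [measurable]: "(\<lambda>v::real^'n. Complex (v $ i) (v $ j)) \<in> borel_measurable borel"
    by (intro borel_measurable_continuous_onI continuous_intros) 
  fix l u :: complex assume lu: "\<And>b. b \<in> Basis \<Longrightarrow> l \<bullet> b \<le> u \<bullet> b"
  define l' u' :: "real ^ 'n" where "l' = (\<chi> k. if k = i then Re l else Im l)" and "u' = (\<chi> k. if k = i then Re u else Im u)"
  have all: "(\<forall>k::'n. P k) \<longleftrightarrow> P i \<and> P j" for P using ij by (metis UNIV_I insertE singletonD)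
  have vi: "(\<lambda>v::real^'n. Complex (v $ i) (v $ j)) -` box l u = box l' u'"
    using ij(2) by (auto simp: in_box_complex_iff mem_box_cart all l'_def u'_def)
  have B: "(Basis :: (real ^ 'n) set) = {axis i 1, axis j 1}"
    unfolding Basis_vec_def using ij(1) by auto
  have ne: "axis i (1::real) \<noteq> axis j 1" using ij(2) by (simp add: axis_eq_axis)
  have le: "Re l \<le> Re u" "Im l \<le> Im u" using lu[of 1] lu[of \<i>] by (auto simp: Basis_complex_def)
  have "emeasure lborel (box l' u') = ennreal (\<Prod>b\<in>Basis. (u' - l') \<bullet> b)"
    using le ij(2) ne by (intro emeasure_lborel_box) (auto simp: B inner_axis l'_def u'_def)
  also have "(\<Prod>b\<in>Basis. (u' - l') \<bullet> b) = (\<Prod>b\<in>Basis. (u - l) \<bullet> b)"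
    unfolding B Basis_complex_def using ne ij(2) by (simp add: inner_axis l'_def u'_def)
  finally show "emeasure (distr lborel borel (\<lambda>v::real^'n. Complex (v $ i) (v $ j))) (box l u) = ennreal (\<Prod>b\<in>Basis. (u - l) \<bullet> b)"
    by (simp add: emeasure_distr vi)
qed simp

text \<open>Conjugation with the coordinate maps \<open>T\<close> and \<open>U\<close> carries
  \<open>L\<close> to an orthogonal map of \<open>real ^ 2\<close>.\<close>

lemma lborel_distr_linear_isometry:
  fixes L :: "complex \<Rightarrow> complex"
  assumes L: "linear L" "\<And>z. norm (L z) = norm z"
  shows "distr lborel borel L = lborel"
proof -
  define T :: "real ^ 2 \<Rightarrow> complex" where "T = (\<lambda>v. Complex (v $ 1) (v $ 2))"
  define U :: "complex \<Rightarrow> real ^ 2" where "U = (\<lambda>z. \<chi> k. if k = 1 then Re z else Im z)"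
  have "(UNIV :: 2 set) = {1, 2}" "(1::2) \<noteq> 2" using UNIV_2 by auto
  from lborel_distr_Complex[OF this] have T: "distr lborel borel T = lborel" by (simp add: T_def)
  have TU: "T (U z) = z" for z by (simp add: T_def U_def)
  have nT: "norm (T v) = norm v" for v
    by (simp add: T_def cmod_def norm_vec_def L2_set_def sum_2)
  have lT: "linear T" by (rule linearI) (auto simp: T_def complex_eq_iff)
  have lU: "linear U" by (rule linearI) (auto simp: U_def vec_eq_iff)
  have "orthogonal_transformation (\<lambda>v. U (L (T v)))"
    unfolding orthogonal_transformation
  proof (intro conjI allI)
    show "linear (\<lambda>v. U (L (T v)))"
      using linear_compose[OF linear_compose[OF lT L(1)] lU] by (simp add: o_def)
    show "norm (U (L (T v))) = norm v" for v using nT[of "U (L (T v))"] L(2) nT by (simp add: TU)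
  qed
  from lborel_distr_orthogonal[OF this] have o: "distr lborel borel (\<lambda>v. U (L (T v))) = lborel" .
  have lm: "f \<in> borel_measurable borel" if "linear f" for f :: "'a::euclidean_space \<Rightarrow> 'b::euclidean_space"
    using that by (intro borel_measurable_continuous_onI linear_continuous_on linear_conv_bounded_linear[THEN iffD1])
  note [measurable] = lm[OF lT] lm[OF lU] lm[OF L(1)]
  have "distr lborel borel L = distr (distr lborel borel T) borel L" by (simp add: T)
  also have "\<dots> = distr lborel borel (\<lambda>v. T (U (L (T v))))" by (subst distr_distr) (auto simp: o_def TU)
  also have "\<dots> = distr (distr lborel borel (\<lambda>v. U (L (T v)))) borel T" by (subst distr_distr) (auto simp: o_def)
  also have "\<dots> = lborel" by (simp add: o T)
  finally show ?thesis .
qed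

lemma lborel_distr_rotate: "norm u = 1 \<Longrightarrow> distr lborel borel ((*) u) = (lborel :: complex measure)"
  by (rule lborel_distr_linear_isometry) (auto simp: norm_mult intro!: linearI simp: algebra_simps)

lemma lborel_distr_mirror: "distr lborel borel mirror = lborel"
  by (rule lborel_distr_linear_isometry) (auto simp: mirror_def intro!: linearI simp: algebra_simps)

interpretation lborel_mirror: mirror_space lborel
proof
  show "distr lborel borel mirror = lborel" by (rule lborel_distr_mirror)
  show "AE z in lborel \<Otimes>\<^sub>M lborel. fst z \<noteq> (snd z :: complex)" by (rule AE_lborel_pair_neq)
qed simp

lemma AE_circ_neq: "AE y in circ. y \<noteq> x"
proof -
  have "AE t in uniform_measure lborel {-pi<..pi}. cis t \<noteq> x"
  proof (rule AE_uniform_measureI)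
    show "AE t in lborel. t \<in> {-pi<..pi} \<longrightarrow> cis t \<noteq> x"
      using AE_lborel_singleton[of "Arg x"] by eventually_elim (auto simp: Arg_cis)
  qed simp
  then show ?thesis unfolding circ_def by (subst AE_distr_iff) auto
qed

interpretation circ_mirror: mirror_space circ
proof
  show "distr circ borel mirror = circ"
  proof -
    have "distr circ borel mirror = distr (distr circ borel cnj) borel ((*) (-1))"
      by (subst distr_distr) (auto simp: o_def mirror_def[abs_def])
    then show ?thesis using circ_rotate[of "-1"] by (simp only: circ_cnj) simp
  qed
  interpret pair_sigma_finite circ circ ..
  show "AE z in circ \<Otimes>\<^sub>M circ. fst z \<noteq> snd z"
  proof (rule AE_pair_measure)
    show "AE x in circ. AE y in circ. fst (x, y) \<noteq> snd (x, y)"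
    proof (rule AE_I2)
      fix x
      show "AE y in circ. fst (x, y) \<noteq> snd (x, y)" using AE_circ_neq[of x] by eventually_elim auto
    qed
  qed measurable
qed simp

section \<open>Mass and entropy under polarization and symmetrization\<close>

lemma adm_mirror: "adm f \<Longrightarrow> adm (\<lambda>x. f (mirror x))"
  using isometry_invariance(1)[OF mirror_measurable lborel_distr_mirror] by (simp add: norm_mirror_diff)

lemma adm_ker_int:
  assumes "adm f"
  shows "integrable (lborel \<Otimes>\<^sub>M lborel) (\<lambda>z. ((f (fst z) + f (mirror (fst z))) * (f (snd z) + f (mirror (snd z)))) * ln (norm (fst z - snd z)))"
proof -
  note m = adm_mirror[OF assms]
  have e: "((f (fst z) + f (mirror (fst z))) * (f (snd z) + f (mirror (snd z)))) * ln (norm (fst z - snd z))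
    = (f (fst z) * f (snd z)) * ln (norm (fst z - snd z)) + (f (fst z) * f (mirror (snd z))) * ln (norm (fst z - snd z))
    + ((f (mirror (fst z)) * f (snd z)) * ln (norm (fst z - snd z)) + (f (mirror (fst z)) * f (mirror (snd z))) * ln (norm (fst z - snd z)))" for z
    by (simp add: algebra_simps)
  show ?thesis unfolding e
    by (intro Bochner_Integration.integrable_add integrable_log_kernel[OF assms assms] integrable_log_kernel[OF assms m]
        integrable_log_kernel[OF m assms] integrable_log_kernel[OF m m])
qed

text \<open>\<open>polarize\<close> and \<open>symm\<close> choose pointwise between the values at
  \<open>x\<close> and at its mirror image, so each integrand is bounded by the sum of the two
  original ones.\<close>

lemma adm_select:
  assumes f: "adm f" and [measurable]: "u \<in> borel_measurable borel" and u: "\<And>x. u x = f x \<or> u x = f (mirror x)"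
  shows "adm u"
proof -
  note m = adm_mirror[OF f]
  have bd: "integrable lborel v"
    if v: "v \<in> borel_measurable borel" "integrable lborel a" "integrable lborel b" "\<And>x. v x = a x \<or> v x = b x" for v a b :: "complex \<Rightarrow> real"
  proof (rule Bochner_Integration.integrable_bound)
    show "integrable lborel (\<lambda>x. \<bar>a x\<bar> + \<bar>b x\<bar>)" using v by auto
    show "AE x in lborel. norm (v x) \<le> norm (\<bar>a x\<bar> + \<bar>b x\<bar>)"
    proof (rule AE_I2)
      fix x show "norm (v x) \<le> norm (\<bar>a x\<bar> + \<bar>b x\<bar>)" using v(4)[of x] by auto
    qed
  qed (use v in simp)
  show ?thesis
    unfolding adm_def
  proof (intro conjI allI)
    show "0 \<le> u x" for x using u[of x] admD(2)[OF f] by auto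
    show "integrable lborel u" using u by (intro bd[OF _ admD(3)[OF f] admD(3)[OF m]]) auto
    show "integrable lborel (\<lambda>x. u x * ln (u x))"
      by (rule bd[OF _ admD(4)[OF f] admD(4)[OF m]]) (measurable, use u in metis)
    show "integrable lborel (\<lambda>x. u x * ln (1 + norm x))"
      by (rule bd[OF _ admD(5)[OF f] admD(5)[OF m]]) (measurable, use u in metis)
  qed measurable
qed

lemma adm_polarize:
  assumes f: "adm f"
  shows "adm (polarize f)" "(\<integral>x. polarize f x \<partial>lborel) = (\<integral>x. f x \<partial>lborel)" "entS (polarize f) = entS f"
proof -
  note [measurable] = admD(1)[OF f]
  show a: "adm (polarize f)"
    by (rule adm_select[OF f]) (use polarize_values[of f] in auto)
  have eq: "(\<integral>x. \<psi> (polarize f x) \<partial>lborel) = (\<integral>x. \<psi> (f x) \<partial>lborel)"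
    if [measurable]: "\<psi> \<in> borel_measurable borel" and i: "integrable lborel (\<lambda>x. \<psi> (f x))" "integrable lborel (\<lambda>x. \<psi> (polarize f x))" for \<psi> :: "real \<Rightarrow> real"
  proof -
    have "2 * (\<integral>x. \<psi> (u x) \<partial>lborel) = (\<integral>x. \<psi> (u x) + \<psi> (u (mirror x)) \<partial>lborel)"
      if [measurable]: "u \<in> borel_measurable borel" and ui: "integrable lborel (\<lambda>x. \<psi> (u x))" for u :: "complex \<Rightarrow> real"
      using lborel_mirror.integral_mirror[of "\<lambda>x. \<psi> (u x)"] ui by (subst Bochner_Integration.integral_add) auto
    note this[of "polarize f"] this[of f]
    moreover have "(\<integral>x. \<psi> (polarize f x) + \<psi> (polarize f (mirror x)) \<partial>lborel) = (\<integral>x. \<psi> (f x) + \<psi> (f (mirror x)) \<partial>lborel)"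
    proof (intro Bochner_Integration.integral_cong refl)
      fix x show "\<psi> (polarize f x) + \<psi> (polarize f (mirror x)) = \<psi> (f x) + \<psi> (f (mirror x))"
        using polarize_values[of f x] by auto
    qed
    ultimately show ?thesis using i by simp
  qed
  show "(\<integral>x. polarize f x \<partial>lborel) = (\<integral>x. f x \<partial>lborel)"
    using eq[of "\<lambda>x. x"] admD(3)[OF f] admD(3)[OF a] by simp
  show "entS (polarize f) = entS f"
    unfolding entS_def using eq[of "\<lambda>x. x * ln x"] admD(4)[OF f] admD(4)[OF a] by simp
qed

lemma sgn_integrable:
  assumes "integrable M f" and [measurable]: "r \<in> borel_measurable M"
  shows "integrable M (\<lambda>x. sgn (r x :: real) * (f x :: real))"
  using assms(1) by (rule Bochner_Integration.integrable_bound)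
    (use borel_measurable_integrable[OF assms(1)] in \<open>auto simp: abs_mult sgn_if\<close>)

lemma integral_sgn_mirror:
  assumes f: "adm f"
  shows "(\<integral>x. sgn (Re x) * f (mirror x) \<partial>lborel) = - (\<integral>x. sgn (Re x) * f x \<partial>lborel)"
proof -
  note [measurable] = admD(1)[OF f]
  have "(\<integral>x. sgn (Re x) * f (mirror x) \<partial>lborel) = (\<integral>x. sgn (Re (mirror x)) * f (mirror (mirror x)) \<partial>lborel)"
    by (rule lborel_mirror.integral_mirror(1)[symmetric]) measurable
  then show ?thesis by (simp add: sgn_minus)
qed

text \<open>As the mirror bisects the mass, doubling either half restores the total. Together the
  two functions take the values \<open>f x\<close> and \<open>f (mirror x)\<close> at every
  \<open>x\<close>, whence the entropies add up to twice that of \<open>f\<close>.\<close>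

lemma adm_symm:
  assumes f: "adm f" and bis: "(\<integral>x. sgn (Re x) * f x \<partial>lborel) = 0"
  shows "adm (symm 1 f)" "adm (symm (-1) f)"
    "(\<integral>x. symm 1 f x \<partial>lborel) = (\<integral>x. f x \<partial>lborel)" "(\<integral>x. symm (-1) f x \<partial>lborel) = (\<integral>x. f x \<partial>lborel)"
    "entS (symm 1 f) + entS (symm (-1) f) = 2 * entS f"
proof -
  note [measurable] = admD(1)[OF f]
  note m = adm_mirror[OF f]
  show a: "adm (symm 1 f)" "adm (symm (-1) f)"
    by (rule adm_select[OF f]; use symm_values[of f] in auto)+
  note i = admD(3)[OF f] admD(3)[OF m] sgn_integrable[OF admD(3)[OF f], of Re] sgn_integrable[OF admD(3)[OF m], of Re]
  have "(\<integral>x. symm c f x \<partial>lborel) = (\<integral>x. f x \<partial>lborel)" for c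
  proof -
    have "symm c f x = (f x + f (mirror x)) / 2 + c * ((sgn (Re x) * f x - sgn (Re x) * f (mirror x)) / 2)" for x
      by (simp add: symm_def even_part_def odd_part_def right_diff_distrib)
    moreover have "(\<integral>x. (f x + f (mirror x)) / 2 + c * ((sgn (Re x) * f x - sgn (Re x) * f (mirror x)) / 2) \<partial>lborel)
        = (\<integral>x. f x \<partial>lborel)"
      using i bis integral_sgn_mirror[OF f] lborel_mirror.integral_mirror(1)[of f] by simp
    ultimately show ?thesis by simp
  qed
  then show "(\<integral>x. symm 1 f x \<partial>lborel) = (\<integral>x. f x \<partial>lborel)" "(\<integral>x. symm (-1) f x \<partial>lborel) = (\<integral>x. f x \<partial>lborel)" by auto
  have "entS (symm 1 f) + entS (symm (-1) f) = (\<integral>x. symm 1 f x * ln (symm 1 f x) + symm (-1) f x * ln (symm (-1) f x) \<partial>lborel)"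
    unfolding entS_def using admD(4)[OF a(1)] admD(4)[OF a(2)] by simp
  also have "\<dots> = (\<integral>x. f x * ln (f x) + f (mirror x) * ln (f (mirror x)) \<partial>lborel)"
  proof (intro Bochner_Integration.integral_cong refl)
    fix x show "symm 1 f x * ln (symm 1 f x) + symm (-1) f x * ln (symm (-1) f x) = f x * ln (f x) + f (mirror x) * ln (f (mirror x))"
      using symm_values[of f x] by auto
  qed
  also have "\<dots> = 2 * entS f"
    unfolding entS_def using admD(4)[OF f] admD(4)[OF m] lborel_mirror.integral_mirror(1)[of "\<lambda>x. f x * ln (f x)"] by simp
  finally show "entS (symm 1 f) + entS (symm (-1) f) = 2 * entS f" .
qed

lemma AE_Re_nonzero: "AE x in lborel. Re x \<noteq> c"
proof -
  have "negligible {x. (1::complex) \<bullet> x = c}" by (rule negligible_hyperplane) simp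
  then have "{x. Re x = c} \<in> null_sets lebesgue"
    by (simp add: negligible_iff_null_sets inner_complex_def)
  then have "AE x in lebesgue. x \<notin> {x. Re x = c}" by (rule AE_not_in)
  then show ?thesis by (simp add: AE_completion_iff)
qed

section \<open>Reflection positivity through the Cayley transform\<close>

definition fold_half :: "complex \<Rightarrow> complex" where
  "fold_half x = Complex \<bar>Re x\<bar> (Im x)"

text \<open>Takes the folded half-plane into the closed unit disc, where the logarithm of
  \<open>1 - p * cnj q\<close> has a series with positive definite terms.\<close>

definition cayley :: "complex \<Rightarrow> complex" where
  "cayley x = (fold_half x - 1) / (fold_half x + 1)"

lemma fold_half_measurable [measurable]: "fold_half \<in> borel_measurable borel"
  unfolding fold_half_def by (intro borel_measurable_continuous_onI continuous_intros)

lemma cayley_identity: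
  fixes a b :: complex
  assumes "a + 1 \<noteq> 0" "b + 1 \<noteq> 0"
  shows "1 - (a - 1) / (a + 1) * ((b - 1) / (b + 1)) = 2 * (a + b) / ((a + 1) * (b + 1))"
proof -
  have "(a - 1) / (a + 1) * ((b - 1) / (b + 1)) * ((a + 1) * (b + 1)) = (a - 1) * (b - 1)"
    using assms by simp
  then have "(1 - (a - 1) / (a + 1) * ((b - 1) / (b + 1))) * ((a + 1) * (b + 1)) = 2 * (a + b)"
    by (simp only: left_diff_distrib) (simp add: algebra_simps)
  then show ?thesis using assms by (simp add: nonzero_eq_divide_eq)
qed

lemma cayley_facts:
  shows "fold_half x + 1 \<noteq> 0" "norm (cayley x) \<le> 1" "1 \<le> norm (fold_half x + 1)" "norm (fold_half x + 1) \<le> 1 + norm x"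
    "1 - cayley x * cnj (cayley y) = 2 * (fold_half x + cnj (fold_half y)) / ((fold_half x + 1) * cnj (fold_half y + 1))"
proof -
  have R: "1 \<le> Re (fold_half x + 1)" for x by (simp add: fold_half_def)
  show ne: "fold_half x + 1 \<noteq> 0" by (metis R not_one_le_zero zero_complex.simps(1))
  have ney: "fold_half y + 1 \<noteq> 0" by (metis R not_one_le_zero zero_complex.simps(1))
  show "1 \<le> norm (fold_half x + 1)" using R[of x] complex_Re_le_cmod order_trans by blast
  have "norm (fold_half x) = norm x" by (simp add: fold_half_def cmod_def)
  then show "norm (fold_half x + 1) \<le> 1 + norm x" using norm_triangle_ineq[of "fold_half x" 1] by simp
  have "(norm (fold_half x - 1))\<^sup>2 \<le> (norm (fold_half x + 1))\<^sup>2"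
    unfolding cmod_power2 by (simp add: fold_half_def power2_eq_square algebra_simps)
  then have "norm (fold_half x - 1) \<le> norm (fold_half x + 1)" by (rule power2_le_imp_le) simp
  then show "norm (cayley x) \<le> 1" using ne by (simp add: cayley_def norm_divide divide_le_eq_1)
  have "cnj (fold_half y) + 1 \<noteq> 0" using ney by (metis complex_cnj_add complex_cnj_one complex_cnj_zero_iff)
  then show "1 - cayley x * cnj (cayley y) = 2 * (fold_half x + cnj (fold_half y)) / ((fold_half x + 1) * cnj (fold_half y + 1))"
    unfolding cayley_def complex_cnj_divide complex_cnj_diff complex_cnj_add complex_cnj_one
    using ne by (intro cayley_identity) auto
qed

text \<open>In both cases this is the distance across the mirror: from \<open>x\<close> to that one
  of \<open>y\<close> and \<open>mirror y\<close> which lies on the other side.\<close>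

lemma fold_kernel:
  assumes "Re x * Re y \<noteq> 0"
  shows "norm (fold_half x + cnj (fold_half y)) = (if Re x * Re y > 0 then norm (x - mirror y) else norm (x - y))"
    and "fold_half x + cnj (fold_half y) \<noteq> 0"
proof -
  have R: "Re x \<noteq> 0" "Re y \<noteq> 0" using assms by auto
  have "(norm (fold_half x + cnj (fold_half y)))\<^sup>2 = (if Re x * Re y > 0 then (norm (x - mirror y))\<^sup>2 else (norm (x - y))\<^sup>2)"
    using R unfolding cmod_power2
    by (cases "Re x > 0"; cases "Re y > 0")
      (auto simp: fold_half_def mirror_def power2_eq_square algebra_simps zero_less_mult_iff)
  then show "norm (fold_half x + cnj (fold_half y)) = (if Re x * Re y > 0 then norm (x - mirror y) else norm (x - y))"
    by (auto split: if_splits)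
  have "0 < Re (fold_half x + cnj (fold_half y))" using R by (simp add: fold_half_def)
  then show "fold_half x + cnj (fold_half y) \<noteq> 0" by (metis less_irrefl zero_complex.simps(1))
qed

text \<open>Half of the difference of the two sides is the form of \<open>h\<close> with the
  logarithm of the distance across the mirror. By the Cayley transform this logarithm is
  \<open>ln |1 - p q'|\<close>, with \<open>q'\<close> the conjugate of \<open>q\<close>, plus a
  constant and functions of one variable. The latter drop out because \<open>h\<close> has mean
  zero, and \<open>log_kernel_nonneg\<close> gives the sign.\<close>

lemma reflection_positivity:
  assumes f: "adm f" and bis: "(\<integral>x. sgn (Re x) * f x \<partial>lborel) = 0"
  shows "logE (symm 1 f) (symm 1 f) + logE (symm (-1) f) (symm (-1) f) \<le> 2 * logE f f"
proof -
  note [measurable] = admD(1)[OF f]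
  note ctx = admD(1)[OF f] admD(2)[OF f] admD(3)[OF f] adm_ker_int[OF f]
  let ?o = "odd_part f" and ?e = "even_part f"
  define h where "h x = sgn (Re x) * ?o x" for x
  have hm [measurable]: "h \<in> borel_measurable borel" unfolding h_def by measurable
  note pb = lborel_mirror.part_bounds[OF ctx]
  have hb: "\<bar>h x\<bar> \<le> f x + f (mirror x)" for x using pb(3)[of x] by (simp add: h_def)
  have he: "h (mirror x) = h x" for x by (simp add: h_def part_mirror sgn_minus)
  let ?B = "lborel_mirror.B"
  have BE: "?B u v = logE u v" for u v by (simp add: lborel_mirror.B_def logE_def)
  let ?k = "\<lambda>z. ln (norm (fst z - snd z :: complex))" and ?k' = "\<lambda>z. ln (norm (fst z - mirror (snd z)))"
  let ?m = "\<lambda>z. ln (norm (fold_half (fst z) + cnj (fold_half (snd z))))"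
  note O = lborel_mirror.B_odd[OF ctx parts_measurable(2)[OF ctx(1)] pb(2) part_mirror(2)]
  note E = lborel_mirror.B_even[OF ctx hm hb he]
  have re: "AE z in lborel \<Otimes>\<^sub>M lborel. Re (fst z) \<noteq> 0 \<and> Re (snd z) \<noteq> 0"
    by (rule AE_pair_both[OF sigma_finite_lborel AE_Re_nonzero])
  \<comment> \<open>On one side of the mirror the terms with \<open>k\<close> cancel, on opposite
    sides those with \<open>k'\<close>; what remains is always the distance across the
    mirror.\<close>
  have id: "AE z in lborel \<Otimes>\<^sub>M lborel. 2 * ((h (fst z) * h (snd z)) * ?m z)
      = (h (fst z) * h (snd z)) * (?k z + ?k' z) - (?o (fst z) * ?o (snd z)) * (?k z - ?k' z)"
    using re
  proof eventually_elim
    fix z :: "complex \<times> complex" assume z: "Re (fst z) \<noteq> 0 \<and> Re (snd z) \<noteq> 0"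
    then have nz: "Re (fst z) * Re (snd z) \<noteq> 0" by simp
    have s: "h (fst z) * h (snd z) = sgn (Re (fst z) * Re (snd z)) * (?o (fst z) * ?o (snd z))"
      by (simp add: h_def sgn_mult)
    show "2 * ((h (fst z) * h (snd z)) * ?m z)
      = (h (fst z) * h (snd z)) * (?k z + ?k' z) - (?o (fst z) * ?o (snd z)) * (?k z - ?k' z)"
      unfolding s fold_kernel(1)[OF nz] using nz
      by (cases "Re (fst z) * Re (snd z) > 0") (auto simp: algebra_simps sgn_if)
  qed
  have mint: "integrable (lborel \<Otimes>\<^sub>M lborel) (\<lambda>z. (h (fst z) * h (snd z)) * ?m z)"
  proof -
    have "integrable (lborel \<Otimes>\<^sub>M lborel) (\<lambda>z. 2 * ((h (fst z) * h (snd z)) * ?m z))"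
      by (rule integrable_cong_AE_imp[OF Bochner_Integration.integrable_diff[OF E(2) O(2)]]) (measurable, use id in \<open>auto elim: eventually_mono\<close>)
    then show ?thesis by simp
  qed
  have mval: "2 * (\<integral>z. (h (fst z) * h (snd z)) * ?m z \<partial>(lborel \<Otimes>\<^sub>M lborel)) = 2 * ?B h h - 2 * ?B ?o ?o"
  proof -
    have "2 * (\<integral>z. (h (fst z) * h (snd z)) * ?m z \<partial>(lborel \<Otimes>\<^sub>M lborel))
      = (\<integral>z. (h (fst z) * h (snd z)) * (?k z + ?k' z) - (?o (fst z) * ?o (snd z)) * (?k z - ?k' z) \<partial>(lborel \<Otimes>\<^sub>M lborel))"
      unfolding integral_mult_right_zero[symmetric] by (rule integral_cong_AE) (measurable, use id in simp)
    then show ?thesis unfolding Bochner_Integration.integral_diff[OF E(2) O(2)] E(1) O(1) .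
  qed
  have fm: "integrable lborel (\<lambda>x. f (mirror x))" by (rule admD(3)[OF adm_mirror[OF f]])
  have hi: "integrable lborel h"
    by (rule Bochner_Integration.integrable_bound[OF Bochner_Integration.integrable_add[OF admD(3)[OF f] fm]])
      (measurable, use hb in \<open>auto intro: order_trans[OF hb abs_ge_self]\<close>)
  have h0: "(\<integral>x. h x \<partial>lborel) = 0"
  proof -
    have "h x = (sgn (Re x) * f x - sgn (Re x) * f (mirror x)) / 2" for x
      by (simp add: h_def odd_part_def right_diff_distrib)
    then have "(\<integral>x. h x \<partial>lborel) = (\<integral>x. (sgn (Re x) * f x - sgn (Re x) * f (mirror x)) / 2 \<partial>lborel)"
      by (simp only:)
    then show ?thesis
      using bis integral_sgn_mirror[OF f] sgn_integrable[OF admD(3)[OF f], of Re] sgn_integrable[OF fm, of Re] by simp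
  qed
  let ?l = "\<lambda>x. ln (norm (fold_half x + 1))"
  have hl: "integrable lborel (\<lambda>x. h x * ?l x)"
  proof (rule Bochner_Integration.integrable_bound)
    show "integrable lborel (\<lambda>x. f x * ln (1 + norm x) + f (mirror x) * ln (1 + norm x))"
      by (intro Bochner_Integration.integrable_add admD(5) f adm_mirror)
    show "AE x in lborel. norm (h x * ?l x) \<le> norm (f x * ln (1 + norm x) + f (mirror x) * ln (1 + norm x))"
    proof (rule AE_I2)
      fix x
      have l: "0 \<le> ?l x" "?l x \<le> ln (1 + norm x)"
        using cayley_facts(3,4)[of x] by (auto intro!: ln_mono)
      have "\<bar>h x\<bar> * ?l x \<le> (f x + f (mirror x)) * ln (1 + norm x)"
        using l hb by (intro mult_mono) (auto intro: order_trans[OF abs_ge_zero hb])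
      also have "\<dots> \<le> norm (f x * ln (1 + norm x) + f (mirror x) * ln (1 + norm x))" by (simp add: distrib_right)
      finally show "norm (h x * ?l x) \<le> norm (f x * ln (1 + norm x) + f (mirror x) * ln (1 + norm x))"
        using l by (simp add: abs_mult)
    qed
  qed measurable
  let ?H = "\<lambda>z. h (fst z) * h (snd z)"
  let ?p = "\<lambda>z. ln (norm (1 - cayley (fst z) * cnj (cayley (snd z))))"
  \<comment> \<open>This is \<open>cayley_facts(5)\<close> after taking logarithms. The two middle
    terms factor over the variables and integrate to zero, as does the last.\<close>
  let ?C = "\<lambda>z. ?H z * ?m z - (h (fst z) * ?l (fst z)) * h (snd z) - h (fst z) * (h (snd z) * ?l (snd z)) + ln 2 * ?H z"
  note i = lborel_pair.integrable_mult_pair[OF hl hi] lborel_pair.integrable_mult_pair[OF hi hl] lborel_pair.integrable_mult_pair[OF hi hi]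
  note i1 = Bochner_Integration.integrable_diff[OF mint i(1)]
  note i2 = Bochner_Integration.integrable_diff[OF i1 i(3)]
  note i3 = integrable_mult_right[OF i(5), of "ln 2"]
  note i4 = Bochner_Integration.integrable_add[OF i2 i3]
  have [measurable]: "cayley \<in> borel_measurable borel" unfolding cayley_def by measurable
  have id2: "AE z in lborel \<Otimes>\<^sub>M lborel. ?C z = ?H z * ?p z"
    using re
  proof eventually_elim
    fix z :: "complex \<times> complex" assume z: "Re (fst z) \<noteq> 0 \<and> Re (snd z) \<noteq> 0"
    then have nz: "Re (fst z) * Re (snd z) \<noteq> 0" by simp
    let ?a = "norm (fold_half (fst z) + 1)" and ?b = "norm (fold_half (snd z) + 1)"
      and ?c = "norm (fold_half (fst z) + cnj (fold_half (snd z)))"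
    have pos: "0 < ?a" "0 < ?b" "0 < ?c" using cayley_facts(1) fold_kernel(2)[OF nz] by auto
    have "norm (1 - cayley (fst z) * cnj (cayley (snd z))) = 2 * ?c / (?a * ?b)"
      unfolding cayley_facts(5) norm_divide norm_mult complex_mod_cnj by simp
    then have "?p z = ln 2 + ln ?c - (ln ?a + ln ?b)"
      using pos by (simp add: ln_div ln_mult_pos)
    moreover have "?C z = ?H z * (ln 2 + ln ?c - (ln ?a + ln ?b))" by (simp add: algebra_simps)
    ultimately show "?C z = ?H z * ?p z" by (simp only:)
  qed
  have pint: "integrable (lborel \<Otimes>\<^sub>M lborel) (\<lambda>z. ?H z * ?p z)"
    by (rule integrable_cong_AE_imp[OF i4]) (measurable, use id2 in \<open>auto elim: eventually_mono\<close>)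
  have "(\<integral>z. ?H z * ?p z \<partial>(lborel \<Otimes>\<^sub>M lborel)) \<le> 0"
  proof (rule lborel.log_kernel_nonneg[OF hi])
    show "AE z in lborel \<Otimes>\<^sub>M lborel. cayley (fst z) * cnj (cayley (snd z)) \<noteq> 1"
      using re
    proof eventually_elim
      fix z :: "complex \<times> complex" assume z: "Re (fst z) \<noteq> 0 \<and> Re (snd z) \<noteq> 0"
      then have nz: "Re (fst z) * Re (snd z) \<noteq> 0" by simp
      have "1 - cayley (fst z) * cnj (cayley (snd z)) \<noteq> 0"
        unfolding cayley_facts(5) using cayley_facts(1) fold_kernel(2)[OF nz]
        by (simp only: divide_eq_0_iff mult_eq_0_iff complex_cnj_zero_iff) simp
      then show "cayley (fst z) * cnj (cayley (snd z)) \<noteq> 1" by auto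
    qed
  qed (use pint cayley_facts(2) in auto)
  moreover have "(\<integral>z. ?H z * ?p z \<partial>(lborel \<Otimes>\<^sub>M lborel)) = (\<integral>z. ?C z \<partial>(lborel \<Otimes>\<^sub>M lborel))"
    by (rule integral_cong_AE) (measurable, use id2 in \<open>auto elim: eventually_mono\<close>)
  moreover have "(\<integral>z. ?C z \<partial>(lborel \<Otimes>\<^sub>M lborel)) = (\<integral>z. ?H z * ?m z \<partial>(lborel \<Otimes>\<^sub>M lborel))"
    unfolding Bochner_Integration.integral_add[OF i2 i3] Bochner_Integration.integral_diff[OF i1 i(3)]
      Bochner_Integration.integral_diff[OF mint i(1)] using i h0 by simp
  ultimately have key: "?B h h \<le> ?B ?o ?o" using mval by linarith
  have neg: "?B ?e (\<lambda>x. - h x) = - ?B ?e h" "?B (\<lambda>x. - h x) ?e = - ?B h ?e" "?B (\<lambda>x. - h x) (\<lambda>x. - h x) = ?B h h"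
    by (simp_all add: lborel_mirror.B_def)
  have s1: "symm 1 f = (\<lambda>x. ?e x + h x)" and s2: "symm (-1) f = (\<lambda>x. ?e x + - h x)"
    by (auto simp: symm_def h_def)
  have "?B (symm 1 f) (symm 1 f) + ?B (symm (-1) f) (symm (-1) f) = 2 * ?B ?e ?e + 2 * ?B h h"
    unfolding s1 s2
    by (subst (1 2) lborel_mirror.B_expand[OF ctx]) (use hb in \<open>auto simp: neg\<close>)
  also have "\<dots> \<le> 2 * ?B f f"
    using key lborel_mirror.B_decomp[OF ctx] by simp
  finally show ?thesis unfolding BE .
qed

section \<open>Reduction to the diagonal inequality\<close>

text \<open>Intermediate value theorem for the signed mass as a function of the level. It is
  continuous by dominated convergence, since level sets are null, and tends to minus and plus the
  total mass at the two ends.\<close>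

lemma bisection:
  fixes f r :: "'a \<Rightarrow> real"
  assumes f: "integrable M f" and [measurable]: "r \<in> borel_measurable M"
    and level: "\<And>c. AE x in M. r x \<noteq> c" and pos: "(\<integral>x. f x \<partial>M) > 0"
  shows "\<exists>c. (\<integral>x. sgn (r x - c) * f x \<partial>M) = 0"
proof -
  define \<Phi> where "\<Phi> c = (\<integral>x. sgn (r x - c) * f x \<partial>M)" for c
  have [measurable]: "f \<in> borel_measurable M" using f by auto
  have bd: "AE x in M. norm (sgn (r x - c) * f x) \<le> \<bar>f x\<bar>" for c
    by (rule AE_I2) (simp add: abs_mult sgn_if)
  have lim: "(\<lambda>n. \<Phi> (s n)) \<longlonglongrightarrow> (\<integral>x. g x * f x \<partial>M)"
    if [measurable]: "g \<in> borel_measurable M" and s: "AE x in M. (\<lambda>n. sgn (r x - s n)) \<longlonglongrightarrow> g x" for s :: "nat \<Rightarrow> real" and g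
    unfolding \<Phi>_def
  proof (rule integral_dominated_convergence[where w="\<lambda>x. \<bar>f x\<bar>"])
    show "AE x in M. (\<lambda>n. sgn (r x - s n) * f x) \<longlonglongrightarrow> g x * f x"
      using s by eventually_elim (intro tendsto_intros)
  qed (use f bd in auto)
  have cont: "isCont \<Phi> c" for c
  proof (rule continuous_at_sequentiallyI)
    fix u :: "nat \<Rightarrow> real" assume u: "u \<longlonglongrightarrow> c"
    have "AE x in M. (\<lambda>n. sgn (r x - u n)) \<longlonglongrightarrow> sgn (r x - c)"
      using level[of c] by eventually_elim (intro tendsto_sgn tendsto_intros u, simp)
    then show "(\<lambda>n. \<Phi> (u n)) \<longlonglongrightarrow> \<Phi> c"
      unfolding \<Phi>_def[of c] by (intro lim) auto
  qed
  have "(\<lambda>n. \<Phi> (real n)) \<longlonglongrightarrow> (\<integral>x. (-1) * f x \<partial>M)"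
  proof (rule lim, simp, rule AE_I2)
    fix x
    have "\<forall>\<^sub>F n in sequentially. sgn (r x - real n) = -1"
    proof -
      obtain k where "r x < real k" using reals_Archimedean2 by blast
      then show ?thesis by (intro eventually_sequentiallyI[of k]) (simp add: sgn_if)
    qed
    then show "(\<lambda>n. sgn (r x - real n)) \<longlonglongrightarrow> -1" by (rule tendsto_eventually)
  qed
  moreover have "(\<integral>x. (-1) * f x \<partial>M) < 0" using pos by simp
  ultimately have "\<forall>\<^sub>F n in sequentially. \<Phi> (real n) < 0" by (rule order_tendstoD)
  then obtain n where n: "\<Phi> (real n) < 0" by (auto simp: eventually_sequentially)
  have "(\<lambda>n. \<Phi> (- real n)) \<longlonglongrightarrow> (\<integral>x. 1 * f x \<partial>M)"
  proof (rule lim, simp, rule AE_I2)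
    fix x
    have "\<forall>\<^sub>F n in sequentially. sgn (r x - - real n) = 1"
    proof -
      obtain k where "- r x < real k" using reals_Archimedean2 by blast
      then show ?thesis by (intro eventually_sequentiallyI[of k]) (simp add: sgn_if)
    qed
    then show "(\<lambda>n. sgn (r x - - real n)) \<longlonglongrightarrow> 1" by (rule tendsto_eventually)
  qed
  moreover have "(\<integral>x. 1 * f x \<partial>M) > 0" using pos by simp
  ultimately have "\<forall>\<^sub>F n in sequentially. \<Phi> (- real n) > 0" by (rule order_tendstoD)
  then obtain m where m: "\<Phi> (- real m) > 0" by (auto simp: eventually_sequentially)
  have "\<exists>c\<ge>- real m. c \<le> real n \<and> \<Phi> c = 0"
    by (rule IVT2) (use n m cont in auto)
  then show ?thesis by (auto simp: \<Phi>_def)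
qed

section \<open>The optimizers and functions of finite entropy\<close>

definition opt :: "'a::euclidean_space \<Rightarrow> real \<Rightarrow> real \<Rightarrow> 'a \<Rightarrow> real" where
  "opt a b C x = C * b ^ DIM('a) / (b\<^sup>2 + (norm (x - a))\<^sup>2) ^ DIM('a)"

lemma one_plus_pos:
  fixes x :: "'a::real_normed_vector"
  shows "0 < 1 + norm x" "0 < 1 + (norm x)\<^sup>2"
  by (auto intro: add_pos_nonneg)

lemma power_weight_bound:
  fixes x :: "'a::euclidean_space"
  shows "(1 + (norm x)\<^sup>2) powr (1/4 - real DIM('a)) \<le> 2 powr (real DIM('a)) * (1 + norm x) powr (1/2 - 2 * real DIM('a))"
proof -
  let ?N = "real DIM('a)"
  have N: "?N \<ge> 1" by (simp add: DIM_positive Suc_leI)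
  have b: "1/4 - ?N \<le> 0" using N by linarith
  have p: "0 < (1 + norm x)\<^sup>2 / 2" by (intro divide_pos_pos zero_less_power add_pos_nonneg) auto
  have "(1 + norm x)\<^sup>2 \<le> 2 * (1 + (norm x)\<^sup>2)"
    using zero_le_power2[of "norm x - 1"] by (simp add: power2_eq_square algebra_simps)
  then have "(1 + (norm x)\<^sup>2) powr (1/4 - ?N) \<le> ((1 + norm x)\<^sup>2 / 2) powr (1/4 - ?N)"
    using b p by (intro powr_mono2') auto
  also have "\<dots> = (1 + norm x) powr (1/2 - 2 * ?N) * 2 powr (?N - 1/4)"
  proof -
    have s: "(1 + norm x)\<^sup>2 = (1 + norm x) powr 2"
      by (subst powr_numeral) (auto intro: add_nonneg_nonneg)
    have "((1 + norm x)\<^sup>2 / 2) powr (1/4 - ?N) = (1 + norm x) powr (2 * (1/4 - ?N)) / 2 powr (1/4 - ?N)"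
      unfolding s powr_divide powr_powr ..
    also have "\<dots> = (1 + norm x) powr (1/2 - 2 * ?N) * 2 powr (- (1/4 - ?N))"
      by (simp only: powr_minus_divide) (simp add: right_diff_distrib)
    finally show ?thesis by simp
  qed
  also have "\<dots> \<le> (1 + norm x) powr (1/2 - 2 * ?N) * 2 powr ?N"
    by (intro mult_left_mono powr_mono) auto
  finally show ?thesis by (simp add: mult.commute)
qed

text \<open>The optimizers decay like \<open>(1 + |x|^2)^(-N)\<close>. The spare exponent
  \<open>1/4\<close> pays for a logarithm, because
  \<open>ln t / 4 \<le> t powr (1/4)\<close>.\<close>

lemma weight_integrable:
  "integrable lborel (\<lambda>x::'a::euclidean_space. (1 + (norm x)\<^sup>2) powr (1/4 - real DIM('a)))"
proof (rule integrableI_bounded)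
  let ?N = "real DIM('a)"
  have "(\<integral>\<^sup>+x. ennreal (norm ((1 + (norm x)\<^sup>2) powr (1/4 - ?N))) \<partial>(lborel :: 'a measure))
    \<le> (\<integral>\<^sup>+x. ennreal (2 powr ?N) * ennreal ((1 + norm x) powr (1/2 - 2 * ?N)) \<partial>(lborel :: 'a measure))"
    by (intro nn_integral_mono) (simp add: ennreal_mult[symmetric] power_weight_bound)
  also have "\<dots> < \<infinity>"
    using nn_integral_tail[where 'a='a] by (simp add: nn_integral_cmult ennreal_mult_less_top)
  finally show "(\<integral>\<^sup>+x. ennreal (norm ((1 + (norm x)\<^sup>2) powr (1/4 - ?N))) \<partial>(lborel :: 'a measure)) < \<infinity>" .
qed measurable

lemma ln_one_plus_le:
  fixes x :: "'a::real_normed_vector"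
  shows "ln (1 + norm x) \<le> (ln 2 + ln (1 + (norm x)\<^sup>2)) / 2"
proof -
  have "(1 + norm x)\<^sup>2 \<le> 2 * (1 + (norm x)\<^sup>2)"
    using zero_le_power2[of "norm x - 1"] by (simp add: power2_eq_square algebra_simps)
  then have "ln ((1 + norm x)\<^sup>2) \<le> ln (2 * (1 + (norm x)\<^sup>2))"
    using one_plus_pos(1)[of x] by (intro ln_mono) simp_all
  then show ?thesis
    using one_plus_pos[of x] ln_mult_pos[of 2 "1 + (norm x)\<^sup>2"] by (simp add: ln_realpow)
qed

lemma ln_square_le:
  fixes x :: "'a::real_normed_vector"
  shows "ln (1 + (norm x)\<^sup>2) \<le> 2 * ln (1 + norm x)"
proof -
  have "ln (1 + (norm x)\<^sup>2) \<le> ln ((1 + norm x)\<^sup>2)"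
    using one_plus_pos(2)[of x] by (intro ln_mono) (simp_all add: power2_eq_square algebra_simps)
  then show ?thesis using one_plus_pos(1)[of x] by (simp add: ln_realpow)
qed

lemma integrable_ln_square:
  assumes f: "adm f"
  shows "integrable lborel (\<lambda>x. f x * ln (1 + (norm x)\<^sup>2))"
proof (rule Bochner_Integration.integrable_bound)
  note [measurable] = admD(1)[OF f]
  show "integrable lborel (\<lambda>x. 2 * (f x * ln (1 + norm x)))" using admD(5)[OF f] by simp
  show "AE x in lborel. norm (f x * ln (1 + (norm x)\<^sup>2)) \<le> norm (2 * (f x * ln (1 + norm x)))"
  proof (rule AE_I2)
    fix x
    have "f x * ln (1 + (norm x)\<^sup>2) \<le> f x * (2 * ln (1 + norm x))"
      by (intro mult_left_mono ln_square_le admD(2)[OF f])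
    then show "norm (f x * ln (1 + (norm x)\<^sup>2)) \<le> norm (2 * (f x * ln (1 + norm x)))"
      using admD(2)[OF f, of x] by (simp add: abs_mult)
  qed
  show "(\<lambda>x. f x * ln (1 + (norm x)\<^sup>2)) \<in> borel_measurable lborel" by measurable
qed

lemma admI:
  fixes f :: "'a::euclidean_space \<Rightarrow> real"
  assumes [measurable]: "f \<in> borel_measurable borel" and nn: "\<And>x. 0 \<le> f x" and int: "integrable lborel f"
    and ent: "integrable lborel (\<lambda>x. f x * ln (f x))" and l: "integrable lborel (\<lambda>x. f x * ln (1 + (norm x)\<^sup>2))"
  shows "adm f"
proof -
  have "integrable lborel (\<lambda>x. f x * ln (1 + norm x))"
  proof (rule Bochner_Integration.integrable_bound)
    show "integrable lborel (\<lambda>x. ln 2 / 2 * f x + (f x * ln (1 + (norm x)\<^sup>2)) / 2)" using int l by auto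
    show "AE x in lborel. norm (f x * ln (1 + norm x)) \<le> norm (ln 2 / 2 * f x + (f x * ln (1 + (norm x)\<^sup>2)) / 2)"
    proof (rule AE_I2)
      fix x
      have "f x * ln (1 + norm x) \<le> f x * ((ln 2 + ln (1 + (norm x)\<^sup>2)) / 2)"
        by (intro mult_left_mono ln_one_plus_le nn)
      then show "norm (f x * ln (1 + norm x)) \<le> norm (ln 2 / 2 * f x + (f x * ln (1 + (norm x)\<^sup>2)) / 2)"
        using nn[of x] by (simp add: abs_mult algebra_simps add_divide_distrib)
    qed
  qed measurable
  then show ?thesis using assms by (auto simp: adm_def)
qed

text \<open>Young's inequality for \<open>f w\<close> against a quarter of
  \<open>ln (1 + |x|^2)\<close> bounds the logarithmic moment by the given positive part plus the
  integrable \<open>v\<close>. The entropy of \<open>f\<close> is then that of \<open>f\<close>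
  relative to \<open>1 / w\<close>, corrected by this moment and the mass.\<close>

lemma finite_entropy_adm:
  fixes f :: "'a::euclidean_space \<Rightarrow> real"
  assumes fm [measurable]: "f \<in> borel_measurable borel" and nn: "\<And>x. 0 \<le> f x" and int: "integrable lborel f"
    and fe: "(\<integral>\<^sup>+x. ennreal (f x * max (ln (f x * ((1 + (norm x)\<^sup>2) / 2) ^ DIM('a))) 0) \<partial>lborel) < \<infinity>"
  shows "adm f"
proof -
  let ?N = "real DIM('a)"
  have N: "?N \<ge> 1" by (simp add: DIM_positive Suc_leI)
  define w where "w x = ((1 + (norm x)\<^sup>2) / 2) ^ DIM('a)" for x :: 'a
  have [measurable]: "w \<in> borel_measurable borel" unfolding w_def by measurable
  have wpos: "0 < w x" for x using one_plus_pos(2)[of x] by (simp add: w_def)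
  define lp where "lp x = f x * max (ln (f x * w x)) 0" for x
  have [measurable]: "lp \<in> borel_measurable borel" unfolding lp_def by measurable
  have lpi: "integrable lborel lp"
  proof (rule integrableI_bounded)
    show "(\<integral>\<^sup>+x. ennreal (norm (lp x)) \<partial>lborel) < \<infinity>" using fe nn by (simp add: lp_def w_def)
  qed simp
  \<comment> \<open>Equal to \<open>(1 + |x|^2)^(1/4) / w\<close> by \<open>wv\<close>; integrable,
    and still above \<open>1 / w\<close>.\<close>
  define v where "v x = 2 powr ?N * (1 + (norm x)\<^sup>2) powr (1/4 - ?N)" for x :: 'a
  have vi: "integrable lborel v" unfolding v_def by (intro integrable_mult_right weight_integrable)
  have [measurable]: "v \<in> borel_measurable borel" unfolding v_def by measurable
  have lnw: "ln (w x) = ?N * (ln (1 + (norm x)\<^sup>2) - ln 2)" for x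
    using one_plus_pos(2)[of x] by (simp add: w_def ln_realpow ln_div)
  have wv: "(1 + (norm x)\<^sup>2) powr (1/4) / w x = v x" for x
    using one_plus_pos(2)[of x] by (simp add: v_def w_def powr_diff powr_realpow power_divide)
  have vw: "1 / w x \<le> v x" for x
  proof -
    have "1 \<le> (1 + (norm x)\<^sup>2) powr (1/4)" by (intro ge_one_powr_ge_zero) auto
    then show ?thesis unfolding wv[symmetric] using wpos[of x] by (intro divide_right_mono) auto
  qed
  have l: "integrable lborel (\<lambda>x. f x * ln (1 + (norm x)\<^sup>2))"
  proof (rule Bochner_Integration.integrable_bound)
    show "integrable lborel (\<lambda>x. 4 * (lp x + v x))" using lpi vi by auto
    show "AE x in lborel. norm (f x * ln (1 + (norm x)\<^sup>2)) \<le> norm (4 * (lp x + v x))"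
    proof (rule AE_I2)
      fix x
      have G: "0 \<le> f x * w x" using nn wpos by (simp add: less_imp_le)
      have "(f x * w x) * (ln (1 + (norm x)\<^sup>2) / 4) \<le> (f x * w x) * ln (f x * w x) - f x * w x + exp (ln (1 + (norm x)\<^sup>2) / 4)"
        by (rule young_exp[OF G])
      also have "\<dots> \<le> (f x * w x) * max (ln (f x * w x)) 0 + (1 + (norm x)\<^sup>2) powr (1/4)"
      proof -
        have "(f x * w x) * ln (f x * w x) \<le> (f x * w x) * max (ln (f x * w x)) 0" using G by (intro mult_left_mono) auto
        then show ?thesis using G one_plus_pos(2)[of x] by (simp add: powr_def)
      qed
      finally have "(f x * w x) * (ln (1 + (norm x)\<^sup>2) / 4) \<le> (f x * w x) * max (ln (f x * w x)) 0 + (1 + (norm x)\<^sup>2) powr (1/4)" .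
      moreover have "(1 + (norm x)\<^sup>2) powr (1/4) = w x * v x" using wpos[of x] unfolding wv[symmetric] by simp
      moreover have "w x * (4 * (lp x + v x)) = 4 * ((f x * w x) * max (ln (f x * w x)) 0) + 4 * (w x * v x)"
        by (simp add: lp_def algebra_simps)
      moreover have "w x * (f x * ln (1 + (norm x)\<^sup>2)) = 4 * ((f x * w x) * (ln (1 + (norm x)\<^sup>2) / 4))" by simp
      ultimately have "w x * (f x * ln (1 + (norm x)\<^sup>2)) \<le> w x * (4 * (lp x + v x))" by linarith
      then have "f x * ln (1 + (norm x)\<^sup>2) \<le> 4 * (lp x + v x)" using wpos[of x] by simp
      then show "norm (f x * ln (1 + (norm x)\<^sup>2)) \<le> norm (4 * (lp x + v x))"
        using nn[of x] by (simp add: abs_mult)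
    qed
  qed measurable
  have e0: "f x * ln (f x) = f x * ln (f x * w x) - ?N * (f x * ln (1 + (norm x)\<^sup>2)) + (?N * ln 2) * f x" for x
  proof (cases "f x = 0")
    case False
    then have "f x > 0" using nn[of x] by simp
    then have "ln (f x * w x) = ln (f x) + ?N * (ln (1 + (norm x)\<^sup>2) - ln 2)"
      using wpos[of x] unfolding lnw[symmetric] by (intro ln_mult_pos)
    then show ?thesis by (simp only:) (simp add: algebra_simps)
  qed simp
  have G: "integrable lborel (\<lambda>x. f x * ln (f x * w x))"
  proof (rule Bochner_Integration.integrable_bound)
    show "integrable lborel (\<lambda>x. lp x + v x)" using lpi vi by auto
    show "AE x in lborel. norm (f x * ln (f x * w x)) \<le> norm (lp x + v x)"
    proof (rule AE_I2)
      fix x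
      have v0: "0 \<le> v x" by (simp add: v_def)
      show "norm (f x * ln (f x * w x)) \<le> norm (lp x + v x)"
      proof (cases "0 \<le> ln (f x * w x)")
        case True
        then show ?thesis using nn[of x] v0 by (simp add: lp_def)
      next
        case False
        \<comment> \<open>Young's inequality at \<open>s = 0\<close> says
          \<open>t ln t \<ge> t - 1\<close>, so the negative part of \<open>f ln (f w)\<close> is at
          most \<open>1 / w\<close>.\<close>
        have "(f x * w x) * 0 \<le> (f x * w x) * ln (f x * w x) - f x * w x + exp 0"
          using nn wpos by (intro young_exp) (simp add: less_imp_le)
        then have "- (f x * ln (f x * w x)) * w x \<le> 1"
          using mult_nonneg_nonneg[OF nn[of x] less_imp_le[OF wpos[of x]]] by (simp add: algebra_simps)
        then have "- (f x * ln (f x * w x)) \<le> 1 / w x" using wpos[of x] by (simp add: pos_le_divide_eq)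
        also have "\<dots> \<le> v x" by (rule vw)
        finally have "- (f x * ln (f x * w x)) \<le> v x" .
        moreover have "f x * ln (f x * w x) \<le> 0" using False nn[of x] by (intro mult_nonneg_nonpos) auto
        moreover have "lp x = 0" using False by (simp add: lp_def)
        ultimately show ?thesis by simp
      qed
    qed
  qed measurable
  have "integrable lborel (\<lambda>x. f x * ln (f x))"
    unfolding e0 by (intro Bochner_Integration.integrable_add Bochner_Integration.integrable_diff integrable_mult_right G l int)
  then show ?thesis using int l nn by (intro admI) auto
qed


lemma opt_standard: "opt 0 1 C x = C / (1 + (norm x)\<^sup>2) ^ DIM('a)" for x :: "'a::euclidean_space"
  by (simp add: opt_def)

lemma ln_opt_standard:
  fixes x :: "'a::euclidean_space"
  assumes "C > 0"
  shows "ln (opt 0 1 C x) = ln C - real DIM('a) * ln (1 + (norm x)\<^sup>2)"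
  using assms one_plus_pos(2)[of x] by (simp add: opt_standard ln_div ln_realpow)

lemma adm_opt_standard:
  fixes C :: real
  assumes C: "C > 0"
  shows "adm (opt (0 :: 'a::euclidean_space) 1 C)"
proof -
  let ?N = "real DIM('a)"
  let ?f = "opt (0 :: 'a) 1 C"
  let ?v = "\<lambda>x::'a. (1 + (norm x)\<^sup>2) powr (1/4 - ?N)"
  have [measurable]: "?f \<in> borel_measurable borel" unfolding opt_def by measurable
  have pos: "0 < ?f x" for x using C one_plus_pos(2)[of x] by (simp add: opt_standard)
  have fv: "?f x * (1 + (norm x)\<^sup>2) powr (1/4) = C * ?v x" for x
    using one_plus_pos(2)[of x] by (simp add: opt_standard powr_diff powr_realpow)
  have one: "1 \<le> (1 + (norm x)\<^sup>2) powr (1/4)" for x :: 'a by (intro ge_one_powr_ge_zero) auto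
  have vi: "integrable lborel (\<lambda>x. C * ?v x)" by (intro integrable_mult_right weight_integrable)
  have fi: "integrable lborel ?f"
  proof (rule Bochner_Integration.integrable_bound[OF vi])
    show "AE x in lborel. norm (?f x) \<le> norm (C * ?v x)"
    proof (rule AE_I2)
      fix x
      have "?f x * 1 \<le> ?f x * (1 + (norm x)\<^sup>2) powr (1/4)" using pos[of x] one[of x] by (intro mult_left_mono) auto
      then show "norm (?f x) \<le> norm (C * ?v x)" using pos[of x] unfolding fv by simp
    qed
  qed simp
  have li: "integrable lborel (\<lambda>x. ?f x * ln (1 + (norm x)\<^sup>2))"
  proof (rule Bochner_Integration.integrable_bound)
    show "integrable lborel (\<lambda>x. 4 * (C * ?v x))" using vi by simp
    show "AE x in lborel. norm (?f x * ln (1 + (norm x)\<^sup>2)) \<le> norm (4 * (C * ?v x))"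
    proof (rule AE_I2)
      fix x :: 'a
      have "ln (1 + (norm x)\<^sup>2) / 4 = ln ((1 + (norm x)\<^sup>2) powr (1/4))"
        using one_plus_pos(2)[of x] by (simp add: ln_powr)
      also have "\<dots> \<le> (1 + (norm x)\<^sup>2) powr (1/4)"
        by (rule order_trans[OF ln_le_minus_one]) (use one[of x] in linarith, simp)
      finally have "?f x * ln (1 + (norm x)\<^sup>2) \<le> ?f x * (4 * (1 + (norm x)\<^sup>2) powr (1/4))"
        using pos[of x] by (intro mult_left_mono) auto
      also have "\<dots> = 4 * (C * ?v x)" using fv[of x] by simp
      finally show "norm (?f x * ln (1 + (norm x)\<^sup>2)) \<le> norm (4 * (C * ?v x))"
        using pos[of x] C by (simp add: abs_mult)
    qed
  qed measurable
  have "?f x * ln (?f x) = ln C * ?f x - ?N * (?f x * ln (1 + (norm x)\<^sup>2))" for x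
    unfolding ln_opt_standard[OF C] by (simp add: algebra_simps)
  then have "integrable lborel (\<lambda>x. ?f x * ln (?f x))"
    using fi li by simp
  then show ?thesis using fi li pos by (intro admI) (auto intro: less_imp_le)
qed

lemma opt_rescale:
  fixes a :: "'a::euclidean_space"
  assumes b: "b > 0"
  shows "opt a b C = rescale (1 / b) (- ((1 / b) *\<^sub>R a)) (opt 0 1 C)"
proof
  fix x
  have "- ((1 / b) *\<^sub>R a) + (1 / b) *\<^sub>R x = (1 / b) *\<^sub>R (x - a)" by (simp add: scaleR_diff_right)
  then have "(norm (- ((1 / b) *\<^sub>R a) + (1 / b) *\<^sub>R x))\<^sup>2 = (norm (x - a))\<^sup>2 / b\<^sup>2"
    using b by (simp add: power_divide)
  then have "rescale (1 / b) (- ((1 / b) *\<^sub>R a)) (opt 0 1 C) x = (1 / b) ^ DIM('a) * (C / (1 + (norm (x - a))\<^sup>2 / b\<^sup>2) ^ DIM('a))"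
    by (simp only: rescale_def opt_standard)
  also have "1 + (norm (x - a))\<^sup>2 / b\<^sup>2 = (b\<^sup>2 + (norm (x - a))\<^sup>2) / b\<^sup>2" using b by (simp add: field_simps)
  also have "(1 / b) ^ DIM('a) * (C / ((b\<^sup>2 + (norm (x - a))\<^sup>2) / b\<^sup>2) ^ DIM('a)) = opt a b C x"
    using b by (simp add: opt_def power_divide power_mult[symmetric] mult_2 power_add power2_eq_square power_mult_distrib)
  finally show "opt a b C x = rescale (1 / b) (- ((1 / b) *\<^sub>R a)) (opt 0 1 C) x" ..
qed

text \<open>Every optimizer is an affine image of the one with \<open>a = 0\<close> and
  \<open>b = 1\<close>, and \<open>logJ\<close> is invariant. Mass, logarithmic moment
  \<open>\<kappa>\<close> and potential of that single function therefore provide all hypotheses of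
  \<open>logHLS_from_diagonal\<close>. The bound is its value: the potential gives
  \<open>logE = \<kappa> / 2\<close>, and the entropy is \<open>ln C - N \<kappa>\<close>.\<close>

lemma logHLS_from_standard:
  fixes f g :: "'a::euclidean_space \<Rightarrow> real"
  defines "N \<equiv> real DIM('a)"
  assumes C: "C > 0" and mass: "(\<integral>x. opt (0::'a) 1 C x \<partial>lborel) = 1"
    and \<kappa>: "(\<integral>x. opt (0::'a) 1 C x * ln (1 + (norm x)\<^sup>2) \<partial>lborel) = \<kappa>"
    and pot: "\<And>g. adm g \<Longrightarrow> (\<integral>x. g x \<partial>lborel) = 1 \<Longrightarrow>
        logE (opt (0::'a) 1 C) g = (\<integral>x. g x * ln (1 + (norm x)\<^sup>2) \<partial>lborel) / 2"
    and diag: "\<And>f :: 'a \<Rightarrow> real. adm f \<Longrightarrow> (\<integral>x. f x \<partial>lborel) = 1 \<Longrightarrow> logJ f f \<le> \<kappa> / 2 - ln C / N"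
    and diag_eq: "\<And>f :: 'a \<Rightarrow> real. adm f \<Longrightarrow> (\<integral>x. f x \<partial>lborel) = 1 \<Longrightarrow> logJ f f = \<kappa> / 2 - ln C / N \<Longrightarrow>
        \<exists>a b. 0 < b \<and> (AE x in lborel. f x = opt a b C x)"
    and f: "adm f" "(\<integral>x. f x \<partial>lborel) = 1" and g: "adm g" "(\<integral>x. g x \<partial>lborel) = 1"
  shows "logJ f g \<le> \<kappa> / 2 - ln C / N \<and> (logJ f g = \<kappa> / 2 - ln C / N \<longleftrightarrow>
    (\<exists>a b. 0 < b \<and> (AE x in lborel. f x = opt a b C x \<and> g x = opt a b C x)))"
\<comment> \<open>The potential of \<open>opt a b C\<close> integrates to half the integral of
  \<open>g\<close> against \<open>ln (1 + |x - a|^2 / b^2)\<close>, plus \<open>ln b\<close>.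
  Solving \<open>lnopt\<close> for that logarithm leaves the constant \<open>K\<close>.\<close>
proof (rule logHLS_from_diagonal[where \<phi>="\<lambda>a b. opt a b C" and K="\<lambda>a b. ln C / (2 * N) + ln b / 2"])
  have N: "N > 0" by (simp add: N_def)
  note adm0 = adm_opt_standard[OF C, where 'a='a]
  fix a :: 'a and b :: real assume b: "0 < b"
  then have ib: "1 / b > 0" by simp
  show "adm (opt a b C)" unfolding opt_rescale[OF b] by (rule adm_rescale(1)[OF ib adm0])
  show "(\<integral>x. opt a b C x \<partial>lborel) = 1" unfolding opt_rescale[OF b] using adm_rescale(2)[OF ib adm0] mass by simp
  have pos: "0 < b\<^sup>2 + (norm y)\<^sup>2" for y :: 'a using b by (auto intro: add_pos_nonneg)
  show "0 < opt a b C x" for x using C b pos[of "x - a"] by (simp add: opt_def)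
  have lnopt: "ln (opt a b C x) = ln C - N * ln b - N * ln (1 + (norm (x - a))\<^sup>2 / b\<^sup>2)" for x
  proof -
    have "1 + (norm (x - a))\<^sup>2 / b\<^sup>2 = (b\<^sup>2 + (norm (x - a))\<^sup>2) / b\<^sup>2"
      using b by (simp add: power_divide field_simps)
    then have e1: "ln (1 + (norm (x - a))\<^sup>2 / b\<^sup>2) = ln (b\<^sup>2 + (norm (x - a))\<^sup>2) - 2 * ln b"
      using pos[of "x - a"] b by (simp add: ln_div ln_realpow)
    have e2: "ln (opt a b C x) = ln C + N * ln b - N * ln (b\<^sup>2 + (norm (x - a))\<^sup>2)"
      using C b pos[of "x - a"] by (simp add: opt_def ln_div ln_mult_pos ln_realpow N_def)
    show ?thesis unfolding e1 e2 by (simp add: algebra_simps)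
  qed
  show "logJ (opt a b C) (opt a b C) = \<kappa> / 2 - ln C / N"
  proof -
    have e: "opt 0 1 C x * ln (opt 0 1 C x) = ln C * opt 0 1 C x - N * (opt 0 1 C x * ln (1 + (norm x)\<^sup>2))" for x :: 'a
      unfolding ln_opt_standard[OF C] by (simp add: algebra_simps N_def)
    have "entS (opt (0::'a) 1 C) = ln C - N * \<kappa>"
      unfolding entS_def e using admD(3)[OF adm0] integrable_ln_square[OF adm0] mass \<kappa> by simp
    then have "logJ (opt (0::'a) 1 C) (opt 0 1 C) = \<kappa> / 2 - ln C / N"
      using pot[OF adm0 mass] \<kappa> N by (simp add: logJ_def N_def[symmetric] diff_divide_distrib)
    then show ?thesis
      unfolding opt_rescale[OF b] using logJ_rescale[OF ib adm0 mass] by simp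
  qed
  fix g :: "'a \<Rightarrow> real" assume g: "adm g" "(\<integral>x. g x \<partial>lborel) = 1"
  note [measurable] = admD(1)[OF g(1)]
  let ?g = "rescale b a g" and ?w = "\<lambda>u::'a. ln (1 + (norm (u - a))\<^sup>2 / b\<^sup>2)"
  note gr = adm_rescale[OF b g(1), of a]
  have wr: "?w (a + b *\<^sub>R x) = ln (1 + (norm x)\<^sup>2)" for x using b by (simp add: power_mult_distrib)
  have "g = rescale (1 / b) (- ((1 / b) *\<^sub>R a)) ?g"
  proof
    fix x
    have "a + b *\<^sub>R (- ((1 / b) *\<^sub>R a) + (1 / b) *\<^sub>R x) = x" using b by (simp only: scaleR_add_right) simp
    then show "g x = rescale (1 / b) (- ((1 / b) *\<^sub>R a)) ?g x"
      using b by (simp only: rescale_def) (simp add: power_divide)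
  qed
  then have "logE (opt a b C) g = logE (rescale (1 / b) (- ((1 / b) *\<^sub>R a)) (opt 0 1 C)) (rescale (1 / b) (- ((1 / b) *\<^sub>R a)) ?g)"
    unfolding opt_rescale[OF b] by simp
  also have "\<dots> = (\<integral>x. ?g x * ln (1 + (norm x)\<^sup>2) \<partial>lborel) / 2 + ln b"
    using logE_rescale[OF ib adm0 gr(1)] pot[OF gr(1)] gr(2) g(2) mass b by (simp add: ln_div)
  also have "(\<integral>x. ?g x * ln (1 + (norm x)\<^sup>2) \<partial>lborel) = (\<integral>x. g x * ?w x \<partial>lborel)"
    using integral_rescale(1)[OF b _ _, of g ?w a] unfolding wr by simp
  finally have E: "logE (opt a b C) g = (\<integral>x. g x * ?w x \<partial>lborel) / 2 + ln b" .
  have wi: "integrable lborel (\<lambda>x. g x * ?w x)"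
    using integral_rescale(2)[OF b _ _, of g ?w a] integrable_ln_square[OF gr(1)] unfolding wr by simp
  have gl: "g x * ln (opt a b C x) = (ln C - N * ln b) * g x - N * (g x * ?w x)" for x
    unfolding lnopt by (simp add: algebra_simps)
  show "integrable lborel (\<lambda>x. g x * ln (opt a b C x)) \<and>
      logE (opt a b C) g = ln C / (2 * N) + ln b / 2 - (\<integral>x. g x * ln (opt a b C x) \<partial>lborel) / (2 * real DIM('a))"
  proof
    show "integrable lborel (\<lambda>x. g x * ln (opt a b C x))"
      unfolding gl using admD(3)[OF g(1)] wi by simp
    have "(\<integral>x. g x * ln (opt a b C x) \<partial>lborel) = (ln C - N * ln b) - N * (\<integral>x. g x * ?w x \<partial>lborel)"
      unfolding gl using admD(3)[OF g(1)] wi g(2) by simp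
    then show "logE (opt a b C) g = ln C / (2 * N) + ln b / 2 - (\<integral>x. g x * ln (opt a b C x) \<partial>lborel) / (2 * real DIM('a))"
      unfolding E N_def[symmetric] using N by (simp add: diff_divide_distrib)
  qed
qed (use diag diag_eq f g in auto)

section \<open>The inequality on the circle\<close>

interpretation circ_pair: pair_sigma_finite circ circ ..

definition circ_dens :: "(complex \<Rightarrow> real) \<Rightarrow> bool" where
  "circ_dens F \<longleftrightarrow> F \<in> borel_measurable borel \<and> (\<forall>z. 0 \<le> F z) \<and> integrable circ F \<and> integrable circ (\<lambda>z. F z * ln (F z))"

lemma circ_densD:
  assumes "circ_dens F"
  shows "F \<in> borel_measurable borel" "0 \<le> F z" "integrable circ F" "integrable circ (\<lambda>z. F z * ln (F z))"
  using assms by (auto simp: circ_dens_def)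

definition circ_ent :: "(complex \<Rightarrow> real) \<Rightarrow> real" where
  "circ_ent F = (\<integral>z. F z * ln (F z) \<partial>circ)"

definition fcoef :: "(complex \<Rightarrow> real) \<Rightarrow> nat \<Rightarrow> complex" where
  "fcoef F m = (\<integral>z. of_real (F z) * z ^ m \<partial>circ)"

lemma norm_circ_kernel:
  assumes "norm z = 1" "norm w = 1"
  shows "norm (1 - z * cnj w) = norm (z - w)"
proof -
  have "w * cnj w = 1" using assms by (simp add: complex_mult_cnj cmod_power2[symmetric])
  then have "z - w = - w * (1 - z * cnj w)" by (simp add: algebra_simps)
  then have "norm (z - w) = norm w * norm (1 - z * cnj w)" by (metis norm_minus_cancel norm_mult)
  then show ?thesis using assms by simp
qed

lemma AE_circ_pair_norm: "AE z in circ \<Otimes>\<^sub>M circ. norm (fst z) = 1 \<and> norm (snd z) = 1"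
  by (rule AE_pair_both[OF circ.sigma_finite_measure_axioms AE_circ_norm])

text \<open>Only the indices \<open>m = d k\<close> contribute. Their weight is
  \<open>1 / (d k)\<close>, while \<open>lebedev_milin\<close> has \<open>1 / k\<close>; this is the
  gain of a factor \<open>d\<close>.\<close>

lemma lebedev_milin_sparse:
  assumes F: "circ_dens F" and d: "d \<ge> 1" "\<And>m. \<not> d dvd m \<Longrightarrow> fcoef F m = 0"
  defines "c \<equiv> (\<integral>z. F z \<partial>circ)"
  shows "(\<Sum>m<n. (norm (fcoef F m))\<^sup>2 / real m) \<le> c * (circ_ent F - c * ln c) / real d"
proof -
  let ?t = "\<lambda>m. (norm (fcoef F m))\<^sup>2 / real m"
  have "(\<Sum>m<n. ?t m) = (\<Sum>m\<in>{m\<in>{..<n}. d dvd m \<and> m \<noteq> 0}. ?t m)"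
    by (rule sum.mono_neutral_right) (use d(2) in auto)
  also have "\<dots> \<le> (\<Sum>m\<in>(\<lambda>k. d * k) ` {1..n}. ?t m)"
  proof (rule sum_mono2)
    show "{m \<in> {..<n}. d dvd m \<and> m \<noteq> 0} \<subseteq> (\<lambda>k. d * k) ` {1..n}"
    proof
      fix m assume m: "m \<in> {m \<in> {..<n}. d dvd m \<and> m \<noteq> 0}"
      then obtain k where k: "m = d * k" by (auto elim: dvdE)
      then have "k \<noteq> 0" using m by auto
      have "k \<le> d * k" using d(1) by simp
      moreover have "m < n" using m by simp
      ultimately have "k \<le> n" using k by linarith
      with \<open>k \<noteq> 0\<close> show "m \<in> (\<lambda>k. d * k) ` {1..n}" using m k by (intro image_eqI[of _ _ k]) auto
    qed
  qed auto
  also have "\<dots> = (\<Sum>k=1..n. ?t (d * k))"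
    using d(1) by (subst sum.reindex) (auto simp: inj_on_def)
  also have "\<dots> = (\<Sum>k=1..n. (norm (fcoef F (d * k)))\<^sup>2 / real k) / real d"
    by (simp add: sum_divide_distrib mult.commute)
  also have "\<dots> \<le> c * (circ_ent F - c * ln c) / real d"
    unfolding c_def circ_ent_def fcoef_def
    using lebedev_milin[OF d(1) circ_densD(2)[OF F] circ_densD(3)[OF F] circ_densD(4)[OF F], of n]
    by (intro divide_right_mono) auto
  finally show ?thesis .
qed

text \<open>Damped series are bounded termwise by Lebedev--Milin, since the coefficients of the
  product density are \<open>|fcoef F m|^2\<close>. Integrability of the undamped kernel is not
  given in advance: Fatou's lemma supplies it first, and only then does \<open>abel_limit\<close>
  transfer the bound.\<close>

lemma circ_energy:
  assumes F: "circ_dens F" and mass: "(\<integral>z. F z \<partial>circ) = 1"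
    and d: "d \<ge> 1" "\<And>m. \<not> d dvd m \<Longrightarrow> fcoef F m = 0"
  shows "integrable (circ \<Otimes>\<^sub>M circ) (\<lambda>z. (F (fst z) * F (snd z)) * ln (norm (fst z - snd z)))"
    and "- circ_mirror.B F F \<le> circ_ent F / real d"
proof -
  note fm [measurable] = circ_densD(1)[OF F]
  let ?C = "circ \<Otimes>\<^sub>M circ" and ?H = "\<lambda>z. F (fst z) * F (snd z)" and ?p = "\<lambda>z. fst z * cnj (snd z)"
  have H: "integrable ?C ?H" and H1: "(\<integral>z. ?H z \<partial>?C) = 1"
    using circ_pair.integrable_mult_pair[OF circ_densD(3)[OF F] circ_densD(3)[OF F]] mass by simp_all
  have Hn: "0 \<le> ?H z" for z using circ_densD(2)[OF F] by simp
  have pn: "AE z in ?C. norm (?p z) \<le> 1"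
    using AE_circ_pair_norm by eventually_elim (simp add: norm_mult)
  have pne: "AE z in ?C. ?p z \<noteq> 1"
    using AE_circ_pair_norm circ_mirror.diag_M
  proof eventually_elim
    fix z :: "complex \<times> complex" assume z: "norm (fst z) = 1 \<and> norm (snd z) = 1" "fst z \<noteq> snd z"
    then have "norm (1 - ?p z) \<noteq> 0" by (simp add: norm_circ_kernel)
    then show "?p z \<noteq> 1" by auto
  qed
  have ker: "AE z in ?C. ?H z * ln (norm (1 - ?p z)) = ?H z * ln (norm (fst z - snd z))"
    using AE_circ_pair_norm by eventually_elim (simp add: norm_circ_kernel)
  have mult: "(\<integral>z. of_real (?H z) * ?p z ^ m \<partial>?C) = of_real ((norm (fcoef F m))\<^sup>2)" for m
  proof -
    have i: "integrable circ (\<lambda>x. of_real (F x) * x ^ m)"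
      by (rule abel_series(2)[OF circ_densD(3)[OF F], of "\<lambda>x. x" 0])
        (use AE_circ_norm in \<open>auto elim: eventually_mono\<close>)
    have "(\<integral>z. of_real (?H z) * ?p z ^ m \<partial>?C) = (\<integral>z. (of_real (F (fst z)) * fst z ^ m) * cnj (of_real (F (snd z)) * snd z ^ m) \<partial>?C)"
      by (intro Bochner_Integration.integral_cong) (simp_all add: power_mult_distrib mult_ac)
    also have "\<dots> = fcoef F m * cnj (fcoef F m)"
      using circ_pair.integrable_mult_pair(2)[OF i integrable_cnj[OF i]]
      by (simp only: fcoef_def Bochner_Integration.integral_cnj)
    finally show ?thesis by (simp only: complex_norm_square)
  qed
  have Ld: "(\<Sum>m<n. (norm (fcoef F m))\<^sup>2 / real m) \<le> circ_ent F / real d" for n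
    using lebedev_milin_sparse[OF F d, of n] mass by simp
  define r where "r n = real n / (real n + 1)" for n
  have r: "0 \<le> r n" "r n < 1" for n by (auto simp: r_def field_simps)
  have rlim: "r \<longlonglongrightarrow> 1" unfolding r_def by real_asymp
  have bound: "(\<integral>z. ?H z * (- ln (norm (1 - of_real (r n) * ?p z))) \<partial>?C) \<le> circ_ent F / real d" for n
  proof -
    have "(\<lambda>m. Re (of_real (r n) ^ m / of_nat m * (\<integral>z. of_real (?H z) * ?p z ^ m \<partial>?C))) sums
      (\<integral>z. ?H z * (- ln (norm (1 - of_real (r n) * ?p z))) \<partial>?C)"
      using r by (intro abel_series H pn) auto
    moreover have "Re (of_real (r n) ^ m / of_nat m * (\<integral>z. of_real (?H z) * ?p z ^ m \<partial>?C))
      = r n ^ m * ((norm (fcoef F m))\<^sup>2 / real m)" for m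
    proof -
      have "of_real (r n) ^ m / of_nat m * (\<integral>z. of_real (?H z) * ?p z ^ m \<partial>?C)
        = of_real (r n ^ m * ((norm (fcoef F m))\<^sup>2 / real m))" unfolding mult by simp
      then show ?thesis by (simp only: Re_complex_of_real)
    qed
    ultimately have S: "(\<lambda>m. r n ^ m * ((norm (fcoef F m))\<^sup>2 / real m)) sums
      (\<integral>z. ?H z * (- ln (norm (1 - of_real (r n) * ?p z))) \<partial>?C)" by (simp only:)
    show ?thesis
    proof (rule LIMSEQ_le_const2[OF S[unfolded sums_def]], intro exI[of _ 0] allI impI)
      fix k
      have "(\<Sum>m<k. r n ^ m * ((norm (fcoef F m))\<^sup>2 / real m)) \<le> (\<Sum>m<k. (norm (fcoef F m))\<^sup>2 / real m)"
        using r[of n] by (intro sum_mono mult_left_le_one_le) (auto intro: power_le_one less_imp_le)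
      then show "(\<Sum>m<k. r n ^ m * ((norm (fcoef F m))\<^sup>2 / real m)) \<le> circ_ent F / real d"
        using Ld[of k] by linarith
    qed
  qed
  \<comment> \<open>Adding \<open>ln 2\<close> makes the integrand nonnegative, because
    \<open>|1 - r p| \<le> 2\<close>; Fatou's lemma needs this.\<close>
  let ?q = "\<lambda>n z. ?H z * (ln 2 - ln (norm (1 - of_real (r n) * ?p z)))"
  have q0: "AE z in ?C. 0 \<le> ?q n z" for n
    using pn
  proof eventually_elim
    fix z :: "complex \<times> complex" assume z: "norm (?p z) \<le> 1"
    have le: "norm (1 - of_real (r n) * ?p z) \<le> 2"
      using norm_triangle_ineq4[of 1 "of_real (r n) * ?p z"] mult_le_one[of "r n" "norm (?p z)"] z r[of n]
      by (simp add: norm_mult)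
    have "of_real (r n) * ?p z \<noteq> 1"
    proof
      assume "of_real (r n) * ?p z = 1"
      then have "norm (of_real (r n) * ?p z) = 1" by simp
      then have "r n * norm (?p z) = 1" using r(1)[of n] by (simp only: norm_mult norm_of_real abs_of_nonneg)
      moreover have "r n * norm (?p z) \<le> r n" using z r(1)[of n] by (intro mult_left_le) auto
      ultimately show False using r(2)[of n] by linarith
    qed
    then have "0 < norm (1 - of_real (r n) * ?p z)" by auto
    then have "ln (norm (1 - of_real (r n) * ?p z)) \<le> ln 2" using le by (intro ln_mono)
    then show "0 \<le> ?q n z" using Hn[of z] by simp
  qed
  have qint: "integrable ?C (\<lambda>z. ?H z * (- ln (norm (1 - of_real (r n) * ?p z))))" for n
  proof (rule Bochner_Integration.integrable_bound)
    show "integrable ?C (\<lambda>z. (ln 2 + \<bar>ln (1 - r n)\<bar>) * ?H z)" using H by simp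
    show "AE z in ?C. norm (?H z * (- ln (norm (1 - of_real (r n) * ?p z)))) \<le> norm ((ln 2 + \<bar>ln (1 - r n)\<bar>) * ?H z)"
      using pn
    proof eventually_elim
      fix z :: "complex \<times> complex" assume z: "norm (?p z) \<le> 1"
      have rp: "norm (of_real (r n) * ?p z) \<le> r n"
        using z r[of n] by (simp only: norm_mult[of "of_real (r n)"] norm_of_real abs_of_nonneg mult_left_le)
      have le: "norm (1 - of_real (r n) * ?p z) \<le> 2" "1 - r n \<le> norm (1 - of_real (r n) * ?p z)"
        using norm_triangle_ineq4[of 1 "of_real (r n) * ?p z"] norm_triangle_ineq2[of 1 "of_real (r n) * ?p z"] rp r[of n]
        by simp_all
      have "ln (norm (1 - of_real (r n) * ?p z)) \<le> ln 2" "ln (1 - r n) \<le> ln (norm (1 - of_real (r n) * ?p z))"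
        using le r(2)[of n] by (intro ln_mono; linarith)+
      then have "\<bar>ln (norm (1 - of_real (r n) * ?p z))\<bar> \<le> ln 2 + \<bar>ln (1 - r n)\<bar>"
        using abs_ge_minus_self[of "ln (1 - r n)"] ln_ge_zero[of "2::real"] by (intro abs_leI) linarith+
      from mult_right_mono[OF this Hn[of z]]
      show "norm (?H z * (- ln (norm (1 - of_real (r n) * ?p z)))) \<le> norm ((ln 2 + \<bar>ln (1 - r n)\<bar>) * ?H z)"
        using Hn[of z] by (simp only: real_norm_def abs_mult[of "?H z"] abs_minus_cancel abs_of_nonneg) (simp add: abs_mult mult.commute circ_densD(2)[OF F])
    qed
  qed measurable
  have "(\<integral>\<^sup>+z. ennreal (?H z * (ln 2 - ln (norm (1 - ?p z)))) \<partial>?C) = (\<integral>\<^sup>+z. liminf (\<lambda>n. ennreal (?q n z)) \<partial>?C)"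
  proof (rule nn_integral_cong_AE)
    show "AE z in ?C. ennreal (?H z * (ln 2 - ln (norm (1 - ?p z)))) = liminf (\<lambda>n. ennreal (?q n z))"
      using pne
    proof eventually_elim
      fix z :: "complex \<times> complex" assume z: "?p z \<noteq> 1"
      have "(\<lambda>n. ?q n z) \<longlonglongrightarrow> ?H z * (ln 2 - ln (norm (1 - of_real 1 * ?p z)))"
        using z by (intro tendsto_intros rlim) auto
      then have "(\<lambda>n. ennreal (?q n z)) \<longlonglongrightarrow> ennreal (?H z * (ln 2 - ln (norm (1 - ?p z))))"
        by (intro tendsto_ennrealI) simp
      then show "ennreal (?H z * (ln 2 - ln (norm (1 - ?p z)))) = liminf (\<lambda>n. ennreal (?q n z))"
        by (rule lim_imp_Liminf[symmetric, rotated]) simp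
    qed
  qed
  also have "\<dots> \<le> liminf (\<lambda>n. \<integral>\<^sup>+z. ennreal (?q n z) \<partial>?C)"
    by (rule nn_integral_liminf) measurable
  also have "\<dots> \<le> liminf (\<lambda>n::nat. ennreal (ln 2 + circ_ent F / real d))"
  proof (intro Liminf_mono always_eventually allI)
    fix n
    have i: "integrable ?C (?q n)"
      using Bochner_Integration.integrable_add[OF integrable_mult_right[OF H, of "ln 2"] qint[of n]]
      by (simp add: algebra_simps)
    have "(\<integral>z. ?q n z \<partial>?C) = (\<integral>z. ln 2 * ?H z + ?H z * (- ln (norm (1 - of_real (r n) * ?p z))) \<partial>?C)"
      by (intro Bochner_Integration.integral_cong) (simp_all add: algebra_simps)
    also have "\<dots> = ln 2 + (\<integral>z. ?H z * (- ln (norm (1 - of_real (r n) * ?p z))) \<partial>?C)"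
      by (subst Bochner_Integration.integral_add[OF integrable_mult_right[OF H] qint]) (simp add: H1)
    finally show "(\<integral>\<^sup>+z. ennreal (?q n z) \<partial>?C) \<le> ennreal (ln 2 + circ_ent F / real d)"
      using bound[of n] by (simp add: nn_integral_eq_integral[OF i q0] ennreal_leI)
  qed
  finally have fin: "(\<integral>\<^sup>+z. ennreal (?H z * (ln 2 - ln (norm (1 - ?p z)))) \<partial>?C) < \<infinity>"
    by (simp add: Liminf_const le_less_trans)
  have pos: "AE z in ?C. 0 \<le> ?H z * (ln 2 - ln (norm (1 - ?p z)))"
    using pn pne
  proof eventually_elim
    fix z :: "complex \<times> complex" assume z: "norm (?p z) \<le> 1" "?p z \<noteq> 1"
    have "norm (1 - ?p z) \<le> 2" using norm_triangle_ineq4[of 1 "?p z"] z(1) by simp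
    then have "ln (norm (1 - ?p z)) \<le> ln 2" using z(2) by (intro ln_mono) auto
    then show "0 \<le> ?H z * (ln 2 - ln (norm (1 - ?p z)))" using Hn[of z] by simp
  qed
  have "integrable ?C (\<lambda>z. ?H z * (ln 2 - ln (norm (1 - ?p z))))"
    by (rule integrableI_nn_integral_finite[of _ _ "enn2real (\<integral>\<^sup>+z. ennreal (?H z * (ln 2 - ln (norm (1 - ?p z)))) \<partial>?C)"])
      (use pos fin in \<open>auto simp: less_top\<close>)
  then have "integrable ?C (\<lambda>z. ln 2 * ?H z - ?H z * (ln 2 - ln (norm (1 - ?p z))))"
    using H by (intro Bochner_Integration.integrable_diff integrable_mult_right)
  then have int: "integrable ?C (\<lambda>z. ?H z * ln (norm (1 - ?p z)))" by (simp add: algebra_simps)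
  then show "integrable ?C (\<lambda>z. ?H z * ln (norm (fst z - snd z)))"
    by (rule integrable_cong_AE_imp) (measurable, use ker in \<open>auto elim: eventually_mono\<close>)
  have "(\<integral>z. ?H z * (- ln (norm (1 - ?p z))) \<partial>?C) \<le> circ_ent F / real d"
  proof (rule LIMSEQ_le_const2[OF abel_limit[OF H _ pn pne int]])
    show "\<exists>N. \<forall>n\<ge>N. (\<integral>z. ?H z * (- ln (norm (1 - of_real (real n / (real n + 1)) * ?p z))) \<partial>?C) \<le> circ_ent F / real d"
      using bound unfolding r_def by blast
  qed measurable
  moreover have "(\<integral>z. ?H z * ln (norm (1 - ?p z)) \<partial>?C) = circ_mirror.B F F"
    unfolding circ_mirror.B_def by (rule integral_cong_AE) (measurable, use ker in simp)
  ultimately show "- circ_mirror.B F F \<le> circ_ent F / real d" by simp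
qed


text \<open>For \<open>a + b > 1\<close> compare with twice the maximum of \<open>a\<close> and
  \<open>b\<close>; for \<open>a + b \<le> 1\<close> use \<open>t ln t \<ge> t - 1\<close>. Entropy
  classes are thus closed under addition.\<close>

lemma entropy_sum_bound:
  fixes a b :: real
  assumes "0 \<le> a" "0 \<le> b"
  shows "\<bar>(a + b) * ln (a + b)\<bar> \<le> 1 + 2 * ln 2 * (a + b) + 2 * (\<bar>a * ln a\<bar> + \<bar>b * ln b\<bar>)"
proof (cases "a + b \<le> 1")
  case True
  have "(a + b) * 0 \<le> (a + b) * ln (a + b) - (a + b) + exp 0" by (rule young_exp) (use assms in simp)
  moreover have "(a + b) * ln (a + b) \<le> 0" using True assms by (cases "a + b = 0") (auto intro: mult_nonneg_nonpos)
  ultimately have "\<bar>(a + b) * ln (a + b)\<bar> \<le> 1" using assms by simp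
  moreover have "0 \<le> 2 * ln 2 * (a + b)" using assms by simp
  moreover have "0 \<le> 2 * (\<bar>a * ln a\<bar> + \<bar>b * ln b\<bar>)" by simp
  ultimately show ?thesis by (simp only: add.assoc add_increasing2 add_nonneg_nonneg)
next
  case False
  define m where "m = max a b"
  have m: "a + b \<le> 2 * m" "0 < m" "m \<le> a + b" "\<bar>m * ln m\<bar> \<le> \<bar>a * ln a\<bar> + \<bar>b * ln b\<bar>"
    using assms False by (auto simp: m_def max_def)
  have "ln (a + b) \<le> ln (2 * m)" using m False by (intro ln_mono) auto
  then have "(a + b) * ln (a + b) \<le> (2 * m) * ln (2 * m)"
    using m False by (intro mult_mono) auto
  also have "\<dots> = 2 * ln 2 * m + 2 * (m * ln m)" using m by (simp add: ln_mult_pos algebra_simps)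
  also have "\<dots> \<le> 2 * ln 2 * (a + b) + 2 * (\<bar>a * ln a\<bar> + \<bar>b * ln b\<bar>)"
  proof -
    have "2 * ln 2 * m \<le> 2 * ln 2 * (a + b)" using m by (intro mult_left_mono) auto
    moreover have "m * ln m \<le> \<bar>a * ln a\<bar> + \<bar>b * ln b\<bar>" using m(4) abs_ge_self order_trans by blast
    ultimately show ?thesis by (intro add_mono mult_left_mono) simp_all
  qed
  finally show ?thesis using False by (simp add: abs_mult)
qed

section \<open>Extremals on the circle\<close>

lemma (in mirror_space) polarize_comp:
  fixes \<psi> :: "real \<Rightarrow> real"
  assumes [measurable]: "f \<in> borel_measurable borel" "\<psi> \<in> borel_measurable borel"
    and i: "integrable M (\<lambda>x. \<psi> (f x))"
  shows "integrable M (\<lambda>x. \<psi> (polarize f x))" "(\<integral>x. \<psi> (polarize f x) \<partial>M) = (\<integral>x. \<psi> (f x) \<partial>M)"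
proof -
  have im: "integrable M (\<lambda>x. \<psi> (f (mirror x)))" using integral_mirror(2)[of "\<lambda>x. \<psi> (f x)"] i by simp
  have pm: "(\<lambda>x. \<psi> (polarize f x)) \<in> borel_measurable borel" by measurable
  show ip: "integrable M (\<lambda>x. \<psi> (polarize f x))"
  proof (rule Bochner_Integration.integrable_bound)
    show "integrable M (\<lambda>x. \<bar>\<psi> (f x)\<bar> + \<bar>\<psi> (f (mirror x))\<bar>)" using i im by auto
    show "AE x in M. norm (\<psi> (polarize f x)) \<le> norm (\<bar>\<psi> (f x)\<bar> + \<bar>\<psi> (f (mirror x))\<bar>)"
    proof (rule AE_I2)
      fix x show "norm (\<psi> (polarize f x)) \<le> norm (\<bar>\<psi> (f x)\<bar> + \<bar>\<psi> (f (mirror x))\<bar>)"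
        using polarize_values[of f x] by auto
    qed
  qed (use pm in \<open>simp add: measurable_M\<close>)
  have ipm: "integrable M (\<lambda>x. \<psi> (polarize f (mirror x)))" using integral_mirror(2)[OF pm] ip by simp
  have "2 * (\<integral>x. \<psi> (polarize f x) \<partial>M) = (\<integral>x. \<psi> (polarize f x) + \<psi> (polarize f (mirror x)) \<partial>M)"
    using integral_mirror(1)[OF pm] ip ipm by simp
  also have "\<dots> = (\<integral>x. \<psi> (f x) + \<psi> (f (mirror x)) \<partial>M)"
  proof (intro Bochner_Integration.integral_cong refl)
    fix x show "\<psi> (polarize f x) + \<psi> (polarize f (mirror x)) = \<psi> (f x) + \<psi> (f (mirror x))"
      using polarize_values[of f x] by auto
  qed
  also have "\<dots> = 2 * (\<integral>x. \<psi> (f x) \<partial>M)"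
    using integral_mirror(1)[of "\<lambda>x. \<psi> (f x)"] i im by simp
  finally show "(\<integral>x. \<psi> (polarize f x) \<partial>M) = (\<integral>x. \<psi> (f x) \<partial>M)" by simp
qed

lemma circ_dens_add:
  assumes F: "circ_dens F" and G: "circ_dens G"
  shows "circ_dens (\<lambda>z. F z + G z)"
proof -
  note [measurable] = circ_densD(1)[OF F] circ_densD(1)[OF G]
  have "integrable circ (\<lambda>z. (F z + G z) * ln (F z + G z))"
  proof (rule Bochner_Integration.integrable_bound)
    show "integrable circ (\<lambda>z. 1 + 2 * ln 2 * (F z + G z) + 2 * (\<bar>F z * ln (F z)\<bar> + \<bar>G z * ln (G z)\<bar>))"
      by (intro Bochner_Integration.integrable_add integrable_mult_right integrable_abs
          circ_densD(3,4)[OF F] circ_densD(3,4)[OF G]) simp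
    show "AE z in circ. norm ((F z + G z) * ln (F z + G z))
        \<le> norm (1 + 2 * ln 2 * (F z + G z) + 2 * (\<bar>F z * ln (F z)\<bar> + \<bar>G z * ln (G z)\<bar>))"
      by (rule AE_I2) (use entropy_sum_bound[OF circ_densD(2)[OF F] circ_densD(2)[OF G]] in \<open>auto intro: order_trans[OF _ abs_ge_self]\<close>)
  qed measurable
  then show ?thesis using circ_densD[OF F] circ_densD[OF G] by (auto simp: circ_dens_def)
qed

lemma circ_dens_compose:
  assumes F: "circ_dens F" and [measurable]: "T \<in> borel_measurable borel" and T: "distr circ borel T = circ"
  shows "circ_dens (\<lambda>z. F (T z))" "(\<integral>z. F (T z) \<partial>circ) = (\<integral>z. F z \<partial>circ)" "circ_ent (\<lambda>z. F (T z)) = circ_ent F"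
proof -
  note [measurable] = circ_densD(1)[OF F]
  have int: "(\<integral>x. h (T x) \<partial>circ) = (\<integral>x. h x \<partial>circ)" "integrable circ (\<lambda>x. h (T x)) \<longleftrightarrow> integrable circ h"
    if [measurable]: "h \<in> borel_measurable borel" for h :: "complex \<Rightarrow> real"
  proof -
    show "(\<integral>x. h (T x) \<partial>circ) = (\<integral>x. h x \<partial>circ)"
      by (subst (2) T[symmetric]) (simp add: integral_distr)
    show "integrable circ (\<lambda>x. h (T x)) \<longleftrightarrow> integrable circ h"
      by (subst (2) T[symmetric]) (simp add: integrable_distr_eq)
  qed
  show "circ_dens (\<lambda>z. F (T z))"
    using circ_densD[OF F] int(2)[of F] int(2)[of "\<lambda>x. F x * ln (F x)"] by (auto simp: circ_dens_def)
  show "(\<integral>z. F (T z) \<partial>circ) = (\<integral>z. F z \<partial>circ)" by (rule int(1)) simp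
  show "circ_ent (\<lambda>z. F (T z)) = circ_ent F"
    unfolding circ_ent_def using int(1)[of "\<lambda>x. F x * ln (F x)"] by simp
qed

lemma circ_energy_le:
  assumes F: "circ_dens F" and mass: "(\<integral>z. F z \<partial>circ) = 1"
  shows "integrable (circ \<Otimes>\<^sub>M circ) (\<lambda>z. (F (fst z) * F (snd z)) * ln (norm (fst z - snd z)))"
    and "- circ_mirror.B F F \<le> circ_ent F"
  using circ_energy[OF F mass, of 1] by simp_all

lemma circ_mirror_distr: "distr circ borel mirror = circ"
  using circ_mirror.mirror_M .

lemma AE_circ_compose:
  assumes "T \<in> borel_measurable borel" "distr circ borel T = circ" "AE z in circ. P z"
  shows "AE z in circ. P (T z)"
proof (rule AE_distrD[of T circ borel])
  show "AE z in distr circ borel T. P z" unfolding assms(2) by fact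
qed (use assms(1) in simp)

text \<open>Polarization keeps mass and entropy and cannot raise \<open>B\<close>. The inequality
  for the polarized function forbids a strict drop, so the equality case of
  \<open>polarization\<close> applies.\<close>

lemma circ_symmetric_of_extremal:
  assumes F: "circ_dens F" and mass: "(\<integral>z. F z \<partial>circ) = 1"
    and ext: "- circ_mirror.B F F = circ_ent F" and bis: "(\<integral>z. sgn (Re z) * F z \<partial>circ) = 0"
  shows "AE z in circ. F (mirror z) = F z"
proof (rule circ_mirror.polarization(2))
  note [measurable] = circ_densD(1)[OF F]
  note Fm = circ_dens_compose[OF F mirror_measurable circ_mirror_distr]
  \<comment> \<open>A density of mass one, so \<open>circ_energy_le\<close> makes its kernel
    integrable; four times this is the hypothesis on the even majorant in
    \<open>polarization\<close>.\<close>
  let ?P = "\<lambda>z. (F z + F (mirror z)) / 2"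
  have P: "circ_dens ?P"
  proof -
    let ?Q = "\<lambda>z. F z + F (mirror z)"
    have Q: "circ_dens ?Q" by (rule circ_dens_add[OF F Fm(1)])
    have "?P z * ln (?P z) = (?Q z * ln (?Q z)) / 2 - ln 2 / 2 * ?Q z" for z
    proof (cases "?Q z = 0")
      case False
      then have "?Q z > 0" using circ_densD(2)[OF Q, of z] by simp
      then show ?thesis by (simp add: ln_div right_diff_distrib diff_divide_distrib)
    qed simp
    then show ?thesis using circ_densD[OF Q] by (auto simp: circ_dens_def)
  qed
  have "(\<integral>z. ?P z \<partial>circ) = 1" using circ_densD(3)[OF F] circ_densD(3)[OF Fm(1)] Fm(2) mass by simp
  from integrable_mult_right[OF circ_energy_le(1)[OF P this], of 4]
  show "integrable (circ \<Otimes>\<^sub>M circ) (\<lambda>z. (F (fst z) + F (mirror (fst z))) * (F (snd z) + F (mirror (snd z))) * ln (norm (fst z - snd z)))"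
    by simp
  then have le: "circ_mirror.B (polarize F) (polarize F) \<le> circ_mirror.B F F"
    by (intro circ_mirror.polarization(1)) (use circ_densD[OF F] in auto)
  have lnm: "(\<lambda>x::real. x * ln x) \<in> borel_measurable borel" by measurable
  have idm: "(\<lambda>x::real. x) \<in> borel_measurable borel" by measurable
  note p1 = circ_mirror.polarize_comp[OF circ_densD(1)[OF F] idm circ_densD(3)[OF F]]
  note p2 = circ_mirror.polarize_comp[OF circ_densD(1)[OF F] lnm circ_densD(4)[OF F]]
  have "0 \<le> polarize F z" for z
    using polarize_values[of F z] circ_densD(2)[OF F, of z] circ_densD(2)[OF F, of "mirror z"] by metis
  then have pd: "circ_dens (polarize F)"
    unfolding circ_dens_def using p1(1) p2(1) parts_measurable(3)[OF circ_densD(1)[OF F]] by blast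
  have "(\<integral>z. polarize F z \<partial>circ) = 1" using p1(2) mass by (simp only:)
  moreover have "circ_ent (polarize F) = circ_ent F" using p2(2) by (simp only: circ_ent_def)
  ultimately have "- circ_mirror.B (polarize F) (polarize F) \<le> circ_ent F"
    using circ_energy_le(2)[OF pd] by simp
  with le ext show "circ_mirror.B (polarize F) (polarize F) = circ_mirror.B F F" by linarith
qed (use circ_densD[OF F] bis in auto)

text \<open>The two reflections compose to \<open>z \<mapsto> - z\<close>, which kills the odd
  coefficients. Extremality and the bound for \<open>d = 2\<close> give
  \<open>circ_ent F \<le> circ_ent F / 2\<close>, hence no positive entropy; Gibbs' inequality
  against the constant 1 then leaves only \<open>F = 1\<close>.\<close>

lemma circ_extremal_constant:
  assumes F: "circ_dens F" and mass: "(\<integral>z. F z \<partial>circ) = 1"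
    and ext: "- circ_mirror.B F F = circ_ent F"
    and bis: "(\<integral>z. sgn (Re z) * F z \<partial>circ) = 0" "(\<integral>z. sgn (Im z) * F z \<partial>circ) = 0"
  shows "AE z in circ. F z = 1"
proof -
  note [measurable] = circ_densD(1)[OF F]
  have s1: "AE z in circ. F (mirror z) = F z"
    by (rule circ_symmetric_of_extremal[OF F mass ext bis(1)])
  \<comment> \<open>A quarter turn exchanges the axes, so that the one mirror also handles
    reflection in the real axis.\<close>
  let ?G = "\<lambda>z. F (\<i> * z)"
  have im: "((*) \<i>) \<in> borel_measurable borel" by measurable
  have id: "distr circ borel ((*) \<i>) = circ" by (rule circ_rotate) simp
  note G = circ_dens_compose[OF F im id]
  have "AE z in circ. ?G (mirror z) = ?G z"
  proof (rule circ_symmetric_of_extremal[OF G(1)])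
    show "(\<integral>z. ?G z \<partial>circ) = 1" using G(2) mass by simp
    have "(\<integral>z. sgn (Re z) * ?G z \<partial>circ) = (\<integral>z. sgn (Re (-\<i> * (\<i> * z))) * F (\<i> * z) \<partial>circ)" by simp
    also have "\<dots> = (\<integral>z. sgn (Re (-\<i> * z)) * F z \<partial>circ)"
      by (rule integral_circ_rotate) auto
    finally show "(\<integral>z. sgn (Re z) * ?G z \<partial>circ) = 0" using bis(2) by simp
    have "circ_mirror.B F F = (\<integral>z. (F (fst z) * F (snd z)) * ln (norm (fst z - snd z))
        \<partial>(distr (circ \<Otimes>\<^sub>M circ) (circ \<Otimes>\<^sub>M circ) (\<lambda>z. (\<i> * fst z, \<i> * snd z))))"
      unfolding circ_mirror.B_def
      by (subst pair_measure_preserving[OF circ.sigma_finite_measure_axioms _ _ im im id id]) auto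
    also have "\<dots> = circ_mirror.B ?G ?G"
      unfolding circ_mirror.B_def
      by (subst integral_distr) (auto simp: right_diff_distrib[symmetric] norm_mult)
    finally show "- circ_mirror.B ?G ?G = circ_ent ?G" using ext G(3) by simp
  qed
  then have s2: "AE z in circ. ?G (mirror (- \<i> * z)) = ?G (- \<i> * z)"
    by (rule AE_circ_compose[rotated 2]) (measurable, rule circ_rotate, simp)
  then have "AE z in circ. ?G (mirror (- \<i> * mirror z)) = ?G (- \<i> * mirror z)"
    by (rule AE_circ_compose[OF mirror_measurable circ_mirror_distr])
  with s1 have s3: "AE z in circ. F (- z) = F z"
    by eventually_elim (simp add: mirror_def)
  have "- circ_mirror.B F F \<le> circ_ent F / real 2"
  proof (rule circ_energy(2)[OF F mass])
    fix m :: nat assume m: "\<not> 2 dvd m"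
    have "fcoef F m = (\<integral>z. of_real (F (-1 * z)) * (-1 * z) ^ m \<partial>circ)"
      unfolding fcoef_def by (rule integral_circ_rotate[symmetric]) auto
    also have "\<dots> = (\<integral>z. - (of_real (F z) * z ^ m) \<partial>circ)"
      using s3 m by (intro integral_cong_AE) (auto simp: uminus_power_if)
    also have "\<dots> = - fcoef F m" by (simp add: fcoef_def)
    finally show "fcoef F m = 0" by simp
  qed simp
  then have "circ_ent F \<le> 0" using ext by simp
  moreover have "(\<integral>z. F z * ln 1 \<partial>circ) \<le> circ_ent F"
    unfolding circ_ent_def
    using gibbs(1)[of F "\<lambda>_. 1" circ] circ_densD[OF F] mass by (simp add: circ.prob_space[simplified])
  ultimately have e0: "(\<integral>z. F z * ln 1 \<partial>circ) = (\<integral>z. F z * ln (F z) \<partial>circ)" by (simp add: circ_ent_def)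
  show ?thesis
    by (rule gibbs(2)[OF _ _ _ _ _ _ _ _ e0]) (use circ_densD[OF F] mass circ.prob_space in auto)
qed

section \<open>The inequality on the real line\<close>

text \<open>Stereographic projection from \<open>-1\<close>, the point of angle \<open>t\<close>
  going to \<open>tan (t / 2)\<close>. At \<open>-1\<close> itself the division by zero gives 0, on
  a null set.\<close>

definition stereo :: "complex \<Rightarrow> real" where
  "stereo z = Im z / (1 + Re z)"

text \<open>The reciprocal of the Cauchy density, which is the image of \<open>circ\<close> under
  \<open>stereo\<close>.\<close>

definition cw :: "real \<Rightarrow> real" where
  "cw x = pi * (1 + x\<^sup>2)"

lemma cw_pos: "0 < cw x"
  by (simp add: cw_def add_pos_nonneg)

lemma cw_measurable [measurable]: "cw \<in> borel_measurable borel"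
  unfolding cw_def by measurable

lemma stereo_measurable [measurable]: "stereo \<in> borel_measurable borel"
  unfolding stereo_def by measurable

lemma stereo_cis: "stereo (cis t) = tan (t / 2)"
  using tan_half[of "t / 2"] by (simp add: stereo_def add.commute)

text \<open>Both measures give the half-line above \<open>x\<close> the mass
  \<open>1 / 2 - arctan x / pi\<close>.\<close>

lemma distr_stereo: "distr circ borel stereo = density lborel (\<lambda>x. ennreal (1 / cw x))"
proof (rule measure_eqI_lessThan)
  fix x :: real
  have "emeasure (distr circ borel stereo) {x<..} = (\<integral>\<^sup>+z. indicator {x<..} (stereo z) \<partial>circ)"
    by (simp add: nn_integral_distr flip: nn_integral_indicator)
  also have "\<dots> = (\<integral>\<^sup>+t. indicator {x<..} (stereo (cis t)) * indicator {-pi<..pi} t \<partial>lborel) / ennreal (2 * pi)"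
    by (rule nn_integral_circ) measurable
  also have "(\<integral>\<^sup>+t. indicator {x<..} (stereo (cis t)) * indicator {-pi<..pi} t \<partial>lborel)
      = (\<integral>\<^sup>+t. indicator {2 * arctan x<..<pi} t \<partial>lborel)"
  proof (rule nn_integral_cong_AE)
    show "AE t in lborel. (indicator {x<..} (stereo (cis t)) * indicator {-pi<..pi} t :: ennreal) = indicator {2 * arctan x<..<pi} t"
      using AE_lborel_singleton[of pi]
    proof eventually_elim
      fix t :: real assume t: "t \<noteq> pi"
      have "x < tan (t / 2) \<longleftrightarrow> 2 * arctan x < t" if "-pi < t" "t < pi"
      proof -
        have "arctan (tan (t / 2)) = t / 2" using that by (intro arctan_tan) auto
        then have "2 * arctan x < t \<longleftrightarrow> arctan x < arctan (tan (t / 2))" by auto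
        then show ?thesis by (simp add: arctan_less_iff)
      qed
      moreover have "-pi < 2 * arctan x" using arctan_lbound[of x] by simp
      ultimately show "(indicator {x<..} (stereo (cis t)) * indicator {-pi<..pi} t :: ennreal) = indicator {2 * arctan x<..<pi} t"
        using t by (auto simp: stereo_cis indicator_def)
    qed
  qed
  also have "\<dots> = ennreal (pi - 2 * arctan x)"
    using arctan_ubound[of x] by simp
  also have "\<dots> / ennreal (2 * pi) = ennreal (1 / 2 - arctan x / pi)"
    using arctan_ubound[of x] by (subst divide_ennreal) (auto simp: diff_divide_distrib)
  finally have L: "emeasure (distr circ borel stereo) {x<..} = ennreal (1 / 2 - arctan x / pi)" .
  have "(\<integral>\<^sup>+t. ennreal (1 / cw t) * indicator {x..} t \<partial>lborel) = ennreal ((pi / 2) / pi - arctan x / pi)"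
  proof (rule nn_integral_FTC_atLeast)
    show "((\<lambda>t. arctan t / pi) has_real_derivative 1 / cw t) (at t)" for t
      by (rule DERIV_cong[OF DERIV_cdivide[OF DERIV_arctan]]) (simp add: cw_def divide_inverse mult.commute)
    show "((\<lambda>t. arctan t / pi) \<longlongrightarrow> (pi / 2) / pi) at_top"
      by (intro tendsto_divide tendsto_arctan_at_top tendsto_const) simp
    show "0 \<le> 1 / cw t" for t using cw_pos[of t] by simp
  qed measurable
  moreover have "emeasure (density lborel (\<lambda>x. ennreal (1 / cw x))) {x<..} = (\<integral>\<^sup>+t. ennreal (1 / cw t) * indicator {x..} t \<partial>lborel)"
    using AE_lborel_singleton[of x] by (subst emeasure_density) (auto intro!: nn_integral_cong_AE split: split_indicator elim!: eventually_mono)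
  ultimately show "emeasure (distr circ borel stereo) {x<..} = emeasure (density lborel (\<lambda>x. ennreal (1 / cw x))) {x<..}"
    unfolding L by simp
  show "emeasure (distr circ borel stereo) {x<..} < \<infinity>" unfolding L by simp
qed auto

lemma integral_stereo:
  fixes h :: "real \<Rightarrow> real"
  assumes [measurable]: "h \<in> borel_measurable borel"
  shows "(\<integral>z. h (stereo z) * cw (stereo z) \<partial>circ) = (\<integral>x. h x \<partial>lborel)"
    and "integrable circ (\<lambda>z. h (stereo z) * cw (stereo z)) \<longleftrightarrow> integrable lborel h"
proof -
  have e: "1 / cw x * (h x * cw x) = h x" for x using cw_pos[of x] by simp
  have "(\<integral>z. h (stereo z) * cw (stereo z) \<partial>circ) = (\<integral>x. h x * cw x \<partial>(distr circ borel stereo))"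
    by (simp add: integral_distr)
  also have "\<dots> = (\<integral>x. h x \<partial>lborel)"
    unfolding distr_stereo by (subst integral_density) (use cw_pos e in \<open>auto intro: less_imp_le\<close>)
  finally show "(\<integral>z. h (stereo z) * cw (stereo z) \<partial>circ) = (\<integral>x. h x \<partial>lborel)" .
  have "integrable circ (\<lambda>z. h (stereo z) * cw (stereo z)) \<longleftrightarrow> integrable (distr circ borel stereo) (\<lambda>x. h x * cw x)"
    by (simp add: integrable_distr_eq)
  also have "\<dots> \<longleftrightarrow> integrable lborel h"
    unfolding distr_stereo by (subst integrable_density) (use cw_pos e in \<open>auto intro: less_imp_le\<close>)
  finally show "integrable circ (\<lambda>z. h (stereo z) * cw (stereo z)) \<longleftrightarrow> integrable lborel h" .
qed

lemma integral_stereo_pair: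
  fixes h :: "real \<times> real \<Rightarrow> real"
  assumes [measurable]: "h \<in> borel_measurable (borel \<Otimes>\<^sub>M borel)"
  defines "k \<equiv> \<lambda>z. h (stereo (fst z), stereo (snd z)) * (cw (stereo (fst z)) * cw (stereo (snd z)))"
  shows "(\<integral>z. k z \<partial>(circ \<Otimes>\<^sub>M circ)) = (\<integral>z. h z \<partial>(lborel \<Otimes>\<^sub>M lborel))"
    and "integrable (circ \<Otimes>\<^sub>M circ) k \<longleftrightarrow> integrable (lborel \<Otimes>\<^sub>M lborel) h"
proof -
  define D where "D = density lborel (\<lambda>x. ennreal (1 / cw x))"
  have D: "distr circ borel stereo = D" unfolding D_def by (rule distr_stereo)
  have Dp: "prob_space D" unfolding D[symmetric] by (rule circ.prob_space_distr) simp
  then interpret D: prob_space D .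
  have setsD: "sets D = sets borel" by (simp add: D_def)
  have P: "distr (circ \<Otimes>\<^sub>M circ) (D \<Otimes>\<^sub>M D) (\<lambda>z. (stereo (fst z), stereo (snd z))) = D \<Otimes>\<^sub>M D"
    by (rule pair_measure_preserving[OF D.sigma_finite_measure_axioms _ setsD _ _ D D]) simp_all
  have Q: "D \<Otimes>\<^sub>M D = density (lborel \<Otimes>\<^sub>M lborel) (\<lambda>(x, y). ennreal (1 / cw x) * ennreal (1 / cw y))"
    unfolding D_def
    by (rule pair_measure_density) (use D.sigma_finite_measure_axioms sigma_finite_lborel in \<open>auto simp: D_def\<close>)
  have Q': "D \<Otimes>\<^sub>M D = density (lborel \<Otimes>\<^sub>M lborel) (\<lambda>z. ennreal (1 / (cw (fst z) * cw (snd z))))"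
    unfolding Q using cw_pos by (intro density_cong) (auto simp: ennreal_mult[symmetric] less_imp_le)
  let ?k = "\<lambda>z. h z * (cw (fst z) * cw (snd z))"
  have e: "1 / (cw (fst z) * cw (snd z)) * ?k z = h z" for z using cw_pos[of "fst z"] cw_pos[of "snd z"] by simp
  have nn: "0 \<le> 1 / (cw (fst z) * cw (snd z))" for z using cw_pos[of "fst z"] cw_pos[of "snd z"] by simp
  have km: "?k \<in> borel_measurable (D \<Otimes>\<^sub>M D)"
    unfolding measurable_cong_sets[OF sets_pair_measure_cong[OF setsD setsD] refl] by measurable
  have sm: "(\<lambda>z. (stereo (fst z), stereo (snd z))) \<in> measurable (circ \<Otimes>\<^sub>M circ) (D \<Otimes>\<^sub>M D)"
    unfolding measurable_cong_sets[OF refl sets_pair_measure_cong[OF setsD setsD]] by measurable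
  have "(\<integral>z. k z \<partial>(circ \<Otimes>\<^sub>M circ)) = (\<integral>z. ?k z \<partial>(D \<Otimes>\<^sub>M D))"
    by (subst P[symmetric], subst integral_distr[OF sm km]) (simp add: k_def)
  also have "\<dots> = (\<integral>z. h z \<partial>(lborel \<Otimes>\<^sub>M lborel))"
    unfolding Q' by (subst integral_density) (use e nn in auto)
  finally show "(\<integral>z. k z \<partial>(circ \<Otimes>\<^sub>M circ)) = (\<integral>z. h z \<partial>(lborel \<Otimes>\<^sub>M lborel))" .
  have "integrable (circ \<Otimes>\<^sub>M circ) k \<longleftrightarrow> integrable (D \<Otimes>\<^sub>M D) ?k"
    by (subst P[symmetric], subst integrable_distr_eq[OF sm km]) (simp add: k_def)
  also have "\<dots> \<longleftrightarrow> integrable (lborel \<Otimes>\<^sub>M lborel) h"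
    unfolding Q' by (subst integrable_density) (use e nn in auto)
  finally show "integrable (circ \<Otimes>\<^sub>M circ) k \<longleftrightarrow> integrable (lborel \<Otimes>\<^sub>M lborel) h" .
qed

lemma unit_circle_facts:
  assumes "norm z = 1" "z \<noteq> -1"
  shows "0 < 1 + Re z" "1 + (stereo z)\<^sup>2 = 2 / (1 + Re z)" "(norm (z + 1))\<^sup>2 = 2 * (1 + Re z)"
proof -
  have n: "(Re z)\<^sup>2 + (Im z)\<^sup>2 = 1" using assms(1) cmod_power2[of z] by simp
  have "\<bar>Re z\<bar> \<le> 1" using abs_Re_le_cmod[of z] assms by simp
  moreover have "Re z \<noteq> -1"
  proof
    assume "Re z = -1"
    then have "Im z = 0" using n by simp
    then show False using assms(2) \<open>Re z = -1\<close> by (simp add: complex_eq_iff)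
  qed
  ultimately show pos: "0 < 1 + Re z" by auto
  have "(Im z)\<^sup>2 = (1 - Re z) * (1 + Re z)" using n by (simp add: power2_eq_square algebra_simps)
  then have "(stereo z)\<^sup>2 = (1 - Re z) / (1 + Re z)"
    using pos by (simp add: stereo_def power_divide power2_eq_square)
  then show "1 + (stereo z)\<^sup>2 = 2 / (1 + Re z)" using pos by (simp add: field_simps)
  show "(norm (z + 1))\<^sup>2 = 2 * (1 + Re z)" using n unfolding cmod_power2 by (simp add: power2_eq_square algebra_simps)
qed

text \<open>The chordal distance formula: the squared distance on the line is the squared chord
  divided by \<open>(1 + Re z) (1 + Re w)\<close>, and \<open>1 + Re z\<close> is 2 divided by
  \<open>1 + (stereo z)^2\<close>.\<close>

lemma stereo_kernel:
  assumes z: "norm z = 1" "z \<noteq> -1" and w: "norm w = 1" "w \<noteq> -1" and ne: "z \<noteq> w"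
  shows "ln (norm (stereo z - stereo w)) = ln (norm (z - w)) - ln 2 + ln (1 + (stereo z)\<^sup>2) / 2 + ln (1 + (stereo w)\<^sup>2) / 2"
proof -
  define a b c d where "a = Re z" and "b = Im z" and "c = Re w" and "d = Im w"
  have n: "a\<^sup>2 + b\<^sup>2 = 1" "c\<^sup>2 + d\<^sup>2 = 1" using z w cmod_power2[of z] cmod_power2[of w] by (simp_all add: a_def b_def c_def d_def)
  have pos: "0 < 1 + a" "0 < 1 + c" using unit_circle_facts(1)[OF z] unit_circle_facts(1)[OF w] by (simp_all add: a_def c_def)
  have b2: "b * b = (1 - a) * (1 + a)" "d * d = (1 - c) * (1 + c)" using n by (simp_all add: power2_eq_square algebra_simps)
  have "(b * (1 + c) - d * (1 + a))\<^sup>2 = (b * b) * (1 + c)\<^sup>2 + (d * d) * (1 + a)\<^sup>2 - 2 * b * d * (1 + a) * (1 + c)"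
    by (simp add: power2_eq_square algebra_simps)
  also have "\<dots> = (1 + a) * (1 + c) * (2 - 2 * (a * c + b * d))"
    unfolding b2 by (simp add: power2_eq_square algebra_simps)
  also have "2 - 2 * (a * c + b * d) = (norm (z - w))\<^sup>2"
    using n unfolding cmod_power2 by (simp add: a_def b_def c_def d_def power2_eq_square algebra_simps)
  finally have k: "(b * (1 + c) - d * (1 + a))\<^sup>2 = (1 + a) * (1 + c) * (norm (z - w))\<^sup>2" .
  have "stereo z - stereo w = (b * (1 + c) - d * (1 + a)) / ((1 + a) * (1 + c))"
    using pos by (simp add: stereo_def a_def b_def c_def d_def diff_frac_eq)
  then have "(stereo z - stereo w)\<^sup>2 = (norm (z - w))\<^sup>2 / ((1 + a) * (1 + c))"
    using pos by (simp only: power_divide k) (simp add: power2_eq_square)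
  then have sq: "(norm (stereo z - stereo w))\<^sup>2 = (norm (z - w))\<^sup>2 / ((1 + a) * (1 + c))" by simp
  have zw: "0 < norm (z - w)" using ne by simp
  then have "0 < (norm (stereo z - stereo w))\<^sup>2" unfolding sq using pos by simp
  then have sp: "0 < norm (stereo z - stereo w)" by simp
  have "2 * ln (norm (stereo z - stereo w)) = ln ((norm (stereo z - stereo w))\<^sup>2)" using sp by (subst ln_realpow) auto
  also have "\<dots> = 2 * ln (norm (z - w)) - (ln (1 + a) + ln (1 + c))"
    unfolding sq using zw pos by (simp add: ln_div ln_mult_pos ln_realpow)
  finally have main: "2 * ln (norm (stereo z - stereo w)) = 2 * ln (norm (z - w)) - (ln (1 + a) + ln (1 + c))" .
  have e: "ln (1 + (stereo z)\<^sup>2) = ln 2 - ln (1 + a)" "ln (1 + (stereo w)\<^sup>2) = ln 2 - ln (1 + c)"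
    unfolding unit_circle_facts(2)[OF z] unit_circle_facts(2)[OF w] using pos by (simp_all add: a_def c_def ln_div)
  have "X = Y - l + (l - A) / 2 + (l - C) / 2" if "2 * X = 2 * Y - (A + C)" for X Y A C l :: real
    using that by (simp add: field_simps)
  from this[OF main] show ?thesis unfolding e .
qed

text \<open>The density with respect to \<open>circ\<close> of the measure on the circle whose image
  under \<open>stereo\<close> has density \<open>f\<close>.\<close>

definition lift :: "(real \<Rightarrow> real) \<Rightarrow> complex \<Rightarrow> real" where
  "lift f z = f (stereo z) * cw (stereo z)"

lemma lift_dens:
  assumes f: "adm f"
  shows "circ_dens (lift f)" "(\<integral>z. lift f z \<partial>circ) = (\<integral>x. f x \<partial>lborel)"
    "circ_ent (lift f) = entS f + (\<integral>x. f x * ln (1 + x\<^sup>2) \<partial>lborel) + ln pi * (\<integral>x. f x \<partial>lborel)"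
proof -
  note [measurable] = admD(1)[OF f]
  have i2: "integrable lborel (\<lambda>x. f x * ln (1 + x\<^sup>2))" using integrable_ln_square[OF f] by simp
  note i = admD(3,4)[OF f] i2
  have e: "lift f z * ln (lift f z) = (f (stereo z) * ln (f (stereo z)) + f (stereo z) * ln (1 + (stereo z)\<^sup>2) + ln pi * f (stereo z)) * cw (stereo z)" for z
  proof (cases "f (stereo z) = 0")
    case False
    then have p: "f (stereo z) > 0" using admD(2)[OF f, of "stereo z"] by simp
    have "ln (cw (stereo z)) = ln pi + ln (1 + (stereo z)\<^sup>2)" unfolding cw_def by (intro ln_mult_pos) (auto intro: add_pos_nonneg)
    then have "ln (lift f z) = ln (f (stereo z)) + (ln pi + ln (1 + (stereo z)\<^sup>2))"
      unfolding lift_def using p cw_pos[of "stereo z"] by (simp add: ln_mult_pos)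
    then show ?thesis by (simp only:) (simp add: lift_def algebra_simps)
  qed (simp add: lift_def)
  show "(\<integral>z. lift f z \<partial>circ) = (\<integral>x. f x \<partial>lborel)" unfolding lift_def by (rule integral_stereo(1)) simp
  have "integrable circ (lift f)" unfolding lift_def using integral_stereo(2)[of f] i by simp
  moreover have hm: "(\<lambda>x. f x * ln (f x) + f x * ln (1 + x\<^sup>2) + ln pi * f x) \<in> borel_measurable borel" by measurable
  have "integrable circ (\<lambda>z. lift f z * ln (lift f z))" unfolding e using integral_stereo(2)[OF hm] i by simp
  moreover have "lift f \<in> borel_measurable borel" unfolding lift_def by measurable
  moreover have "0 \<le> lift f z" for z using admD(2)[OF f] cw_pos[of "stereo z"] by (simp add: lift_def)
  ultimately show "circ_dens (lift f)" by (simp add: circ_dens_def)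
  show "circ_ent (lift f) = entS f + (\<integral>x. f x * ln (1 + x\<^sup>2) \<partial>lborel) + ln pi * (\<integral>x. f x \<partial>lborel)"
    unfolding circ_ent_def e entS_def using integral_stereo(1)[OF hm] i by simp
qed

lemma AE_circ_unit: "AE z in circ. norm z = 1 \<and> z \<noteq> -1"
  using AE_circ_norm AE_circ_neq[of "-1"] by eventually_elim simp

lemma lift_energy:
  assumes f: "adm f" "(\<integral>x. f x \<partial>lborel) = 1" and g: "adm g" "(\<integral>x. g x \<partial>lborel) = 1"
  shows "logE f g = circ_mirror.B (lift f) (lift g) - ln 2
      + (\<integral>x. f x * ln (1 + x\<^sup>2) \<partial>lborel) / 2 + (\<integral>x. g x * ln (1 + x\<^sup>2) \<partial>lborel) / 2"
    and "integrable (circ \<Otimes>\<^sub>M circ) (\<lambda>z. (lift f (fst z) * lift g (snd z)) * ln (norm (fst z - snd z)))"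
proof -
  note [measurable] = admD(1)[OF f(1)] admD(1)[OF g(1)]
  let ?C = "circ \<Otimes>\<^sub>M circ" and ?s = "stereo"
  let ?h = "\<lambda>z. (f (fst z) * g (snd z)) * ln (norm (fst z - snd z))"
  let ?F = "lift f" and ?G = "lift g"
  let ?lF = "\<lambda>z. lift f z * ln (1 + (?s z)\<^sup>2)" and ?lG = "\<lambda>z. lift g z * ln (1 + (?s z)\<^sup>2)"
  note F = lift_dens[OF f(1)] and G = lift_dens[OF g(1)]
  have [measurable]: "lift f \<in> borel_measurable borel" "lift g \<in> borel_measurable borel"
    using circ_densD(1)[OF F(1)] circ_densD(1)[OF G(1)] .
  have l: "integrable circ (\<lambda>z. lift u z * ln (1 + (?s z)\<^sup>2))" "(\<integral>z. lift u z * ln (1 + (?s z)\<^sup>2) \<partial>circ) = (\<integral>x. u x * ln (1 + x\<^sup>2) \<partial>lborel)"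
    if u: "adm u" for u :: "real \<Rightarrow> real"
  proof -
    note [measurable] = admD(1)[OF u]
    have hm: "(\<lambda>x. u x * ln (1 + x\<^sup>2)) \<in> borel_measurable borel" by measurable
    have e: "lift u z * ln (1 + (?s z)\<^sup>2) = (u (?s z) * ln (1 + (?s z)\<^sup>2)) * cw (?s z)" for z by (simp add: lift_def)
    show "integrable circ (\<lambda>z. lift u z * ln (1 + (?s z)\<^sup>2))" unfolding e using integral_stereo(2)[OF hm] integrable_ln_square[OF u] by simp
    show "(\<integral>z. lift u z * ln (1 + (?s z)\<^sup>2) \<partial>circ) = (\<integral>x. u x * ln (1 + x\<^sup>2) \<partial>lborel)" unfolding e by (rule integral_stereo(1)[OF hm])
  qed
  have hm: "?h \<in> borel_measurable (borel \<Otimes>\<^sub>M borel)" by measurable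
  let ?k = "\<lambda>z. ?h (?s (fst z), ?s (snd z)) * (cw (?s (fst z)) * cw (?s (snd z)))"
  have ki: "integrable ?C ?k" using integral_stereo_pair(2)[OF hm] integrable_log_kernel[OF f(1) g(1)] by simp
  have kv: "(\<integral>z. ?k z \<partial>?C) = logE f g" unfolding integral_stereo_pair(1)[OF hm] logE_def ..
  let ?L = "\<lambda>z. (?F (fst z) * ?G (snd z)) * ln (norm (fst z - snd z))"
  note p0 = circ_pair.integrable_mult_pair[OF circ_densD(3)[OF F(1)] circ_densD(3)[OF G(1)]]
  note p1 = circ_pair.integrable_mult_pair[OF l(1)[OF f(1)] circ_densD(3)[OF G(1)]]
  note p2 = circ_pair.integrable_mult_pair[OF circ_densD(3)[OF F(1)] l(1)[OF g(1)]]
  let ?R = "\<lambda>z. ?k z + ln 2 * (?F (fst z) * ?G (snd z)) - (?lF (fst z) * ?G (snd z)) / 2 - (?F (fst z) * ?lG (snd z)) / 2"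
  note i1 = Bochner_Integration.integrable_add[OF ki integrable_mult_right[OF p0(1), of "ln 2"]]
  note i2 = Bochner_Integration.integrable_diff[OF i1 integrable_divide[OF p1(1), of 2]]
  note i3 = Bochner_Integration.integrable_diff[OF i2 integrable_divide[OF p2(1), of 2]]
  have id: "AE z in ?C. ?R z = ?L z"
    using AE_pair_both[OF circ.sigma_finite_measure_axioms AE_circ_unit] circ_mirror.diag_M
  proof eventually_elim
    fix z :: "complex \<times> complex"
    assume z: "(norm (fst z) = 1 \<and> fst z \<noteq> -1) \<and> (norm (snd z) = 1 \<and> snd z \<noteq> -1)" "fst z \<noteq> snd z"
    have "ln (norm (?s (fst z) - ?s (snd z))) = ln (norm (fst z - snd z)) - ln 2 + ln (1 + (?s (fst z))\<^sup>2) / 2 + ln (1 + (?s (snd z))\<^sup>2) / 2"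
      using z by (intro stereo_kernel) auto
    then have "?k z = (?F (fst z) * ?G (snd z)) * (ln (norm (fst z - snd z)) - ln 2 + ln (1 + (?s (fst z))\<^sup>2) / 2 + ln (1 + (?s (snd z))\<^sup>2) / 2)"
      by (simp only: fst_conv snd_conv) (simp add: lift_def mult_ac)
    then show "?R z = ?L z" by (simp only:) (simp add: algebra_simps add_divide_distrib)
  qed
  show "integrable ?C ?L" by (rule integrable_cong_AE_imp[OF i3]) (measurable, use id in \<open>auto elim: eventually_mono\<close>)
  have "circ_mirror.B ?F ?G = (\<integral>z. ?R z \<partial>?C)"
    unfolding circ_mirror.B_def by (rule integral_cong_AE) (measurable, use borel_measurable_integrable[OF ki] in measurable, use id in \<open>auto elim: eventually_mono\<close>)
  also have "\<dots> = logE f g + ln 2 - (\<integral>x. f x * ln (1 + x\<^sup>2) \<partial>lborel) / 2 - (\<integral>x. g x * ln (1 + x\<^sup>2) \<partial>lborel) / 2"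
    unfolding Bochner_Integration.integral_diff[OF i2 integrable_divide[OF p2(1), of 2]]
      Bochner_Integration.integral_diff[OF i1 integrable_divide[OF p1(1), of 2]]
      Bochner_Integration.integral_add[OF ki integrable_mult_right[OF p0(1), of "ln 2"]] kv
    using p0(2) p1(2) p2(2) l(2)[OF f(1)] l(2)[OF g(1)] F(2) G(2) f(2) g(2) by simp
  finally show "logE f g = circ_mirror.B ?F ?G - ln 2
      + (\<integral>x. f x * ln (1 + x\<^sup>2) \<partial>lborel) / 2 + (\<integral>x. g x * ln (1 + x\<^sup>2) \<partial>lborel) / 2" by simp
qed

text \<open>Energy and entropy both contain the moment of \<open>ln (1 + x^2)\<close>, with opposite
  signs in \<open>logJ\<close>; it cancels. This is conformal invariance for
  \<open>N = 1\<close>.\<close>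

lemma logJ_lift:
  assumes f: "adm f" "(\<integral>x. f x \<partial>lborel) = 1"
  shows "logJ f f = ln 2 + ln pi + (- circ_mirror.B (lift f) (lift f) - circ_ent (lift f))"
  using lift_energy(1)[OF f f] lift_dens(3)[OF f(1)] f(2) by (simp add: logJ_def)


lemma logJ_real_le:
  assumes f: "adm f" "(\<integral>x. f x \<partial>(lborel :: real measure)) = 1"
  shows "logJ f f \<le> ln 2 + ln pi"
  using circ_energy_le(2)[OF lift_dens(1)[OF f(1)]] lift_dens(2)[OF f(1)] f(2) logJ_lift[OF f] by simp

section \<open>The optimizer on the line\<close>

text \<open>Integrability: the constant density has finite energy, so Fubini makes the kernel
  integrable for some \<open>w\<close> on the circle, and a rotation moves \<open>w\<close> to 1.
  Value: all positive Fourier modes of the constant vanish, so every damped integral is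
  zero.\<close>

lemma mean_ln_circle:
  shows "integrable circ (\<lambda>z. ln (norm (1 - z)))" "(\<integral>z. ln (norm (1 - z)) \<partial>circ) = 0"
proof -
  have one: "circ_dens (\<lambda>_. 1)" by (simp add: circ_dens_def)
  have "integrable (circ \<Otimes>\<^sub>M circ) (\<lambda>z. ln (norm (fst z - snd z)))"
    using circ_energy_le(1)[OF one] circ.prob_space by simp
  moreover have "(\<lambda>(z, w). ln (norm (z - w))) = (\<lambda>z. ln (norm (fst z - snd z :: complex)))" by auto
  ultimately have "integrable (circ \<Otimes>\<^sub>M circ) (\<lambda>(z, w). ln (norm (z - w)))" by (simp only:)
  then have "AE w in circ. integrable circ (\<lambda>z. ln (norm (z - w)))"
    by (rule circ_pair.AE_integrable_snd)
  with AE_circ_norm have "AE w in circ. norm w = 1 \<and> integrable circ (\<lambda>z. ln (norm (z - w)))"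
    by eventually_elim simp
  then have "\<exists>w. norm w = 1 \<and> integrable circ (\<lambda>z. ln (norm (z - w)))"
  proof (rule contrapos_pp)
    assume n: "\<nexists>w. norm w = 1 \<and> integrable circ (\<lambda>z. ln (norm (z - w)))"
    have e: "(\<lambda>w. norm w = 1 \<and> integrable circ (\<lambda>z. ln (norm (z - w)))) = (\<lambda>w. False)"
      using n by blast
    show "\<not> (AE w in circ. norm w = 1 \<and> integrable circ (\<lambda>z. ln (norm (z - w))))"
      unfolding e using circ.emeasure_space_1 by (simp add: eventually_False ae_filter_eq_bot_iff)
  qed
  then obtain w where w: "norm w = 1" "integrable circ (\<lambda>z. ln (norm (z - w)))" by blast
  have "integrable (distr circ borel ((*) w)) (\<lambda>z. ln (norm (z - w)))"
    using w by (simp add: circ_rotate)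
  then have "integrable circ (\<lambda>z. ln (norm (w * z - w)))"
    by (subst (asm) integrable_distr_eq) auto
  moreover have "norm (w * z - w) = norm (1 - z)" for z
  proof -
    have "w * z - w = - w * (1 - z)" by (simp add: algebra_simps)
    then show ?thesis using w(1) by (simp only: norm_mult norm_minus_cancel mult_1)
  qed
  ultimately show int: "integrable circ (\<lambda>z. ln (norm (1 - z)))" by simp
  have "(\<lambda>n. \<integral>z. 1 * (- ln (norm (1 - of_real (real n / (real n + 1)) * z))) \<partial>circ) \<longlonglongrightarrow>
    (\<integral>z. 1 * (- ln (norm (1 - z))) \<partial>circ)"
    by (rule abel_limit) (use AE_circ_norm AE_circ_neq int in \<open>auto elim: eventually_mono\<close>)
  moreover have "(\<integral>z. 1 * (- ln (norm (1 - of_real (real n / (real n + 1)) * z))) \<partial>circ) = 0" for n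
  proof -
    have "(\<lambda>m. Re (of_real (real n / (real n + 1)) ^ m / of_nat m * (\<integral>z. of_real 1 * z ^ m \<partial>circ))) sums
      (\<integral>z. 1 * (- ln (norm (1 - of_real (real n / (real n + 1)) * z))) \<partial>circ)"
    proof (rule abel_series(1))
      show "norm (complex_of_real (real n / (real n + 1))) < 1" by (simp only: norm_of_real) simp
    qed (use AE_circ_norm in \<open>auto elim: eventually_mono\<close>)
    moreover have "of_real (real n / (real n + 1)) ^ m / of_nat m * (\<integral>z. of_real 1 * z ^ m \<partial>circ) = 0" for m
      using integral_circ_monomial[of m 0] by (cases "m = 0") simp_all
    ultimately have "(\<lambda>m::nat. 0) sums (\<integral>z. 1 * (- ln (norm (1 - of_real (real n / (real n + 1)) * z))) \<partial>circ)"
      by (simp only: zero_complex.simps)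
    then show ?thesis using sums_unique2 sums_zero by blast
  qed
  ultimately show "(\<integral>z. ln (norm (1 - z)) \<partial>circ) = 0"
    by (simp only: LIMSEQ_const_iff) simp
qed

abbreviation (input) Copt :: real where "Copt \<equiv> 1 / pi"

lemma opt_real: "opt 0 1 Copt x = 1 / cw x"
  by (simp add: opt_standard cw_def)

lemma lift_opt: "lift (opt 0 1 Copt) = (\<lambda>_. 1)"
  using cw_pos by (auto simp: lift_def opt_real less_imp_neq[symmetric])

lemma adm_opt_real: "adm (opt (0::real) 1 Copt)"
  by (rule adm_opt_standard) simp

lemma opt_real_mass: "(\<integral>x. opt (0::real) 1 Copt x \<partial>lborel) = 1"
  using lift_dens(2)[OF adm_opt_real] circ.prob_space by (simp add: lift_opt)

lemma integral_circ_ln_shift: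
  assumes "norm w = 1"
  shows "(\<integral>z. ln (norm (z - w)) \<partial>circ) = 0"
proof -
  have "(\<integral>z. ln (norm (z - w)) \<partial>circ) = (\<integral>z. ln (norm (w * z - w)) \<partial>circ)"
    by (rule integral_circ_rotate[OF _ assms, symmetric]) measurable
  also have "\<dots> = (\<integral>z. ln (norm (1 - z)) \<partial>circ)"
  proof (intro Bochner_Integration.integral_cong refl)
    fix z
    have "w * z - w = - w * (1 - z)" by (simp add: algebra_simps)
    then have "norm (w * z - w) = norm (1 - z)" using assms by (simp only: norm_mult norm_minus_cancel mult_1)
    then show "ln (norm (w * z - w)) = ln (norm (1 - z))" by simp
  qed
  finally show ?thesis using mean_ln_circle(2) by simp
qed

text \<open>On the circle the optimizer is the constant 1 and \<open>ln (1 + x^2)\<close> is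
  \<open>2 ln 2 - 2 ln |z + 1|\<close>, whose last term has mean zero.\<close>

lemma opt_real_kappa: "(\<integral>x. opt (0::real) 1 Copt x * ln (1 + (norm x)\<^sup>2) \<partial>lborel) = 2 * ln 2"
proof -
  note [measurable] = admD(1)[OF adm_opt_real]
  have "(\<integral>x. opt (0::real) 1 Copt x * ln (1 + (norm x)\<^sup>2) \<partial>lborel)
      = (\<integral>z. (opt 0 1 Copt (stereo z) * ln (1 + (norm (stereo z))\<^sup>2)) * cw (stereo z) \<partial>circ)"
    by (rule integral_stereo(1)[symmetric]) measurable
  also have "\<dots> = (\<integral>z. ln (1 + (stereo z)\<^sup>2) \<partial>circ)"
    using cw_pos by (intro Bochner_Integration.integral_cong) (auto simp: opt_real less_imp_neq[symmetric])
  also have "\<dots> = (\<integral>z. 2 * ln 2 - 2 * ln (norm (z - (-1))) \<partial>circ)"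
  proof (rule integral_cong_AE)
    show "AE z in circ. ln (1 + (stereo z)\<^sup>2) = 2 * ln 2 - 2 * ln (norm (z - (-1)))"
      using AE_circ_unit
    proof eventually_elim
      fix z :: complex assume "norm z = 1 \<and> z \<noteq> - 1"
      then have z: "norm z = 1" "z \<noteq> -1" by auto
      note u = unit_circle_facts[OF z]
      have "z + 1 \<noteq> 0" using z(2) by (metis add_eq_0_iff add.commute)
      then have "2 * ln (norm (z + 1)) = ln ((norm (z + 1))\<^sup>2)" by (subst ln_realpow) auto
      also have "\<dots> = ln 2 + ln (1 + Re z)" unfolding u(3) using u(1) by (intro ln_mult_pos) auto
      finally show "ln (1 + (stereo z)\<^sup>2) = 2 * ln 2 - 2 * ln (norm (z - (-1)))"
        unfolding u(2) using u(1) by (simp add: ln_div)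
    qed
  qed measurable
  also have "\<dots> = 2 * ln 2"
  proof -
    have "(\<integral>z. ln (norm (-1 * z - (-1))) \<partial>circ) = 0" using integral_circ_ln_shift[of "-1"]
      integral_circ_rotate[of "\<lambda>z. ln (norm (z - (-1)))" "-1"] by simp
    have "integrable (distr circ borel ((*) (-1))) (\<lambda>z. ln (norm (1 - z)))"
      by (subst circ_rotate) (use mean_ln_circle(1) in auto)
    then have "integrable circ (\<lambda>z. ln (norm (1 - (-1) * z)))" by (subst (asm) integrable_distr_eq) auto
    then have "integrable circ (\<lambda>z. ln (norm (z - (-1))))" by (simp add: add.commute)
    then show ?thesis using integral_circ_ln_shift[of "-1"] circ.prob_space by (subst Bochner_Integration.integral_diff) auto
  qed
  finally show ?thesis .
qed

text \<open>The uniform measure has zero logarithmic potential on the circle, so the form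
  \<open>B\<close> vanishes. Of the remaining terms, \<open>- ln 2\<close> cancels against half the
  moment of the optimizer.\<close>

lemma opt_real_potential:
  assumes g: "adm g" "(\<integral>x. g x \<partial>(lborel :: real measure)) = 1"
  shows "logE (opt 0 1 Copt) g = (\<integral>x. g x * ln (1 + (norm x)\<^sup>2) \<partial>lborel) / 2"
proof -
  note e = lift_energy[OF adm_opt_real opt_real_mass g]
  let ?h = "\<lambda>z w. lift g w * ln (norm (z - w))"
  have cp: "(\<lambda>(z, w). ?h z w) = (\<lambda>z. ?h (fst z) (snd z))" by auto
  have i: "integrable (circ \<Otimes>\<^sub>M circ) (\<lambda>(z, w). ?h z w)" using e(2) by (simp add: lift_opt cp)
  have "circ_mirror.B (lift (opt 0 1 Copt)) (lift g) = (\<integral>(z, w). ?h z w \<partial>(circ \<Otimes>\<^sub>M circ))"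
    by (simp add: circ_mirror.B_def lift_opt cp)
  also have "\<dots> = (\<integral>w. (\<integral>z. ?h z w \<partial>circ) \<partial>circ)"
    by (rule circ_pair.integral_snd[OF i, symmetric])
  also have "\<dots> = (\<integral>w. 0 \<partial>circ)"
    using circ_densD(1)[OF lift_dens(1)[OF g(1)]] AE_circ_norm
    by (intro integral_cong_AE) (auto simp: integral_circ_ln_shift elim!: eventually_mono)
  finally have "circ_mirror.B (lift (opt 0 1 Copt)) (lift g) = 0" by simp
  then show ?thesis using e(1) opt_real_kappa by simp
qed

lemma AE_affine:
  fixes P :: "'a::euclidean_space \<Rightarrow> bool"
  assumes c: "c > 0" and P: "AE x in lborel. P x"
  shows "AE x in lborel. P (t + c *\<^sub>R x)"
proof -
  have eq: "lborel = density (distr lborel borel (\<lambda>x::'a. t + c *\<^sub>R x)) (\<lambda>_. ennreal (c ^ DIM('a)))"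
    using lborel_affine[of c t] c by simp
  have "AE x in density (distr lborel borel (\<lambda>x::'a. t + c *\<^sub>R x)) (\<lambda>_. ennreal (c ^ DIM('a))). P x"
    by (rule subst[OF eq, of "\<lambda>M. AE x in M. P x", OF P])
  then have "AE x in distr lborel borel (\<lambda>x::'a. t + c *\<^sub>R x). P x"
    by (subst (asm) AE_density) (use c in auto)
  then show ?thesis by (rule AE_distrD[rotated]) measurable
qed

lemma opt_of_rescale_AE:
  fixes f :: "'a::euclidean_space \<Rightarrow> real"
  assumes c: "c > 0" and ae: "AE x in lborel. rescale c t f x = opt 0 1 C x"
  shows "AE x in lborel. f x = opt t c C x"
proof -
  have ic: "1 / c > 0" using c by simp
  from AE_affine[OF ic ae, of "- ((1 / c) *\<^sub>R t)"] show ?thesis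
  proof eventually_elim
    fix x
    have x: "t + c *\<^sub>R (- ((1 / c) *\<^sub>R t) + (1 / c) *\<^sub>R x) = x" using c by (simp only: scaleR_add_right) simp
    assume "rescale c t f (- ((1 / c) *\<^sub>R t) + (1 / c) *\<^sub>R x) = opt 0 1 C (- ((1 / c) *\<^sub>R t) + (1 / c) *\<^sub>R x)"
    then have "(1 / c) ^ DIM('a) * (c ^ DIM('a) * f x) = opt t c C x"
      unfolding opt_rescale[OF c] by (simp only: rescale_def x)
    then show "f x = opt t c C x" using c by (simp add: power_divide)
  qed
qed

text \<open>Translate the median \<open>c\<close> of \<open>f\<close> to 0 and dilate so that the
  median \<open>b\<close> of \<open>|x - c|\<close> becomes 1. Under \<open>stereo\<close> the
  points \<open>x = 0\<close> and \<open>|x| = 1\<close> correspond to \<open>Im z = 0\<close> and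
  \<open>Re z = 0\<close>, so both mirrors bisect the lifted mass and the lift must be
  constant.\<close>

lemma logJ_real_eq:
  assumes f: "adm f" "(\<integral>x. f x \<partial>(lborel :: real measure)) = 1" and eq: "logJ f f = ln 2 + ln pi"
  shows "\<exists>a b. 0 < b \<and> (AE x in lborel. f x = opt a b Copt x)"
proof -
  note fm [measurable] = admD(1)[OF f(1)]
  have fpos: "(\<integral>x. f x \<partial>lborel) > 0" using f(2) by simp
  have lev: "AE x in lborel. x \<noteq> (s::real)" for s by (rule AE_lborel_singleton)
  obtain c where c: "(\<integral>x. sgn (x - c) * f x \<partial>lborel) = 0"
    using bisection[OF admD(3)[OF f(1)], of "\<lambda>x. x"] lev fpos by auto
  have labs: "AE x in lborel. \<bar>x - c\<bar> \<noteq> s" for s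
    using lev[of "c + s"] lev[of "c - s"] by eventually_elim auto
  obtain b where b: "(\<integral>x. sgn (\<bar>x - c\<bar> - b) * f x \<partial>lborel) = 0"
    using bisection[OF admD(3)[OF f(1)], of "\<lambda>x. \<bar>x - c\<bar>"] labs fpos by auto
  \<comment> \<open>Otherwise the sign would be 1 almost everywhere, and the integral would be the
    whole mass.\<close>
  have b0: "b > 0"
  proof (rule ccontr)
    assume nb: "\<not> b > 0"
    have "(\<integral>x. sgn (\<bar>x - c\<bar> - b) * f x \<partial>lborel) = (\<integral>x. f x \<partial>lborel)"
    proof (rule integral_cong_AE)
      show "AE x in lborel. sgn (\<bar>x - c\<bar> - b) * f x = f x"
        using lev[of c]
      proof eventually_elim
        fix x assume "x \<noteq> c"
        then have "\<bar>x - c\<bar> - b > 0" using nb by auto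
        then show "sgn (\<bar>x - c\<bar> - b) * f x = f x" by simp
      qed
    qed auto
    then show False using b f(2) by simp
  qed
  let ?g = "rescale b c f"
  note g = adm_rescale(1,2)[OF b0 f(1), of c]
  note gm [measurable] = admD(1)[OF g(1)]
  have g1: "(\<integral>x. ?g x \<partial>lborel) = 1" using g(2) f(2) by simp
  have bis1: "(\<integral>x. sgn x * ?g x \<partial>lborel) = 0"
  proof -
    have "(\<integral>x. ?g x * sgn ((c + b *\<^sub>R x) - c) \<partial>lborel) = (\<integral>x. f x * sgn (x - c) \<partial>lborel)"
      by (rule integral_rescale(1)[OF b0]) auto
    moreover have "sgn ((c + b *\<^sub>R x) - c) = sgn x" for x using b0 by (simp add: sgn_mult)
    ultimately show ?thesis using c by (simp add: mult.commute)
  qed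
  have bis2: "(\<integral>x. sgn (\<bar>x\<bar> - 1) * ?g x \<partial>lborel) = 0"
  proof -
    have "(\<integral>x. ?g x * sgn (\<bar>(c + b *\<^sub>R x) - c\<bar> - b) \<partial>lborel) = (\<integral>x. f x * sgn (\<bar>x - c\<bar> - b) \<partial>lborel)"
      by (rule integral_rescale(1)[OF b0]) auto
    moreover have "sgn (\<bar>(c + b *\<^sub>R x) - c\<bar> - b) = sgn (\<bar>x\<bar> - 1)" for x
    proof -
      have "\<bar>(c + b *\<^sub>R x) - c\<bar> - b = b * (\<bar>x\<bar> - 1)" using b0 by (simp add: abs_mult algebra_simps)
      then show ?thesis using b0 by (simp only: sgn_mult) simp
    qed
    ultimately show ?thesis using b by (simp add: mult.commute)
  qed
  let ?F = "lift ?g"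
  note F = lift_dens[OF g(1)]
  have "logJ ?g ?g = ln 2 + ln pi" using logJ_rescale[OF b0 f] eq by simp
  then have ext: "- circ_mirror.B ?F ?F = circ_ent ?F" using logJ_lift[OF g(1) g1] by simp
  have "AE z in circ. ?F z = 1"
  proof (rule circ_extremal_constant[OF F(1) _ ext])
    show "(\<integral>z. ?F z \<partial>circ) = 1" using F(2) g1 by simp
    have "(\<integral>z. sgn (Im z) * ?F z \<partial>circ) = (\<integral>z. (sgn (stereo z) * ?g (stereo z)) * cw (stereo z) \<partial>circ)"
    proof (rule integral_cong_AE)
      show "AE z in circ. sgn (Im z) * ?F z = (sgn (stereo z) * ?g (stereo z)) * cw (stereo z)"
        using AE_circ_unit by eventually_elim (auto simp: lift_def stereo_def sgn_divide unit_circle_facts(1))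
    qed (use circ_densD(1)[OF F(1)] in auto)
    also have "\<dots> = 0" using bis1 by (subst integral_stereo(1)) auto
    finally show "(\<integral>z. sgn (Im z) * ?F z \<partial>circ) = 0" .
    have "(\<integral>z. sgn (Re z) * ?F z \<partial>circ) = (\<integral>z. (- sgn (\<bar>stereo z\<bar> - 1) * ?g (stereo z)) * cw (stereo z) \<partial>circ)"
    proof (rule integral_cong_AE)
      show "AE z in circ. sgn (Re z) * ?F z = (- sgn (\<bar>stereo z\<bar> - 1) * ?g (stereo z)) * cw (stereo z)"
        using AE_circ_unit
      proof eventually_elim
        fix z :: complex assume "norm z = 1 \<and> z \<noteq> - 1"
        then have z: "norm z = 1" "z \<noteq> -1" by auto
        note u = unit_circle_facts[OF z]
        \<comment> \<open>Hence \<open>|stereo z| > 1\<close> exactly when \<open>Re z < 0\<close>,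
          which turns the median of \<open>|x|\<close> into the mirror
          \<open>Re z = 0\<close>.\<close>
        have "(stereo z)\<^sup>2 - 1 = - 2 * Re z / (1 + Re z)" using u(1,2) by (simp add: field_simps)
        moreover have "(stereo z)\<^sup>2 - 1 = (\<bar>stereo z\<bar> - 1) * (\<bar>stereo z\<bar> + 1)"
          by (simp add: power2_eq_square algebra_simps flip: abs_mult)
        ultimately have "sgn (\<bar>stereo z\<bar> - 1) * sgn (\<bar>stereo z\<bar> + 1) = sgn (- 2 * Re z / (1 + Re z))"
          by (metis sgn_mult)
        moreover have "sgn (\<bar>stereo z\<bar> + 1) = 1" by (simp add: add_nonneg_pos)
        moreover have "sgn (- 2 * Re z / (1 + Re z)) = - sgn (Re z)" using u(1) by (simp add: sgn_divide sgn_mult)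
        ultimately have "sgn (Re z) = - sgn (\<bar>stereo z\<bar> - 1)" by simp
        then show "sgn (Re z) * ?F z = (- sgn (\<bar>stereo z\<bar> - 1) * ?g (stereo z)) * cw (stereo z)" by (simp add: lift_def)
      qed
    qed (use circ_densD(1)[OF F(1)] in auto)
    also have "\<dots> = 0" using bis2 by (subst integral_stereo(1)) auto
    finally show "(\<integral>z. sgn (Re z) * ?F z \<partial>circ) = 0" .
  qed
  then have "AE z in circ. ?g (stereo z) = opt 0 1 Copt (stereo z)"
    by eventually_elim (use cw_pos in \<open>simp add: lift_def opt_real field_simps less_imp_neq[symmetric]\<close>)
  then have "AE x in distr circ borel stereo. ?g x = opt 0 1 Copt x"
    using admD(1)[OF adm_opt_real] by (subst AE_distr_iff) auto
  then have "AE x in lborel. ?g x = opt 0 1 Copt x"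
    unfolding distr_stereo by (subst (asm) AE_density) (use cw_pos in auto)
  from opt_of_rescale_AE[OF b0 this] b0 show ?thesis by blast
qed

lemma log_HLS_real:
  fixes f g :: "real \<Rightarrow> real"
  assumes f: "adm f" "(\<integral>x. f x \<partial>lborel) = 1" and g: "adm g" "(\<integral>x. g x \<partial>lborel) = 1"
  shows "logJ f g \<le> ln 2 + ln pi \<and> (logJ f g = ln 2 + ln pi \<longleftrightarrow>
    (\<exists>a b. 0 < b \<and> (AE x in lborel. f x = opt a b (1 / pi) x \<and> g x = opt a b (1 / pi) x)))"
proof -
  have H: "(2 * ln 2) / 2 - ln Copt / real DIM(real) = ln 2 + ln pi" by (simp add: ln_div)
  show ?thesis
    using logHLS_from_standard[of Copt "2 * ln 2" f g, unfolded H] opt_real_mass opt_real_kappa opt_real_potential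
      logJ_real_le logJ_real_eq f g by simp
qed

section \<open>Symmetrization in the plane\<close>

lemma logJ_complex: "logJ f f = - logE f f - entS f / 2" for f :: "complex \<Rightarrow> real"
  by (simp add: logJ_def)

lemma isometry_complex:
  fixes f :: "complex \<Rightarrow> real" and T :: "complex \<Rightarrow> complex"
  assumes L: "linear T" "\<And>z. norm (T z) = norm z" and f: "adm f"
  shows "adm (\<lambda>x. f (T x))" "(\<integral>x. f (T x) \<partial>lborel) = (\<integral>x. f x \<partial>lborel)"
    "logJ (\<lambda>x. f (T x)) (\<lambda>x. f (T x)) = logJ f f"
proof -
  have m: "T \<in> borel_measurable borel"
    using L(1) by (intro borel_measurable_continuous_onI linear_continuous_on linear_conv_bounded_linear[THEN iffD1])
  have "norm (T x - T y) = norm (x - y)" for x y using L(2)[of "x - y"] by (simp add: linear_diff[OF L(1)])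
  note i = isometry_invariance[OF m lborel_distr_linear_isometry[OF L] this L(2) f f]
  show "adm (\<lambda>x. f (T x))" "(\<integral>x. f (T x) \<partial>lborel) = (\<integral>x. f x \<partial>lborel)" by (rule i)+
  show "logJ (\<lambda>x. f (T x)) (\<lambda>x. f (T x)) = logJ f f" using i(3,4) by (simp add: logJ_def)
qed

lemma linear_mult_i: "linear ((*) \<i>)" "norm (\<i> * z) = norm z"
  by (auto intro!: linearI simp: algebra_simps norm_mult)

text \<open>The sum of \<open>logJ\<close> over the two symmetrizations is at least twice
  \<open>logJ f f\<close>, so a bound for both of them bounds \<open>f\<close>.\<close>

lemma symmetrization_step:
  fixes f :: "complex \<Rightarrow> real"
  assumes f: "adm f" "(\<integral>x. f x \<partial>lborel) = 1" and bis: "(\<integral>x. sgn (Re x) * f x \<partial>lborel) = 0"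
    and le: "\<And>s. s = symm 1 f \<or> s = symm (-1) f \<Longrightarrow> adm s \<Longrightarrow> (\<integral>x. s x \<partial>lborel) = 1 \<Longrightarrow> logJ s s \<le> H"
  shows "logJ f f \<le> H"
proof -
  note s = adm_symm[OF f(1) bis]
  have "logJ (symm 1 f) (symm 1 f) \<le> H" "logJ (symm (-1) f) (symm (-1) f) \<le> H"
    using le s f(2) by auto
  then show ?thesis
    using reflection_positivity[OF f(1) bis] s(5) unfolding logJ_complex by linarith
qed

lemma recentre_Re:
  fixes f :: "complex \<Rightarrow> real"
  assumes f: "adm f" "(\<integral>x. f x \<partial>lborel) = 1"
  shows "\<exists>c::real. (\<integral>x. sgn (Re x - c) * f x \<partial>lborel) = 0"
  using bisection[OF admD(3)[OF f(1)], of Re] AE_Re_nonzero f(2) by auto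

lemma shift_sgn:
  fixes f :: "complex \<Rightarrow> real" and r :: "complex \<Rightarrow> real"
  assumes f: "adm f" and [measurable]: "r \<in> borel_measurable borel" and r: "\<And>x. r (t + x) = r x + c"
  shows "(\<integral>x. sgn (r x) * rescale 1 t f x \<partial>lborel) = (\<integral>x. sgn (r x - c) * f x \<partial>lborel)"
proof -
  note [measurable] = admD(1)[OF f]
  have "(\<integral>x. rescale 1 t f x * sgn (r (t + 1 *\<^sub>R x) - c) \<partial>lborel) = (\<integral>x. f x * sgn (r x - c) \<partial>lborel)"
    by (rule integral_rescale(1)) auto
  then show ?thesis by (simp add: r mult.commute)
qed

text \<open>Symmetrize in a vertical bisecting line, turn by a quarter so that the symmetry becomes
  conjugation, and symmetrize in a vertical bisecting line again. The second step preserves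
  conjugation symmetry, and the two reflections compose to \<open>x \<mapsto> - x\<close>.\<close>

lemma reduce_to_even:
  fixes H :: real
  assumes ev: "\<And>w::complex \<Rightarrow> real. adm w \<Longrightarrow> (\<integral>x. w x \<partial>lborel) = 1 \<Longrightarrow> (\<And>x. w (- x) = w x) \<Longrightarrow> logJ w w \<le> H"
    and f: "adm f" "(\<integral>x. f x \<partial>(lborel :: complex measure)) = 1"
  shows "logJ f f \<le> H"
proof -
  \<comment> \<open>The second step. The recentring translation is real, so it respects conjugation
    symmetry.\<close>
  have A: "logJ v v \<le> H" if v: "adm v" "(\<integral>x. v x \<partial>lborel) = 1" "\<And>x. v (cnj x) = v x" for v
  proof -
    obtain c where c: "(\<integral>x. sgn (Re x - c) * v x \<partial>lborel) = 0" using recentre_Re[OF v(1,2)] by blast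
    let ?v = "rescale 1 (of_real c) v"
    note r = adm_rescale(1,2)[OF zero_less_one v(1), of "of_real c"]
    have sym: "?v (cnj x) = ?v x" for x using v(3)[of "of_real c + x"] by (simp add: rescale_def)
    have bis: "(\<integral>x. sgn (Re x) * ?v x \<partial>lborel) = 0"
      using c by (subst shift_sgn[OF v(1), where c=c]) auto
    have "logJ ?v ?v \<le> H"
    proof (rule symmetrization_step[OF r(1) _ bis])
      show "(\<integral>x. ?v x \<partial>lborel) = 1" using r(2) v(2) by simp
      fix s assume s: "s = symm 1 ?v \<or> s = symm (- 1) ?v" "adm s" "(\<integral>x. s x \<partial>lborel) = 1"
      have mc: "mirror (cnj x) = cnj (mirror x)" for x by (simp add: mirror_def)
      have "symm k ?v (- x) = symm k ?v x" for k x
      proof -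
        have "symm k ?v (cnj (mirror x)) = symm k ?v (mirror x)"
          unfolding symm_def even_part_def odd_part_def mc sym by simp
        moreover have "cnj (mirror x) = - x" by (simp add: mirror_def)
        ultimately show ?thesis by (simp add: symm_mirror)
      qed
      then show "logJ s s \<le> H" using s by (intro ev) auto
    qed
    then show ?thesis using logJ_rescale[OF zero_less_one v(1,2)] by simp
  qed
  obtain c where c: "(\<integral>x. sgn (Re x - c) * f x \<partial>lborel) = 0" using recentre_Re[OF f] by blast
  let ?f = "rescale 1 (of_real c) f"
  note r = adm_rescale(1,2)[OF zero_less_one f(1), of "of_real c"]
  have bis: "(\<integral>x. sgn (Re x) * ?f x \<partial>lborel) = 0"
    using c by (subst shift_sgn[OF f(1), where c=c]) auto
  have "logJ ?f ?f \<le> H"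
  proof (rule symmetrization_step[OF r(1) _ bis])
    show "(\<integral>x. ?f x \<partial>lborel) = 1" using r(2) f(2) by simp
    fix s assume s: "s = symm 1 ?f \<or> s = symm (- 1) ?f" "adm s" "(\<integral>x. s x \<partial>lborel) = 1"
    note i = isometry_complex[OF linear_mult_i s(2)]
    have "logJ (\<lambda>x. s (\<i> * x)) (\<lambda>x. s (\<i> * x)) \<le> H"
    proof (rule A)
      fix x
      have "\<i> * cnj x = mirror (\<i> * x)" by (simp add: mirror_def)
      then show "s (\<i> * cnj x) = s (\<i> * x)" using s(1) symm_mirror by metis
    qed (use i s in auto)
    then show "logJ s s \<le> H" using i(3) by simp
  qed
  then show ?thesis using logJ_rescale[OF zero_less_one f] by simp
qed

text \<open>Polarization keeps mass and entropy and cannot raise \<open>logE\<close>; by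
  \<open>diag\<close> it cannot lower it either, which is the equality case.\<close>

lemma extremal_mirror:
  fixes f :: "complex \<Rightarrow> real"
  assumes diag: "\<And>f::complex \<Rightarrow> real. adm f \<Longrightarrow> (\<integral>x. f x \<partial>lborel) = 1 \<Longrightarrow> logJ f f \<le> H"
    and f: "adm f" "(\<integral>x. f x \<partial>lborel) = 1" and eq: "logJ f f = H" and bis: "(\<integral>x. sgn (Re x) * f x \<partial>lborel) = 0"
  shows "AE x in lborel. f (mirror x) = f x"
proof -
  note ctx = admD(1)[OF f(1)] admD(2)[OF f(1)] admD(3)[OF f(1)] adm_ker_int[OF f(1)]
  note p = adm_polarize[OF f(1)]
  have BE: "lborel_mirror.B u v = logE u v" for u v by (simp add: lborel_mirror.B_def logE_def)
  have "logJ (polarize f) (polarize f) \<le> logJ f f" using diag[OF p(1)] p(2) f(2) eq by simp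
  then have "logE f f \<le> logE (polarize f) (polarize f)" using p(3) unfolding logJ_complex by simp
  moreover have "logE (polarize f) (polarize f) \<le> logE f f"
    using lborel_mirror.polarization(1)[OF ctx] unfolding BE .
  ultimately have "lborel_mirror.B (polarize f) (polarize f) = lborel_mirror.B f f" unfolding BE by simp
  then show ?thesis by (rule lborel_mirror.polarization(2)[OF ctx _ bis])
qed

text \<open>The symmetrized functions of \<open>reduce_to_even\<close> say nothing about
  \<open>f\<close> itself. Here \<open>f\<close> is translated once, so that both axes bisect its
  mass, and each axis is a mirror by extremality; composing the reflections gives the point
  symmetry.\<close>

lemma extremal_even:
  fixes f :: "complex \<Rightarrow> real"
  assumes diag: "\<And>f::complex \<Rightarrow> real. adm f \<Longrightarrow> (\<integral>x. f x \<partial>lborel) = 1 \<Longrightarrow> logJ f f \<le> H"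
    and f: "adm f" "(\<integral>x. f x \<partial>lborel) = 1" and eq: "logJ f f = H"
  shows "\<exists>t. AE x in lborel. rescale 1 t f (- x) = rescale 1 t f x"
proof -
  obtain c where c: "(\<integral>x. sgn (Re x - c) * f x \<partial>lborel) = 0" using recentre_Re[OF f] by blast
  let ?u = "\<lambda>x. f (\<i> * x)"
  note u = isometry_complex[OF linear_mult_i f(1)]
  obtain d where d: "(\<integral>x. sgn (Re x - d) * ?u x \<partial>lborel) = 0" using recentre_Re[OF u(1)] u(2) f(2) by auto
  \<comment> \<open>Its real part is the median of \<open>f\<close> along \<open>Re\<close>. Its
    imaginary part is that of the rotated function \<open>?u\<close>, so that after the translation
    the real axis bisects as well.\<close>
  define t where "t = of_real c + \<i> * of_real d"
  let ?g = "rescale 1 t f"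
  note g = adm_rescale(1,2)[OF zero_less_one f(1), of t]
  have g1: "(\<integral>x. ?g x \<partial>lborel) = 1" using g(2) f(2) by simp
  have gH: "logJ ?g ?g = H" using logJ_rescale[OF zero_less_one f] eq by simp
  have "(\<integral>x. sgn (Re x) * ?g x \<partial>lborel) = 0"
    using c by (subst shift_sgn[OF f(1), where c=c]) (auto simp: t_def)
  from extremal_mirror[OF diag g(1) g1 gH this] have s1: "AE x in lborel. ?g (mirror x) = ?g x" .
  let ?w = "\<lambda>x. ?g (\<i> * x)"
  note w = isometry_complex[OF linear_mult_i g(1)]
  have wu: "?w x = rescale 1 (of_real d - \<i> * of_real c) ?u x" for x
    by (simp add: rescale_def t_def algebra_simps)
  have "(\<integral>x. sgn (Re x) * ?w x \<partial>lborel) = 0"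
    unfolding wu using d by (subst shift_sgn[OF u(1), where c=d]) auto
  from extremal_mirror[OF diag w(1) _ _ this] have "AE x in lborel. ?w (mirror x) = ?w x"
    using w(2,3) g1 gH by simp
  then have "AE x in lborel. ?w (mirror (- \<i> * x)) = ?w (- \<i> * x)"
  proof -
    assume ae: "AE x in lborel. ?w (mirror x) = ?w x"
    have "distr lborel borel ((*) (- \<i>)) = (lborel :: complex measure)" by (rule lborel_distr_rotate) simp
    then have "AE x in distr lborel borel ((*) (- \<i>)). ?w (mirror x) = ?w x" using ae by (simp only:)
    then show ?thesis by (rule AE_distrD[rotated]) measurable
  qed
  then have "AE x in lborel. ?g (cnj x) = ?g x" by (simp add: mirror_def)
  then have "AE x in distr lborel borel mirror. ?g (cnj x) = ?g x" by (simp only: lborel_distr_mirror)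
  then have "AE x in lborel. ?g (cnj (mirror x)) = ?g (mirror x)" by (rule AE_distrD[rotated]) simp
  with s1 have "AE x in lborel. ?g (- x) = ?g x" by eventually_elim (simp add: mirror_def)
  then show ?thesis by blast
qed

section \<open>A sharp inequality for densities on the half-line\<close>

text \<open>\<open>- ln X\<close> is the integral of \<open>1 / t\<close> over \<open>t\<close>
  between \<open>X\<close> and 1. After exchanging the integrals, \<open>P\<close> cancels the
  factor \<open>1 / t\<close> and leaves the length of the unit interval.\<close>

lemma (in prob_space) uniform_ln:
  assumes [measurable]: "X \<in> borel_measurable M" and le1: "AE \<omega> in M. X \<omega> \<le> 1"
    and P: "\<And>t. 0 < t \<Longrightarrow> t < 1 \<Longrightarrow> prob {\<omega> \<in> space M. X \<omega> \<le> t} = t"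
  shows "AE \<omega> in M. 0 < X \<omega>" "integrable M (\<lambda>\<omega>. ln (X \<omega>))" "(\<integral>\<omega>. ln (X \<omega>) \<partial>M) = -1"
proof -
  have "prob {\<omega> \<in> space M. X \<omega> \<le> 0} \<le> t" if "0 < t" "t < 1" for t
  proof -
    have "prob {\<omega> \<in> space M. X \<omega> \<le> 0} \<le> prob {\<omega> \<in> space M. X \<omega> \<le> t}"
      using that by (intro finite_measure_mono) auto
    then show ?thesis using P that by simp
  qed
  then have "prob {\<omega> \<in> space M. X \<omega> \<le> 0} \<le> 0" by (intro dense_ge_bounded[of 0 1]) auto
  then have z: "prob {\<omega> \<in> space M. X \<omega> \<le> 0} = 0"
    using measure_nonneg[of M "{\<omega> \<in> space M. X \<omega> \<le> 0}"] by linarith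
  have "{\<omega> \<in> space M. X \<omega> \<le> 0} \<in> sets M" by measurable
  from prob_eq_0[OF this] z have "AE \<omega> in M. \<omega> \<notin> {\<omega> \<in> space M. X \<omega> \<le> 0}" by blast
  with AE_space show pos: "AE \<omega> in M. 0 < X \<omega>"
  proof eventually_elim
    case (elim \<omega>)
    then show ?case by (cases "X \<omega> \<le> 0") simp_all
  qed
  have "(\<integral>\<^sup>+\<omega>. ennreal (- ln (X \<omega>)) \<partial>M)
      = (\<integral>\<^sup>+\<omega>. (\<integral>\<^sup>+t. ennreal (1 / t) * indicator {0<..<1} t * indicator {X \<omega>..} t \<partial>lborel) \<partial>M)"
  proof (rule nn_integral_cong_AE)
    show "AE \<omega> in M. ennreal (- ln (X \<omega>))
        = (\<integral>\<^sup>+t. ennreal (1 / t) * indicator {0<..<1} t * indicator {X \<omega>..} t \<partial>lborel)"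
      using pos le1
    proof eventually_elim
      case (elim \<omega>)
      have "(\<integral>\<^sup>+t. ennreal (1 / t) * indicator {0<..<1} t * indicator {X \<omega>..} t \<partial>lborel)
          = (\<integral>\<^sup>+t. ennreal (1 / t) * indicator {X \<omega>..1} t \<partial>lborel)"
        by (rule nn_integral_cong_AE, rule AE_mp[OF AE_lborel_singleton[of 1]], rule AE_I2) (use elim in \<open>auto split: split_indicator\<close>)
      also have "\<dots> = ennreal (ln 1 - ln (X \<omega>))"
        using elim by (intro nn_integral_FTC_Icc) (auto intro!: derivative_eq_intros simp: field_simps)
      finally show ?case by simp
    qed
  qed
  also have "\<dots> = (\<integral>\<^sup>+t. (\<integral>\<^sup>+\<omega>. ennreal (1 / t) * indicator {0<..<1} t * indicator {X \<omega>..} t \<partial>M) \<partial>lborel)"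
  proof -
    interpret pair_sigma_finite M "lborel :: real measure" by unfold_locales
    have eq: "indicator {X \<omega>..} t = (if X \<omega> \<le> t then 1 else 0 :: ennreal)" for \<omega> and t :: real by (auto split: split_indicator)
    show ?thesis unfolding eq by (intro Fubini'[symmetric]) measurable
  qed
  also have "\<dots> = (\<integral>\<^sup>+t. indicator {0<..<1} t \<partial>(lborel :: real measure))"
  proof (rule nn_integral_cong)
    fix t :: real
    have "(\<integral>\<^sup>+\<omega>. ennreal (1 / t) * indicator {0<..<1} t * indicator {X \<omega>..} t \<partial>M)
       = (\<integral>\<^sup>+\<omega>. ennreal (1 / t) * indicator {0<..<1} t * indicator {\<omega> \<in> space M. X \<omega> \<le> t} \<omega> \<partial>M)"
      by (intro nn_integral_cong) (auto split: split_indicator)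
    also have "\<dots> = ennreal (1 / t) * indicator {0<..<1} t * emeasure M {\<omega> \<in> space M. X \<omega> \<le> t}"
      by (subst nn_integral_cmult_indicator) auto
    also have "\<dots> = indicator {0<..<1} t"
      using P[of t] by (auto simp: emeasure_eq_measure ennreal_mult''[symmetric] split: split_indicator)
    finally show "(\<integral>\<^sup>+\<omega>. ennreal (1 / t) * indicator {0<..<1} t * indicator {X \<omega>..} t \<partial>M) = indicator {0<..<1} t" .
  qed
  also have "\<dots> = 1" by simp
  finally have *: "(\<integral>\<^sup>+\<omega>. ennreal (- ln (X \<omega>)) \<partial>M) = ennreal 1" by simp
  have nn: "AE \<omega> in M. 0 \<le> - ln (X \<omega>)" using pos le1 by eventually_elim simp
  have "has_bochner_integral M (\<lambda>\<omega>. - ln (X \<omega>)) 1"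
    by (rule has_bochner_integral_nn_integral[OF _ nn _ *]) auto
  then have "has_bochner_integral M (\<lambda>\<omega>. - (- ln (X \<omega>))) (- 1)" by (rule has_bochner_integral_minus)
  then show "integrable M (\<lambda>\<omega>. ln (X \<omega>))" "(\<integral>\<omega>. ln (X \<omega>) \<partial>M) = -1"
    by (auto simp: has_bochner_integral_iff)
qed

locale positive_density =
  fixes \<rho> :: "real \<Rightarrow> real"
  assumes meas[measurable]: "\<rho> \<in> borel_measurable borel" and nonneg: "\<And>v. 0 \<le> \<rho> v"
    and supp: "\<And>v. v \<le> 0 \<Longrightarrow> \<rho> v = 0"
    and int: "integrable lborel \<rho>" and mass: "(\<integral>v. \<rho> v \<partial>lborel) = 1"
begin

definition "law = density lborel (\<lambda>v. ennreal (\<rho> v))"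

lemma sets_law[measurable_cong]: "sets law = sets borel" by (simp add: law_def)

lemma nn_integral_density_one: "(\<integral>\<^sup>+v. ennreal (\<rho> v) \<partial>lborel) = 1"
  using nn_integral_eq_integral[OF int] nonneg mass by simp

lemma real_distribution_law: "real_distribution law"
proof -
  have "prob_space law"
    by (intro prob_spaceI) (simp add: law_def emeasure_density nn_integral_density_one)
  then show ?thesis by (intro real_distribution.intro real_distribution_axioms.intro) (simp_all add: sets_law)
qed

sublocale L: real_distribution law by (rule real_distribution_law)

definition "M = cdf law"

lemma M_cont: "isCont M v"
proof -
  have "emeasure law {v} = 0"
    unfolding law_def using AE_lborel_singleton[of v]
    by (subst emeasure_density) (auto simp: nn_integral_0_iff_AE elim!: eventually_mono split: split_indicator)
  then show ?thesis unfolding M_def by (simp add: L.isCont_cdf measure_def)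
qed

lemma M_meas[measurable]: "M \<in> borel_measurable borel"
  by (intro borel_measurable_continuous_onI continuous_at_imp_continuous_on ballI M_cont)

lemma M_bounds: "0 \<le> M v" "M v \<le> 1" by (simp_all add: M_def L.cdf_nonneg L.cdf_bounded_prob)

lemma M_mono: "u \<le> v \<Longrightarrow> M u \<le> M v" by (simp add: M_def L.cdf_nondecreasing)

lemma emeasure_law: "A \<in> sets borel \<Longrightarrow> emeasure law A = (\<integral>\<^sup>+v. ennreal (\<rho> v) * indicator A v \<partial>lborel)"
  unfolding law_def by (subst emeasure_density) auto

lemma M_0: "M 0 = 0"
proof -
  have "(\<lambda>v. ennreal (\<rho> v) * indicator {..0} v) = (\<lambda>v. 0)" by (auto simp: supp split: split_indicator)
  then have "emeasure law {..0} = 0" by (subst emeasure_law) simp_all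
  then show ?thesis by (simp add: M_def cdf_def measure_def)
qed

lemma M_surj: "\<exists>v. M v = t" if "0 < t" "t < 1"
proof -
  have "eventually (\<lambda>v. M v < t) at_bot" "eventually (\<lambda>v. t < M v) at_top"
    unfolding M_def using L.cdf_lim_at_bot L.cdf_lim_at_top_prob that by (auto intro: order_tendstoD)
  then obtain a b where ab: "M a < t" "t < M b" by (meson eventually_at_bot_linorder eventually_at_top_linorder order_refl)
  then have "a \<le> b" using M_mono[of b a] by (cases "a \<le> b") auto
  then show ?thesis using IVT[of M a t b] ab M_cont by auto
qed

text \<open>The probability integral transform: a continuous distribution function is uniformly
  distributed under its own law. The second identity gives the same for the upper tail.\<close>

lemma law_M: "L.prob {v \<in> space law. M v \<le> t} = t" "L.prob {v \<in> space law. 1 - M v \<le> t} = t"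
  if t: "0 < t" "t < 1" for t
proof -
  have [simp]: "space law = UNIV" by (simp add: law_def)
  \<comment> \<open>\<open>M\<close> may be constant on intervals, so a point with
    \<open>M v = t\<close> need not bound the set \<open>M \<le> t\<close>; a point at a higher
    level \<open>s\<close> does, and \<open>s\<close> then decreases to \<open>t\<close>.\<close>
  have le: "L.prob {v. M v \<le> t} \<le> s" if st: "t < s" "s < 1" "0 < t" for s t :: real
  proof -
    obtain v where v: "M v = s" using M_surj[of s] st by force
    have "u \<le> v" if "M u \<le> t" for u
      using M_mono[of v u] that v \<open>t < s\<close> by (cases "u \<le> v") auto
    then have "L.prob {v. M v \<le> t} \<le> L.prob {..v}" by (intro L.finite_measure_mono) auto
    then show ?thesis using v by (simp add: M_def cdf_def)
  qed
  have ge: "t \<le> L.prob {v. M v \<le> t}" if t: "0 < t" "t < 1" for t :: real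
  proof -
    obtain v where v: "M v = t" using M_surj[of t] t by auto
    have "L.prob {..v} \<le> L.prob {v. M v \<le> t}"
      using v M_mono by (intro L.finite_measure_mono) auto
    then show ?thesis using v by (simp add: M_def cdf_def)
  qed
  have eq: "L.prob {v. M v \<le> t} = t" if t: "0 < t" "t < 1" for t :: real
  proof (rule antisym[OF _ ge[OF t]])
    show "L.prob {v. M v \<le> t} \<le> t" by (rule dense_ge_bounded[OF t(2)]) (rule le[OF _ _ t(1)])
  qed
  show "L.prob {v \<in> space law. M v \<le> t} = t" using eq[OF t] by simp
  have lt: "L.prob {v. M v < s} = s" if s: "0 < s" "s < 1" for s :: real
  proof (rule antisym)
    have "L.prob {v. M v < s} \<le> L.prob {v. M v \<le> s}" by (intro L.finite_measure_mono) auto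
    then show "L.prob {v. M v < s} \<le> s" using eq[OF s] by simp
    have "r \<le> L.prob {v. M v < s}" if "0 < r" "r < s" for r
    proof -
      have "L.prob {v. M v \<le> r} \<le> L.prob {v. M v < s}" using that by (intro L.finite_measure_mono) auto
      then show ?thesis using eq[of r] that s by simp
    qed
    then show "s \<le> L.prob {v. M v < s}" using s by (intro dense_le_bounded[of 0 s]) auto
  qed
  have "L.prob (space law - {v. M v < 1 - t}) = 1 - L.prob {v. M v < 1 - t}"
    by (rule L.prob_compl) simp
  moreover have "space law - {v. M v < 1 - t} = {v \<in> space law. 1 - M v \<le> t}" by auto
  ultimately show "L.prob {v \<in> space law. 1 - M v \<le> t} = t" using lt[of "1 - t"] t by simp
qed

lemma ln_M:
  "AE v in lborel. 0 < \<rho> v \<longrightarrow> 0 < M v \<and> M v < 1"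
  "integrable lborel (\<lambda>v. \<rho> v * ln (M v))" "(\<integral>v. \<rho> v * ln (M v) \<partial>lborel) = -1"
  "integrable lborel (\<lambda>v. \<rho> v * ln (1 - M v))" "(\<integral>v. \<rho> v * ln (1 - M v) \<partial>lborel) = -1"
proof -
  have m: "M \<in> borel_measurable law" "(\<lambda>v. 1 - M v) \<in> borel_measurable law" by measurable
  note a = L.uniform_ln[OF m(1) _ law_M(1)] and b = L.uniform_ln[OF m(2) _ law_M(2)]
  have "AE v in law. 0 < M v" "AE v in law. 0 < 1 - M v" using a(1) b(1) M_bounds by auto
  then have "AE v in law. 0 < M v \<and> M v < 1" by eventually_elim simp
  then show "AE v in lborel. 0 < \<rho> v \<longrightarrow> 0 < M v \<and> M v < 1"
    unfolding law_def by (subst (asm) AE_density) auto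
  have "integrable law (\<lambda>v. ln (M v))" "(\<integral>v. ln (M v) \<partial>law) = -1"
     "integrable law (\<lambda>v. ln (1 - M v))" "(\<integral>v. ln (1 - M v) \<partial>law) = -1"
    using a(2,3) b(2,3) M_bounds by auto
  then show "integrable lborel (\<lambda>v. \<rho> v * ln (M v))" "(\<integral>v. \<rho> v * ln (M v) \<partial>lborel) = -1"
     "integrable lborel (\<lambda>v. \<rho> v * ln (1 - M v))" "(\<integral>v. \<rho> v * ln (1 - M v) \<partial>lborel) = -1"
    unfolding law_def by (auto simp: integrable_density integral_density nonneg)
qed

lemma nn_M: "(\<integral>\<^sup>+a. ennreal (\<rho> a) * indicator {..v} a \<partial>lborel) = ennreal (M v)"
    "(\<integral>\<^sup>+a. ennreal (\<rho> a) * indicator {v<..} a \<partial>lborel) = ennreal (1 - M v)"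
proof -
  show "(\<integral>\<^sup>+a. ennreal (\<rho> a) * indicator {..v} a \<partial>lborel) = ennreal (M v)"
    by (subst emeasure_law[symmetric]) (auto simp: M_def cdf_def L.emeasure_eq_measure)
  have "space law - {..v} = {v<..}" by (auto simp: law_def)
  then have "L.prob {v<..} = 1 - M v" using L.prob_compl[of "{..v}"] by (simp add: M_def cdf_def)
  then show "(\<integral>\<^sup>+a. ennreal (\<rho> a) * indicator {v<..} a \<partial>lborel) = ennreal (1 - M v)"
    by (subst emeasure_law[symmetric]) (auto simp: L.emeasure_eq_measure)
qed

text \<open>The comparison density. Its mass need not be 1: by \<open>gap\<close> it is half the
  mean of \<open>|ln a - ln b|\<close> over independent pairs, and this is how the energy
  enters.\<close>

definition "dens v = (if v \<le> 0 then 0 else M v * (1 - M v) / v)"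

lemma dens_meas[measurable]: "dens \<in> borel_measurable borel" unfolding dens_def by measurable

lemma dens_nonneg: "0 \<le> dens v" using M_bounds[of v] by (simp add: dens_def)

lemma ln_gap:
  fixes a b :: real assumes "0 < a" "0 < b"
  shows "(\<integral>\<^sup>+v. ennreal (1 / v) * indicator {0<..} v * (indicator {..v} a * indicator {v<..} b) \<partial>lborel)
    = ennreal (ln b - ln a)"
proof (cases "a \<le> b")
  case True
  have "(\<integral>\<^sup>+v. ennreal (1 / v) * indicator {0<..} v * (indicator {..v} a * indicator {v<..} b) \<partial>lborel)
      = (\<integral>\<^sup>+v. ennreal (1 / v) * indicator {a..b} v \<partial>lborel)"
    by (rule nn_integral_cong_AE, rule AE_mp[OF AE_lborel_singleton[of b]], rule AE_I2) (use assms in \<open>auto split: split_indicator\<close>)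
  also have "\<dots> = ennreal (ln b - ln a)"
    using assms True by (intro nn_integral_FTC_Icc) (auto intro!: derivative_eq_intros simp: field_simps)
  finally show ?thesis .
next
  case False
  then have "ln b - ln a \<le> 0" using assms by simp
  moreover have z: "(indicator {..v} a * indicator {v<..} b :: ennreal) = 0" for v
    using False by (auto split: split_indicator)
  ultimately show ?thesis unfolding z by (simp add: ennreal_neg)
qed

text \<open>\<open>ln b - ln a\<close> is the integral of \<open>1 / v\<close> over \<open>v\<close>
  between \<open>a\<close> and \<open>b\<close>. Integrating \<open>a\<close> and \<open>b\<close>
  first separates them into \<open>M v\<close> and \<open>1 - M v\<close>. Conversion to
  \<open>ennreal\<close> cuts negative differences to zero, so only pairs with \<open>a < b\<close>
  count.\<close>

lemma nn_half_gap:
  "(\<integral>\<^sup>+a. (\<integral>\<^sup>+b. ennreal (\<rho> a) * ennreal (\<rho> b) * ennreal (ln b - ln a) \<partial>lborel) \<partial>lborel) = (\<integral>\<^sup>+v. ennreal (dens v) \<partial>lborel)"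
proof -
  let ?k = "\<lambda>v::real. ennreal (1 / v) * indicator {0<..} v"
  let ?i = "\<lambda>a v. if a \<le> v then 1 else 0 :: ennreal" and ?j = "\<lambda>b v. if v < b then 1 else 0 :: ennreal"
  have ind: "indicator {..v} a = ?i a v" "indicator {v<..} b = ?j b v" for a b v :: real by auto
  have "(\<integral>\<^sup>+a. (\<integral>\<^sup>+b. ennreal (\<rho> a) * ennreal (\<rho> b) * ennreal (ln b - ln a) \<partial>lborel) \<partial>lborel)
      = (\<integral>\<^sup>+a. (\<integral>\<^sup>+b. (\<integral>\<^sup>+v. ?k v * (ennreal (\<rho> a) * ?i a v) * (ennreal (\<rho> b) * ?j b v) \<partial>lborel) \<partial>lborel) \<partial>lborel)"
  proof (intro nn_integral_cong)
    fix a b :: real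
    have "(\<integral>\<^sup>+v. ?k v * (ennreal (\<rho> a) * ?i a v) * (ennreal (\<rho> b) * ?j b v) \<partial>lborel)
        = (\<integral>\<^sup>+v. (ennreal (\<rho> a) * ennreal (\<rho> b)) * (?k v * (indicator {..v} a * indicator {v<..} b)) \<partial>lborel)"
      unfolding ind by (intro nn_integral_cong) (simp add: mult_ac)
    also have "\<dots> = (ennreal (\<rho> a) * ennreal (\<rho> b)) * (\<integral>\<^sup>+v. ?k v * (indicator {..v} a * indicator {v<..} b) \<partial>lborel)"
      unfolding ind by (rule nn_integral_cmult) measurable
    also have "\<dots> = ennreal (\<rho> a) * ennreal (\<rho> b) * ennreal (ln b - ln a)"
    proof (cases "0 < a \<and> 0 < b")
      case True
      then show ?thesis by (simp only: ln_gap)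
    next
      case False
      then have "\<rho> a = 0 \<or> \<rho> b = 0" using supp by (metis not_less)
      then show ?thesis by (elim disjE) (simp_all only: ennreal_0 mult_zero_left mult_zero_right)
    qed
    finally show "ennreal (\<rho> a) * ennreal (\<rho> b) * ennreal (ln b - ln a)
       = (\<integral>\<^sup>+v. ?k v * (ennreal (\<rho> a) * ?i a v) * (ennreal (\<rho> b) * ?j b v) \<partial>lborel)" by simp
  qed
  also have "\<dots> = (\<integral>\<^sup>+a. (\<integral>\<^sup>+v. (\<integral>\<^sup>+b. ?k v * (ennreal (\<rho> a) * ?i a v) * (ennreal (\<rho> b) * ?j b v) \<partial>lborel) \<partial>lborel) \<partial>lborel)"
    by (intro nn_integral_cong lborel_pair.Fubini') measurable
  also have "\<dots> = (\<integral>\<^sup>+a. (\<integral>\<^sup>+v. ?k v * (ennreal (\<rho> a) * ?i a v) * ennreal (1 - M v) \<partial>lborel) \<partial>lborel)"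
    by (intro nn_integral_cong) (subst nn_integral_cmult, measurable, simp only: ind[symmetric] nn_M)
  also have "\<dots> = (\<integral>\<^sup>+v. (\<integral>\<^sup>+a. ?k v * (ennreal (\<rho> a) * ?i a v) * ennreal (1 - M v) \<partial>lborel) \<partial>lborel)"
    by (intro lborel_pair.Fubini') measurable
  also have "\<dots> = (\<integral>\<^sup>+v. ?k v * ennreal (M v) * ennreal (1 - M v) \<partial>lborel)"
    by (intro nn_integral_cong) (subst nn_integral_multc, measurable, subst nn_integral_cmult, measurable, simp only: ind[symmetric] nn_M)
  also have "\<dots> = (\<integral>\<^sup>+v. ennreal (dens v) \<partial>lborel)"
    by (intro nn_integral_cong)
      (use M_bounds in \<open>auto simp: dens_def ennreal_mult''[symmetric] ennreal_mult'[symmetric] split: split_indicator\<close>)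
  finally show ?thesis .
qed

lemma gap:
  assumes lnm: "integrable lborel (\<lambda>v. \<rho> v * ln v)"
  shows "integrable (lborel \<Otimes>\<^sub>M lborel) (\<lambda>z. \<rho> (fst z) * \<rho> (snd z) * \<bar>ln (fst z) - ln (snd z)\<bar>)" (is "integrable _ ?g")
    "integrable lborel dens"
    "2 * (\<integral>v. dens v \<partial>lborel) = (\<integral>z. \<rho> (fst z) * \<rho> (snd z) * \<bar>ln (fst z) - ln (snd z)\<bar> \<partial>(lborel \<Otimes>\<^sub>M lborel))"
proof -
  note i1 = lborel_pair.integrable_mult_pair(1)[OF lnm int]
  note i2 = lborel_pair.integrable_mult_pair(1)[OF int lnm]
  note i = Bochner_Integration.integrable_add[OF integrable_abs[OF i1] integrable_abs[OF i2]]
  show g: "integrable (lborel \<Otimes>\<^sub>M lborel) ?g"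
  proof (rule Bochner_Integration.integrable_bound[OF i])
    show "?g \<in> borel_measurable (lborel \<Otimes>\<^sub>M lborel)" by measurable
    have "\<rho> a * \<rho> b * \<bar>ln a - ln b\<bar> \<le> \<bar>\<rho> a * ln a * \<rho> b\<bar> + \<bar>\<rho> a * (\<rho> b * ln b)\<bar>" for a b
    proof -
      have "\<rho> a * \<rho> b * \<bar>ln a - ln b\<bar> \<le> \<rho> a * \<rho> b * (\<bar>ln a\<bar> + \<bar>ln b\<bar>)"
        using nonneg by (intro mult_left_mono) auto
      then show ?thesis using nonneg[of a] nonneg[of b] by (simp add: abs_mult algebra_simps)
    qed
    then show "AE z in lborel \<Otimes>\<^sub>M lborel. norm (?g z) \<le> norm (\<bar>\<rho> (fst z) * ln (fst z) * \<rho> (snd z)\<bar> + \<bar>\<rho> (fst z) * (\<rho> (snd z) * ln (snd z))\<bar>)"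
      using nonneg by (intro AE_I2) (auto simp: abs_mult)
  qed
  have abs: "ennreal \<bar>x\<bar> = ennreal x + ennreal (- x)" for x :: real
    by (cases "0 \<le> x") (auto simp: ennreal_neg)
  have "(\<integral>\<^sup>+z. ennreal (?g z) \<partial>(lborel \<Otimes>\<^sub>M lborel)) = (\<integral>\<^sup>+a. (\<integral>\<^sup>+b. ennreal (\<rho> a) * ennreal (\<rho> b) * ennreal (ln b - ln a)
       + ennreal (\<rho> b) * ennreal (\<rho> a) * ennreal (ln a - ln b) \<partial>lborel) \<partial>lborel)"
    by (subst lborel.nn_integral_fst[symmetric], measurable, intro nn_integral_cong)
      (use nonneg in \<open>simp add: ennreal_mult'' abs ennreal_mult' algebra_simps\<close>)
  also have "\<dots> = (\<integral>\<^sup>+a. (\<integral>\<^sup>+b. ennreal (\<rho> a) * ennreal (\<rho> b) * ennreal (ln b - ln a) \<partial>lborel) \<partial>lborel)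
       + (\<integral>\<^sup>+a. (\<integral>\<^sup>+b. ennreal (\<rho> b) * ennreal (\<rho> a) * ennreal (ln a - ln b) \<partial>lborel) \<partial>lborel)"
    by (subst nn_integral_add[symmetric], measurable, intro nn_integral_cong nn_integral_add) measurable
  also have "(\<integral>\<^sup>+a. (\<integral>\<^sup>+b. ennreal (\<rho> b) * ennreal (\<rho> a) * ennreal (ln a - ln b) \<partial>lborel) \<partial>lborel)
      = (\<integral>\<^sup>+a. (\<integral>\<^sup>+b. ennreal (\<rho> a) * ennreal (\<rho> b) * ennreal (ln b - ln a) \<partial>lborel) \<partial>lborel)"
    by (rule lborel_pair.Fubini') measurable
  finally have W: "(\<integral>\<^sup>+z. ennreal (?g z) \<partial>(lborel \<Otimes>\<^sub>M lborel)) = 2 * (\<integral>\<^sup>+v. ennreal (dens v) \<partial>lborel)"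
    unfolding nn_half_gap by (simp add: mult_2)
  have "(\<integral>\<^sup>+z. ennreal (?g z) \<partial>(lborel \<Otimes>\<^sub>M lborel)) = ennreal (\<integral>z. ?g z \<partial>(lborel \<Otimes>\<^sub>M lborel))"
    using nonneg by (intro nn_integral_eq_integral[OF g]) auto
  with W have W': "2 * (\<integral>\<^sup>+v. ennreal (dens v) \<partial>lborel) = ennreal (\<integral>z. ?g z \<partial>(lborel \<Otimes>\<^sub>M lborel))" by simp
  then have fin: "(\<integral>\<^sup>+v. ennreal (dens v) \<partial>lborel) < \<infinity>"
    by (cases "(\<integral>\<^sup>+v. ennreal (dens v) \<partial>lborel) = top") (simp_all add: ennreal_mult_top less_top)
  then show d: "integrable lborel dens" using dens_nonneg by (intro integrableI_nonneg) auto
  have "(\<integral>\<^sup>+v. ennreal (dens v) \<partial>lborel) = ennreal (\<integral>v. dens v \<partial>lborel)"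
    using dens_nonneg by (intro nn_integral_eq_integral[OF d]) auto
  moreover have "ennreal (2 * (\<integral>v. dens v \<partial>lborel)) = 2 * ennreal (\<integral>v. dens v \<partial>lborel)"
    by (subst ennreal_mult') simp_all
  ultimately have "ennreal (2 * (\<integral>v. dens v \<partial>lborel)) = ennreal (\<integral>z. ?g z \<partial>(lborel \<Otimes>\<^sub>M lborel))"
    using W' by (simp only:)
  moreover have "0 \<le> (\<integral>z. ?g z \<partial>(lborel \<Otimes>\<^sub>M lborel))" "0 \<le> 2 * (\<integral>v. dens v \<partial>lborel)"
    using nonneg dens_nonneg by (auto intro!: integral_nonneg_AE)
  ultimately show "2 * (\<integral>v. dens v \<partial>lborel) = (\<integral>z. ?g z \<partial>(lborel \<Otimes>\<^sub>M lborel))" by (subst (asm) ennreal_inj) auto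
qed

text \<open>\<open>\<rho> = dens\<close> holds only almost everywhere, but \<open>dens\<close> is
  continuous on the positive half-line because \<open>M\<close> is. So \<open>M\<close> agrees
  locally, up to a constant, with an antiderivative of \<open>dens\<close>.\<close>

lemma M_has_derivative:
  assumes ae: "AE v in lborel. \<rho> v = dens v" and x: "0 < x"
  shows "(M has_real_derivative M x * (1 - M x) / x) (at x)"
proof -
  let ?D = "\<lambda>v. M v * (1 - M v) / v"
  define a b where "a = x / 2" and "b = 2 * x"
  have ab: "0 < a" "a < x" "x < b" using x by (auto simp: a_def b_def)
  have "continuous_on {a / 2..2 * b} ?D"
    using ab by (intro continuous_intros continuous_at_imp_continuous_on ballI M_cont) auto
  \<comment> \<open>The interval is larger than \<open>{a..b}\<close>, so that one-sided derivatives
    at its ends do not interfere.\<close>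
  then obtain G where G0: "\<And>y. y \<in> {a / 2..2 * b} \<Longrightarrow> (G has_vector_derivative ?D y) (at y within {a / 2..2 * b})"
    using antiderivative_continuous by blast
  have G: "(G has_vector_derivative ?D y) (at y)" if "y \<in> {a..b}" for y
  proof -
    have "a / 2 < y" "y < 2 * b" using that ab by auto
    then show ?thesis using G0[of y] by (simp add: at_within_Icc_at)
  qed
  have MG: "M y = M a + (G y - G a)" if y: "y \<in> {a..b}" for y
  proof -
    have Dpos: "0 \<le> ?D u" if "u \<in> {a..y}" for u using M_bounds[of u] that ab by auto
    have GD: "(G has_vector_derivative ?D u) (at u within {a..y})" if "u \<in> {a..y}" for u
      using G[of u] that y by (auto intro: has_vector_derivative_at_within)
    have ftc: "(\<integral>\<^sup>+u. ennreal (?D u) * indicator {a..y} u \<partial>lborel) = ennreal (G y - G a)"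
      using y by (intro nn_integral_FTC_Icc Dpos) (auto simp: has_real_derivative_iff_has_vector_derivative G)
    have ay: "a \<le> y" using y by simp
    have "(?D has_integral (G y - G a)) {a..y}" by (rule fundamental_theorem_of_calculus[OF ay GD])
    then have Gle: "G a \<le> G y" using has_integral_nonneg[of ?D "G y - G a" "{a..y}"] Dpos by simp
    have "emeasure law {a<..y} = (\<integral>\<^sup>+u. ennreal (\<rho> u) * indicator {a<..y} u \<partial>lborel)" by (rule emeasure_law) simp
    also have "\<dots> = (\<integral>\<^sup>+u. ennreal (?D u) * indicator {a..y} u \<partial>lborel)"
    proof (rule nn_integral_cong_AE)
      show "AE u in lborel. ennreal (\<rho> u) * indicator {a<..y} u = ennreal (?D u) * indicator {a..y} u"
        using ae AE_lborel_singleton[of a]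
        by eventually_elim (use ab in \<open>auto simp: dens_def split: split_indicator\<close>)
    qed
    finally have em: "emeasure law {a<..y} = ennreal (G y - G a)" using ftc by simp
    show ?thesis
    proof (cases "a = y")
      case False
      then have "a < y" using y by simp
      then have "M y - M a = L.prob {a<..y}" unfolding M_def by (rule L.cdf_diff_eq)
      also have "\<dots> = G y - G a" using em Gle by (simp add: measure_def)
      finally show ?thesis by simp
    qed simp
  qed
  have "(G has_real_derivative ?D x) (at x)"
    unfolding has_real_derivative_iff_has_vector_derivative by (rule G) (use ab in simp)
  then have "((\<lambda>y. M a + (G y - G a)) has_real_derivative 0 + (?D x - 0)) (at x)"
    by (intro DERIV_add DERIV_diff DERIV_const)
  then have D: "((\<lambda>y. M a + (G y - G a)) has_real_derivative ?D x) (at x)" by simp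
  show ?thesis
  proof (rule has_field_derivative_transform_within_open[OF D])
    show "open {a<..<b}" "x \<in> {a<..<b}" using ab by simp_all
    fix y assume "y \<in> {a<..<b}"
    then show "M a + (G y - G a) = M y" using MG[of y] by simp
  qed
qed

end

text \<open>The defect \<open>w\<close> of the solution through \<open>v1\<close> satisfies a linear
  equation with coefficient \<open>(1 - M v) / v\<close>. Hence \<open>w^2\<close> is nondecreasing
  and \<open>(w / v)^2\<close> is nonincreasing; since \<open>w\<close> vanishes at
  \<open>v1\<close>, the first settles the left and the second the right of
  \<open>v1\<close>.\<close>

lemma logistic_ode:
  fixes M :: "real \<Rightarrow> real"
  assumes D: "\<And>v. 0 < v \<Longrightarrow> (M has_real_derivative M v * (1 - M v) / v) (at v)"
    and b: "\<And>v. 0 \<le> M v" "\<And>v. M v \<le> 1" and v1: "0 < v1" "0 < M v1" "M v1 < 1"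
  shows "\<exists>c>0. \<forall>v>0. M v = v / (v + c)"
proof -
  define c where "c = v1 * (1 - M v1) / M v1"
  have c: "0 < c" using v1 by (simp add: c_def)
  define w where "w v = M v * (v + c) - v" for v
  have w1: "w v1 = 0" using v1 by (simp add: w_def c_def field_simps)
  have Dw: "(w has_real_derivative (1 - M v) * w v / v) (at v)" if v: "0 < v" for v
    unfolding w_def using v by (auto intro!: derivative_eq_intros D simp: field_simps)
  have "w v = 0" if v: "0 < v" for v
  proof (cases "v \<le> v1")
    case True
    have "(w v)\<^sup>2 \<le> (w v1)\<^sup>2"
    proof (rule DERIV_nonneg_imp_nondecreasing[OF True])
      fix x assume "v \<le> x" "x \<le> v1"
      then have x: "0 < x" using v by simp
      have "((\<lambda>v. (w v)\<^sup>2) has_real_derivative 2 * ((1 - M x) * (w x)\<^sup>2 / x)) (at x)"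
        by (rule derivative_eq_intros Dw[OF x] refl)+ (simp add: power2_eq_square)
      moreover have "0 \<le> 2 * ((1 - M x) * (w x)\<^sup>2 / x)" using b(2)[of x] x by simp
      ultimately show "\<exists>y. ((\<lambda>v. (w v)\<^sup>2) has_real_derivative y) (at x) \<and> 0 \<le> y" by blast
    qed
    then show ?thesis using w1 by simp
  next
    case False
    then have le: "v1 \<le> v" by simp
    have "(w v / v)\<^sup>2 \<le> (w v1 / v1)\<^sup>2"
    proof (rule DERIV_nonpos_imp_nonincreasing[OF le])
      fix x assume "v1 \<le> x" "x \<le> v"
      then have x: "0 < x" using v1 by simp
      have "((\<lambda>v. w v / v) has_real_derivative - (M x * w x / x\<^sup>2)) (at x)"
        by (rule derivative_eq_intros Dw[OF x] refl)+ (use x in \<open>simp_all add: field_simps power2_eq_square\<close>)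
      from DERIV_power[OF this, of 2]
      have "((\<lambda>v. (w v / v)\<^sup>2) has_real_derivative 2 * (w x / x) * (- (M x * w x / x\<^sup>2))) (at x)"
        by (simp add: mult_ac)
      moreover have "2 * (w x / x) * (- (M x * w x / x\<^sup>2)) \<le> 0"
      proof -
        have "2 * (w x / x) * (- (M x * w x / x\<^sup>2)) = - (2 * M x * (w x)\<^sup>2 / x ^ 3)"
          by (simp add: power2_eq_square power3_eq_cube mult_ac)
        also have "\<dots> \<le> 0" using b(1)[of x] x by simp
        finally show ?thesis .
      qed
      ultimately show "\<exists>y. ((\<lambda>v. (w v / v)\<^sup>2) has_real_derivative y) (at x) \<and> y \<le> 0" by blast
    qed
    then show ?thesis using w1 v by simp
  qed
  then have "\<forall>v>0. M v = v / (v + c)" using c by (auto simp: w_def field_simps)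
  then show ?thesis using c by blast
qed

context positive_density
begin

text \<open>\<open>R\<close> is the relative entropy of \<open>\<rho>\<close> against
  \<open>dens\<close>, including the terms \<open>- \<rho> + dens\<close> needed for unequal masses.
  The logarithms of \<open>M\<close> and \<open>1 - M\<close> contribute 1 each and the mass of
  \<open>\<rho>\<close> takes one away, which gives the constant 1; the mass of \<open>dens\<close>
  is the gap term.\<close>

lemma radial_inequality:
  assumes ent: "integrable lborel (\<lambda>v. \<rho> v * ln (\<rho> v))" and lnm: "integrable lborel (\<lambda>v. \<rho> v * ln v)"
  defines "R \<equiv> 1 + (\<integral>v. \<rho> v * ln (\<rho> v) \<partial>lborel) + (\<integral>v. \<rho> v * ln v \<partial>lborel)
    + (\<integral>z. \<rho> (fst z) * \<rho> (snd z) * \<bar>ln (fst z) - ln (snd z)\<bar> \<partial>(lborel \<Otimes>\<^sub>M lborel)) / 2"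
  shows "0 \<le> R" "R = 0 \<Longrightarrow> \<exists>c>0. AE v in lborel. 0 < v \<longrightarrow> \<rho> v = c / (c + v)\<^sup>2"
proof -
  let ?h = "\<lambda>v. \<rho> v * ln (\<rho> v) - (\<rho> v * ln (M v) + \<rho> v * ln (1 - M v) - \<rho> v * ln v) - \<rho> v + dens v"
  note i1 = Bochner_Integration.integrable_add[OF ln_M(2,4)]
  note i2 = Bochner_Integration.integrable_diff[OF i1 lnm]
  note i3 = Bochner_Integration.integrable_diff[OF ent i2]
  note i4 = Bochner_Integration.integrable_diff[OF i3 int]
  note h = Bochner_Integration.integrable_add[OF i4 gap(2)[OF lnm]]
  have hR: "(\<integral>v. ?h v \<partial>lborel) = R"
    unfolding Bochner_Integration.integral_add[OF i4 gap(2)[OF lnm]] Bochner_Integration.integral_diff[OF i3 int]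
      Bochner_Integration.integral_diff[OF ent i2] Bochner_Integration.integral_diff[OF i1 lnm]
      Bochner_Integration.integral_add[OF ln_M(2,4)] ln_M mass R_def gap(3)[OF lnm, symmetric] by simp
  have pt: "AE v in lborel. (dens v = 0 \<longrightarrow> \<rho> v = 0) \<and> ?h v = \<rho> v * ln (\<rho> v) - \<rho> v * ln (dens v) - \<rho> v + dens v"
    using ln_M(1)
  proof eventually_elim
    case (elim v)
    show ?case
    proof (cases "\<rho> v = 0")
      case False
      then have v: "0 < v" "0 < M v" "M v < 1" using elim nonneg[of v] supp[of v] by force+
      then have d: "0 < dens v" and e: "ln (dens v) = ln (M v) + ln (1 - M v) - ln v"
        by (simp_all add: dens_def ln_div ln_mult)
      show ?thesis using d unfolding e by (simp add: algebra_simps)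
    qed simp
  qed
  then have pos: "AE v in lborel. 0 \<le> ?h v"
  proof eventually_elim
    case (elim v)
    show ?case unfolding conjunct2[OF elim] by (rule gibbs_pointwise(1)[OF nonneg dens_nonneg]) (use elim in blast)
  qed
  show "0 \<le> R" using integral_nonneg_AE[OF pos] hR by simp
  assume "R = 0"
  then have "AE v in lborel. ?h v = 0" using integral_nonneg_eq_0_iff_AE[OF h pos] hR by simp
  with pt have ae: "AE v in lborel. \<rho> v = dens v"
  proof eventually_elim
    case (elim v)
    note e = conjunct2[OF elim(1)] and d = conjunct1[OF elim(1)]
    show ?case using elim(2) unfolding e by (rule gibbs_pointwise(2)[OF nonneg dens_nonneg, rotated]) (use d in blast)
  qed
  obtain v1 where v1: "M v1 = 1 / 2" using M_surj[of "1/2"] by auto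
  then have "0 < v1" using M_mono[of v1 0] M_0 by (cases "0 < v1") auto
  then obtain c where c: "0 < c" "\<And>v. 0 < v \<Longrightarrow> M v = v / (v + c)"
    using logistic_ode[OF M_has_derivative[OF ae] M_bounds, of v1] v1 by auto
  have "AE v in lborel. 0 < v \<longrightarrow> \<rho> v = c / (c + v)\<^sup>2"
    using ae
  proof eventually_elim
    case (elim v)
    show ?case
    proof
      assume v: "0 < v"
      have e: "1 - v / (v + c) = c / (v + c)" using v c(1) by (simp add: field_simps)
      have q: "v / s * (c / s) / v = c / s\<^sup>2" if "0 < s" for s
        using that v by (simp add: power2_eq_square)
      have "\<rho> v = M v * (1 - M v) / v" using elim v by (simp add: dens_def)
      also have "\<dots> = c / (v + c)\<^sup>2" unfolding c(2)[OF v] e by (rule q) (use v c in simp)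
      finally show "\<rho> v = c / (c + v)\<^sup>2" by (simp add: add.commute)
    qed
  qed
  then show "\<exists>c>0. AE v in lborel. 0 < v \<longrightarrow> \<rho> v = c / (c + v)\<^sup>2" using c(1) by blast
qed

end

section \<open>Angular averages in the plane\<close>

text \<open>If almost every \<open>T p\<close> preserves \<open>M\<close>, then the map from the
  product of \<open>M\<close> and the probability \<open>P\<close> also has image \<open>M\<close>,
  and all claims are Fubini for it. Almost every is needed because \<open>circ\<close> lives on
  \<open>complex\<close>, and only points of modulus 1 act by isometries.\<close>

lemma average:
  fixes h :: "'a \<Rightarrow> real" and T :: "'p \<Rightarrow> 'a \<Rightarrow> 'a"
  assumes P: "prob_space P" and M: "sigma_finite_measure M"
    and T: "(\<lambda>z. T (snd z) (fst z)) \<in> measurable (M \<Otimes>\<^sub>M P) M"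
    and pres: "AE p in P. distr M M (T p) = M" and h: "integrable M h"
  shows "AE x in M. integrable P (\<lambda>p. h (T p x))" "integrable M (\<lambda>x. \<integral>p. h (T p x) \<partial>P)"
    "(\<integral>x. (\<integral>p. h (T p x) \<partial>P) \<partial>M) = (\<integral>x. h x \<partial>M)"
proof -
  interpret P: prob_space P by fact
  interpret M: sigma_finite_measure M by fact
  interpret MP: pair_sigma_finite M P ..
  have [measurable]: "h \<in> borel_measurable M" using h by auto
  let ?\<Phi> = "\<lambda>z. T (snd z) (fst z)"
  have D: "distr (M \<Otimes>\<^sub>M P) M ?\<Phi> = M"
  proof (rule measure_eqI)
    fix A assume "A \<in> sets (distr (M \<Otimes>\<^sub>M P) M ?\<Phi>)"
    then have A [measurable]: "A \<in> sets M" by simp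
    have ind: "(\<lambda>z. indicator A (?\<Phi> z) :: ennreal) \<in> borel_measurable (M \<Otimes>\<^sub>M P)"
      using measurable_compose[OF T borel_measurable_indicator[OF A]] .
    have "emeasure (distr (M \<Otimes>\<^sub>M P) M ?\<Phi>) A = (\<integral>\<^sup>+z. indicator A z \<partial>distr (M \<Otimes>\<^sub>M P) M ?\<Phi>)" using A by simp
    also have "\<dots> = (\<integral>\<^sup>+z. indicator A (?\<Phi> z) \<partial>(M \<Otimes>\<^sub>M P))"
      by (rule nn_integral_distr[OF T]) measurable
    also have "\<dots> = (\<integral>\<^sup>+p. (\<integral>\<^sup>+x. indicator A (T p x) \<partial>M) \<partial>P)"
      using MP.nn_integral_snd[OF ind] by simp
    also have "\<dots> = (\<integral>\<^sup>+p. emeasure M A \<partial>P)"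
    proof (rule nn_integral_cong_AE)
      show "AE p in P. (\<integral>\<^sup>+x. indicator A (T p x) \<partial>M) = emeasure M A"
        using pres AE_space
      proof eventually_elim
        case (elim p)
        have Tp: "T p \<in> measurable M M"
          using measurable_compose[OF measurable_Pair2'[OF elim(2)] T] by simp
        have "(\<integral>\<^sup>+x. indicator A (T p x) \<partial>M) = (\<integral>\<^sup>+x. indicator A x \<partial>distr M M (T p))"
          by (rule nn_integral_distr[OF Tp, symmetric]) measurable
        also have "\<dots> = emeasure M A" unfolding elim(1) using A by simp
        finally show ?case .
      qed
    qed
    also have "\<dots> = emeasure M A" by (simp add: P.emeasure_space_1)
    finally show "emeasure (distr (M \<Otimes>\<^sub>M P) M ?\<Phi>) A = emeasure M A" .
  qed simp
  have I: "integrable (M \<Otimes>\<^sub>M P) (\<lambda>z. h (?\<Phi> z))"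
    using h by (subst integrable_distr_eq[OF T, symmetric]) (simp_all add: D)
  show "AE x in M. integrable P (\<lambda>p. h (T p x))" using MP.AE_integrable_fst'[OF I] by simp
  show "integrable M (\<lambda>x. \<integral>p. h (T p x) \<partial>P)" using MP.integrable_fst'[OF I] by simp
  have "(\<integral>x. (\<integral>p. h (T p x) \<partial>P) \<partial>M) = (\<integral>z. h (?\<Phi> z) \<partial>(M \<Otimes>\<^sub>M P))"
    using MP.integral_fst'[OF I] by simp
  also have "\<dots> = (\<integral>x. h x \<partial>distr (M \<Otimes>\<^sub>M P) M ?\<Phi>)"
    by (rule integral_distr[OF T, symmetric]) measurable
  finally show "(\<integral>x. (\<integral>p. h (T p x) \<partial>P) \<partial>M) = (\<integral>x. h x \<partial>M)" unfolding D .
qed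

lemma average_circ:
  fixes h :: "complex \<Rightarrow> real"
  assumes h: "integrable lborel h"
  shows "AE x in lborel. integrable circ (\<lambda>u. h (u * x))" "integrable lborel (\<lambda>x. \<integral>u. h (u * x) \<partial>circ)"
    "(\<integral>x. (\<integral>u. h (u * x) \<partial>circ) \<partial>lborel) = (\<integral>x. h x \<partial>lborel)"
proof -
  have d: "distr lborel lborel ((*) u) = (lborel :: complex measure)" if "norm u = 1" for u
    using lborel_distr_rotate[OF that] by (metis distr_cong sets_lborel)
  have p: "AE u in circ. distr lborel lborel ((*) u) = (lborel :: complex measure)"
    using AE_circ_norm by eventually_elim (rule d)
  note a = average[OF circ.prob_space_axioms lborel.sigma_finite_measure_axioms _ p h]
  have m: "(\<lambda>z. snd z * fst z) \<in> measurable (lborel \<Otimes>\<^sub>M circ) (lborel :: complex measure)" by measurable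
  show "AE x in lborel. integrable circ (\<lambda>u. h (u * x))" "integrable lborel (\<lambda>x. \<integral>u. h (u * x) \<partial>circ)"
    "(\<integral>x. (\<integral>u. h (u * x) \<partial>circ) \<partial>lborel) = (\<integral>x. h x \<partial>lborel)"
    by (rule a[OF m])+
qed

lemma average_circ_pair:
  fixes h :: "complex \<times> complex \<Rightarrow> real"
  assumes h: "integrable (lborel \<Otimes>\<^sub>M lborel) h"
  defines "A \<equiv> \<lambda>z. \<integral>p. h (fst p * fst z, snd p * snd z) \<partial>(circ \<Otimes>\<^sub>M circ)"
  shows "AE z in lborel \<Otimes>\<^sub>M lborel. integrable (circ \<Otimes>\<^sub>M circ) (\<lambda>p. h (fst p * fst z, snd p * snd z))"
    "integrable (lborel \<Otimes>\<^sub>M lborel) A" "(\<integral>z. A z \<partial>(lborel \<Otimes>\<^sub>M lborel)) = (\<integral>z. h z \<partial>(lborel \<Otimes>\<^sub>M lborel))"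
proof -
  have p: "AE p in circ \<Otimes>\<^sub>M circ. distr (lborel \<Otimes>\<^sub>M lborel) (lborel \<Otimes>\<^sub>M lborel) (\<lambda>z. (fst p * fst z, snd p * snd z))
      = (lborel :: complex measure) \<Otimes>\<^sub>M (lborel :: complex measure)"
    using AE_circ_pair_norm
    by eventually_elim (intro pair_measure_preserving lborel.sigma_finite_measure_axioms lborel_distr_rotate, simp_all)
  have P: "prob_space (circ \<Otimes>\<^sub>M circ)" by (intro prob_space_pair circ.prob_space_axioms)
  have M: "sigma_finite_measure ((lborel :: complex measure) \<Otimes>\<^sub>M (lborel :: complex measure))"
    by (rule lborel_pair.sigma_finite_measure_axioms)
  note a = average[OF P M _ p h]
  have m: "(\<lambda>z. (fst (snd z) * fst (fst z), snd (snd z) * snd (fst z)))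
      \<in> measurable ((lborel \<Otimes>\<^sub>M lborel) \<Otimes>\<^sub>M (circ \<Otimes>\<^sub>M circ)) (lborel \<Otimes>\<^sub>M (lborel :: complex measure))" by measurable
  show "AE z in lborel \<Otimes>\<^sub>M lborel. integrable (circ \<Otimes>\<^sub>M circ) (\<lambda>p. h (fst p * fst z, snd p * snd z))"
    "integrable (lborel \<Otimes>\<^sub>M lborel) A" "(\<integral>z. A z \<partial>(lborel \<Otimes>\<^sub>M lborel)) = (\<integral>z. h z \<partial>(lborel \<Otimes>\<^sub>M lborel))"
    unfolding A_def by (rule a[OF m])+
qed

text \<open>The deficit in Jensen's inequality for \<open>t ln t\<close>: the entropy lost when
  \<open>F\<close> is replaced by its mean.\<close>

definition circ_gap :: "(complex \<Rightarrow> real) \<Rightarrow> real" where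
  "circ_gap F = circ_ent F - (\<integral>z. F z \<partial>circ) * ln (\<integral>z. F z \<partial>circ)"

lemma circ_mean_nonneg: "circ_dens F \<Longrightarrow> 0 \<le> (\<integral>z. F z \<partial>circ)"
  by (intro integral_nonneg_AE AE_I2 circ_densD(2))

lemma circ_gap_nonneg:
  assumes F: "circ_dens F"
  shows "0 \<le> circ_gap F"
proof (cases "(\<integral>z. F z \<partial>circ) = 0")
  case True
  then have "AE z in circ. F z = 0"
    using integral_nonneg_eq_0_iff_AE[OF circ_densD(3)[OF F] AE_I2[OF circ_densD(2)[OF F]]] by simp
  then have "AE z in circ. F z * ln (F z) = 0" by eventually_elim simp
  then have "circ_ent F = 0" unfolding circ_ent_def by (rule integral_eq_zero_AE)
  then show ?thesis using True by (simp add: circ_gap_def)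
next
  case False
  then have c: "0 < (\<integral>z. F z \<partial>circ)" using circ_mean_nonneg[OF F] by simp
  \<comment> \<open>The empty sum in Lebedev--Milin is already Jensen's inequality.\<close>
  have "0 \<le> (\<integral>z. F z \<partial>circ) * circ_gap F" using lebedev_milin_sparse[OF F, of 1 0] by (simp add: circ_gap_def)
  then show ?thesis using c by (simp add: zero_le_mult_iff)
qed

lemma integrable_fcoef: "circ_dens F \<Longrightarrow> integrable circ (\<lambda>x. of_real (F x) * x ^ m)"
  by (rule abel_series(2)[OF circ_densD(3), of F "\<lambda>x. x" 0])
    (use AE_circ_norm in \<open>auto elim: eventually_mono\<close>)

lemma norm_fcoef_le:
  assumes F: "circ_dens F"
  shows "norm (fcoef F m) \<le> (\<integral>z. F z \<partial>circ)"
proof -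
  note [measurable] = circ_densD(1)[OF F]
  have "norm (fcoef F m) \<le> (\<integral>z. norm (of_real (F z) * z ^ m) \<partial>circ)"
    unfolding fcoef_def by (rule Bochner_Integration.integral_norm_bound)
  also have "\<dots> = (\<integral>z. F z \<partial>circ)"
  proof (rule integral_cong_AE)
    show "AE z in circ. norm (of_real (F z) * z ^ m) = F z"
      using AE_circ_norm by eventually_elim (use circ_densD(2)[OF F] in \<open>simp add: norm_mult norm_power\<close>)
  qed measurable
  finally show ?thesis .
qed

text \<open>The first surviving mode is \<open>m = 2\<close>, hence the factor \<open>|w|^2\<close>.
  Splitting the mixed products into squares gives one factor \<open>1/2\<close>, and the bound with
  \<open>d = 2\<close> gives the other.\<close>

lemma circ_pair_bound:
  assumes F: "circ_dens F" and G: "circ_dens G"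
    and odd: "\<And>m. odd m \<Longrightarrow> fcoef F m = 0" "\<And>m. odd m \<Longrightarrow> fcoef G m = 0" and w: "norm w < 1"
  shows "(\<integral>z. (F (fst z) * G (snd z)) * (- ln (norm (1 - w * (cnj (fst z) * snd z)))) \<partial>(circ \<Otimes>\<^sub>M circ))
    \<le> (norm w)\<^sup>2 / 4 * ((\<integral>z. G z \<partial>circ) * circ_gap F + (\<integral>z. F z \<partial>circ) * circ_gap G)"
proof -
  note [measurable] = circ_densD(1)[OF F] circ_densD(1)[OF G]
  let ?C = "circ \<Otimes>\<^sub>M circ" and ?H = "\<lambda>z. F (fst z) * G (snd z)" and ?p = "\<lambda>z. cnj (fst z) * snd z"
  define c c' where "c = (\<integral>z. F z \<partial>circ)" and "c' = (\<integral>z. G z \<partial>circ)"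
  have c: "0 \<le> c" "0 \<le> c'" using circ_mean_nonneg F G by (auto simp: c_def c'_def)
  have H: "integrable ?C ?H" by (rule circ_pair.integrable_mult_pair(1)[OF circ_densD(3)[OF F] circ_densD(3)[OF G]])
  have pn: "AE z in ?C. norm (?p z) \<le> 1"
    using AE_circ_pair_norm by eventually_elim (simp add: norm_mult)
  have mult: "(\<integral>z. of_real (?H z) * ?p z ^ m \<partial>?C) = cnj (fcoef F m) * fcoef G m" for m
  proof -
    note iF = integrable_fcoef[OF F, of m] and iG = integrable_fcoef[OF G, of m]
    have "(\<integral>z. of_real (?H z) * ?p z ^ m \<partial>?C) = (\<integral>z. cnj (of_real (F (fst z)) * fst z ^ m) * (of_real (G (snd z)) * snd z ^ m) \<partial>?C)"
      by (intro Bochner_Integration.integral_cong) (simp_all add: power_mult_distrib mult_ac)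
    also have "\<dots> = cnj (fcoef F m) * fcoef G m"
      using circ_pair.integrable_mult_pair(2)[OF integrable_cnj[OF iF] iG]
      by (simp only: fcoef_def Bochner_Integration.integral_cnj)
    finally show ?thesis .
  qed
  have "?H \<in> borel_measurable ?C" "?p \<in> borel_measurable ?C" by measurable
  then have S: "(\<lambda>m. Re (w ^ m / of_nat m * (cnj (fcoef F m) * fcoef G m))) sums
      (\<integral>z. ?H z * (- ln (norm (1 - w * ?p z))) \<partial>?C)"
    using abel_series(1)[OF H _ pn w] unfolding mult by simp
  let ?t = "\<lambda>m. Re (w ^ m / of_nat m * (cnj (fcoef F m) * fcoef G m))"
  have t: "?t m \<le> (norm w)\<^sup>2 * (norm (fcoef F m) * norm (fcoef G m) / real m)" for m
  proof (cases "m = 0 \<or> odd m")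
    case True then show ?thesis using odd by auto
  next
    case False
    then have m: "2 \<le> m" by (auto elim!: evenE)
    have "?t m \<le> norm (w ^ m / of_nat m * (cnj (fcoef F m) * fcoef G m))" by (rule complex_Re_le_cmod)
    also have "\<dots> = norm w ^ m * (norm (fcoef F m) * norm (fcoef G m) / real m)"
      by (simp add: norm_mult norm_divide norm_power)
    also have "\<dots> \<le> (norm w)\<^sup>2 * (norm (fcoef F m) * norm (fcoef G m) / real m)"
      using m w by (intro mult_right_mono power_decreasing) auto
    finally show ?thesis .
  qed
  show ?thesis
  proof (rule LIMSEQ_le_const2[OF S[unfolded sums_def]], intro exI[of _ 0] allI impI)
    fix n
    have "(\<Sum>m<n. norm (fcoef F m) * norm (fcoef G m) / real m) \<le> (c' * circ_gap F + c * circ_gap G) / 4"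
    proof (cases "c = 0 \<or> c' = 0")
      case True
      then have z: "norm (fcoef F m) * norm (fcoef G m) = 0" for m
        using norm_fcoef_le[OF F, of m] norm_fcoef_le[OF G, of m] by (auto simp: c_def c'_def)
      have "(\<Sum>m<n. norm (fcoef F m) * norm (fcoef G m) / real m) = 0" unfolding z by simp
      then show ?thesis using c circ_gap_nonneg[OF F] circ_gap_nonneg[OF G] by simp
    next
      case False
      then have cp: "0 < c" "0 < c'" using c by auto
      \<comment> \<open>The weights compensate the masses: they turn \<open>c\<close> times the gap
        of \<open>F\<close>, as it comes out of Lebedev--Milin, into \<open>c'\<close> times that
        gap, and conversely.\<close>
      have amgm: "a * b \<le> (c' / c * a\<^sup>2 + c / c' * b\<^sup>2) / 2" for a b
      proof -
        have "(c' / c * a\<^sup>2 + c / c' * b\<^sup>2) - 2 * (a * b) = (c' * a - c * b)\<^sup>2 / (c * c')"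
          using cp by (simp add: power2_eq_square field_simps)
        moreover have "0 \<le> (c' * a - c * b)\<^sup>2 / (c * c')" using cp by simp
        ultimately have "0 \<le> (c' / c * a\<^sup>2 + c / c' * b\<^sup>2) - 2 * (a * b)" by (simp only:)
        moreover have "0 \<le> p - 2 * q \<Longrightarrow> q \<le> p / 2" for p q :: real by simp
        ultimately show ?thesis by blast
      qed
      have "(\<Sum>m<n. norm (fcoef F m) * norm (fcoef G m) / real m)
          \<le> (\<Sum>m<n. (c' / c * (norm (fcoef F m))\<^sup>2 + c / c' * (norm (fcoef G m))\<^sup>2) / 2 / real m)"
        by (intro sum_mono divide_right_mono amgm) auto
      also have "\<dots> = (c' / c * (\<Sum>m<n. (norm (fcoef F m))\<^sup>2 / real m) + c / c' * (\<Sum>m<n. (norm (fcoef G m))\<^sup>2 / real m)) / 2"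
        by (simp add: sum.distrib[symmetric] sum_distrib_left sum_divide_distrib add_divide_distrib mult_ac)
      also have "\<dots> \<le> (c' / c * (c * circ_gap F / 2) + c / c' * (c' * circ_gap G / 2)) / 2"
        using lebedev_milin_sparse[OF F, of 2 n] lebedev_milin_sparse[OF G, of 2 n] odd cp
        by (intro divide_right_mono add_mono mult_left_mono) (auto simp: circ_gap_def c_def c'_def)
      also have "\<dots> = (c' * circ_gap F + c * circ_gap G) / 4" using cp by (simp add: field_simps)
      finally show ?thesis .
    qed
    then have "(norm w)\<^sup>2 * (\<Sum>m<n. norm (fcoef F m) * norm (fcoef G m) / real m)
        \<le> (norm w)\<^sup>2 * ((c' * circ_gap F + c * circ_gap G) / 4)" by (rule mult_left_mono) simp
    moreover have "(\<Sum>m<n. ?t m) \<le> (norm w)\<^sup>2 * (\<Sum>m<n. norm (fcoef F m) * norm (fcoef G m) / real m)"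
      unfolding sum_distrib_left by (rule sum_mono) (rule t)
    ultimately show "(\<Sum>m<n. ?t m) \<le> (norm w)\<^sup>2 / 4 * ((\<integral>z. G z \<partial>circ) * circ_gap F + (\<integral>z. F z \<partial>circ) * circ_gap G)"
      unfolding c_def c'_def by simp
  qed
qed

lemma fcoef_even:
  assumes [measurable]: "F \<in> borel_measurable borel" and F: "\<And>z. F (- z) = F z" and m: "odd m"
  shows "fcoef F m = 0"
proof -
  have "fcoef F m = (\<integral>z. of_real (F (- 1 * z)) * (- 1 * z) ^ m \<partial>circ)"
    unfolding fcoef_def by (rule integral_circ_rotate[symmetric]) simp_all
  also have "\<dots> = - fcoef F m" using m F by (simp add: fcoef_def power_minus_odd)
  finally show ?thesis by simp
qed

text \<open>Factoring out the larger radius leaves the kernel of \<open>circ_pair_bound\<close>,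
  with \<open>|w|\<close> the ratio of the radii. The resulting \<open>q = |w|^2\<close> is strictly
  below 1, which later decides the equality case.\<close>

lemma two_circle_bound:
  fixes f :: "complex \<Rightarrow> real" and x y :: complex
  defines "F \<equiv> \<lambda>u. f (u * x)" and "G \<equiv> \<lambda>u. f (u * y)"
  assumes F: "circ_dens F" and G: "circ_dens G" and ev: "\<And>z. f (- z) = f z"
    and int: "integrable (circ \<Otimes>\<^sub>M circ) (\<lambda>p. (F (fst p) * G (snd p)) * ln (norm (fst p * x - snd p * y)))"
    and ne: "x \<noteq> 0" "y \<noteq> 0" "norm x \<noteq> norm y"
  shows "\<exists>q<1. - (\<integral>p. (F (fst p) * G (snd p)) * ln (norm (fst p * x - snd p * y)) \<partial>(circ \<Otimes>\<^sub>M circ))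
    \<le> - ln (max (norm x) (norm y)) * ((\<integral>z. F z \<partial>circ) * (\<integral>z. G z \<partial>circ))
      + q / 4 * ((\<integral>z. G z \<partial>circ) * circ_gap F + (\<integral>z. F z \<partial>circ) * circ_gap G)"
proof -
  let ?C = "circ \<Otimes>\<^sub>M circ" and ?H = "\<lambda>p. F (fst p) * G (snd p)" and ?p = "\<lambda>z. cnj (fst z) * snd z"
  have odd: "fcoef F m = 0" "fcoef G m = 0" if "odd m" for m
    using that circ_densD(1)[OF F] circ_densD(1)[OF G] by (auto intro!: fcoef_even simp: F_def G_def ev)
  have H: "integrable ?C ?H" "(\<integral>p. ?H p \<partial>?C) = (\<integral>z. F z \<partial>circ) * (\<integral>z. G z \<partial>circ)"
    using circ_pair.integrable_mult_pair[OF circ_densD(3)[OF F] circ_densD(3)[OF G]] by simp_all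
  \<comment> \<open>Covers both orders of the radii: \<open>w\<close> is \<open>y / x\<close>, or
    the conjugate of \<open>x / y\<close>, since \<open>circ_pair_bound\<close> conjugates the first
    variable.\<close>
  have main: ?thesis if w: "norm w < 1" and r: "r = max (norm x) (norm y)"
    and k: "\<And>u v. norm u = 1 \<Longrightarrow> norm v = 1 \<Longrightarrow> norm (u * x - v * y) = r * norm (1 - w * (cnj u * v))" for w r
  proof -
    have rp: "0 < r" using ne r by (simp add: max_def)
    have pt: "AE p in ?C. ?H p * (- ln (norm (1 - w * ?p p))) = ln r * ?H p - ?H p * ln (norm (fst p * x - snd p * y))"
      using AE_circ_pair_norm
    proof eventually_elim
      case (elim p)
      have "norm (w * (cnj (fst p) * snd p)) < 1" using elim w by (simp add: norm_mult)
      then have "norm (1 - w * (cnj (fst p) * snd p)) \<noteq> 0" by auto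
      then have "ln (norm (fst p * x - snd p * y)) = ln r + ln (norm (1 - w * ?p p))"
        using k[of "fst p" "snd p"] elim rp by (simp add: ln_mult)
      then show ?case by (simp add: algebra_simps)
    qed
    have "(\<integral>p. ?H p * (- ln (norm (1 - w * ?p p))) \<partial>?C) = (\<integral>p. ln r * ?H p - ?H p * ln (norm (fst p * x - snd p * y)) \<partial>?C)"
    proof (rule integral_cong_AE[OF _ _ pt])
      note [measurable] = circ_densD(1)[OF F] circ_densD(1)[OF G]
      show "(\<lambda>p. ?H p * (- ln (norm (1 - w * ?p p)))) \<in> borel_measurable ?C" by measurable
      show "(\<lambda>p. ln r * ?H p - ?H p * ln (norm (fst p * x - snd p * y))) \<in> borel_measurable ?C" by measurable
    qed
    also have "\<dots> = ln r * (\<integral>p. ?H p \<partial>?C) - (\<integral>p. ?H p * ln (norm (fst p * x - snd p * y)) \<partial>?C)"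
      unfolding Bochner_Integration.integral_diff[OF integrable_mult_right[OF H(1)] int] by simp
    finally have "ln r * ((\<integral>z. F z \<partial>circ) * (\<integral>z. G z \<partial>circ)) - (\<integral>p. ?H p * ln (norm (fst p * x - snd p * y)) \<partial>?C)
        \<le> (norm w)\<^sup>2 / 4 * ((\<integral>z. G z \<partial>circ) * circ_gap F + (\<integral>z. F z \<partial>circ) * circ_gap G)"
      using circ_pair_bound[OF F G odd w] H(2) by simp
    moreover have "(norm w)\<^sup>2 < 1" using w by (simp add: power_less_one_iff)
    ultimately show ?thesis by (intro exI[of _ "(norm w)\<^sup>2"]) (simp add: r)
  qed
  show ?thesis
  proof (cases "norm y < norm x")
    case True
    show ?thesis
    proof (rule main[of "y / x" "norm x"])
      show "norm (y / x) < 1" using True ne by (simp add: norm_divide)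
      fix u v :: complex assume u: "norm u = 1" "norm v = 1"
      have "u * cnj u = 1" using u by (simp add: complex_mult_cnj cmod_power2[symmetric])
      then have "u * x - v * y = u * (x * (1 - y / x * (cnj u * v)))" using ne by (simp add: field_simps)
      then show "norm (u * x - v * y) = norm x * norm (1 - y / x * (cnj u * v))" using u by (simp add: norm_mult)
    qed (use True in simp)
  next
    case False
    then have lt: "norm x < norm y" using ne by simp
    show ?thesis
    proof (rule main[of "cnj (x / y)" "norm y"])
      show "norm (cnj (x / y)) < 1" using lt ne by (simp add: norm_divide)
      fix u v :: complex assume u: "norm u = 1" "norm v = 1"
      have "v * cnj v = 1" using u by (simp add: complex_mult_cnj cmod_power2[symmetric])
      then have "u * x - v * y = - (v * (y * (1 - x / y * (u * cnj v))))" using ne by (simp add: field_simps)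
      then have "norm (u * x - v * y) = norm y * norm (1 - x / y * (u * cnj v))" using u by (simp only: norm_minus_cancel norm_mult mult_1_left)
      also have "norm (1 - x / y * (u * cnj v)) = norm (cnj (1 - x / y * (u * cnj v)))" by (rule complex_mod_cnj[symmetric])
      also have "cnj (1 - x / y * (u * cnj v)) = 1 - cnj (x / y) * (cnj u * v)" by simp
      finally show "norm (u * x - v * y) = norm y * norm (1 - cnj (x / y) * (cnj u * v))" .
    qed (use lt in simp)
  qed
qed

section \<open>Radial densities in the plane\<close>

text \<open>The same trade as for the kernel: the logarithmic moment at infinity, and entropy plus
  \<open>|x|^(-1/2)\<close> near 0.\<close>

lemma adm_ln_norm:
  fixes f :: "'a::euclidean_space \<Rightarrow> real"
  assumes f: "adm f"
  shows "integrable lborel (\<lambda>x. f x * ln (norm x))"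
proof -
  note [measurable] = admD(1)[OF f]
  have fn: "0 \<le> f x" for x by (rule admD(2)[OF f])
  define \<phi> where "\<phi> z = norm z powr (-1/2) * indicator {..<1} (norm z)" for z :: 'a
  have [measurable]: "\<phi> \<in> borel_measurable borel" unfolding \<phi>_def by measurable
  have \<phi>n: "0 \<le> \<phi> z" for z by (simp add: \<phi>_def)
  have \<phi>: "integrable lborel \<phi>"
  proof (rule integrableI_bounded)
    have "(\<integral>\<^sup>+x. ennreal (norm (\<phi> x)) \<partial>lborel) = (\<integral>\<^sup>+x. ennreal (norm x powr (-1/2)) * indicator (ball 0 1) x \<partial>(lborel :: 'a measure))"
      by (intro nn_integral_cong) (auto simp: \<phi>_def split: split_indicator)
    then show "(\<integral>\<^sup>+x. ennreal (norm (\<phi> x)) \<partial>lborel) < \<infinity>" using nn_integral_powr_ball[where 'a='a] by simp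
  qed simp
  let ?B = "\<lambda>x. f x * ln (1 + norm x) + 2 * \<bar>f x * ln (f x)\<bar> + 2 * \<phi> x"
  have B: "integrable lborel ?B"
    by (intro Bochner_Integration.integrable_add integrable_mult_right integrable_abs \<phi> admD[OF f])
  have bound: "\<bar>f x * ln (norm x)\<bar> \<le> ?B x" for x
  proof -
    have P: "0 \<le> f x * ln (1 + norm x)" "0 \<le> \<bar>f x * ln (f x)\<bar>" using fn by auto
    consider "x = 0" | "norm x \<ge> 1" | "0 < norm x" "norm x < 1" by fastforce
    then show ?thesis
    proof cases
      case 1
      then show ?thesis using P \<phi>n[of x] by simp
    next
      case 2
      then have "0 < norm x" by linarith
      then have "ln (norm x) \<le> ln (1 + norm x)" "0 \<le> ln (norm x)" using 2 by (subst ln_le_cancel_iff, auto)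
      then have "\<bar>f x * ln (norm x)\<bar> \<le> f x * ln (1 + norm x)" using fn[of x] by (simp add: mult_left_mono)
      then show ?thesis using P \<phi>n[of x] by linarith
    next
      case 3
      have "f x * (- ln (norm x) / 2) \<le> f x * ln (f x) - f x + exp (- ln (norm x) / 2)"
        using fn by (rule young_exp)
      also have "exp (- ln (norm x) / 2) = \<phi> x" using 3 by (simp add: \<phi>_def powr_def)
      finally have "f x * (- ln (norm x)) \<le> 2 * \<bar>f x * ln (f x)\<bar> + 2 * \<phi> x"
        using fn[of x] by (simp add: abs_if split: if_splits)
      moreover have "\<bar>f x * ln (norm x)\<bar> = f x * (- ln (norm x))"
        using mult_nonneg_nonpos[OF fn[of x], of "ln (norm x)"] 3 by (simp add: abs_of_nonpos)
      ultimately show ?thesis using P by linarith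
    qed
  qed
  show ?thesis
    by (rule Bochner_Integration.integrable_bound[OF B])
       (measurable, use bound order_trans[OF bound abs_ge_self] in auto)
qed

text \<open>In the area coordinate \<open>v = pi |x|^2\<close> a radial integral becomes a plain
  integral over the half-line. As \<open>h\<close> vanishes on negative numbers, it can be taken
  over the whole line.\<close>

lemma radial_transfer:
  fixes h :: "real \<Rightarrow> real" and H :: "complex \<Rightarrow> real"
  assumes [measurable]: "h \<in> borel_measurable borel" "H \<in> borel_measurable borel" and z: "\<And>v. v < 0 \<Longrightarrow> h v = 0"
    and H: "AE x in lborel. H x = h (pi * (norm x)\<^sup>2)"
  shows "integrable lborel H \<longleftrightarrow> integrable lborel h" "(\<integral>x. H x \<partial>lborel) = (\<integral>v. h v \<partial>lborel)"
proof -
  have "(ball_vol :: complex \<Rightarrow> real) = (\<lambda>x. pi * (norm x)\<^sup>2)" by (simp add: ball_vol_def fun_eq_iff unit_ball_vol_2)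
  then have D: "distr (lborel :: complex measure) borel (\<lambda>x. pi * (norm x)\<^sup>2) = density lborel (\<lambda>v. ennreal (indicator {0..} v))"
    using distr_ball_vol[where 'a=complex] by (simp add: ennreal_indicator)
  have bm: "(\<lambda>x::complex. pi * (norm x)\<^sup>2) \<in> measurable lborel borel" by measurable
  have e: "(\<lambda>v. indicator {0..} v * h v) = h" using z by (auto split: split_indicator simp: fun_eq_iff not_le)
  have "integrable lborel H \<longleftrightarrow> integrable lborel (\<lambda>x::complex. h (pi * (norm x)\<^sup>2))"
    by (rule integrable_cong_AE) (use H in auto)
  also have "\<dots> \<longleftrightarrow> integrable (density lborel (\<lambda>v. ennreal (indicator {0..} v))) h"
    unfolding D[symmetric] by (subst integrable_distr_eq[OF bm]) auto
  also have "\<dots> \<longleftrightarrow> integrable lborel h" by (subst integrable_density) (auto simp: e)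
  finally show "integrable lborel H \<longleftrightarrow> integrable lborel h" .
  have "(\<integral>x. H x \<partial>lborel) = (\<integral>x. h (pi * (norm x)\<^sup>2) \<partial>(lborel :: complex measure))"
    by (rule integral_cong_AE) (use H in auto)
  also have "\<dots> = (\<integral>v. h v \<partial>density lborel (\<lambda>v. ennreal (indicator {0..} v)))"
    unfolding D[symmetric] by (subst integral_distr[OF bm]) auto
  also have "\<dots> = (\<integral>v. h v \<partial>lborel)" by (subst integral_density) (auto simp: e)
  finally show "(\<integral>x. H x \<partial>lborel) = (\<integral>v. h v \<partial>lborel)" .
qed

lemma ln_max_eq:
  fixes a b :: real assumes "0 < a" "0 < b"
  shows "ln (max a b) = (ln a + ln b) / 2 + \<bar>ln a - ln b\<bar> / 2"
  using assms by (cases "a \<le> b") (auto simp: max_def abs_if field_simps)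

lemma AE_pair_nonzero: "AE z in (lborel :: complex measure) \<Otimes>\<^sub>M (lborel :: complex measure). fst z \<noteq> 0 \<and> snd z \<noteq> 0"
  using AE_pair_both[OF lborel.sigma_finite_measure_axioms AE_lborel_singleton[of 0]] by simp

text \<open>The average of \<open>ln |x - y|\<close> over two circles is the logarithm of the larger
  radius, that is, the mean of the two logarithms plus half their gap, by \<open>ln_max_eq\<close>.
  With \<open>ln v = ln pi + 2 ln |x|\<close>, twice the claimed inequality is
  \<open>0 \<le> R\<close> from \<open>radial_inequality\<close>.\<close>

lemma radial_value:
  fixes \<phi> :: "complex \<Rightarrow> real"
  assumes \<phi>: "adm \<phi>" "(\<integral>x. \<phi> x \<partial>lborel) = 1" and rad: "\<And>x. \<phi> x = \<phi> (of_real (norm x))"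
  defines "K \<equiv> \<lambda>z. (\<phi> (fst z) * \<phi> (snd z)) * ln (max (norm (fst z)) (norm (snd z)))"
  shows "integrable (lborel \<Otimes>\<^sub>M lborel) K"
    "- (\<integral>z. K z \<partial>(lborel \<Otimes>\<^sub>M lborel)) - entS \<phi> / 2 \<le> 1 / 2 + ln pi / 2"
    "- (\<integral>z. K z \<partial>(lborel \<Otimes>\<^sub>M lborel)) - entS \<phi> / 2 = 1 / 2 + ln pi / 2 \<Longrightarrow>
      \<exists>b>0. AE x in lborel. \<phi> x = opt 0 b (1 / pi) x"
proof -
  note [measurable] = admD(1)[OF \<phi>(1)]
  have \<phi>n: "0 \<le> \<phi> x" for x by (rule admD(2)[OF \<phi>(1)])
  \<comment> \<open>The law of \<open>pi |x|^2\<close> under \<open>\<phi>\<close> has this density.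
    The value 0 for \<open>v \<le> 0\<close> is what \<open>positive_density\<close> asks for and
    changes \<open>\<phi>\<close> only at the origin.\<close>
  define \<rho> where "\<rho> v = (if v \<le> 0 then 0 else \<phi> (of_real (sqrt (v / pi))))" for v
  have [measurable]: "\<rho> \<in> borel_measurable borel" unfolding \<rho>_def by measurable
  have \<phi>\<rho>: "\<phi> x = \<rho> (pi * (norm x)\<^sup>2)" if "x \<noteq> 0" for x
  proof -
    have "0 < pi * (norm x)\<^sup>2" using that by simp
    then show ?thesis using rad[of x] by (simp add: \<rho>_def)
  qed
  have lnv: "ln (pi * (norm x)\<^sup>2) = ln pi + 2 * ln (norm x)" if "x \<noteq> 0" for x :: complex
    using that by (simp add: ln_mult ln_realpow)
  have ae1: "AE x in lborel. \<phi> x = \<rho> (pi * (norm x)\<^sup>2)"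
    using AE_lborel_singleton[of 0] by eventually_elim (rule \<phi>\<rho>)
  have ae2: "AE x in lborel. \<phi> x * ln (\<phi> x) = \<rho> (pi * (norm x)\<^sup>2) * ln (\<rho> (pi * (norm x)\<^sup>2))"
    using ae1 by eventually_elim simp
  have ae3: "AE x in lborel. \<phi> x * ln pi + 2 * (\<phi> x * ln (norm x)) = \<rho> (pi * (norm x)\<^sup>2) * ln (pi * (norm x)\<^sup>2)"
    using AE_lborel_singleton[of 0] by eventually_elim (simp add: \<phi>\<rho>[symmetric] lnv algebra_simps)
  have m1: "(\<lambda>v. \<rho> v * ln (\<rho> v)) \<in> borel_measurable borel" "(\<lambda>v. \<rho> v * ln v) \<in> borel_measurable borel"
    "(\<lambda>x. \<phi> x * ln (\<phi> x)) \<in> borel_measurable borel"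
    "(\<lambda>x. \<phi> x * ln pi + 2 * (\<phi> x * ln (norm x))) \<in> borel_measurable borel" by measurable
  have z: "\<rho> v = 0" if "v \<le> 0" for v using that by (simp add: \<rho>_def)
  have z1: "\<rho> v = 0" "\<rho> v * ln (\<rho> v) = 0" "\<rho> v * ln v = 0" if "v < 0" for v using z[of v] that by auto
  have \<rho>n: "0 \<le> \<rho> v" for v by (simp add: \<rho>_def \<phi>n)
  note t1 = radial_transfer[OF \<open>\<rho> \<in> _\<close> \<open>\<phi> \<in> _\<close> z1(1) ae1]
  note t2 = radial_transfer[OF m1(1,3) z1(2) ae2]
  note t3 = radial_transfer[OF m1(2,4) z1(3) ae3]
  note iL = adm_ln_norm[OF \<phi>(1)]
  have i3: "integrable lborel (\<lambda>x. \<phi> x * ln pi + 2 * (\<phi> x * ln (norm x)))"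
    by (intro Bochner_Integration.integrable_add integrable_mult_left integrable_mult_right iL admD(3)[OF \<phi>(1)])
  have v3: "(\<integral>x. \<phi> x * ln pi + 2 * (\<phi> x * ln (norm x)) \<partial>lborel) = ln pi + 2 * (\<integral>x. \<phi> x * ln (norm x) \<partial>lborel)"
    unfolding Bochner_Integration.integral_add[OF integrable_mult_left[OF admD(3)[OF \<phi>(1)]] integrable_mult_right[OF iL]]
    using \<phi>(2) by simp
  interpret pd: positive_density \<rho>
    by unfold_locales (use t1 admD(3)[OF \<phi>(1)] \<phi>(2) z \<rho>n in simp_all)
  have S: "integrable lborel (\<lambda>v. \<rho> v * ln (\<rho> v))" "entS \<phi> = (\<integral>v. \<rho> v * ln (\<rho> v) \<partial>lborel)"
    using t2 admD(4)[OF \<phi>(1)] by (auto simp: entS_def)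
  have L: "integrable lborel (\<lambda>v. \<rho> v * ln v)"
     "(\<integral>v. \<rho> v * ln v \<partial>lborel) = ln pi + 2 * (\<integral>x. \<phi> x * ln (norm x) \<partial>lborel)"
    using t3 i3 v3 by simp_all
  let ?k = "\<lambda>z. \<rho> (fst z) * \<rho> (snd z) * \<bar>ln (fst z) - ln (snd z)\<bar>"
  let ?G = "\<lambda>z. (\<phi> (fst z) * \<phi> (snd z)) * (2 * \<bar>ln (norm (fst z)) - ln (norm (snd z))\<bar>)"
  note p1 = lborel_pair.integrable_mult_pair[OF iL admD(3)[OF \<phi>(1)]]
  note p2 = lborel_pair.integrable_mult_pair[OF admD(3)[OF \<phi>(1)] iL]
  have G: "integrable (lborel \<Otimes>\<^sub>M lborel) ?G"
  proof (rule Bochner_Integration.integrable_bound[OF integrable_mult_right[OF Bochner_Integration.integrable_add[OF integrable_abs[OF p1(1)] integrable_abs[OF p2(1)]], of 2]])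
    show "?G \<in> borel_measurable (lborel \<Otimes>\<^sub>M lborel)" by measurable
    have "\<phi> a * \<phi> b * (2 * \<bar>s - t\<bar>) \<le> 2 * (\<bar>\<phi> a * s * \<phi> b\<bar> + \<bar>\<phi> a * (\<phi> b * t)\<bar>)" for a b s t
    proof -
      have "\<phi> a * \<phi> b * \<bar>s - t\<bar> \<le> \<phi> a * \<phi> b * (\<bar>s\<bar> + \<bar>t\<bar>)" using \<phi>n by (intro mult_left_mono) auto
      then show ?thesis using \<phi>n[of a] \<phi>n[of b] by (simp add: abs_mult algebra_simps)
    qed
    then show "AE z in lborel \<Otimes>\<^sub>M lborel. norm (?G z) \<le> norm (2 * (\<bar>\<phi> (fst z) * ln (norm (fst z)) * \<phi> (snd z)\<bar> + \<bar>\<phi> (fst z) * (\<phi> (snd z) * ln (norm (snd z)))\<bar>))"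
      using \<phi>n by (intro AE_I2) (simp add: abs_mult)
  qed
  have kG: "?G (x, y) = ?k (pi * (norm x)\<^sup>2, pi * (norm y)\<^sup>2)" if "x \<noteq> 0" "y \<noteq> 0" for x y
  proof -
    have "ln (pi * (norm x)\<^sup>2) - ln (pi * (norm y)\<^sup>2) = 2 * (ln (norm x) - ln (norm y))"
      unfolding lnv[OF that(1)] lnv[OF that(2)] by (simp add: right_diff_distrib)
    then have "\<bar>ln (pi * (norm x)\<^sup>2) - ln (pi * (norm y)\<^sup>2)\<bar> = 2 * \<bar>ln (norm x) - ln (norm y)\<bar>"
      by (simp only: abs_mult abs_numeral)
    then show ?thesis by (simp only: fst_conv snd_conv \<phi>\<rho>[OF that(1)] \<phi>\<rho>[OF that(2)])
  qed
  have W: "(\<integral>z. ?G z \<partial>(lborel \<Otimes>\<^sub>M lborel)) = (\<integral>z. ?k z \<partial>(lborel \<Otimes>\<^sub>M lborel))"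
  proof -
    let ?h = "\<lambda>a. (\<integral>b. ?k (a, b) \<partial>lborel)"
    have inner: "(\<integral>y. ?G (x, y) \<partial>lborel) = ?h (pi * (norm x)\<^sup>2)" if x: "x \<noteq> 0" for x
    proof (rule radial_transfer(2))
      show "AE y in lborel. ?G (x, y) = ?k (pi * (norm x)\<^sup>2, pi * (norm y)\<^sup>2)"
        using AE_lborel_singleton[of 0] by eventually_elim (rule kG[OF x])
    qed (simp_all add: z)
    have "(\<integral>z. ?G z \<partial>(lborel \<Otimes>\<^sub>M lborel)) = (\<integral>x. (\<integral>y. ?G (x, y) \<partial>lborel) \<partial>lborel)"
      by (rule lborel_pair.integral_fst'[OF G, symmetric])
    also have "\<dots> = (\<integral>a. ?h a \<partial>lborel)"
    proof (rule radial_transfer(2))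
      show "AE x in lborel. (\<integral>y. ?G (x, y) \<partial>lborel) = ?h (pi * (norm x)\<^sup>2)"
        using AE_lborel_singleton[of 0] by eventually_elim (rule inner)
      show "?h \<in> borel_measurable borel" by measurable
      show "(\<lambda>x. \<integral>y. ?G (x, y) \<partial>lborel) \<in> borel_measurable borel" by measurable
    qed (simp add: z)
    also have "\<dots> = (\<integral>z. ?k z \<partial>(lborel \<Otimes>\<^sub>M lborel))"
      by (rule lborel_pair.integral_fst'[OF pd.gap(1)[OF L(1)]])
    finally show ?thesis .
  qed
  let ?S = "\<lambda>z. (\<phi> (fst z) * ln (norm (fst z)) * \<phi> (snd z) / 2 + \<phi> (fst z) * (\<phi> (snd z) * ln (norm (snd z))) / 2) + ?G z / 4"
  have aeK: "AE z in lborel \<Otimes>\<^sub>M lborel. K z = ?S z"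
    using AE_pair_nonzero
    by eventually_elim (simp add: K_def ln_max_eq field_simps)
  note h1 = integrable_divide[OF p1(1), of 2] and h2 = integrable_divide[OF p2(1), of 2] and h3 = integrable_divide[OF G, of 4]
  note h12 = Bochner_Integration.integrable_add[OF h1 h2]
  note SI = Bochner_Integration.integrable_add[OF h12 h3]
  have Km: "K \<in> borel_measurable (lborel \<Otimes>\<^sub>M lborel)" unfolding K_def by measurable
  have Sm: "?S \<in> borel_measurable (lborel \<Otimes>\<^sub>M lborel)" by measurable
  show "integrable (lborel \<Otimes>\<^sub>M lborel) K" using integrable_cong_AE[OF Km Sm aeK] SI by blast
  have "(\<integral>z. K z \<partial>(lborel \<Otimes>\<^sub>M lborel)) = (\<integral>z. ?S z \<partial>(lborel \<Otimes>\<^sub>M lborel))" by (rule integral_cong_AE[OF Km Sm aeK])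
  also have "\<dots> = (\<integral>x. \<phi> x * ln (norm x) \<partial>lborel) + (\<integral>z. ?k z \<partial>(lborel \<Otimes>\<^sub>M lborel)) / 4"
    unfolding Bochner_Integration.integral_add[OF h12 h3] Bochner_Integration.integral_add[OF h1 h2]
      integral_divide_zero p1(2) p2(2) W \<phi>(2) by simp
  finally have KV: "(\<integral>z. K z \<partial>(lborel \<Otimes>\<^sub>M lborel)) = (\<integral>x. \<phi> x * ln (norm x) \<partial>lborel) + (\<integral>z. ?k z \<partial>(lborel \<Otimes>\<^sub>M lborel)) / 4" .
  note R = pd.radial_inequality[OF S(1) L(1)]
  show "- (\<integral>z. K z \<partial>(lborel \<Otimes>\<^sub>M lborel)) - entS \<phi> / 2 \<le> 1 / 2 + ln pi / 2"
    using R(1) unfolding KV S(2) L(2) by simp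
  assume "- (\<integral>z. K z \<partial>(lborel \<Otimes>\<^sub>M lborel)) - entS \<phi> / 2 = 1 / 2 + ln pi / 2"
  then obtain c where c: "0 < c" "AE v in lborel. 0 < v \<longrightarrow> \<rho> v = c / (c + v)\<^sup>2"
    using R(2) unfolding KV S(2) L(2) by auto
  have D: "distr (lborel :: complex measure) borel (\<lambda>x. pi * (norm x)\<^sup>2) = density lborel (indicator {0..})"
  proof -
    have "(ball_vol :: complex \<Rightarrow> real) = (\<lambda>x. pi * (norm x)\<^sup>2)" by (simp add: ball_vol_def fun_eq_iff unit_ball_vol_2)
    then show ?thesis using distr_ball_vol[where 'a=complex] by simp
  qed
  have "AE v in density lborel (indicator {0..}). 0 < v \<longrightarrow> \<rho> v = c / (c + v)\<^sup>2"
    by (subst AE_density) (use c(2) in \<open>auto elim: eventually_mono\<close>)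
  then have "AE v in distr (lborel :: complex measure) borel (\<lambda>x. pi * (norm x)\<^sup>2). 0 < v \<longrightarrow> \<rho> v = c / (c + v)\<^sup>2"
    unfolding D .
  then have "AE x in (lborel :: complex measure). 0 < pi * (norm x)\<^sup>2 \<longrightarrow> \<rho> (pi * (norm x)\<^sup>2) = c / (c + pi * (norm x)\<^sup>2)\<^sup>2"
    by (rule AE_distrD[rotated]) measurable
  then have "AE x in lborel. \<phi> x = opt 0 (sqrt (c / pi)) (1 / pi) x"
    using AE_lborel_singleton[of 0]
  proof eventually_elim
    case (elim x)
    \<comment> \<open>The logistic density in \<open>pi |x|^2\<close> is the optimizer with
      \<open>b^2 = c / pi\<close>.\<close>
    have "c / (c + pi * n)\<^sup>2 = 1 / pi * (c / pi) / (c / pi + n)\<^sup>2" if "0 \<le> n" for n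
    proof -
      have "c + pi * n = pi * (c / pi + n)" by (simp add: distrib_left)
      then show ?thesis by (simp only: power_mult_distrib) (simp add: power2_eq_square)
    qed
    then show ?case using elim c(1) by (simp add: \<phi>\<rho> opt_def)
  qed
  moreover have "0 < sqrt (c / pi)" using c by simp
  ultimately show "\<exists>b>0. AE x in lborel. \<phi> x = opt 0 b (1 / pi) x" by blast
qed

section \<open>Averaging over rotations and the equality case for even functions\<close>

definition avg :: "(complex \<Rightarrow> real) \<Rightarrow> complex \<Rightarrow> real" where
  "avg f x = (\<integral>u. f (u * x) \<partial>circ)"

lemma avg_measurable[measurable]:
  assumes [measurable]: "f \<in> borel_measurable borel"
  shows "avg f \<in> borel_measurable borel"
  unfolding avg_def by measurable

lemma avg_radial:
  assumes [measurable]: "f \<in> borel_measurable borel"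
  shows "avg f x = avg f (of_real (norm x))"
proof (cases "x = 0")
  case False
  define v where "v = x / of_real (norm x)"
  have v: "norm v = 1" "x = v * of_real (norm x)" using False by (simp_all add: v_def norm_divide)
  have "avg f x = (\<integral>u. f ((v * u) * of_real (norm x)) \<partial>circ)"
    unfolding avg_def by (subst v(2)) (simp add: mult_ac)
  also have "\<dots> = avg f (of_real (norm x))"
    unfolding avg_def by (rule integral_circ_rotate[where f="\<lambda>u. f (u * of_real (norm x))"]) (use v in measurable)
  finally show ?thesis .
qed simp

lemma avg_mult_radial:
  assumes [measurable]: "f \<in> borel_measurable borel" "r \<in> borel_measurable borel" and r: "\<And>u. norm u = 1 \<Longrightarrow> r (u * x) = r x"
  shows "(\<integral>u. f (u * x) * r (u * x) \<partial>circ) = avg f x * r x"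
proof -
  have "(\<integral>u. f (u * x) * r (u * x) \<partial>circ) = (\<integral>u. f (u * x) * r x \<partial>circ)"
    by (rule integral_cong_AE) (use AE_circ_norm r in \<open>auto elim: eventually_mono\<close>)
  then show ?thesis by (simp add: avg_def)
qed

lemma AE_circ_dens:
  assumes f: "adm f"
  shows "AE x in lborel. circ_dens (\<lambda>u. f (u * x))"
  using average_circ(1)[OF admD(3)[OF f]] average_circ(1)[OF admD(4)[OF f]]
proof eventually_elim
  case (elim x)
  note [measurable] = admD(1)[OF f]
  have "(\<lambda>u. f (u * x)) \<in> borel_measurable borel" by measurable
  then show ?case using elim admD(2)[OF f] by (simp add: circ_dens_def)
qed

text \<open>Jensen on each circle bounds \<open>avg f ln (avg f)\<close> from above only. That is
  enough for \<open>finite_entropy_adm\<close>, which asks for a positive part; the weight there is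
  radial and so commutes with averaging.\<close>

lemma adm_avg:
  assumes f: "adm f"
  shows "adm (avg f)" "(\<integral>x. avg f x \<partial>lborel) = (\<integral>x. f x \<partial>lborel)"
proof -
  note [measurable] = admD(1)[OF f]
  have i: "integrable lborel (avg f)" using average_circ(2)[OF admD(3)[OF f]] by (simp add: avg_def[abs_def])
  show "(\<integral>x. avg f x \<partial>lborel) = (\<integral>x. f x \<partial>lborel)" using average_circ(3)[OF admD(3)[OF f]] by (simp add: avg_def)
  have an: "0 \<le> avg f x" for x unfolding avg_def using admD(2)[OF f] by (intro integral_nonneg_AE) auto
  define l where "l x = \<bar>ln (((1 + (norm x)\<^sup>2) / 2) ^ 2)\<bar>" for x :: complex
  have [measurable]: "l \<in> borel_measurable borel" unfolding l_def by measurable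
  have lb: "l x \<le> 4 * ln (1 + norm x) + 2 * ln 2" for x
  proof -
    have p: "0 < (1 + (norm x)\<^sup>2) / 2" using one_plus_pos[of x] by simp
    have "(1 + (norm x)\<^sup>2) / 2 \<le> (1 + norm x)\<^sup>2" by (simp add: power2_eq_square algebra_simps)
    then have "ln ((1 + (norm x)\<^sup>2) / 2) \<le> ln ((1 + norm x)\<^sup>2)" using p by (intro ln_mono) auto
    also have "\<dots> = 2 * ln (1 + norm x)" using one_plus_pos[of x] by (simp add: ln_realpow)
    finally have a: "ln ((1 + (norm x)\<^sup>2) / 2) \<le> 2 * ln (1 + norm x)" .
    have "ln (1 / 2) \<le> ln ((1 + (norm x)\<^sup>2) / 2)" using p by (intro ln_mono) auto
    then have b: "- ln 2 \<le> ln ((1 + (norm x)\<^sup>2) / 2)" by (simp add: ln_div)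
    have "0 \<le> ln (1 + norm x)" "(0::real) \<le> ln 2" by auto
    moreover have "ln (((1 + (norm x)\<^sup>2) / 2) ^ 2) = 2 * ln ((1 + (norm x)\<^sup>2) / 2)" using p by (subst ln_realpow) auto
    ultimately show ?thesis using a b unfolding l_def by linarith
  qed
  have il: "integrable lborel (\<lambda>x. f x * l x)"
  proof (rule Bochner_Integration.integrable_bound)
    show "integrable lborel (\<lambda>x. 4 * (f x * ln (1 + norm x)) + 2 * ln 2 * f x)"
      by (intro Bochner_Integration.integrable_add integrable_mult_right admD[OF f])
    have "f x * l x \<le> f x * (4 * ln (1 + norm x) + 2 * ln 2)" for x
      by (rule mult_left_mono[OF lb admD(2)[OF f]])
    moreover have "0 \<le> f x * l x" for x using admD(2)[OF f, of x] by (simp add: l_def)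
    ultimately show "AE x in lborel. norm (f x * l x) \<le> norm (4 * (f x * ln (1 + norm x)) + 2 * ln 2 * f x)"
      by (intro AE_I2) (smt (verit) distrib_left mult.commute mult.left_commute real_norm_def)
  qed measurable
  let ?a = "\<lambda>x. \<integral>u. \<bar>f (u * x) * ln (f (u * x))\<bar> \<partial>circ"
  have ia: "integrable lborel ?a" using average_circ(2)[OF integrable_abs[OF admD(4)[OF f]]] by simp
  have ib: "integrable lborel (\<lambda>x. avg f x * l x)"
  proof -
    have "(\<lambda>x. avg f x * l x) = (\<lambda>x. \<integral>u. f (u * x) * l (u * x) \<partial>circ)"
      by (intro ext avg_mult_radial[symmetric]) (simp_all add: l_def norm_mult)
    then show ?thesis using average_circ(2)[OF il] by simp
  qed
  show "adm (avg f)"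
  proof (rule finite_entropy_adm[OF avg_measurable an i])
    have "(\<integral>\<^sup>+x. ennreal (avg f x * max (ln (avg f x * ((1 + (norm x)\<^sup>2) / 2) ^ DIM(complex))) 0) \<partial>lborel)
        \<le> (\<integral>\<^sup>+x. ennreal (?a x + avg f x * l x) \<partial>lborel)"
    proof (rule nn_integral_mono_AE)
      show "AE x in lborel. ennreal (avg f x * max (ln (avg f x * ((1 + (norm x)\<^sup>2) / 2) ^ DIM(complex))) 0) \<le> ennreal (?a x + avg f x * l x)"
        using AE_circ_dens[OF f]
      proof eventually_elim
        case (elim x)
        have p: "0 < (1 + (norm x)\<^sup>2) / 2" using one_plus_pos[of x] by simp
        have "avg f x * ln (avg f x) \<le> circ_ent (\<lambda>u. f (u * x))"
          using circ_gap_nonneg[OF elim] by (simp add: circ_gap_def avg_def)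
        also have "\<dots> \<le> ?a x"
          unfolding circ_ent_def using circ_densD(4)[OF elim] by (intro integral_mono integrable_abs) auto
        finally have e: "avg f x * ln (avg f x) \<le> ?a x" .
        have a0: "0 \<le> ?a x" by simp
        have l0: "0 \<le> avg f x * l x" using an by (simp add: l_def)
        have le: "avg f x * ln (((1 + (norm x)\<^sup>2) / 2) ^ 2) \<le> avg f x * l x"
          unfolding l_def using an by (intro mult_left_mono) auto
        have "avg f x * max (ln (avg f x * ((1 + (norm x)\<^sup>2) / 2) ^ 2)) 0 \<le> ?a x + avg f x * l x"
        proof (cases "avg f x = 0")
          case False
          then have "0 < avg f x" using an[of x] by simp
          then have "ln (avg f x * ((1 + (norm x)\<^sup>2) / 2) ^ 2) = ln (avg f x) + ln (((1 + (norm x)\<^sup>2) / 2) ^ 2)"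
            using p by (intro ln_mult_pos) auto
          then show ?thesis using e le a0 l0 by (simp add: max_def algebra_simps)
        qed (use a0 l0 in simp)
        then show ?case by (intro ennreal_leI) simp
      qed
    qed
    also have "\<dots> < \<infinity>"
    proof -
      have "0 \<le> ?a x + avg f x * l x" for x using an by (simp add: l_def)
      then have "(\<integral>\<^sup>+x. ennreal (?a x + avg f x * l x) \<partial>lborel) = ennreal (\<integral>x. ?a x + avg f x * l x \<partial>lborel)"
        by (intro nn_integral_eq_integral Bochner_Integration.integrable_add ia ib AE_I2)
      then show ?thesis by simp
    qed
    finally show "(\<integral>\<^sup>+x. ennreal (avg f x * max (ln (avg f x * ((1 + (norm x)\<^sup>2) / 2) ^ DIM(complex))) 0) \<partial>lborel) < \<infinity>" .
  qed measurable
qed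

lemma AE_norm_neq: "AE y in (lborel :: complex measure). norm y \<noteq> r"
proof -
  have "sphere (0::complex) r \<in> null_sets lebesgue"
    using negligible_sphere[of "0::complex" r] by (simp add: negligible_iff_null_sets)
  then have "AE y in lebesgue. y \<notin> sphere (0::complex) r" by (rule AE_not_in)
  then have "AE y in lborel. y \<notin> sphere (0::complex) r" by (simp only: AE_completion_iff)
  then show ?thesis by eventually_elim simp
qed

lemma AE_pair_norm_neq:
  "AE z in (lborel :: complex measure) \<Otimes>\<^sub>M (lborel :: complex measure). norm (fst z) \<noteq> norm (snd z)"
proof (rule lborel_pair.AE_pair_measure)
  show "{z \<in> space ((lborel :: complex measure) \<Otimes>\<^sub>M (lborel :: complex measure)). norm (fst z) \<noteq> norm (snd z)} \<in> sets (lborel \<Otimes>\<^sub>M lborel)"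
    by measurable
  show "AE x in lborel. AE y in lborel. norm (fst (x :: complex, y :: complex)) \<noteq> norm (snd (x, y))"
  proof (rule AE_I2)
    fix x :: complex
    show "AE y in lborel. norm (fst (x, y :: complex)) \<noteq> norm (snd (x, y))"
      using AE_norm_neq[of "norm x"] by eventually_elim (metis fst_conv snd_conv)
  qed
qed

lemma ln_opt_complex:
  fixes x :: complex
  assumes b: "0 < b"
  shows "0 < opt 0 b (1 / pi) x" "ln (opt 0 b (1 / pi) x) = 2 * ln b - ln pi - 2 * ln (b\<^sup>2 + (norm x)\<^sup>2)"
proof -
  have p: "0 < b\<^sup>2 + (norm x)\<^sup>2" using b by (intro add_pos_nonneg) auto
  show "0 < opt 0 b (1 / pi) x" using b p by (simp add: opt_def)
  have o: "opt 0 b (1 / pi) x = b\<^sup>2 / (pi * (b\<^sup>2 + (norm x)\<^sup>2)\<^sup>2)" by (simp add: opt_def)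
  show "ln (opt 0 b (1 / pi) x) = 2 * ln b - ln pi - 2 * ln (b\<^sup>2 + (norm x)\<^sup>2)"
    unfolding o using b p by (subst ln_div, simp, simp, subst ln_mult, simp, simp) (simp add: ln_realpow)
qed

lemma integrable_ln_opt:
  fixes f :: "complex \<Rightarrow> real"
  assumes f: "adm f" and b: "0 < b"
  shows "integrable lborel (\<lambda>x. f x * ln (opt 0 b (1 / pi) x))"
proof -
  note [measurable] = admD(1)[OF f]
  let ?B = "\<lambda>x. (\<bar>2 * ln b - ln pi\<bar> + 2 * \<bar>ln (b\<^sup>2)\<bar> + 2 * ln (1 + b\<^sup>2)) * f x + 4 * (f x * ln (1 + norm x))"
  have B: "integrable lborel ?B"
    by (intro Bochner_Integration.integrable_add integrable_mult_right admD[OF f])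
  have bd: "\<bar>ln (opt 0 b (1 / pi) x)\<bar> \<le> \<bar>2 * ln b - ln pi\<bar> + 2 * \<bar>ln (b\<^sup>2)\<bar> + 2 * ln (1 + b\<^sup>2) + 4 * ln (1 + norm x)" for x :: complex
  proof -
    have bp: "0 < b\<^sup>2" using b by simp
    have p: "0 < b\<^sup>2 + (norm x)\<^sup>2" using bp by (intro add_pos_nonneg) auto
    have lo: "ln (b\<^sup>2) \<le> ln (b\<^sup>2 + (norm x)\<^sup>2)" using bp by (intro ln_mono) auto
    have one: "0 < 1 + b\<^sup>2" "0 < 1 + norm x" by (simp_all add: add_pos_nonneg)
    have "0 \<le> 1 + 2 * norm x + b\<^sup>2 * (norm x)\<^sup>2 + 2 * b\<^sup>2 * norm x"
      by (intro add_nonneg_nonneg mult_nonneg_nonneg) simp_all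
    then have "b\<^sup>2 + (norm x)\<^sup>2 \<le> (1 + b\<^sup>2) * (1 + norm x)\<^sup>2"
      by (simp add: power2_eq_square algebra_simps)
    then have "ln (b\<^sup>2 + (norm x)\<^sup>2) \<le> ln ((1 + b\<^sup>2) * (1 + norm x)\<^sup>2)" using p by (intro ln_mono) auto
    also have "\<dots> = ln (1 + b\<^sup>2) + 2 * ln (1 + norm x)" using one by (subst ln_mult_pos) (simp_all add: ln_realpow)
    finally have hi: "ln (b\<^sup>2 + (norm x)\<^sup>2) \<le> ln (1 + b\<^sup>2) + 2 * ln (1 + norm x)" .
    have "0 \<le> ln (1 + norm x)" "0 \<le> ln (1 + b\<^sup>2)" by auto
    then show ?thesis unfolding ln_opt_complex(2)[OF b] using lo hi by linarith
  qed
  show ?thesis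
  proof (rule Bochner_Integration.integrable_bound[OF B])
    have "\<bar>f x * ln (opt 0 b (1 / pi) x)\<bar> \<le> ?B x" for x
    proof -
      have "\<bar>f x * ln (opt 0 b (1 / pi) x)\<bar> = f x * \<bar>ln (opt 0 b (1 / pi) x)\<bar>"
        using admD(2)[OF f, of x] by (simp add: abs_mult)
      also have "\<dots> \<le> f x * (\<bar>2 * ln b - ln pi\<bar> + 2 * \<bar>ln (b\<^sup>2)\<bar> + 2 * ln (1 + b\<^sup>2) + 4 * ln (1 + norm x))"
        by (rule mult_left_mono[OF bd admD(2)[OF f]])
      finally show ?thesis by (simp only: algebra_simps)
    qed
    then show "AE x in lborel. norm (f x * ln (opt 0 b (1 / pi) x)) \<le> norm (?B x)"
      unfolding real_norm_def by (intro AE_I2 order_trans[OF _ abs_ge_self])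
    show "(\<lambda>x. f x * ln (opt 0 b (1 / pi) x)) \<in> borel_measurable lborel" unfolding opt_def by measurable
  qed
qed

text \<open>The angular entropy loss \<open>E\<close> integrates to
  \<open>entS f - entS (avg f)\<close>, and \<open>?Q / 4\<close> integrates to half of this, the
  weight of entropy in \<open>logJ\<close>. The pointwise bound
  \<open>(1 - q) ?Q / 4 \<le> ?G\<close> gives the inequality. In the equality case it gives
  \<open>?Q = 0\<close>, hence no entropy loss, and Gibbs' inequality against the radial optimizer
  identifies \<open>f\<close>.\<close>

lemma even_bound:
  fixes f :: "complex \<Rightarrow> real"
  assumes f: "adm f" "(\<integral>x. f x \<partial>lborel) = 1" and ev: "\<And>x. f (- x) = f x"
  shows "logJ f f \<le> 1 / 2 + ln pi / 2"
    "logJ f f = 1 / 2 + ln pi / 2 \<Longrightarrow> \<exists>b>0. AE x in lborel. f x = opt 0 b (1 / pi) x"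
proof -
  note [measurable] = admD(1)[OF f(1)]
  let ?P = "(lborel :: complex measure) \<Otimes>\<^sub>M (lborel :: complex measure)" and ?C = "circ \<Otimes>\<^sub>M circ"
  let ?\<phi> = "avg f"
  note a = adm_avg[OF f(1)]
  have a1: "(\<integral>x. ?\<phi> x \<partial>lborel) = 1" using a(2) f(2) by simp
  have rad: "?\<phi> x = ?\<phi> (of_real (norm x))" for x by (rule avg_radial) measurable
  note rv = radial_value[OF a(1) a1 rad]
  define E where "E x = circ_gap (\<lambda>u. f (u * x))" for x
  have En: "AE x in lborel. 0 \<le> E x" using AE_circ_dens[OF f(1)] unfolding E_def by eventually_elim (rule circ_gap_nonneg)
  have Eq: "E = (\<lambda>x. (\<integral>u. f (u * x) * ln (f (u * x)) \<partial>circ) - ?\<phi> x * ln (?\<phi> x))"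
    by (simp add: E_def circ_gap_def circ_ent_def avg_def fun_eq_iff)
  note ac = average_circ[OF admD(4)[OF f(1)]]
  have Ei: "integrable lborel E" unfolding Eq by (rule Bochner_Integration.integrable_diff[OF ac(2) admD(4)[OF a(1)]])
  have EI: "(\<integral>x. E x \<partial>lborel) = entS f - entS ?\<phi>"
    unfolding Eq Bochner_Integration.integral_diff[OF ac(2) admD(4)[OF a(1)]] ac(3) by (simp add: entS_def)
  define A where "A z = (\<integral>p. (f (fst p * fst z) * f (snd p * snd z)) * ln (norm (fst p * fst z - snd p * snd z)) \<partial>?C)" for z
  note ap = average_circ_pair[OF integrable_log_kernel[OF f(1) f(1)], simplified fst_conv snd_conv]
  have Ai: "integrable ?P A" "(\<integral>z. A z \<partial>?P) = logE f f" using ap(2,3) by (simp_all add: A_def[abs_def] logE_def)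
  let ?K = "\<lambda>z. (?\<phi> (fst z) * ?\<phi> (snd z)) * ln (max (norm (fst z)) (norm (snd z)))"
  note q1 = lborel_pair.integrable_mult_pair[OF Ei admD(3)[OF a(1)]]
  note q2 = lborel_pair.integrable_mult_pair[OF admD(3)[OF a(1)] Ei]
  note s1 = Bochner_Integration.integrable_add[OF q1(1) q2(1)]
  note s2 = integrable_divide[OF s1, of 4]
  note s3 = Bochner_Integration.integrable_diff[OF s2 rv(1)]
  let ?Q = "\<lambda>z. E (fst z) * ?\<phi> (snd z) + ?\<phi> (fst z) * E (snd z)"
  \<comment> \<open>Its integral is the radial value of \<open>avg f\<close> minus
    \<open>logJ f f\<close>, by \<open>GI\<close>.\<close>
  let ?G = "\<lambda>z. ?Q z / 4 - ?K z + A z"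
  have Gi: "integrable ?P ?G" by (rule Bochner_Integration.integrable_add[OF s3 Ai(1)])
  have GI: "(\<integral>z. ?G z \<partial>?P) = (- (\<integral>z. ?K z \<partial>?P) - entS ?\<phi> / 2) - logJ f f"
    unfolding Bochner_Integration.integral_add[OF s3 Ai(1)] Bochner_Integration.integral_diff[OF s2 rv(1)] integral_divide_zero
      Bochner_Integration.integral_add[OF q1(1) q2(1)] q1(2) q2(2) Ai(2) EI a1 logJ_complex by (simp add: field_simps)
  have pt: "AE z in ?P. 0 \<le> ?G z \<and> (?G z = 0 \<longrightarrow> ?Q z = 0)"
    using AE_pair_both[OF lborel.sigma_finite_measure_axioms AE_circ_dens[OF f(1)]]
      AE_pair_both[OF lborel.sigma_finite_measure_axioms En] ap(1) AE_pair_nonzero AE_pair_norm_neq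
  proof eventually_elim
    case (elim z)
    let ?x = "fst z" and ?y = "snd z"
    obtain q where q: "q < 1" "- A z \<le> - ln (max (norm ?x) (norm ?y)) * (?\<phi> ?x * ?\<phi> ?y)
        + q / 4 * (?\<phi> ?y * E ?x + ?\<phi> ?x * E ?y)"
      using two_circle_bound[of f ?x ?y] elim ev unfolding A_def avg_def E_def by blast
    have Qn: "0 \<le> ?Q z" using elim admD(2)[OF a(1)] by (intro add_nonneg_nonneg mult_nonneg_nonneg) auto
    have "- ln (max (norm ?x) (norm ?y)) * (?\<phi> ?x * ?\<phi> ?y) + q / 4 * (?\<phi> ?y * E ?x + ?\<phi> ?x * E ?y)
        = - ?K z + q * (?Q z / 4)" by (simp add: algebra_simps)
    with q(2) have "- A z \<le> - ?K z + q * (?Q z / 4)" by (simp only:)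
    moreover have "- a \<le> - k + q * c \<Longrightarrow> (1 - q) * c \<le> c - k + a" for a k c :: real
      by (simp add: left_diff_distrib)
    ultimately have le: "(1 - q) * (?Q z / 4) \<le> ?G z" by blast
    have nn: "0 \<le> (1 - q) * (?Q z / 4)" using q(1) Qn by simp
    show ?case
    proof (intro conjI impI)
      show "0 \<le> ?G z" by (rule order_trans[OF nn le])
      assume "?G z = 0"
      with le have "(1 - q) * (?Q z / 4) \<le> 0" by (simp only:)
      then have "(1 - q) * (?Q z / 4) = 0" using nn by (rule antisym)
      then show "?Q z = 0" using q(1) by simp
    qed
  qed
  then have Gn: "AE z in ?P. 0 \<le> ?G z" by eventually_elim blast
  have "0 \<le> (\<integral>z. ?G z \<partial>?P)" by (rule integral_nonneg_AE[OF Gn])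
  then have le: "logJ f f \<le> - (\<integral>z. ?K z \<partial>?P) - entS ?\<phi> / 2" unfolding GI by simp
  then show "logJ f f \<le> 1 / 2 + ln pi / 2" using rv(2) by linarith
  assume eq: "logJ f f = 1 / 2 + ln pi / 2"
  then have req: "- (\<integral>z. ?K z \<partial>?P) - entS ?\<phi> / 2 = 1 / 2 + ln pi / 2" using le rv(2) by linarith
  then obtain b where b: "0 < b" "AE x in lborel. ?\<phi> x = opt 0 b (1 / pi) x" using rv(3) by blast
  have "(\<integral>z. ?G z \<partial>?P) = 0" unfolding GI req eq by simp
  then have "AE z in ?P. ?G z = 0" using integral_nonneg_eq_0_iff_AE[OF Gi Gn] by simp
  with pt have "AE z in ?P. ?Q z = 0" by eventually_elim blast
  then have "(\<integral>z. ?Q z \<partial>?P) = 0" by (rule integral_eq_zero_AE)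
  then have "2 * (\<integral>x. E x \<partial>lborel) = 0"
    unfolding Bochner_Integration.integral_add[OF q1(1) q2(1)] q1(2) q2(2) a1 by simp
  then have S: "entS f = entS ?\<phi>" using EI by simp
  let ?o = "opt (0::complex) b (1 / pi)"
  have om [measurable]: "?o \<in> borel_measurable borel" unfolding opt_def[abs_def] by measurable
  have oi: "integrable lborel ?o"
    using integrable_cong_AE[of ?\<phi> lborel ?o] b(2) admD(3)[OF a(1)] by simp
  have o1: "(\<integral>x. ?o x \<partial>lborel) = 1"
    using integral_cong_AE[of ?\<phi> lborel ?o] b(2) a1 by simp
  have io: "integrable lborel (\<lambda>x. f x * ln (?o x))" by (rule integrable_ln_opt[OF f(1) b(1)])
  \<comment> \<open>The logarithm of the optimizer is radial, so it cannot distinguish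
    \<open>f\<close> from its average.\<close>
  have "(\<integral>x. f x * ln (?o x) \<partial>lborel) = (\<integral>x. (\<integral>u. f (u * x) * ln (?o (u * x)) \<partial>circ) \<partial>lborel)"
    by (rule average_circ(3)[OF io, symmetric])
  also have "\<dots> = (\<integral>x. ?\<phi> x * ln (?o x) \<partial>lborel)"
    by (intro Bochner_Integration.integral_cong refl avg_mult_radial) (simp_all add: opt_def norm_mult)
  also have "\<dots> = (\<integral>x. ?\<phi> x * ln (?\<phi> x) \<partial>lborel)"
    by (rule integral_cong_AE) (use b(2) in \<open>auto elim: eventually_mono\<close>)
  also have "\<dots> = (\<integral>x. f x * ln (f x) \<partial>lborel)" using S by (simp add: entS_def)
  finally have g: "(\<integral>x. f x * ln (?o x) \<partial>lborel) = (\<integral>x. f x * ln (f x) \<partial>lborel)" .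
  have op: "0 \<le> ?o x" "?o x \<noteq> 0" for x using ln_opt_complex(1)[OF b(1), of x] by simp_all
  have "AE x in lborel. f x = ?o x"
    by (rule gibbs(2)[OF admD(2)[OF f(1)] op(1) admD(3)[OF f(1)] oi _ admD(4)[OF f(1)] io _ g]) (use f(2) o1 op(2) in simp_all)
  then show "\<exists>b>0. AE x in lborel. f x = opt 0 b (1 / pi) x" using b(1) by blast
qed

lemma logJ_cong_AE:
  fixes f g :: "complex \<Rightarrow> real"
  assumes f: "adm f" and g: "adm g" and ae: "AE x in lborel. f x = g x"
  shows "logJ f f = logJ g g"
  using logE_cong_AE[OF admD(1)[OF f] admD(1)[OF g] admD(1)[OF f] admD(1)[OF g] ae ae] entS_cong_AE[OF admD(1)[OF f] admD(1)[OF g] ae] by (simp add: logJ_def)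

lemma complex_diag:
  fixes f :: "complex \<Rightarrow> real"
  assumes f: "adm f" "(\<integral>x. f x \<partial>lborel) = 1"
  shows "logJ f f \<le> 1 / 2 + ln pi / 2"
  by (rule reduce_to_even[OF even_bound(1) f])

lemma complex_diag_eq:
  fixes f :: "complex \<Rightarrow> real"
  assumes f: "adm f" "(\<integral>x. f x \<partial>lborel) = 1" and eq: "logJ f f = 1 / 2 + ln pi / 2"
  shows "\<exists>a b. 0 < b \<and> (AE x in lborel. f x = opt a b (1 / pi) x)"
proof -
  obtain t where t: "AE x in lborel. rescale 1 t f (- x) = rescale 1 t f x"
    using extremal_even[OF complex_diag f eq] by blast
  let ?g = "rescale 1 t f"
  note g = adm_rescale(1,2)[OF zero_less_one f(1), of t]
  have g1: "(\<integral>x. ?g x \<partial>lborel) = 1" using g(2) f(2) by simp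
  note [measurable] = admD(1)[OF g(1)]
  \<comment> \<open>Evenness is known only almost everywhere, whereas \<open>even_bound\<close> asks
    for it at every point and on every circle; \<open>h\<close> repairs this on a null set.\<close>
  define h where "h x = (if ?g (- x) = ?g x then ?g x else 0)" for x
  have hm [measurable]: "h \<in> borel_measurable borel" unfolding h_def by measurable
  have hg: "AE x in lborel. h x = ?g x" using t by eventually_elim (simp add: h_def)
  have ev: "h (- x) = h x" for x by (simp add: h_def)
  have h: "adm h"
    unfolding adm_def
  proof (intro conjI allI)
    show "h \<in> borel_measurable borel" by (rule hm)
    show "0 \<le> h x" for x using admD(2)[OF g(1)] by (simp add: h_def)
    show "integrable lborel h"
      by (rule integrable_cong_AE_imp[OF admD(3)[OF g(1)]]) (use hg in \<open>simp_all add: eq_commute\<close>)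
    have a: "AE x in lborel. ?g x * ln (?g x) = h x * ln (h x)" "AE x in lborel. ?g x * ln (1 + norm x) = h x * ln (1 + norm x)"
      using hg by (auto elim: eventually_mono)
    show "integrable lborel (\<lambda>x. h x * ln (h x))"
      by (rule integrable_cong_AE_imp[OF admD(4)[OF g(1)] _ a(1)]) measurable
    show "integrable lborel (\<lambda>x. h x * ln (1 + norm x))"
      by (rule integrable_cong_AE_imp[OF admD(5)[OF g(1)] _ a(2)]) measurable
  qed
  have h1: "(\<integral>x. h x \<partial>lborel) = 1" using integral_cong_AE[OF _ _ hg] g1 by simp
  have "logJ h h = logJ ?g ?g" by (rule logJ_cong_AE[OF h g(1) hg])
  also have "\<dots> = 1 / 2 + ln pi / 2" using logJ_rescale[OF zero_less_one f] eq by simp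
  finally obtain b where b: "0 < b" "AE x in lborel. h x = opt 0 b (1 / pi) x"
    using even_bound(2)[OF h h1 ev] by auto
  have go: "AE x in lborel. ?g x = opt 0 b (1 / pi) x" using b(2) hg by eventually_elim simp
  have "AE x in lborel. f x = opt t b (1 / pi) x"
    using AE_affine[OF zero_less_one go, of "- t"]
    by eventually_elim (simp add: rescale_def opt_def)
  then show ?thesis using b(1) by blast
qed

section \<open>The inequality in the plane\<close>

text \<open>Mean value property of the harmonic function \<open>ln |1 - w z|\<close>, read off from
  the vanishing of all positive Fourier modes of the constant.\<close>

lemma mean_ln_disc:
  assumes w: "norm w < 1"
  shows "integrable circ (\<lambda>z. ln (norm (1 - w * z)))" "(\<integral>z. ln (norm (1 - w * z)) \<partial>circ) = 0"
proof -
  show "integrable circ (\<lambda>z. ln (norm (1 - w * z)))"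
  proof (rule integrable_circ_bounded)
    fix z :: complex assume z: "norm z = 1"
    have wz: "norm (w * z) = norm w" using z by (simp add: norm_mult)
    have lo: "1 - norm w \<le> norm (1 - w * z)" using norm_triangle_ineq2[of 1 "w * z"] wz by simp
    have hi: "norm (1 - w * z) \<le> 2" using norm_triangle_ineq4[of 1 "w * z"] wz w by simp
    have "ln (1 - norm w) \<le> ln (norm (1 - w * z))" using lo w by (intro ln_mono) auto
    moreover have "ln (norm (1 - w * z)) \<le> ln 2"
    proof -
      have "0 < norm (1 - w * z)" using lo w by linarith
      then show ?thesis using hi by (subst ln_le_cancel_iff) auto
    qed
    ultimately show "norm (ln (norm (1 - w * z))) \<le> \<bar>ln (1 - norm w)\<bar> + \<bar>ln 2\<bar>"
      unfolding real_norm_def by linarith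
  qed measurable
  have "AE z in circ. norm z \<le> 1" using AE_circ_norm by eventually_elim simp
  then have "(\<lambda>m. Re (w ^ m / of_nat m * (\<integral>z. of_real 1 * z ^ m \<partial>circ))) sums (\<integral>z. 1 * (- ln (norm (1 - w * z))) \<partial>circ)"
    using w by (intro abel_series(1)) auto
  moreover have "Re (w ^ m / of_nat m * (\<integral>z. of_real 1 * z ^ m \<partial>circ)) = 0" for m
    using integral_circ_monomial[of m 0] by (cases "m = 0") auto
  ultimately have "(\<lambda>m. 0) sums (\<integral>z. 1 * (- ln (norm (1 - w * z))) \<partial>circ)" by (simp only:)
  then have "(\<integral>z. 1 * (- ln (norm (1 - w * z))) \<partial>circ) = 0" using sums_zero sums_unique2 by blast
  then show "(\<integral>z. ln (norm (1 - w * z)) \<partial>circ) = 0" by simp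
qed

text \<open>Newton's theorem for the logarithmic potential of a circle: factor out the larger
  modulus, and the remaining logarithm has mean zero.\<close>

lemma mean_ln_two:
  assumes ne: "x \<noteq> 0" "y \<noteq> 0" "norm x \<noteq> norm y"
  shows "(\<integral>u. ln (norm (y - u * x)) \<partial>circ) = ln (max (norm x) (norm y))"
proof -
  have main: "(\<integral>u. ln (norm (y - u * x)) \<partial>circ) = ln r"
    if r: "0 < r" and I: "integrable circ (\<lambda>u. ln (norm (1 - W u)))" "(\<integral>u. ln (norm (1 - W u)) \<partial>circ) = 0"
      and k: "\<And>u. norm u = 1 \<Longrightarrow> norm (y - u * x) = r * norm (1 - W u) \<and> norm (W u) < 1"
      and [measurable]: "W \<in> borel_measurable borel" for r and W :: "complex \<Rightarrow> complex"
  proof -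
    have "(\<integral>u. ln (norm (y - u * x)) \<partial>circ) = (\<integral>u. ln r + ln (norm (1 - W u)) \<partial>circ)"
    proof (rule integral_cong_AE)
      show "AE u in circ. ln (norm (y - u * x)) = ln r + ln (norm (1 - W u))"
        using AE_circ_norm
      proof eventually_elim
        case (elim u)
        have "norm (1 - W u) \<noteq> 0" using k[OF elim] by auto
        then show ?case using k[OF elim] r by (simp add: ln_mult)
      qed
    qed measurable
    also have "\<dots> = ln r" using I circ.prob_space by (subst Bochner_Integration.integral_add) auto
    finally show ?thesis .
  qed
  show ?thesis
  proof (cases "norm x < norm y")
    case True
    then have w: "norm (x / y) < 1" using ne by (simp add: norm_divide)
    have "(\<integral>u. ln (norm (y - u * x)) \<partial>circ) = ln (norm y)"
    proof (rule main[OF _ mean_ln_disc[OF w]])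
      fix u :: complex assume u: "norm u = 1"
      have "y - u * x = y * (1 - x / y * u)" using ne by (simp add: field_simps)
      then show "norm (y - u * x) = norm y * norm (1 - x / y * u) \<and> norm (x / y * u) < 1"
        using u w by (simp only: norm_mult) simp
    qed (use ne in simp_all)
    then show ?thesis using True by simp
  next
    case False
    then have lt: "norm y < norm x" using ne by simp
    then have w: "norm (y / x) < 1" using ne by (simp add: norm_divide)
    have I: "integrable circ (\<lambda>u. ln (norm (1 - y / x * cnj u)))" "(\<integral>u. ln (norm (1 - y / x * cnj u)) \<partial>circ) = 0"
    proof -
      have m: "(\<lambda>u. ln (norm (1 - y / x * u))) \<in> borel_measurable borel" by measurable
      have mc: "cnj \<in> measurable circ borel" by measurable
      show "integrable circ (\<lambda>u. ln (norm (1 - y / x * cnj u)))"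
        using mean_ln_disc(1)[OF w] integrable_distr_eq[OF mc m] by (simp add: circ_cnj)
      show "(\<integral>u. ln (norm (1 - y / x * cnj u)) \<partial>circ) = 0"
        using mean_ln_disc(2)[OF w] integral_distr[OF mc m] by (simp add: circ_cnj)
    qed
    have "(\<integral>u. ln (norm (y - u * x)) \<partial>circ) = ln (norm x)"
    proof (rule main[OF _ I])
      fix u :: complex assume u: "norm u = 1"
      have "u * cnj u = 1" using u by (simp add: complex_mult_cnj cmod_power2[symmetric])
      then have "y - u * x = - (u * (x * (1 - y / x * cnj u)))" using ne by (simp add: field_simps)
      then show "norm (y - u * x) = norm x * norm (1 - y / x * cnj u) \<and> norm (y / x * cnj u) < 1"
        using u w by (simp only: norm_mult norm_minus_cancel) simp
    qed (use ne in simp_all)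
    then show ?thesis using lt by simp
  qed
qed

section \<open>Mass, moment and potential of the optimizer in the plane\<close>

lemma integral_FTC_atLeast_nonneg:
  fixes f F :: "real \<Rightarrow> real"
  assumes [measurable]: "f \<in> borel_measurable borel" and D: "\<And>x. a \<le> x \<Longrightarrow> (F has_real_derivative f x) (at x)"
    and nn: "\<And>x. a \<le> x \<Longrightarrow> 0 \<le> f x" and lim: "(F \<longlongrightarrow> T) at_top" and le: "F a \<le> T"
  shows "integrable lborel (\<lambda>x. f x * indicator {a..} x)" "(\<integral>x. f x * indicator {a..} x \<partial>lborel) = T - F a"
proof -
  have "(\<integral>\<^sup>+x. ennreal (f x * indicator {a..} x) \<partial>lborel) = (\<integral>\<^sup>+x. ennreal (f x) * indicator {a..} x \<partial>lborel)"
    by (intro nn_integral_cong) (auto split: split_indicator)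
  also have "\<dots> = ennreal (T - F a)" by (rule nn_integral_FTC_atLeast[OF _ D nn lim]) measurable
  finally have n: "(\<integral>\<^sup>+x. ennreal (f x * indicator {a..} x) \<partial>lborel) = ennreal (T - F a)" .
  have p: "AE x in lborel. 0 \<le> f x * indicator {a..} x" using nn by (auto split: split_indicator)
  have "has_bochner_integral lborel (\<lambda>x. f x * indicator {a..} x) (T - F a)"
    by (rule has_bochner_integral_nn_integral[OF _ p _ n]) (use le in auto)
  then show "integrable lborel (\<lambda>x. f x * indicator {a..} x)" "(\<integral>x. f x * indicator {a..} x \<partial>lborel) = T - F a"
    by (auto simp: has_bochner_integral_iff)
qed

lemma opt_complex_radial: "opt 0 1 (1 / pi) x = pi / (pi + pi * (norm x)\<^sup>2)\<^sup>2" for x :: complex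
proof -
  have "pi + pi * (norm x)\<^sup>2 = pi * (1 + (norm x)\<^sup>2)" by (simp add: distrib_left)
  then show ?thesis by (simp add: opt_def power_mult_distrib power2_eq_square)
qed

lemma opt_complex_mass: "(\<integral>x. opt (0::complex) 1 (1 / pi) x \<partial>lborel) = 1"
proof -
  let ?f = "\<lambda>v::real. pi / (pi + v)\<^sup>2"
  have F: "(\<integral>v. ?f v * indicator {0..} v \<partial>lborel) = 0 - (- (pi / (pi + 0)))"
  proof (rule integral_FTC_atLeast_nonneg(2))
    show "((\<lambda>v. - (pi / (pi + v))) has_real_derivative ?f x) (at x)" if "0 \<le> x" for x
    proof -
      have "pi + x \<noteq> 0" using that pi_gt_zero by linarith
      then show ?thesis by (auto intro!: derivative_eq_intros simp: power2_eq_square)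
    qed
    show "((\<lambda>v. - (pi / (pi + v))) \<longlongrightarrow> 0) at_top" by real_asymp
  qed auto
  have "(\<integral>x. opt (0::complex) 1 (1 / pi) x \<partial>lborel) = (\<integral>v. ?f v * indicator {0..} v \<partial>lborel)"
  proof (rule radial_transfer(2))
    show "opt (0::complex) 1 (1 / pi) \<in> borel_measurable borel" unfolding opt_def[abs_def] by measurable
  qed (auto simp: opt_complex_radial)
  then show ?thesis using F by simp
qed

lemma opt_complex_kappa: "(\<integral>x. opt (0::complex) 1 (1 / pi) x * ln (1 + (norm x)\<^sup>2) \<partial>lborel) = 1"
proof -
  let ?f = "\<lambda>v::real. pi / (pi + v)\<^sup>2 * ln (1 + v / pi)" and ?F = "\<lambda>v::real. - (pi / (pi + v) * (ln (1 + v / pi) + 1))"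
  have F: "(\<integral>v. ?f v * indicator {0..} v \<partial>lborel) = 0 - ?F 0"
  proof (rule integral_FTC_atLeast_nonneg(2))
    fix x :: real assume x: "0 \<le> x"
    have p: "0 < pi + x" "0 < 1 + x / pi" using x pi_gt_zero by (simp_all add: add_pos_nonneg)
    have e: "1 / (1 + x / pi) * (1 / pi) = 1 / (pi + x)" using p by (simp add: field_simps)
    have "((\<lambda>v. ln (1 + v / pi)) has_real_derivative 1 / (pi + x)) (at x)"
      unfolding e[symmetric] using p by (auto intro!: derivative_eq_intros)
    moreover have "((\<lambda>v. pi / (pi + v)) has_real_derivative - (pi / (pi + x)\<^sup>2)) (at x)"
      using p by (auto intro!: derivative_eq_intros simp: power2_eq_square)
    ultimately have "(?F has_real_derivative - (- (pi / (pi + x)\<^sup>2) * (ln (1 + x / pi) + 1) + (1 / (pi + x) + 0) * (pi / (pi + x)))) (at x)"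
      by (intro DERIV_minus DERIV_mult DERIV_add DERIV_const)
    moreover have "- (- (k / p\<^sup>2) * (L + 1) + (1 / p + 0) * (k / p)) = k / p\<^sup>2 * L" for k p L :: real
      by (simp add: power2_eq_square distrib_left)
    ultimately show "(?F has_real_derivative ?f x) (at x)" by (simp only:)
    show "0 \<le> ?f x" using x p by simp
  next
    show "(?F \<longlongrightarrow> 0) at_top" by real_asymp
  qed auto
  have "(\<integral>x. opt (0::complex) 1 (1 / pi) x * ln (1 + (norm x)\<^sup>2) \<partial>lborel) = (\<integral>v. ?f v * indicator {0..} v \<partial>lborel)"
  proof (rule radial_transfer(2))
    show "(\<lambda>x::complex. opt 0 1 (1 / pi) x * ln (1 + (norm x)\<^sup>2)) \<in> borel_measurable borel" unfolding opt_def by measurable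
  qed (auto simp: opt_complex_radial)
  then show ?thesis using F by simp
qed

text \<open>The logarithm of the maximum is \<open>ln r\<close> plus the positive part of
  \<open>ln |x| - ln r\<close>. Only the latter has to be integrated, and in the area coordinate it
  lives on \<open>v \<ge> b\<close>.\<close>

lemma opt_complex_ln_max:
  assumes r: "0 < r"
  shows "(\<integral>x. opt (0::complex) 1 (1 / pi) x * ln (max (norm x) r) \<partial>lborel) = ln (1 + r\<^sup>2) / 2"
proof -
  let ?o = "opt (0::complex) 1 (1 / pi)"
  define b where "b = pi * r\<^sup>2"
  have b: "0 < b" using r by (simp add: b_def)
  let ?f = "\<lambda>v::real. pi / (pi + v)\<^sup>2 * (ln v - ln b) / 2"
  \<comment> \<open>Integration by parts with \<open>- pi / (pi + v)\<close> as antiderivative of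
    the density; the leftover \<open>pi / (v (pi + v))\<close> integrates to
    \<open>ln v - ln (pi + v)\<close>. The factor \<open>1/2\<close> comes from
    \<open>ln |x|\<close> being half of \<open>ln v\<close> up to a constant.\<close>
  let ?F = "\<lambda>v::real. (- (pi / (pi + v) * (ln v - ln b)) + (ln v - ln (pi + v))) / 2"
  have f: "integrable lborel (\<lambda>v. ?f v * indicator {b..} v)" "(\<integral>v. ?f v * indicator {b..} v \<partial>lborel) = 0 - ?F b"
  proof -
    have D: "(?F has_real_derivative ?f x) (at x)" if "b \<le> x" for x
    proof -
      have x: "0 < x" "0 < pi + x" "pi + x \<noteq> 0" using b that pi_gt_zero by linarith+
      have "((\<lambda>v. pi / (pi + v)) has_real_derivative - (pi / (pi + x)\<^sup>2)) (at x)"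
        using x by (auto intro!: derivative_eq_intros simp: power2_eq_square)
      moreover have "(ln has_real_derivative 1 / x) (at x)" using x by (auto intro!: derivative_eq_intros)
      moreover have "((\<lambda>v. ln (pi + v)) has_real_derivative 1 / (pi + x)) (at x)"
        using x by (auto intro!: derivative_eq_intros)
      ultimately have "(?F has_real_derivative (- (- (pi / (pi + x)\<^sup>2) * (ln x - ln b) + (1 / x - 0) * (pi / (pi + x))) + (1 / x - 1 / (pi + x))) / 2) (at x)"
        by (intro DERIV_minus DERIV_mult DERIV_add DERIV_diff DERIV_const DERIV_cdivide)
      moreover have "1 / x * (pi / (pi + x)) = 1 / x - 1 / (pi + x)" using x by (simp add: field_simps)
      ultimately show ?thesis by (simp add: algebra_simps)
    qed
    have nn: "0 \<le> ?f x" if "b \<le> x" for x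
    proof -
      have "ln b \<le> ln x" using b that by simp
      then show ?thesis by (intro divide_nonneg_nonneg mult_nonneg_nonneg) auto
    qed
    have "((\<lambda>v. pi / (pi + v) * ln v) \<longlongrightarrow> 0) at_top" "((\<lambda>v. pi / (pi + v)) \<longlongrightarrow> 0) at_top" "((\<lambda>v. ln v - ln (pi + v)) \<longlongrightarrow> 0) at_top"
      by real_asymp+
    then have "((\<lambda>v. (- (pi / (pi + v) * ln v - pi / (pi + v) * ln b) + (ln v - ln (pi + v))) / 2) \<longlongrightarrow> (- (0 - 0 * ln b) + 0) / 2) at_top"
      by (intro tendsto_intros) auto
    then have lim: "(?F \<longlongrightarrow> 0) at_top" by (simp add: right_diff_distrib)
    have le: "?F b \<le> 0" using b by (simp add: ln_mono)
    show "integrable lborel (\<lambda>v. ?f v * indicator {b..} v)" "(\<integral>v. ?f v * indicator {b..} v \<partial>lborel) = 0 - ?F b"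
      by (rule integral_FTC_atLeast_nonneg[OF _ D nn lim le]; measurable)+
  qed
  let ?H = "\<lambda>x::complex. ?o x * max 0 (ln (norm x) - ln r)"
  have om [measurable]: "?o \<in> borel_measurable borel" unfolding opt_def[abs_def] by measurable
  have ae: "AE x in lborel. ?H x = ?f (pi * (norm x)\<^sup>2) * indicator {b..} (pi * (norm x)\<^sup>2)"
    using AE_lborel_singleton[of 0]
  proof eventually_elim
    case (elim x)
    have lv: "ln (pi * (norm x)\<^sup>2) - ln b = 2 * (ln (norm x) - ln r)"
      using elim r by (simp add: b_def ln_mult ln_realpow)
    have "b \<le> pi * (norm x)\<^sup>2 \<longleftrightarrow> ln b \<le> ln (pi * (norm x)\<^sup>2)" using b elim by (subst ln_le_cancel_iff) auto
    moreover have "ln b \<le> ln (pi * (norm x)\<^sup>2) \<longleftrightarrow> ln r \<le> ln (norm x)"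
    proof -
      have "s - t = 2 * (u - v) \<Longrightarrow> t \<le> s \<longleftrightarrow> v \<le> u" for s t u v :: real by auto
      then show ?thesis using lv by blast
    qed
    ultimately have "b \<le> pi * (norm x)\<^sup>2 \<longleftrightarrow> ln r \<le> ln (norm x)" by (simp only:)
    moreover have h: "c * (2 * t) / 2 = c * t" for c t :: real by simp
    ultimately show ?case unfolding lv h by (auto simp: opt_complex_radial max_def split: split_indicator)
  qed
  have z: "?f v * indicator {b..} v = 0" if "v < 0" for v using that b by (auto split: split_indicator)
  have fm: "(\<lambda>v. ?f v * indicator {b..} v) \<in> borel_measurable borel" by measurable
  have Hm: "?H \<in> borel_measurable borel" by measurable
  note t = radial_transfer[OF fm Hm z ae]
  have oi: "integrable lborel ?o" by (rule admD(3)[OF adm_opt_standard]) simp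
  have Hi: "integrable lborel ?H" using t(1) f(1) by blast
  have "(\<integral>x. ?o x * ln (max (norm x) r) \<partial>lborel) = (\<integral>x. ln r * ?o x + ?H x \<partial>lborel)"
  proof (rule integral_cong_AE)
    show "AE x in lborel. ?o x * ln (max (norm x) r) = ln r * ?o x + ?H x"
      using AE_lborel_singleton[of 0]
    proof eventually_elim
      case (elim x)
      then have "ln (max (norm x) r) = ln r + max 0 (ln (norm x) - ln r)"
        using r by (cases "norm x \<le> r") (auto simp: max_def)
      then show ?case by (simp add: algebra_simps)
    qed
  qed measurable
  also have "\<dots> = (\<integral>x. ln r * ?o x \<partial>lborel) + (\<integral>x. ?H x \<partial>lborel)"
    by (rule Bochner_Integration.integral_add[OF integrable_mult_right[OF oi] Hi])
  also have "\<dots> = ln r + (0 - ?F b)"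
  proof -
    have HB: "(\<integral>x. ?H x \<partial>lborel) = 0 - ?F b" using t(2) f(2) by (rule trans)
    have oB: "(\<integral>x. ln r * ?o x \<partial>lborel) = ln r" using opt_complex_mass by simp
    show ?thesis unfolding HB oB ..
  qed
  also have "\<dots> = ln (1 + r\<^sup>2) / 2"
  proof -
    have "pi + b = pi * (1 + r\<^sup>2)" by (simp add: b_def distrib_left)
    then have "ln (pi + b) = ln pi + ln (1 + r\<^sup>2)" by (simp add: ln_mult_pos add_pos_nonneg)
    moreover have "ln b = ln pi + 2 * ln r" using r by (simp add: b_def ln_mult ln_realpow)
    ultimately show ?thesis by (simp add: field_simps)
  qed
  finally show ?thesis .
qed

text \<open>The optimizer is radial, so its potential at \<open>x\<close> may be averaged over
  circles; Newton's theorem turns the kernel into the logarithm of the larger modulus, which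
  \<open>opt_complex_ln_max\<close> integrates.\<close>

lemma complex_potential:
  fixes g :: "complex \<Rightarrow> real"
  assumes g: "adm g"
  shows "logE (opt 0 1 (1 / pi)) g = (\<integral>x. g x * ln (1 + (norm x)\<^sup>2) \<partial>lborel) / 2"
proof -
  let ?o = "opt (0::complex) 1 (1 / pi)"
  have o: "adm ?o" by (rule adm_opt_standard) simp
  note [measurable] = admD(1)[OF g] admD(1)[OF o]
  note K = integrable_log_kernel[OF g o]
  have "logE ?o g = logE g ?o" by (rule logE_commute)
  also have "\<dots> = (\<integral>x. (\<integral>y. (g x * ?o y) * ln (norm (x - y)) \<partial>lborel) \<partial>lborel)"
    unfolding logE_def by (subst lborel_pair.integral_fst'[OF K, symmetric]) simp
  also have "\<dots> = (\<integral>x. g x * ln (1 + (norm x)\<^sup>2) / 2 \<partial>lborel)"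
  proof (rule integral_cong_AE)
    show "AE x in lborel. (\<integral>y. (g x * ?o y) * ln (norm (x - y)) \<partial>lborel) = g x * ln (1 + (norm x)\<^sup>2) / 2"
      using lborel_pair.AE_integrable_fst'[OF K] AE_lborel_singleton[of 0]
    proof eventually_elim
      case (elim x)
      show ?case
      proof (cases "g x = 0")
        case False
        have "integrable lborel (\<lambda>y. g x * (?o y * ln (norm (x - y))))" using elim(1) by (simp add: mult.assoc)
        then have i: "integrable lborel (\<lambda>y. ?o y * ln (norm (x - y)))" using False by simp
        have "(\<integral>y. ?o y * ln (norm (x - y)) \<partial>lborel) = (\<integral>y. (\<integral>u. ?o (u * y) * ln (norm (x - u * y)) \<partial>circ) \<partial>lborel)"
          by (rule average_circ(3)[OF i, symmetric])
        also have "\<dots> = (\<integral>y. ?o y * ln (max (norm y) (norm x)) \<partial>lborel)"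
        proof (rule integral_cong_AE)
          show "AE y in lborel. (\<integral>u. ?o (u * y) * ln (norm (x - u * y)) \<partial>circ) = ?o y * ln (max (norm y) (norm x))"
            using AE_lborel_singleton[of 0] AE_norm_neq[of "norm x"]
          proof eventually_elim
            case (elim y)
            have "(\<integral>u. ?o (u * y) * ln (norm (x - u * y)) \<partial>circ) = (\<integral>u. ?o y * ln (norm (x - u * y)) \<partial>circ)"
              by (rule integral_cong_AE, measurable)
                (use AE_circ_norm in eventually_elim, simp add: opt_def norm_mult)
            then show ?case using mean_ln_two[of y x] elim \<open>x \<noteq> 0\<close> by simp
          qed
        qed measurable
        also have "\<dots> = ln (1 + (norm x)\<^sup>2) / 2" by (rule opt_complex_ln_max) (use elim(2) in simp)
        finally show ?thesis by (simp add: mult.assoc)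
      qed simp
    qed
  qed measurable
  finally show ?thesis by simp
qed

lemma log_HLS_complex:
  fixes f g :: "complex \<Rightarrow> real"
  assumes f: "adm f" "(\<integral>x. f x \<partial>lborel) = 1" and g: "adm g" "(\<integral>x. g x \<partial>lborel) = 1"
  shows "logJ f g \<le> 1 / 2 + ln pi / 2 \<and> (logJ f g = 1 / 2 + ln pi / 2 \<longleftrightarrow>
    (\<exists>a b. 0 < b \<and> (AE x in lborel. f x = opt a b (1 / pi) x \<and> g x = opt a b (1 / pi) x)))"
proof -
  have H: "1 / 2 - ln (1 / pi) / real DIM(complex) = 1 / 2 + ln pi / 2" by (simp add: ln_div)
  show ?thesis
    using logHLS_from_standard[of "1 / pi" 1 f g, unfolded H] opt_complex_mass opt_complex_kappa complex_potential
      complex_diag complex_diag_eq f g by simp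
qed

section \<open>Transfer to the statement\<close>

text \<open>A Borel function equal to \<open>f\<close> almost everywhere may be negative on a null
  set; taking the maximum with 0 repairs this.\<close>

lemma borel_representative:
  fixes f :: "real ^ 'n \<Rightarrow> real"
  assumes nn: "\<And>x. 0 \<le> f x" and int: "integrable lebesgue f" and mass: "(LINT x|lebesgue. f x) = 1"
    and ent: "finite_entropy f"
  shows "\<exists>f'. adm f' \<and> (\<integral>x. f' x \<partial>lborel) = 1 \<and> (AE x in lborel. f x = f' x)"
proof -
  have "f \<in> borel_measurable lebesgue" using int by auto
  then obtain f0 where f0: "f0 \<in> borel_measurable lborel" "AE x in lborel. f x = f0 x"
    using completion_ex_borel_measurable_real by blast
  define f' where "f' x = max 0 (f0 x)" for x
  have m [measurable]: "f' \<in> borel_measurable borel" unfolding f'_def using f0(1) by simp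
  have ae: "AE x in lborel. f x = f' x"
    using f0(2)
  proof eventually_elim
    case (elim x)
    then show ?case using nn[of x] by (simp add: f'_def)
  qed
  have ml: "f' \<in> borel_measurable lebesgue" by (rule measurable_completion) simp
  have i: "integrable lborel f'"
  proof -
    have "integrable lebesgue f'" by (rule integrable_cong_AE_imp[OF int ml AE_completion]) (use ae in simp)
    then show ?thesis using integrable_completion[of f' lborel] m by simp
  qed
  have I: "(\<integral>x. f' x \<partial>lborel) = 1"
  proof -
    have "(LINT x|lebesgue. f x) = (LINT x|lebesgue. f' x)"
      by (rule integral_cong_AE[OF _ ml AE_completion[OF ae]]) (use int in auto)
    then show ?thesis using mass integral_completion[of f' lborel] m by simp
  qed
  have "(\<integral>\<^sup>+x. ennreal (f' x * max (ln (f' x * ((1 + (norm x)\<^sup>2) / 2) ^ DIM(real ^ 'n))) 0) \<partial>lborel)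
      = (\<integral>\<^sup>+x. ennreal (f x * log_plus (f x * ((1 + (norm x)\<^sup>2) / 2) ^ CARD('n))) \<partial>lborel)"
    by (rule nn_integral_cong_AE) (use ae in eventually_elim, simp add: log_plus_def)
  also have "\<dots> < \<infinity>" using ent by (simp add: finite_entropy_def nn_integral_completion)
  finally have "adm f'" by (intro finite_entropy_adm m i) (auto simp: f'_def)
  then show ?thesis using I ae by blast
qed

lemma lebesgue_integral_eqI:
  fixes h k :: "'a::euclidean_space \<Rightarrow> real"
  assumes k: "k \<in> borel_measurable borel" and ae: "AE x in lborel. h x = k x"
  shows "(LINT x|lebesgue. h x) = (\<integral>x. k x \<partial>lborel)"
proof -
  have kl: "k \<in> borel_measurable lebesgue" by (rule measurable_completion) (use k in simp)
  have ael: "AE x in lebesgue. h x = k x" by (rule AE_completion[OF ae])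
  then have "AE x in lebesgue. k x = h x" by (simp add: eq_commute)
  then have "h \<in> borel_measurable lebesgue" by (rule borel_measurable_AE[OF kl])
  then have "(LINT x|lebesgue. h x) = (LINT x|lebesgue. k x)" by (rule integral_cong_AE[OF _ kl ael])
  also have "\<dots> = (\<integral>x. k x \<partial>lborel)" by (rule integral_completion) (use k in simp)
  finally show ?thesis .
qed

lemma log_HLS_functional_eq:
  fixes f g f' g' :: "real ^ 'n \<Rightarrow> real"
  assumes f: "adm f'" "AE x in lborel. f x = f' x" and g: "adm g'" "AE x in lborel. g x = g' x"
  shows "log_HLS_functional f g = logJ f' g'"
proof -
  note [measurable] = admD(1)[OF f(1)] admD(1)[OF g(1)]
  let ?V = "lborel :: (real ^ 'n) measure"
  have S: "(LINT x|lebesgue. f x * ln (f x)) = entS f'" "(LINT x|lebesgue. g x * ln (g x)) = entS g'"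
    unfolding entS_def by (rule lebesgue_integral_eqI, measurable, use f(2) g(2) in eventually_elim, simp)+
  let ?k = "\<lambda>z. - ((f' (fst z) * g' (snd z)) * ln (norm (fst z - snd z)))"
  have km: "?k \<in> borel_measurable borel" by (simp only: borel_prod[symmetric]) measurable
  \<comment> \<open>Also valid on the diagonal, where \<open>1 / 0 = 0\<close> and
    \<open>ln 0 = 0\<close>.\<close>
  have lnr: "ln (1 / r) = - ln r" for r :: real
    by (cases "r = 0") (simp_all add: ln_div)
  have "AE x in ?V. f x = f' x \<and> g x = g' x" using f(2) g(2) by eventually_elim simp
  from AE_pair_both[OF lborel.sigma_finite_measure_axioms this]
  have "AE z in ?V \<Otimes>\<^sub>M ?V. (case z of (x, y) \<Rightarrow> f x * ln (1 / norm (x - y)) * g y) = ?k z"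
    by eventually_elim (auto simp: lnr)
  then have "AE z in lborel. (case z of (x, y) \<Rightarrow> f x * ln (1 / norm (x - y)) * g y) = ?k z"
    by (simp only: lborel_prod)
  from lebesgue_integral_eqI[OF km this]
  have "(LINT (x, y)|lebesgue. f x * ln (1 / norm (x - y)) * g y) = (\<integral>z. ?k z \<partial>lborel)" .
  also have "\<dots> = - logE f' g'" by (simp add: logE_def lborel_prod)
  finally show ?thesis unfolding log_HLS_functional_def S logJ_def by (simp add: add_divide_distrib)
qed

text \<open>The inequality is proved on \<open>real\<close> and \<open>complex\<close>;
  \<open>S\<close> and \<open>T\<close> are mutually inverse isometries to \<open>real ^ 'n\<close>
  that preserve Lebesgue measure, and they carry optimizers to optimizers with the centre
  transported.\<close>

lemma log_HLS_transfer:
  fixes f g :: "real ^ 'n \<Rightarrow> real" and S :: "real ^ 'n \<Rightarrow> 'b::euclidean_space" and T :: "'b \<Rightarrow> real ^ 'n"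
  assumes Sm [measurable]: "S \<in> borel_measurable borel" and Tm [measurable]: "T \<in> borel_measurable borel"
    and Sd: "distr lborel borel S = lborel" and inv: "\<And>v. T (S v) = v" "\<And>x. S (T x) = x"
    and iso: "\<And>x y. norm (T x - T y) = norm (x - y)" "\<And>x. norm (T x) = norm x"
    and dim: "DIM('b) = CARD('n)" and const: "log_HLS_const CARD('n) = H"
    and opt: "\<And>a b. (log_HLS_optimizer a b :: real ^ 'n \<Rightarrow> real) = opt a b C"
    and main: "\<And>f g :: 'b \<Rightarrow> real. adm f \<Longrightarrow> (\<integral>x. f x \<partial>lborel) = 1 \<Longrightarrow> adm g \<Longrightarrow> (\<integral>x. g x \<partial>lborel) = 1 \<Longrightarrow>
      logJ f g \<le> H \<and> (logJ f g = H \<longleftrightarrow> (\<exists>a b. 0 < b \<and> (AE x in lborel. f x = opt a b C x \<and> g x = opt a b C x)))"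
    and f_nonneg: "\<And>x. 0 \<le> f x" and g_nonneg: "\<And>x. 0 \<le> g x"
    and f_int: "integrable lebesgue f" and g_int: "integrable lebesgue g"
    and f_mass: "(LINT x|lebesgue. f x) = 1" and g_mass: "(LINT x|lebesgue. g x) = 1"
    and f_entropy: "finite_entropy f" and g_entropy: "finite_entropy g"
  shows "log_HLS_functional f g \<le> log_HLS_const CARD('n) \<and>
    (log_HLS_functional f g = log_HLS_const CARD('n) \<longleftrightarrow>
      (\<exists>a b. b > 0 \<and>
        (AE x in lebesgue. f x = log_HLS_optimizer a b x \<and> g x = log_HLS_optimizer a b x)))"
proof -
  obtain f' where f': "adm f'" "(\<integral>x. f' x \<partial>lborel) = 1" "AE x in lborel. f x = f' x"
    using borel_representative[OF f_nonneg f_int f_mass f_entropy] by blast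
  obtain g' where g': "adm g'" "(\<integral>x. g' x \<partial>lborel) = 1" "AE x in lborel. g x = g' x"
    using borel_representative[OF g_nonneg g_int g_mass g_entropy] by blast
  have J: "log_HLS_functional f g = logJ f' g'" by (rule log_HLS_functional_eq[OF f'(1,3) g'(1,3)])
  have Td: "distr lborel borel T = lborel"
  proof -
    have "distr lborel borel T = distr (distr lborel borel S) borel T" by (simp only: Sd)
    also have "\<dots> = distr lborel borel (T \<circ> S)" by (rule distr_distr) simp_all
    also have "\<dots> = distr lborel lborel (\<lambda>x. x)" using inv(1) by (intro distr_cong) auto
    also have "\<dots> = lborel" by (rule distr_id)
    finally show ?thesis .
  qed
  note i = isometry_invariance[OF Tm Td iso f'(1) g'(1)]
  note ig = isometry_invariance[OF Tm Td iso g'(1) f'(1)]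
  have JT: "logJ (\<lambda>x. f' (T x)) (\<lambda>x. g' (T x)) = logJ f' g'"
    unfolding logJ_def i(3,4) ig(3) using dim by simp
  have shift: "opt (S a) b C x = opt a b C (T x)" for a b x
    using iso(1)[of x "S a"] inv(1)[of a] dim by (simp add: opt_def)
  have "(\<exists>a b. 0 < b \<and> (AE x in lborel. f' (T x) = opt a b C x \<and> g' (T x) = opt a b C x)) \<longleftrightarrow>
      (\<exists>a b. 0 < b \<and> (AE x in lebesgue. f x = log_HLS_optimizer a b x \<and> g x = log_HLS_optimizer a b x))" (is "?L \<longleftrightarrow> ?R")
  proof
    assume ?L
    then obtain a b where ab: "0 < b" "AE x in lborel. f' (T x) = opt a b C x \<and> g' (T x) = opt a b C x" by blast
    from ab(2) have "AE x in distr lborel borel S. f' (T x) = opt a b C x \<and> g' (T x) = opt a b C x" by (simp only: Sd)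
    then have "AE v in lborel. f' (T (S v)) = opt a b C (S v) \<and> g' (T (S v)) = opt a b C (S v)"
      by (rule AE_distrD[rotated]) simp
    with f'(3) g'(3) have "AE v in lborel. f v = opt (T a) b C v \<and> g v = opt (T a) b C v"
      by eventually_elim (use shift[of "T a" b] in \<open>simp add: inv\<close>)
    then have "AE v in lebesgue. f v = log_HLS_optimizer (T a) b v \<and> g v = log_HLS_optimizer (T a) b v"
      unfolding opt by (rule AE_completion)
    then show ?R using ab(1) by blast
  next
    assume ?R
    then obtain a b where ab: "0 < b" "AE v in lebesgue. f v = log_HLS_optimizer a b v \<and> g v = log_HLS_optimizer a b v" by blast
    then have "AE v in lborel. f v = opt a b C v \<and> g v = opt a b C v" by (simp only: opt AE_completion_iff)
    with f'(3) g'(3) have "AE v in lborel. f' v = opt a b C v \<and> g' v = opt a b C v" by eventually_elim simp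
    then have "AE v in distr lborel borel T. f' v = opt a b C v \<and> g' v = opt a b C v" by (simp only: Td)
    then have "AE x in lborel. f' (T x) = opt a b C (T x) \<and> g' (T x) = opt a b C (T x)"
      by (rule AE_distrD[rotated]) simp
    then have "AE x in lborel. f' (T x) = opt (S a) b C x \<and> g' (T x) = opt (S a) b C x" by (simp only: shift)
    then show ?L using ab(1) by blast
  qed
  then show ?thesis
    using main[OF i(1) _ ig(1)] i(2) ig(2) f'(2) g'(2) unfolding J JT const by simp
qed

lemma lborel_distr_nth:
  fixes i :: "'n::finite"
  assumes i: "(UNIV :: 'n set) = {i}"
  shows "distr (lborel :: (real ^ 'n) measure) borel (\<lambda>v. v $ i) = lborel"
proof (rule lborel_eqI[symmetric])
  have Tm [measurable]: "(\<lambda>v::real^'n. v $ i) \<in> borel_measurable borel"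
    by (intro borel_measurable_continuous_onI continuous_intros)
  fix l u :: real assume lu: "\<And>b. b \<in> Basis \<Longrightarrow> l \<bullet> b \<le> u \<bullet> b"
  define l' u' :: "real ^ 'n" where "l' = (\<chi> k. l)" and "u' = (\<chi> k. u)"
  have all: "(\<forall>k::'n. P k) \<longleftrightarrow> P i" for P using i by (metis UNIV_I singletonD)
  have vi: "(\<lambda>v::real^'n. v $ i) -` box l u = box l' u'"
    by (auto simp: mem_box_cart all l'_def u'_def)
  have B: "(Basis :: (real ^ 'n) set) = {axis i 1}" unfolding Basis_vec_def using i by auto
  have "emeasure lborel (box l' u') = ennreal (\<Prod>b\<in>Basis. (u' - l') \<bullet> b)"
    using lu by (intro emeasure_lborel_box) (auto simp: B inner_axis l'_def u'_def)
  also have "(\<Prod>b\<in>Basis. (u' - l') \<bullet> b) = (\<Prod>b\<in>Basis. (u - l) \<bullet> b)"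
    unfolding B by (simp add: inner_axis l'_def u'_def)
  finally have vol: "emeasure lborel (box l' u') = ennreal (\<Prod>b\<in>Basis. (u - l) \<bullet> b)" .
  have "emeasure (distr (lborel :: (real ^ 'n) measure) borel (\<lambda>v. v $ i)) (box l u)
      = emeasure lborel ((\<lambda>v::real^'n. v $ i) -` box l u \<inter> space lborel)"
    by (rule emeasure_distr) (use Tm in simp_all)
  also have "\<dots> = ennreal (\<Prod>b\<in>Basis. (u - l) \<bullet> b)" by (simp only: vi vol space_lborel space_borel Int_UNIV_right)
  finally show "emeasure (distr (lborel :: (real ^ 'n) measure) borel (\<lambda>v. v $ i)) (box l u)
      = ennreal (\<Prod>b\<in>Basis. (u - l) \<bullet> b)" .
qed simp

text \<open>\<open>Digamma 1 - Digamma (1/2)\<close> is \<open>2 ln 2\<close>, and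
  \<open>Gamma (1/2) = sqrt pi\<close> contributes the second half of \<open>ln pi\<close>.\<close>

lemma log_HLS_const_1: "log_HLS_const 1 = ln 2 + ln pi"
  by (simp add: log_HLS_const_def Digamma_one_half Gamma_one_half_real ln_div ln_sqrt field_simps)

lemma log_HLS_const_2: "log_HLS_const 2 = 1 / 2 + ln pi / 2"
proof -
  have "Digamma (2::real) = Digamma 1 + 1" using Digamma_plus1[of "1::real"] by simp
  moreover have "Gamma (2::real) = 1" using Gamma_plus1[of "1::real"] by simp
  ultimately show ?thesis by (simp add: log_HLS_const_def)
qed

text \<open>The normalizing constant is \<open>1 / pi\<close> in both dimensions; for
  \<open>N = 2\<close> this uses \<open>Gamma (3/2) = sqrt pi / 2\<close>.\<close>

lemma log_HLS_optimizer_opt: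
  assumes "CARD('n::finite) \<in> {1, 2}"
  shows "(log_HLS_optimizer a b :: real ^ 'n \<Rightarrow> real) = opt a b (1 / pi)"
proof -
  have "Gamma (3 / 2 :: real) = sqrt pi / 2"
  proof -
    have "(1 / 2 :: real) \<notin> \<int>\<^sub>\<le>\<^sub>0" by (auto elim!: nonpos_Ints_cases)
    then show ?thesis using Gamma_plus1[of "1 / 2 :: real"] Gamma_one_half_real by simp
  qed
  moreover have "pi powr (3 / 2) = pi * sqrt pi"
    using powr_add[of pi 1 "1 / 2"] by (simp add: powr_half_sqrt)
  ultimately have "2 ^ (CARD('n) - 1) * Gamma ((real CARD('n) + 1) / 2) / pi powr ((real CARD('n) + 1) / 2) = 1 / pi"
    using assms by (elim insertE) (simp_all add: field_simps)
  then show ?thesis by (simp add: fun_eq_iff log_HLS_optimizer_def opt_def)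
qed

theorem theorem2p2:
  fixes f g :: "real ^ 'n \<Rightarrow> real"
  assumes N: "CARD('n) \<in> {1, 2}"
    and f_nonneg: "\<And>x. 0 \<le> f x" and g_nonneg: "\<And>x. 0 \<le> g x"
    and f_int: "integrable lebesgue f" and g_int: "integrable lebesgue g"
    and f_mass: "(LINT x|lebesgue. f x) = 1" and g_mass: "(LINT x|lebesgue. g x) = 1"
    and f_entropy: "finite_entropy f" and g_entropy: "finite_entropy g"
  shows "log_HLS_functional f g \<le> log_HLS_const CARD('n) \<and>
    (log_HLS_functional f g = log_HLS_const CARD('n) \<longleftrightarrow>
      (\<exists>a b. b > 0 \<and>
        (AE x in lebesgue. f x = log_HLS_optimizer a b x \<and> g x = log_HLS_optimizer a b x)))"
proof -
  note hyps = f_nonneg g_nonneg f_int g_int f_mass g_mass f_entropy g_entropy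
  note opt = log_HLS_optimizer_opt[OF N]
  from N consider "CARD('n) = 1" | "CARD('n) = 2" by auto
  then show ?thesis
  proof cases
    case 1
    then obtain i :: 'n where i: "(UNIV :: 'n set) = {i}" by (auto simp: card_1_singleton_iff)
    have all: "k = i" for k using i by auto
    define T :: "real \<Rightarrow> real ^ 'n" where "T r = (\<chi> k. r)" for r
    have n: "norm v = \<bar>v $ i\<bar>" for v :: "real ^ 'n" by (simp add: norm_vec_def L2_set_def i)
    show ?thesis
    proof (rule log_HLS_transfer[where S="\<lambda>v. v $ i" and T=T, OF _ _ lborel_distr_nth[OF i] _ _ _ _ _ _ opt log_HLS_real hyps])
      show "(\<lambda>v::real^'n. v $ i) \<in> borel_measurable borel"
        by (intro borel_measurable_continuous_onI continuous_intros)
      show "T \<in> borel_measurable borel" unfolding T_def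
        by (intro borel_measurable_continuous_onI continuous_intros)
      show "T (v $ i) = v" for v 
      proof (rule vec_eq_iff[THEN iffD2], rule allI)
        show "T (v $ i) $ k = v $ k" for k unfolding all[of k] by (simp add: T_def)
      qed
      show "T x $ i = x" for x by (simp add: T_def)
      show "norm (T x - T y) = norm (x - y)" "norm (T x) = norm x" for x y by (simp_all add: n T_def)
      show "DIM(real) = CARD('n)" using 1 by simp
      show "log_HLS_const CARD('n) = ln 2 + ln pi" unfolding 1 by (rule log_HLS_const_1)
    qed
  next
    case 2
    then obtain i j :: 'n where ij: "(UNIV :: 'n set) = {i, j}" "i \<noteq> j" by (auto simp: card_2_iff)
    have all: "k = i \<or> k = j" for k using ij by auto
    define T :: "complex \<Rightarrow> real ^ 'n" where "T z = (\<chi> k. if k = i then Re z else Im z)" for z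
    have n: "norm v = cmod (Complex (v $ i) (v $ j))" for v :: "real ^ 'n"
      unfolding norm_vec_def L2_set_def ij(1) using ij(2) by (simp add: cmod_def)
    show ?thesis
    proof (rule log_HLS_transfer[where S="\<lambda>v. Complex (v $ i) (v $ j)" and T=T, OF _ _ lborel_distr_Complex[OF ij] _ _ _ _ _ _ opt log_HLS_complex hyps])
      show "(\<lambda>v::real^'n. Complex (v $ i) (v $ j)) \<in> borel_measurable borel"
        by (intro borel_measurable_continuous_onI continuous_intros)
      have "continuous_on UNIV (\<lambda>z. if k = i then Re z else Im z)" for k
        by (cases "k = i") (auto intro!: continuous_intros)
      then show "T \<in> borel_measurable borel" unfolding T_def
        by (intro borel_measurable_continuous_onI continuous_intros)
      show "T (Complex (v $ i) (v $ j)) = v" for v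
        using all by (auto simp: T_def vec_eq_iff) 
      show "Complex (T x $ i) (T x $ j) = x" for x using ij(2) by (simp add: T_def)
      show "norm (T x - T y) = norm (x - y)" "norm (T x) = norm x" for x y
        using ij(2) by (simp_all add: n T_def cmod_def)
      show "DIM(complex) = CARD('n)" using 2 by simp
      show "log_HLS_const CARD('n) = 1 / 2 + ln pi / 2" unfolding 2 by (rule log_HLS_const_2)
    qed
  qed
qed

end
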